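(* The function $\mathcal{M}(-1;z):=\mathcal{O}(-1;q)-I(-1;z)$, where $$I(-1;z):=\frac{\sqrt2}{\pi i}\int_{-\bar z}^{i\infty}\frac{\eta^2(\tau)}{\eta(2\tau)\,(-i(\tau+z))^{3/2}}\,d\tau,$$ is a (harmonic) weak Maass form of weight $\frac32$ on $\Gamma_0(16)$ (with trivial Nebentypus).
   Context: $z\in\mathbb{H}$, $q:=e^{2\pi i z}$, $\eta(z):=q^{1/24}\prod_{n\ge1}(1-q^n)$ is Dedekind's eta function, and the root $(\cdot)^{3/2}$ is the principal branch. With $(a;q)_n:=\prod_{r=0}^{n-1}(1-aq^r)$, $$\mathcal{O}(-1;q):=\sum_{n\ge0}\frac{(-1;q)_n\,q^{n(n+1)/2}}{(-q;q)_n^2}=4\frac{(-q;q)_\infty}{(q;q)_\infty}\sum_{n\in\mathbb{Z}}(-1)^n\frac{q^{n^2+n}}{(1+q^n)^2}.$$ Weak Maass forms: for $k\in\frac12\mathbb{Z}\setminus\mathbb{Z}$ let $\Delta_k:=-y^2\left(\frac{\partial^2}{\partial x^2}+\frac{\partial^2}{\partial y^2}\right)+iky\left(\frac{\partial}{\partial x}+i\frac{\partial}{\partial y}\right)$ ($z=x+iy$); for odd $v$ let $\epsilon_v=1$ if $v\equiv1\pmod4$, $\epsilon_v=i$ if $v\equiv3\pmod4$. A weak Maass form of weight $k$ and Nebentypus $\chi$ on $\Gamma\subseteq\Gamma_0(4)$ is a smooth $f:\mathbb{H}\to\mathbb{C}$ with $f(Az)=\left(\frac cd\right)^{2k}\epsilon_d^{-2k}\chi(d)(cz+d)^kf(z)$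 for all $A=\left(\begin{smallmatrix}a&b\\c&d\end{smallmatrix}\right)\in\Gamma$, $\Delta_kf=0$, and at most linear exponential growth at all cusps of $\Gamma$. *)

theory Defs
  imports "HOL-Analysis.Analysis" "HOL-Number_Theory.Number_Theory"
begin

definition qexp :: "complex \<Rightarrow> complex" where
  "qexp z = exp (2 * of_real pi * \<i> * z)"

definition eta :: "complex \<Rightarrow> complex" where
  "eta z = exp (2 * of_real pi * \<i> * z / 24) * prodinf (\<lambda>n. 1 - qexp z ^ Suc n)"

definition qpoch :: "complex \<Rightarrow> complex \<Rightarrow> nat \<Rightarrow> complex" where
  "qpoch a q n = (\<Prod>r<n. 1 - a * q ^ r)"

definition overpartO :: "complex \<Rightarrow> complex" where
  "overpartO q = (\<Sum>n. qpoch (-1) q n * q ^ (n * (n + 1) div 2) / (qpoch (- q) q n) ^ 2)"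

text \<open>I(-1;z): the integral from -conj z to i*infinity, taken along the vertical ray
  tau = -x + i t, t from y to infinity (d tau = i dt).\<close>
definition nonholI :: "complex \<Rightarrow> complex" where
  "nonholI z = of_real (sqrt 2) / (of_real pi * \<i>) *
     integral {Im z..} (\<lambda>t. let \<tau> = Complex (- Re z) t in
        eta \<tau> ^ 2 / (eta (2 * \<tau>) * (- \<i> * (\<tau> + z)) powr (3 / 2)) * \<i>)"

definition mockM :: "complex \<Rightarrow> complex" where
  "mockM z = overpartO (qexp z) - nonholI z"

definition jacobi :: "int \<Rightarrow> nat \<Rightarrow> int" where
  "jacobi a n = (\<Prod>p\<in>prime_factors n. Legendre a (int p) ^ multiplicity p n)"

definition shimura_symbol :: "int \<Rightarrow> int \<Rightarrow> int" where
  "shimura_symbol c d =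
     (if c < 0 \<and> d < 0 then - jacobi c (nat \<bar>d\<bar>) else jacobi c (nat \<bar>d\<bar>))"

definition eps :: "int \<Rightarrow> complex" where
  "eps v = (if v mod 4 = 1 then 1 else \<i>)"

definition moebius_int :: "int \<Rightarrow> int \<Rightarrow> int \<Rightarrow> int \<Rightarrow> complex \<Rightarrow> complex" where
  "moebius_int a b c d z = (of_int a * z + of_int b) / (of_int c * z + of_int d)"

definition Gamma0 :: "int \<Rightarrow> (int \<times> int \<times> int \<times> int) set" where
  "Gamma0 N = {(a, b, c, d). a * d - b * c = 1 \<and> N dvd c}"

definition SL2Z :: "(int \<times> int \<times> int \<times> int) set" where
  "SL2Z = {(a, b, c, d). a * d - b * c = 1}"

definition trivial_char :: "int \<Rightarrow> int \<Rightarrow> complex" where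
  "trivial_char N d = (if coprime d N then 1 else 0)"

definition dx :: "(complex \<Rightarrow> complex) \<Rightarrow> complex \<Rightarrow> complex" where
  "dx f z = vector_derivative (\<lambda>t::real. f (z + of_real t)) (at 0)"

definition dy :: "(complex \<Rightarrow> complex) \<Rightarrow> complex \<Rightarrow> complex" where
  "dy f z = vector_derivative (\<lambda>t::real. f (z + \<i> * of_real t)) (at 0)"

fun pdiff :: "bool list \<Rightarrow> (complex \<Rightarrow> complex) \<Rightarrow> complex \<Rightarrow> complex" where
  "pdiff [] f = f"
| "pdiff (b # bs) f = (if b then dx else dy) (pdiff bs f)"

definition smooth_on :: "complex set \<Rightarrow> (complex \<Rightarrow> complex) \<Rightarrow> bool" where
  "smooth_on S f \<longleftrightarrow> (\<forall>bs. \<forall>z\<in>S. pdiff bs f differentiable (at z))"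

definition hyp_laplacian :: "real \<Rightarrow> (complex \<Rightarrow> complex) \<Rightarrow> complex \<Rightarrow> complex" where
  "hyp_laplacian k f z =
     - of_real ((Im z)^2) * (dx (dx f) z + dy (dy f) z)
     + \<i> * of_real k * of_real (Im z) * (dx f z + \<i> * dy f z)"

definition upper_half_plane :: "complex set" where
  "upper_half_plane = {z. Im z > 0}"

definition weak_maass_form ::
  "real \<Rightarrow> (int \<Rightarrow> complex) \<Rightarrow> (int \<times> int \<times> int \<times> int) set \<Rightarrow> (complex \<Rightarrow> complex) \<Rightarrow> bool" where
  "weak_maass_form k chi \<Gamma> f \<longleftrightarrow>
     smooth_on upper_half_plane f \<and>
     (\<forall>(a, b, c, d)\<in>\<Gamma>. \<forall>z. Im z > 0 \<longrightarrow>
        f (moebius_int a b c d z) =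
          of_int (shimura_symbol c d) powi round (2 * k) * eps d powi (- round (2 * k)) * chi d
          * (of_int c * z + of_int d) powr of_real k * f z) \<and>
     (\<forall>z. Im z > 0 \<longrightarrow> hyp_laplacian k f z = 0) \<and>
     (\<forall>(a, b, c, d)\<in>SL2Z. \<exists>C Y. C > 0 \<and>
        (\<forall>z. Im z \<ge> Y \<longrightarrow>
           norm (f (moebius_int a b c d z))
             \<le> C * exp (C * Im z) * norm (of_int c * z + of_int d) powr k))"

end

theory Submission
  imports Defs "HOL-Complex_Analysis.Complex_Analysis" "HOL-Probability.Probability" "HOL-Real_Asymp.Real_Asymp"
begin

text \<open>Both the eta quotient, which is the theta series \<open>th4\<close>, and the q-series are expanded explicitly. A Bailey type
  rearrangement writes \<open>th4\<close> times the overpartition series as a sum over \<open>(-1)^n q^(n\<^sup>2 + n) / (1 + q^n)\<^sup>2\<close>,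
  which on the imaginary axis is a Gaussian sum weighted by \<open>1 / cosh\<^sup>2\<close>. A Fourier expansion of the weight turns
  this into a Mordell integral plus a holomorphic q-series over \<open>th2\<close>, and the Mordell integral is a period
  integral of \<open>th4\<close>. Splitting that period integral at \<open>y\<close> gives the inversion formula relating the completed
  function at \<open>z\<close> to a companion \<open>dual_mock\<close> at \<open>-1/(4z)\<close>, first for \<open>z = \<i> y\<close> and then, since both
  shadows agree, everywhere. The companion is multiplied by \<open>-\<i>\<close> under translation by 1, so the shift of the
  completed function by 1/2 has the automorphy of \<open>\<theta>\<^sup>3\<close> under \<open>z \<mapsto> z + 1\<close> and \<open>z \<mapsto> z/(4z + 1)\<close>,
  which generate \<open>\<Gamma>\<^sub>0(4)\<close> up to sign; undoing the shift leaves \<open>\<Gamma>\<^sub>0(16)\<close>.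
  Growth at the cusps follows from the bound \<open>4 exp(2/y)\<close> together with
  the automorphy under translations of the cusp.\<close>

text \<open>Two coincidences carry the proof. The constant \<open>sqrt 2 / pi\<close> makes the
  Mordell term \<open>8 * mordell y\<close> of the overpartition series cancel against the period
  integral over the whole half line, so only a q-series and the part of the integral below
  \<open>y\<close> survive; theta inversion turns that part into a period integral of
  \<open>th2\<close>. And \<open>1 / th2\<close> and the period integral of \<open>th2\<close> gain
  the same factor under translation by 1, so that their sum has a multiplier at all. The obstacles
  are that nonholomorphic identities cannot be continued from the imaginary axis, and that the
  multiplier must be matched with principal branches and the extended quadratic symbol. For the
  latter, the factor \<open>jfac\<close> is compared with the two generators and with the negative
  of a matrix only; quadratic reciprocity enters through the periodicity of the symbol in
  \<open>d\<close>. The level 16: conjugation by z -> z + 1/2 sends \<open>Gamma0 16\<close> into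
  \<open>Gamma0 4\<close>, since \<open>d - a\<close> is even and 4 divides \<open>c\<close>, and
  divisibility by 16 keeps the symbol unchanged.\<close>

section \<open>Jacobi symbols and reciprocity\<close>

text \<open>Euler's criterion gives multiplicativity modulo \<open>p\<close>. Both sides have
  absolute value at most 1, so a difference divisible by \<open>p > 2\<close> vanishes.\<close>

lemma Legendre_prime_mult:
  assumes "prime p" "odd p"
  shows "Legendre (a * b) (int p) = Legendre a (int p) * Legendre b (int p)"
proof -
  have p: "p > 2" using assms prime_gt_1_nat[of p] by (cases "p = 2") auto
  have E: "[Legendre c (int p) = c ^ ((p - 1) div 2)] (mod int p)" for c
    using euler_criterion[OF assms(1) p] by blast
  have "[Legendre (a * b) (int p) = Legendre a (int p) * Legendre b (int p)] (mod int p)"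
    using cong_trans[OF E[of "a * b"] cong_sym[OF cong_mult[OF E[of a] E[of b]], folded power_mult_distrib]] .
  moreover have "\<bar>Legendre c (int p)\<bar> \<le> 1" for c by (auto simp: Legendre_def)
  then have "\<bar>Legendre (a * b) (int p)\<bar> \<le> 1" "\<bar>Legendre a (int p) * Legendre b (int p)\<bar> \<le> 1"
    by (auto simp: abs_mult intro: mult_le_one)
  ultimately have d: "int p dvd (Legendre (a * b) (int p) - Legendre a (int p) * Legendre b (int p))"
     and le: "\<bar>Legendre (a * b) (int p) - Legendre a (int p) * Legendre b (int p)\<bar> \<le> 2"
    by (auto simp: cong_iff_dvd_diff)
  show ?thesis
  proof (rule ccontr)
    assume "\<not> ?thesis"
    then show False using dvd_imp_le_int[OF _ d] le p by simp
  qed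
qed

lemma jacobi_mult_left:
  assumes "odd n"
  shows "jacobi (a * b) n = jacobi a n * jacobi b n"
proof -
  have "Legendre (a * b) (int p) = Legendre a (int p) * Legendre b (int p)" if "p \<in> prime_factors n" for p
  proof (intro Legendre_prime_mult)
    have "p dvd n" using that by auto
    then show "odd p" using assms dvd_trans by blast
  qed (use that in auto)
  then show ?thesis by (simp add: jacobi_def power_mult_distrib prod.distrib)
qed

lemma jacobi_1_right [simp]: "jacobi a 1 = 1" "jacobi a (Suc 0) = 1"
  by (simp_all add: jacobi_def)

lemma jacobi_prime: "prime p \<Longrightarrow> jacobi a p = Legendre a (int p)"
  by (simp add: jacobi_def prime_factorization_prime)

text \<open>Primes of \<open>S\<close> outside the factorisation have multiplicity 0. Enlarging the
  index set lets the products for \<open>m\<close>, \<open>n\<close> and \<open>m * n\<close> be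
  compared over one set of primes.\<close>

lemma jacobi_conv_sup:
  assumes "n > 0" "finite S" "prime_factors n \<subseteq> S" "\<forall>p\<in>S. prime p"
  shows "jacobi a n = (\<Prod>p\<in>S. Legendre a (int p) ^ multiplicity p n)"
  unfolding jacobi_def
proof (rule prod.mono_neutral_left)
  show "\<forall>i\<in>S - prime_factors n. Legendre a (int i) ^ multiplicity i n = 1"
    using assms by (auto simp: prime_factors_multiplicity)
qed (use assms in auto)

lemma jacobi_mult_right:
  assumes "m > 0" "n > 0"
  shows "jacobi a (m * n) = jacobi a m * jacobi a n"
proof -
  let ?S = "prime_factors m \<union> prime_factors n"
  have S: "finite ?S" "\<forall>p\<in>?S. prime p" by auto
  have "jacobi a (m * n) = (\<Prod>p\<in>?S. Legendre a (int p) ^ multiplicity p (m*n))"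
    using assms by (intro jacobi_conv_sup) (auto simp: prime_factors_product)
  also have "\<dots> = (\<Prod>p\<in>?S. Legendre a (int p) ^ multiplicity p m) * (\<Prod>p\<in>?S. Legendre a (int p) ^ multiplicity p n)"
  proof -
    have "multiplicity p (m * n) = multiplicity p m + multiplicity p n" if "p \<in> ?S" for p
      using that assms by (intro prime_elem_multiplicity_mult_distrib) (auto simp: prime_imp_prime_elem)
    then have "(\<Prod>p\<in>?S. Legendre a (int p) ^ multiplicity p (m*n)) =
      (\<Prod>p\<in>?S. Legendre a (int p) ^ multiplicity p m * Legendre a (int p) ^ multiplicity p n)"
      by (intro prod.cong) (auto simp del: Un_iff simp: power_add)
    then show ?thesis by (simp add: prod.distrib)
  qed
  also have "\<dots> = jacobi a m * jacobi a n"
    using assms by (subst (1 2) jacobi_conv_sup[where S = ?S]) auto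
  finally show ?thesis .
qed

lemma jacobi_cong:
  assumes "[a = b] (mod int n)"
  shows "jacobi a n = jacobi b n"
proof -
  have "Legendre a (int p) = Legendre b (int p)" if "p \<in> prime_factors n" for p
  proof -
    have "int p dvd int n" using that by auto
    then have ab: "[a = b] (mod int p)" using assms by (rule cong_dvd_modulus[rotated])
    then have "QuadRes (int p) a = QuadRes (int p) b" unfolding QuadRes_def
      using cong_trans cong_sym by blast
    moreover have "[a = 0] (mod int p) = [b = 0] (mod int p)" using ab cong_trans cong_sym by blast
    ultimately show ?thesis by (simp add: Legendre_def)
  qed
  then show ?thesis by (simp add: jacobi_def)
qed

lemma odd_induct_prime [consumes 1, case_names one mult]:
  fixes n :: nat
  assumes "odd n" "P 1" "\<And>p m. prime p \<Longrightarrow> odd p \<Longrightarrow> odd m \<Longrightarrow> P m \<Longrightarrow> P (p * m)"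
  shows "P n"
  using assms(1)
proof (induction n rule: less_induct)
  case (less n)
  show ?case
  proof (cases "n = 1")
    case False
    then obtain p where p: "prime p" "p dvd n" using prime_factor_nat by blast
    then obtain m where m: "n = p * m" by (auto elim: dvdE)
    have "m > 0" using m less.prems by (auto intro: Nat.gr0I)
    then have "m < n" using m prime_gt_1_nat[OF p(1)] by simp
    then show ?thesis using assms(3)[of p m] p m less by auto
  qed (use assms in simp)
qed

text \<open>Modulo 2, the map a -> (a - 1) / 2 turns products of odd numbers into sums: it is the
  nontrivial character modulo 4 written additively.\<close>

lemma half_mult_parity:
  fixes a b :: int
  assumes "odd a" "odd b"
  shows "even ((a * b - 1) div 2) = (even ((a - 1) div 2) = even ((b - 1) div 2))"
proof -
  obtain u v where [simp]: "a = 2 * u + 1" "b = 2 * v + 1" using assms by (auto elim!: oddE)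
  have "a * b - 1 = 2 * (2 * u * v + u + v)" by (simp add: algebra_simps)
  then have "(a * b - 1) div 2 = 2 * u * v + u + v" by (metis nonzero_mult_div_cancel_left zero_neq_numeral)
  then show ?thesis by auto
qed

text \<open>The sign of quadratic reciprocity, extended to odd integers of either sign. Since (-1 -
  1) div 2 is odd, \<open>qsign n (-1)\<close> is the nontrivial character modulo 4, which evaluates
  the symbol of -1.\<close>

definition qsign :: "int \<Rightarrow> int \<Rightarrow> int" where
  "qsign a b = (if even ((a - 1) div 2) \<or> even ((b - 1) div 2) then 1 else -1)"

lemma qsign_mult: "odd a \<Longrightarrow> odd a' \<Longrightarrow> odd b \<Longrightarrow> qsign (a * a') b = qsign a b * qsign a' b"
  using half_mult_parity[of a a'] unfolding qsign_def
  by (cases "even ((b - 1) div 2)"; cases "even ((a - 1) div 2)"; cases "even ((a' - 1) div 2)";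
      simp only: simp_thms if_True if_False; simp)

lemma qsign_commute: "qsign a b = qsign b a" by (auto simp: qsign_def)

lemma jacobi_minus_one:
  assumes "odd n"
  shows "jacobi (-1) n = qsign (int n) (-1)"
  using assms
proof (induction n rule: odd_induct_prime)
  case (mult p m)
  have p2: "p > 2" using mult prime_gt_1_nat[of p] by (cases "p = 2") auto
  have "[Legendre (-1) (int p) = (-1) ^ ((p - 1) div 2)] (mod int p)"
    using euler_criterion[OF mult(1) p2] by blast
  then have "int p dvd Legendre (-1) (int p) - (-1) ^ ((p - 1) div 2)" by (simp add: cong_iff_dvd_diff)
  moreover have "\<bar>Legendre (-1) (int p) - (-1) ^ ((p - 1) div 2)\<bar> \<le> 2"
    by (auto simp: Legendre_def minus_one_power_iff)
  ultimately have L: "Legendre (-1) (int p) = (-1) ^ ((p - 1) div 2)"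
    using p2 dvd_imp_le_int[of "Legendre (-1) (int p) - (-1) ^ ((p - 1) div 2)" "int p"] by (cases "Legendre (-1) (int p) = (-1) ^ ((p - 1) div 2)") auto
  have "(int p - 1) div 2 = int ((p - 1) div 2)" using p2 by (simp add: zdiv_int of_nat_diff)
  then have "(-1) ^ ((p - 1) div 2) = qsign (int p) (-1)"
    by (auto simp: qsign_def minus_one_power_iff)
  moreover have "m > 0" using mult by (auto intro: Nat.gr0I)
  ultimately show ?case using mult p2 L
    by (simp add: jacobi_mult_right jacobi_prime qsign_mult)
qed (simp add: qsign_def)

lemma quadratic_reciprocity_primes:
  assumes "prime p" "odd p" "prime q" "odd q" "p \<noteq> q"
  shows "Legendre (int p) (int q) * Legendre (int q) (int p) = qsign (int p) (int q)"
proof -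
  have p2: "p > 2" "q > 2" using assms prime_gt_1_nat[of p] prime_gt_1_nat[of q]
    by (cases "p = 2"; cases "q = 2"; simp)+
  have "(int p - 1) div 2 = int ((p - 1) div 2)" "(int q - 1) div 2 = int ((q - 1) div 2)"
    using p2 by (simp_all add: zdiv_int of_nat_diff)
  then have "(-1) ^ (((p - 1) div 2) * ((q - 1) div 2)) = qsign (int p) (int q)"
    by (auto simp: qsign_def minus_one_power_iff)
  then show ?thesis using Quadratic_Reciprocity[of p q] assms p2 by simp
qed

text \<open>Reciprocity is extended one entry at a time: here the upper entry is still prime and the
  lower one is built up prime by prime. The induction on the upper entry in
  \<open>jacobi_reciprocity\<close> uses this in its step.\<close>

lemma jacobi_reciprocity_prime:
  assumes "odd n" "prime p" "odd p" "coprime p n"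
  shows "jacobi (int p) n = qsign (int p) (int n) * Legendre (int n) (int p)"
  using assms
proof (induction n rule: odd_induct_prime)
  case one
  have "QuadRes (int p) 1" unfolding QuadRes_def by (rule exI[of _ 1]) simp
  then show ?case using prime_gt_1_nat[OF one(1)] by (simp add: qsign_def Legendre_def cong_def)
next
  case (mult r m)
  have m0: "m > 0" "r > 0" using mult by (auto intro: Nat.gr0I simp: prime_gt_0_nat)
  have cop: "coprime p m" "coprime p r" using mult.prems by auto
  then have "p \<noteq> r" using mult.prems by (auto simp: prime_nat_iff)
  then have "Legendre (int p) (int r) * Legendre (int r) (int p) = qsign (int p) (int r)"
    using mult by (intro quadratic_reciprocity_primes) auto
  \<comment> \<open>For distinct primes the symbol is plus or minus 1, hence its own inverse, so the
    product form of reciprocity can be solved for one factor.\<close>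
  moreover have "Legendre (int r) (int p) \<in> {-1,1}"
    using \<open>p \<noteq> r\<close> mult by (auto simp: Legendre_def cong_0_iff primes_dvd_imp_eq)
  ultimately have L: "Legendre (int p) (int r) = qsign (int p) (int r) * Legendre (int r) (int p)" by auto
  show ?case using mult m0 L cop
    by (simp add: jacobi_mult_right jacobi_prime Legendre_prime_mult qsign_mult qsign_commute[of "int p"])
qed

lemma qsign_1 [simp]: "qsign 1 b = 1" "qsign a 1 = 1" by (auto simp: qsign_def)

lemma jacobi_1_left: "odd n \<Longrightarrow> jacobi 1 n = 1"
proof (induction n rule: odd_induct_prime)
  case (mult p m)
  have "QuadRes (int p) 1" unfolding QuadRes_def by (rule exI[of _ 1]) simp
  then have "Legendre 1 (int p) = 1" using prime_gt_1_nat[OF mult(1)] by (simp add: Legendre_def cong_def)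
  moreover have "m > 0" "p > 0" using mult by (auto intro: Nat.gr0I simp: prime_gt_0_nat)
  ultimately show ?case using mult by (simp add: jacobi_mult_right jacobi_prime)
qed simp

theorem jacobi_reciprocity:
  assumes "odd m" "odd n" "coprime m n"
  shows "jacobi (int m) n = qsign (int m) (int n) * jacobi (int n) m"
  using assms
proof (induction m rule: odd_induct_prime)
  case one then show ?case using jacobi_1_left by simp
next
  case (mult p m)
  have m0: "m > 0" "p > 0" using mult by (auto intro: Nat.gr0I simp: prime_gt_0_nat)
  show ?case using mult m0
    by (simp add: jacobi_mult_right jacobi_mult_left jacobi_prime jacobi_reciprocity_prime qsign_mult)
qed

lemma jacobi_values:
  assumes "odd n" "coprime a (int n)"
  shows "jacobi a n \<in> {-1, 1}"
  using assms
proof (induction n rule: odd_induct_prime)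
  case (mult p m)
  have "m > 0" "p > 0" using mult by (auto intro: Nat.gr0I simp: prime_gt_0_nat)
  moreover have "coprime a (int p)" "coprime a (int m)" using mult.prems by auto
  moreover have "Legendre a (int p) \<in> {-1, 1}"
  proof -
    have "\<not> [a = 0] (mod int p)"
    proof
      assume "[a = 0] (mod int p)"
      then have "int p dvd a" by (simp add: cong_0_iff)
      then have "is_unit (int p)" using \<open>coprime a (int p)\<close> by (meson coprime_common_divisor dvd_refl)
      then show False using prime_gt_1_nat[OF mult(1)] by simp
    qed
    then show ?thesis by (auto simp: Legendre_def)
  qed
  ultimately show ?case using mult by (auto simp: jacobi_mult_right jacobi_prime)
qed auto

text \<open>The supplementary law for 2 follows from reciprocity by descent: 2 = (-1)(-2), -2 is
  congruent to \<open>n - 2\<close> modulo \<open>n\<close>, and after inversion of the symbol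
  \<open>n\<close> is congruent to 2 modulo \<open>n - 2\<close>.\<close>

lemma jacobi_2_step:
  assumes "odd n" "n \<ge> 3"
  shows "jacobi 2 n = qsign (int n) (-1) * jacobi 2 (n - 2)"
proof -
  have cop: "coprime (n - 2) n"
  proof -
    have "coprime (n - 2) 2" using assms by auto
    then have "coprime (n - 2) (2 + (n - 2))" by (metis coprime_iff_gcd_eq_1 gcd_add2 add.commute)
    moreover have "2 + (n - 2) = n" using assms by simp
    ultimately show ?thesis by simp
  qed
  have "jacobi 2 n = jacobi (-1) n * jacobi (-2) n"
    using jacobi_mult_left[OF assms(1), of "-1" "-2"] by simp
  also have "jacobi (-2) n = jacobi (int (n - 2)) n"
    using assms by (intro jacobi_cong) (simp add: cong_iff_dvd_diff of_nat_diff)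
  also have "\<dots> = qsign (int (n - 2)) (int n) * jacobi (int n) (n - 2)"
    using assms cop by (intro jacobi_reciprocity) auto
  \<comment> \<open>One of the odd numbers \<open>n - 2\<close> and \<open>n\<close> is 1 modulo
    4.\<close>
  also have "qsign (int (n - 2)) (int n) = 1"
  proof -
    obtain k where "n = 2 * k + 1" using assms by (auto elim: oddE)
    then show ?thesis using assms by (auto simp: qsign_def of_nat_diff)
  qed
  also have "jacobi (int n) (n - 2) = jacobi 2 (n - 2)"
    using assms by (intro jacobi_cong) (simp add: cong_iff_dvd_diff of_nat_diff)
  finally show ?thesis using assms by (simp add: jacobi_minus_one)
qed

lemma jacobi_2: "jacobi 2 (2 * k + 1) = (if k mod 4 \<in> {0, 3} then 1 else -1)"
proof (induction k)
  case (Suc k)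
  have "jacobi 2 (2 * Suc k + 1) = qsign (int (2 * Suc k + 1)) (-1) * jacobi 2 (2 * k + 1)"
    using jacobi_2_step[of "2 * Suc k + 1"] by simp
  moreover have "qsign (int (2 * Suc k + 1)) (-1) = (if even (Suc k) then 1 else -1)"
    by (auto simp: qsign_def)
  moreover have "k mod 4 = 0 \<and> Suc k mod 4 = 1 \<or> k mod 4 = 1 \<and> Suc k mod 4 = 2 \<or>
      k mod 4 = 2 \<and> Suc k mod 4 = 3 \<or> k mod 4 = 3 \<and> Suc k mod 4 = 0" by presburger
  moreover have "even (Suc k) \<longleftrightarrow> Suc k mod 4 = 0 \<or> Suc k mod 4 = 2" by presburger
  ultimately show ?case using Suc by auto
qed simp

lemma jacobi_2': 
  assumes "odd n"
  shows "jacobi 2 n = (if int n mod 8 = 1 \<or> int n mod 8 = 7 then 1 else -1)"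
proof -
  obtain k where k: "n = 2 * k + 1" using assms by (auto elim: oddE)
  define m r where "m = k div 4" and "r = k mod 4"
  have "k = 4 * m + r" "r < 4" by (simp_all add: m_def r_def)
  then have n: "int n = 8 * int m + (2 * int r + 1)" by (simp add: k)
  have "r = 0 \<or> r = 1 \<or> r = 2 \<or> r = 3" using \<open>r < 4\<close> by linarith
  then have "r = 0 \<or> r = 3 \<longleftrightarrow> int n mod 8 = 1 \<or> int n mod 8 = 7" unfolding n by auto
  then show ?thesis using jacobi_2[of k] unfolding r_def by (simp add: k)
qed

text \<open>Being 1 or 7 modulo 8 is invariant under negation, so the absolute values do not disturb
  the period 8.\<close>

lemma jacobi_2_shift:
  assumes "odd d" "8 dvd c"
  shows "jacobi 2 (nat \<bar>d + c\<bar>) = jacobi 2 (nat \<bar>d\<bar>)"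
proof -
  have *: "\<bar>x\<bar> mod 8 = 1 \<or> \<bar>x\<bar> mod 8 = 7 \<longleftrightarrow> x mod 8 = 1 \<or> x mod 8 = 7" if "odd x" for x :: int
  proof (cases "x > 0")
    case False
    have "(- x) mod 8 = 1 \<or> (- x) mod 8 = 7 \<longleftrightarrow> x mod 8 = 1 \<or> x mod 8 = 7"
      by (auto simp: zmod_zminus1_eq_if)
    then show ?thesis using False by simp
  qed simp
  obtain k where k: "c = 8 * k" using assms(2) by (auto elim: dvdE)
  have o: "odd (d + c)" using assms(1) by (simp add: k)
  have m: "(d + c) mod 8 = d mod 8" by (simp add: k)
  have "jacobi 2 (nat \<bar>x\<bar>) = (if x mod 8 = 1 \<or> x mod 8 = 7 then 1 else -1)" if "odd x" for x
    using jacobi_2'[of "nat \<bar>x\<bar>"] *[OF that] that by (simp only: int_nat_eq abs_ge_zero if_True even_nat_iff) (simp add: even_nat_iff)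
  from this[OF o] this[OF assms(1)] show ?thesis unfolding m by simp
qed

section \<open>Periodicity of the extended quadratic symbol in its lower entry\<close>

lemma qsign_cong4: "[b = b'] (mod 4) \<Longrightarrow> odd b \<Longrightarrow> qsign a b = qsign a b'"
proof -
  assume "[b = b'] (mod 4)" "odd b"
  then have "even ((b - 1) div 2) \<longleftrightarrow> even ((b' - 1) div 2)" unfolding cong_def by presburger
  then show ?thesis by (auto simp: qsign_def)
qed

lemma qsign_minus: "odd a \<Longrightarrow> odd b \<Longrightarrow> qsign a (- b) = qsign a b * qsign a (-1)"
  using qsign_mult[of b "-1" a] by (simp add: qsign_commute[of _ a])

lemma qsign_square: "qsign a b * qsign a b = 1" by (simp add: qsign_def)

text \<open>Splitting the upper entry into sign, power of 2 and odd part \<open>u\<close>, and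
  inverting the symbol for \<open>u\<close>, leaves factors depending on \<open>d\<close> only
  modulo 4, 8 and \<open>u\<close>. The extra sign in \<open>shimura_symbol\<close> for two negative
  entries is what makes the formula uniform in the sign of \<open>d\<close>.\<close>

lemma shimura_symbol_formula:
  fixes s :: int and u e :: nat
  assumes "s = 1 \<or> s = -1" "odd u" "odd d" "coprime (s * 2 ^ e * int u) d"
  shows "shimura_symbol (s * 2 ^ e * int u) d =
    (if s = 1 then 1 else qsign (-1) d) * jacobi 2 (nat \<bar>d\<bar>) ^ e * (qsign (int u) d * jacobi d u)"
proof -
  let ?n = "nat \<bar>d\<bar>"
  have n: "odd ?n" "?n > 0" using assms(3) by (auto simp: even_nat_iff)
  have u0: "u > 0" using assms(2) by (auto intro: Nat.gr0I)
  have pw: "jacobi (2 ^ e) ?n = jacobi 2 ?n ^ e"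
    by (induction e) (auto simp: jacobi_1_left[OF n(1)] jacobi_mult_left[OF n(1)])
  have "coprime (int u) d" using assms(4) by auto
  then have cop: "coprime u ?n" by (metis coprime_abs_right_iff coprime_int_iff int_nat_eq abs_ge_zero)
  have J: "jacobi (s * 2 ^ e * int u) ?n = jacobi s ?n * jacobi 2 ?n ^ e * (qsign (int u) \<bar>d\<bar> * jacobi \<bar>d\<bar> u)"
    using jacobi_reciprocity[OF assms(2) n(1) cop] n by (simp add: jacobi_mult_left pw)
  show ?thesis
  proof (cases "d > 0")
    case True
    then show ?thesis using J assms(1) jacobi_minus_one[OF n(1)] jacobi_1_left[OF n(1)]
      by (auto simp: shimura_symbol_def qsign_commute)
  next
    case False
    then have d: "\<bar>d\<bar> = - d" "d < 0" using assms(3) by (cases "d = 0"; auto)+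
    have "jacobi (- d) u = qsign (int u) (-1) * jacobi d u"
      using jacobi_mult_left[OF assms(2), of "-1" d] jacobi_minus_one[OF assms(2)] by simp
    moreover have "qsign (int u) (- d) = qsign (int u) d * qsign (int u) (-1)"
      using assms by (intro qsign_minus) auto
    ultimately have "qsign (int u) \<bar>d\<bar> * jacobi \<bar>d\<bar> u = qsign (int u) d * jacobi d u"
      using qsign_square[of "int u" "-1"] by (simp add: d)
    \<comment> \<open>This minus sign cancels the one built into \<open>shimura_symbol\<close> when
      both entries are negative.\<close>
    moreover have "qsign (- 1) (- d) = - qsign (-1) d"
      using assms by (subst qsign_minus) (auto simp: qsign_def)
    moreover have "int ?n = - d" using d by simp
    moreover have "s * 2 ^ e * int u < 0 \<longleftrightarrow> s = -1" using assms(1) u0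
      by (auto simp: mult_less_0_iff)
    ultimately show ?thesis using J assms(1) jacobi_minus_one[OF n(1)] jacobi_1_left[OF n(1)] d
      by (auto simp: shimura_symbol_def qsign_commute[of _ "-1"])
  qed
qed

lemma coprime_add_mult: "coprime c d \<Longrightarrow> coprime c (d + k * c)" for c d k :: int
  by (metis add.commute coprime_iff_gcd_eq_1 gcd_add_mult)

text \<open>In the factorised form the periods are 4, 8 and \<open>u\<close>, and 4 and
  \<open>u\<close> divide \<open>c\<close>. Only the factor for 2 needs care: it is 1 for an even
  exponent \<open>e\<close>, while an odd exponent is at least 3, so that 8 divides
  \<open>c\<close>.\<close>

lemma shimura_symbol_shift:
  assumes "4 dvd c" "odd d" "coprime c d"
  shows "shimura_symbol c (d + c) = shimura_symbol c d"
proof (cases "c = 0")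
  case False
  define e where "e = multiplicity 2 (nat \<bar>c\<bar>)"
  obtain u where u: "nat \<bar>c\<bar> = 2 ^ e * u" "\<not> 2 dvd u"
    using False multiplicity_decompose'[of "nat \<bar>c\<bar>" 2] unfolding e_def by auto
  define s where "s = sgn c"
  have s: "s = 1 \<or> s = -1" using False by (auto simp: s_def sgn_if)
  have "\<bar>c\<bar> = 2 ^ e * int u" using u(1) by (metis abs_ge_zero int_nat_eq of_nat_mult of_nat_numeral of_nat_power)
  then have c: "c = s * 2 ^ e * int u" by (metis mult.assoc mult_sgn_abs s_def)
  have odd': "odd (d + c)" using assms by presburger
  have cop: "coprime c (d + c)" using coprime_add_mult[OF assms(3), of 1] by simp
  have 1: "shimura_symbol c d = (if s = 1 then 1 else qsign (-1) d) * jacobi 2 (nat \<bar>d\<bar>) ^ e * (qsign (int u) d * jacobi d u)"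
    using shimura_symbol_formula[of s u d e] s u assms unfolding c[symmetric] by auto
  have 2: "shimura_symbol c (d + c) = (if s = 1 then 1 else qsign (-1) (d + c)) * jacobi 2 (nat \<bar>d + c\<bar>) ^ e * (qsign (int u) (d + c) * jacobi (d + c) u)"
    using shimura_symbol_formula[of s u "d + c" e] s u cop odd' unfolding c[symmetric] by auto
  have q: "qsign a (d + c) = qsign a d" for a
    using assms odd' by (intro qsign_cong4) (auto simp: cong_iff_dvd_diff)
  have j: "jacobi (d + c) u = jacobi d u"
    by (intro jacobi_cong) (simp add: cong_iff_dvd_diff c)
  have "jacobi 2 (nat \<bar>d + c\<bar>) ^ e = jacobi 2 (nat \<bar>d\<bar>) ^ e"
  proof (cases "even e")
    case True
    have "jacobi 2 (nat \<bar>x\<bar>) ^ e = 1" if "odd x" for x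
      using jacobi_values[of "nat \<bar>x\<bar>" 2] that True by (auto simp: even_nat_iff)
    then show ?thesis using assms(2) odd' by simp
  next
    case False
    have "e \<noteq> 1"
    proof
      assume "e = 1"
      then have "\<bar>c\<bar> = 2 * int u" using \<open>\<bar>c\<bar> = 2 ^ e * int u\<close> by simp
      then show False using assms(1) u(2) by presburger
    qed
    with False have "e \<ge> 3" by (cases e rule: parity_cases; presburger)
    then have "(2::int) ^ 3 dvd 2 ^ e" by (rule le_imp_power_dvd)
    then have "8 dvd c" unfolding c by simp
    then show ?thesis using jacobi_2_shift[OF assms(2)] by simp
  qed
  then show ?thesis unfolding 1 2 q j by simp
qed simp

lemma shimura_symbol_shift_mult:
  assumes "4 dvd c" "odd d" "coprime c d"
  shows "shimura_symbol c (d + n * c) = shimura_symbol c d"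
proof -
  have step: "shimura_symbol c (d + (k + 1) * c) = shimura_symbol c (d + k * c)" for k
  proof -
    have "odd (d + k * c)" using assms(1,2) by (auto dest: dvd_trans[of 2 4])
    moreover have "coprime c (d + k * c)" using assms(3) by (rule coprime_add_mult)
    ultimately have "shimura_symbol c (d + k * c + c) = shimura_symbol c (d + k * c)"
      using assms(1) by (intro shimura_symbol_shift) auto
    then show ?thesis by (simp add: algebra_simps)
  qed
  show ?thesis
  proof (induction n rule: int_induct[of _ 0])
    case (step2 i)
    then show ?case using step[of "i - 1"] by simp
  qed (use step in auto)
qed

section \<open>The automorphy factor of weight 3/2\<close>

text \<open>The automorphy factor of the cube of the theta function. The exponents 3 and -3 are
  \<open>round (2 * k)\<close> and its negative at weight 3/2.\<close>

definition jfac :: "int \<Rightarrow> int \<Rightarrow> complex \<Rightarrow> complex" where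
  "jfac c d z = of_int (shimura_symbol c d) powi 3 * eps d powi (-3) * (of_int c * z + of_int d) powr (3 / 2)"

text \<open>The sum of the logarithms differs from the logarithm of the product by an integer
  multiple of 2 pi i, and the bound on the arguments leaves only 0.\<close>

lemma powr_mult_Arg_bound:
  fixes u v s :: complex
  assumes "u \<noteq> 0" "v \<noteq> 0" "\<bar>Im (Ln u) + Im (Ln v) - Im (Ln (u * v))\<bar> < 2 * pi"
  shows "(u * v) powr s = u powr s * v powr s"
proof -
  have "exp (Ln u + Ln v) = exp (Ln (u * v))" using assms by (simp add: exp_add)
  then obtain n :: int where n: "Ln u + Ln v = Ln (u * v) + (of_int (2 * n) * pi) * \<i>"
    unfolding exp_eq by auto
  then have "Im (Ln u) + Im (Ln v) - Im (Ln (u * v)) = 2 * real_of_int n * pi"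
    by (simp add: complex_eq_iff)
  then have "\<bar>real_of_int n\<bar> * (2 * pi) < 2 * pi" using assms(3) by (simp add: abs_mult)
  then have "\<bar>real_of_int n\<bar> < 1" by simp
  then have "n = 0" by linarith
  then show ?thesis using n assms by (simp add: powr_def flip: exp_add distrib_left)
qed

section \<open>Moebius action and the factor under sign change and translation\<close>

lemma moebius_denom_nonzero: "Im z > 0 \<Longrightarrow> c \<noteq> 0 \<or> d \<noteq> 0 \<Longrightarrow> of_int c * z + of_int d \<noteq> (0::complex)"
  by (auto simp: complex_eq_iff)

lemma Im_moebius:
  assumes "a * d - b * c = (1::int)" "Im z > 0"
  shows "Im (moebius_int a b c d z) = Im z / norm (of_int c * z + of_int d) ^ 2"
proof -
  have "Im (moebius_int a b c d z) = Im ((of_int a * z + of_int b) * cnj (of_int c * z + of_int d)) / norm (of_int c * z + of_int d) ^ 2"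
    by (simp add: moebius_int_def complex_div_cnj[of "of_int a * z + of_int b"] Im_divide_of_real del: complex_cnj_add complex_cnj_mult)
  also have "Im ((of_int a * z + of_int b) * cnj (of_int c * z + of_int d)) = (of_int (a * d - b * c)) * Im z"
    by (simp add: algebra_simps)
  finally show ?thesis using assms by simp
qed

lemma Im_moebius_pos:
  assumes "a * d - b * c = (1::int)" "Im z > 0"
  shows "Im (moebius_int a b c d z) > 0"
proof -
  have "c \<noteq> 0 \<or> d \<noteq> 0" using assms by auto
  then have "of_int c * z + of_int d \<noteq> 0" using assms by (intro moebius_denom_nonzero)
  then show ?thesis using assms by (simp add: Im_moebius)
qed

lemma moebius_comp:
  assumes "Im z > 0" "a' * d' - b' * c' = (1::int)"
  shows "moebius_int a b c d (moebius_int a' b' c' d' z) =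
     moebius_int (a * a' + b * c') (a * b' + b * d') (c * a' + d * c') (c * b' + d * d') z"
proof -
  have "c' \<noteq> 0 \<or> d' \<noteq> 0" using assms by auto
  then have nz: "of_int c' * z + of_int d' \<noteq> 0" using assms by (intro moebius_denom_nonzero)
  have *: "A * (p / n) + B = (A * p + B * n) / n" if "n \<noteq> 0" for A B p n :: complex
    using that by (simp add: field_simps)
  show ?thesis unfolding moebius_int_def *[OF nz] using nz
    by (simp add: divide_divide_eq_left[symmetric] del: divide_divide_eq_left) (simp add: algebra_simps)
qed

text \<open>For an argument in (0, pi], \<open>Ln (- u)\<close> is \<open>Ln u\<close> minus pi i,
  and exp(-3 pi i / 2) = \<open>\<i>\<close>.\<close>

lemma powr_uminus_upper:
  assumes "u \<noteq> 0" "Im u > 0 \<or> Im u = 0 \<and> Re u < 0"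
  shows "(- u) powr (3 / 2) = \<i> * u powr (3 / 2)"
proof -
  have "Ln (- u) = Ln u - \<i> * pi"
    using assms by (auto simp: Ln_minus)
  then have "(- u) powr (3 / 2) = exp (3 / 2 * Ln u - \<i> * (3 / 2 * pi))"
    using assms by (simp add: powr_def right_diff_distrib mult.left_commute)
  also have "\<dots> = exp (3 / 2 * Ln u) / exp (\<i> * (3 / 2 * pi))" by (simp add: exp_diff)
  also have "exp (\<i> * (3 / 2 * pi)) = - \<i>"
  proof -
    have "exp (\<i> * (3 / 2 * pi)) = cis (3 / 2 * pi)" by (simp add: cis_conv_exp)
    also have "\<dots> = - \<i>" using cos_3over2_pi sin_3over2_pi by (simp only: complex_eq_iff cis.sel) simp
    finally show ?thesis .
  qed
  finally show ?thesis using assms by (simp add: powr_def field_simps)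
qed

lemma eps_cases:
  assumes "odd d"
  shows "eps d = (if even ((d - 1) div 2) then 1 else \<i>)"
proof -
  have "d mod 4 = 1 \<longleftrightarrow> even ((d - 1) div 2)" using assms by presburger
  then show ?thesis by (simp add: eps_def)
qed

lemma powi_ii_minus3: "\<i> powi (-3) = \<i>"
  by (simp add: power_int_def eval_nat_numeral)

lemma eps_minus:
  assumes "odd d"
  shows "eps (- d) powi (-3) * \<i> = of_int (- qsign d (-1)) * eps d powi (-3)"
proof -
  have "even ((- d - 1) div 2) \<longleftrightarrow> odd ((d - 1) div 2)" using assms by presburger
  then show ?thesis using assms by (simp add: eps_cases qsign_def powi_ii_minus3)
qed

lemma qsign_uminus_left: "odd d \<Longrightarrow> qsign (- d) (-1) = - qsign d (-1)"
proof -
  assume "odd d"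
  then have "even ((- d - 1) div 2) \<longleftrightarrow> odd ((d - 1) div 2)" by presburger
  then show ?thesis by (simp add: qsign_def)
qed

lemma shimura_symbol_uminus:
  assumes "c > 0" "odd d"
  shows "shimura_symbol (- c) (- d) = - qsign d (-1) * shimura_symbol c d"
proof -
  have n: "odd (nat \<bar>d\<bar>)" using assms by (simp add: even_nat_iff)
  have "jacobi (- c) (nat \<bar>d\<bar>) = jacobi (-1) (nat \<bar>d\<bar>) * jacobi c (nat \<bar>d\<bar>)"
    using jacobi_mult_left[OF n, of "-1" c] by simp
  then have J: "jacobi (- c) (nat \<bar>d\<bar>) = qsign \<bar>d\<bar> (-1) * jacobi c (nat \<bar>d\<bar>)"
    unfolding jacobi_minus_one[OF n] by simp
  show ?thesis
  proof (cases "d > 0")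
    case True
    have "shimura_symbol (- c) (- d) = - jacobi (- c) (nat \<bar>d\<bar>)" "shimura_symbol c d = jacobi c (nat \<bar>d\<bar>)"
      using assms True by (simp_all add: shimura_symbol_def)
    moreover have "\<bar>d\<bar> = d" using True by simp
    ultimately show ?thesis using J by simp
  next
    case False
    have "shimura_symbol (- c) (- d) = jacobi (- c) (nat \<bar>d\<bar>)" "shimura_symbol c d = jacobi c (nat \<bar>d\<bar>)"
      using assms False by (simp_all add: shimura_symbol_def)
    moreover have "\<bar>d\<bar> = - d" using False by simp
    ultimately show ?thesis using J qsign_uminus_left[OF assms(2)] by simp
  qed
qed

text \<open>A matrix and its negative act identically, so their factors must agree. The power
  contributes \<open>\<i>\<close>, the symbol a sign, and \<open>eps\<close> combined with this
  \<open>\<i>\<close> the same sign again.\<close>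

lemma jfac_uminus_aux:
  assumes "Im z > 0" "odd d" "c > 0"
  shows "jfac (- c) (- d) z = jfac c d z"
proof -
  have "(- (of_int c * z + of_int d)) powr (3 / 2) = \<i> * (of_int c * z + of_int d) powr (3 / 2)"
    using assms moebius_denom_nonzero[of z c d] by (intro powr_uminus_upper) auto
  moreover have "qsign d (-1) ^ 3 = qsign d (-1)" by (simp add: qsign_def)
  ultimately have "jfac (- c) (- d) z = of_int (- qsign d (-1)) * of_int (shimura_symbol c d) powi 3 *
      (eps (- d) powi (-3) * \<i>) * (of_int c * z + of_int d) powr (3 / 2)"
    using assms by (simp add: jfac_def shimura_symbol_uminus power_int_numeral power_mult_distrib flip: of_int_power)
  also have "\<dots> = (of_int (- qsign d (-1)) * of_int (- qsign d (-1))) * jfac c d z"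
    using assms by (simp add: eps_minus jfac_def)
  also have "of_int (- qsign d (-1)) * of_int (- qsign d (-1)) = (1::complex)" by (simp add: qsign_def)
  finally show ?thesis by simp
qed

text \<open>The symbol is 1 as an empty product; for \<open>d = -1\<close> the values eps(-1)^(-3) =
  \<open>\<i>\<close> and (-1)^(3/2) = \<open>- \<i>\<close> cancel.\<close>

lemma jfac_uminus_0: "jfac 0 1 z = 1" "jfac 0 (-1) z = 1"
proof -
  have "(-1 :: complex) powr (3 / 2) = - \<i>"
    using arg_cong[OF powr_uminus_upper[of "-1"], of "\<lambda>x. - \<i> * x"] by simp
  then show "jfac 0 1 z = 1" "jfac 0 (-1) z = 1"
    by (simp_all add: jfac_def shimura_symbol_def eps_def powi_ii_minus3)
qed

lemma jfac_uminus:
  assumes "Im z > 0" "odd d" "coprime c d"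
  shows "jfac (- c) (- d) z = jfac c d z"
proof -
  consider "c > 0" | "c < 0" | "c = 0" by linarith
  then show ?thesis
  proof cases
    case 1 then show ?thesis using assms by (intro jfac_uminus_aux) auto
  next
    case 2 then show ?thesis using assms jfac_uminus_aux[of z "- d" "- c"] by auto
  next
    case 3
    then have "d = 1 \<or> d = -1" using assms by auto
    then show ?thesis using 3 by (auto simp: jfac_uminus_0)
  qed
qed

lemma jfac_shift:
  assumes "4 dvd c" "odd d" "coprime c d"
  shows "jfac c (d + n * c) (z - of_int n) = jfac c d z"
proof -
  have "eps (d + n * c) = eps d"
  proof -
    obtain k where "c = 4 * k" using assms by (auto elim: dvdE)
    then have "(d + n * c) mod 4 = d mod 4" by (metis mod_mult_self2 mult.left_commute)
    then show ?thesis by (simp add: eps_def)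
  qed
  moreover have "of_int c * (z - of_int n) + of_int (d + n * c) = of_int c * z + of_int d"
    by (simp add: algebra_simps)
  ultimately show ?thesis using assms by (simp add: jfac_def shimura_symbol_shift_mult del: of_int_add)
qed

lemma Im_Ln_sign:
  assumes "Im u = 0 \<Longrightarrow> Re u > 0"
  shows "Im u > 0 \<Longrightarrow> 0 < Im (Ln u) \<and> Im (Ln u) < pi" "Im u < 0 \<Longrightarrow> - pi < Im (Ln u) \<and> Im (Ln u) < 0"
    "Im u = 0 \<Longrightarrow> Im (Ln u) = 0"
proof -
  have nz: "u \<noteq> 0" using assms by auto
  show "Im u > 0 \<Longrightarrow> 0 < Im (Ln u) \<and> Im (Ln u) < pi" 
    using Im_Ln_pos_lt[OF nz] by simp
  show "Im u < 0 \<Longrightarrow> - pi < Im (Ln u) \<and> Im (Ln u) < 0" 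
    using mpi_less_Im_Ln[OF nz] Im_Ln_le_pi[OF nz] Im_Ln_pos_le[OF nz] by auto
  show "Im u = 0 \<Longrightarrow> Im (Ln u) = 0" using assms Im_Ln_eq_0[OF nz] by simp
qed

lemma jfac_V:
  fixes e :: int
  assumes z: "Im z > 0" and d: "d > 0" and e: "e = 1 \<or> e = -1"
  defines "w \<equiv> z / (1 - 4 * of_int e * z)"
  shows "jfac (c + 4 * e * d) d w * (1 - 4 * of_int e * z) powr (3 / 2) = jfac c d z"
proof -
  let ?v = "1 - 4 * of_int e * z"
  let ?c = "c + 4 * e * d"
  let ?u = "of_int ?c * w + of_int d"
  have v0: "Im ?v \<noteq> 0" using z e by auto
  then have v: "?v \<noteq> 0" by (metis zero_complex.simps(2))
  have uv: "?u * ?v = of_int c * z + of_int d" using v unfolding w_def by (simp add: field_simps)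
  have w: "Im w > 0"
  proof -
    have "w = moebius_int 1 0 (-4 * e) 1 z" by (simp add: w_def moebius_int_def)
    then show ?thesis using Im_moebius_pos[of 1 1 0 "-4 * e" z] z by simp
  qed
  have u0: "?u \<noteq> 0" using moebius_denom_nonzero[OF w, of ?c d] d by simp
  have A: "Im ?u = of_int ?c * Im w" "Im ?u = 0 \<Longrightarrow> Re ?u > 0" using w d by (auto simp del: of_int_add)
  have B: "Im (?u * ?v) = of_int c * Im z" "Im (?u * ?v) = 0 \<Longrightarrow> Re (?u * ?v) > 0" unfolding uv using z d by auto
  have c: "Im ?v = - 4 * of_int e * Im z" by simp
  have "(?u * ?v) powr (3 / 2) = ?u powr (3 / 2) * ?v powr (3 / 2)"
  proof (rule powr_mult_Arg_bound[OF u0 v])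
    note L = Im_Ln_sign[OF A(2)] Im_Ln_sign[OF B(2)] Im_Ln_sign[of ?v]
    have sA: "Im ?u > 0 \<longleftrightarrow> ?c > 0" "Im ?u < 0 \<longleftrightarrow> ?c < 0" "Im ?u = 0 \<longleftrightarrow> ?c = 0"
      unfolding A(1) using w by (simp_all add: zero_less_mult_iff mult_less_0_iff del: of_int_add)
    have sB: "Im (?u * ?v) > 0 \<longleftrightarrow> c > 0" "Im (?u * ?v) < 0 \<longleftrightarrow> c < 0" "Im (?u * ?v) = 0 \<longleftrightarrow> c = 0"
      unfolding B(1) using z by (simp_all add: zero_less_mult_iff mult_less_0_iff)
    note L' = L(1-6)[unfolded sA sB]
    show "\<bar>Im (Ln ?u) + Im (Ln ?v) - Im (Ln (?u * ?v))\<bar> < 2 * pi"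
    proof (cases "e = 1")
      case True
      have "- pi < Im (Ln ?v) \<and> Im (Ln ?v) < 0" using L(8) v0 z True unfolding c by simp
      \<comment> \<open>A jump by -2 pi would need a negative argument of the first factor and a
        nonnegative one of the product; this implication rules it out.\<close>
      moreover have "?c < 0 \<Longrightarrow> c < 0" using d True by auto
      moreover have "?c > 0 \<or> ?c = 0 \<or> ?c < 0" "c > 0 \<or> c = 0 \<or> c < 0" by linarith+
      ultimately show ?thesis using L' pi_gt_zero by (elim disjE) (auto simp del: of_int_add)
    next
      case False
      then have e: "e = -1" using e by simp
      have "0 < Im (Ln ?v) \<and> Im (Ln ?v) < pi" using L(7) v0 z e unfolding c by simp
      moreover have "?c > 0 \<Longrightarrow> c > 0" using d e by auto
      moreover have "?c > 0 \<or> ?c = 0 \<or> ?c < 0" "c > 0 \<or> c = 0 \<or> c < 0" by linarith+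
      ultimately show ?thesis using L' pi_gt_zero by (elim disjE) (auto simp del: of_int_add)
    qed
  qed
  moreover have "shimura_symbol ?c d = shimura_symbol c d"
    using d by (simp add: shimura_symbol_def jacobi_cong cong_iff_dvd_diff)
  ultimately show ?thesis using uv by (simp add: jfac_def del: of_int_add)
qed

text \<open>Euclidean descent on the absolute value of \<open>c\<close>. A translation replaces
  \<open>d\<close> by its residue of least absolute value modulo \<open>c\<close>, the negative of
  the matrix makes \<open>d\<close> positive if necessary, and a map z -> z / (1 - 4ez) then
  replaces \<open>c\<close> by the smaller c + 4ed. The base case \<open>c = 0\<close> is a
  translation up to sign.\<close>

lemma Gamma0_4_automorphy:
  assumes T: "\<And>z. Im z > 0 \<Longrightarrow> F (z + 1) = F z"
    and V: "\<And>z. Im z > 0 \<Longrightarrow> F (z / (4 * z + 1)) = (4 * z + 1) powr (3 / 2) * F z"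
    and A: "a * d - b * c = 1" "4 dvd c" and z: "Im z > 0"
  shows "F (moebius_int a b c d z) = jfac c d z * F z"
proof -
  have T': "F (z + of_int n) = F z" if "Im z > 0" for z n
  proof (induction n rule: int_induct[of _ 0])
    case (step1 i) then show ?case using T[of "z + of_int i"] that by (simp add: add.assoc)
  next
    case (step2 i) then show ?case using T[of "z + of_int (i - 1)"] that by (simp add: add.assoc)
  qed simp
  have V': "F (z / (1 - 4 * of_int e * z)) = (1 - 4 * of_int e * z) powr (3 / 2) * F z"
    if z: "Im z > 0" and e: "e = 1 \<or> e = -1" for z and e :: int
  proof (cases "e = -1")
    case True then show ?thesis using V[OF z] by (simp add: add.commute)
  next
    case False
    then have e: "e = 1" using e by simp
    \<comment> \<open>The case \<open>e = 1\<close> is the inverse of the assumed transformation,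
      obtained by applying \<open>V\<close> at \<open>w\<close>, where 4w + 1 is the reciprocal of 1
      - 4z.\<close>
    define w where "w = z / (1 - 4 * z)"
    have v: "1 - 4 * z \<noteq> 0" using z by (auto simp: complex_eq_iff)
    have w: "Im w > 0"
    proof -
      have "w = moebius_int 1 0 (-4) 1 z" by (simp add: w_def moebius_int_def)
      then show ?thesis using Im_moebius_pos[of 1 1 0 "-4" z] z by simp
    qed
    have "4 * w + 1 = 1 / (1 - 4 * z)" using v by (simp add: w_def field_simps)
    moreover have "w / (1 / (1 - 4 * z)) = z" using v by (simp add: w_def)
    ultimately have "F z = (1 / (1 - 4 * z)) powr (3 / 2) * F w" using V[OF w] by simp
    moreover have "(1 / (1 - 4 * z)) powr (3 / 2) * (1 - 4 * z) powr (3 / 2) = 1"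
    proof -
      have "1 - 4 * z \<notin> \<real>\<^sub>\<le>\<^sub>0" using z by (auto simp: complex_nonpos_Reals_iff)
      then have "Ln (1 / (1 - 4 * z)) = - Ln (1 - 4 * z)" by (simp add: Ln_inverse flip: inverse_eq_divide)
      then show ?thesis using v by (simp add: powr_def flip: exp_add)
    qed
    ultimately show ?thesis using e unfolding w_def by (simp add: algebra_simps)
  qed
  define P where "P a b c d \<longleftrightarrow> (\<forall>z. Im z > 0 \<longrightarrow> F (moebius_int a b c d z) = jfac c d z * F z)" for a b c d
  have mneg: "moebius_int (- a) (- b) (- c) (- d) z = moebius_int a b c d z" for a b c d z
  proof -
    have "of_int (- a) * z + of_int (- b) = - (of_int a * z + of_int b)"
      "of_int (- c) * z + of_int (- d) = - (of_int c * z + of_int d)" by simp_all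
    then show ?thesis unfolding moebius_int_def by (simp only: minus_divide_divide)
  qed
  have cop: "coprime c d" "odd d" if "a * d - b * c = 1" "4 dvd c" for a b c d :: int
  proof -
    show "coprime c d"
    proof (rule coprimeI)
      fix k assume "k dvd c" "k dvd d"
      then have "k dvd a * d - b * c" by simp
      then show "is_unit k" using that by simp
    qed
    have "even c" using that(2) by (rule dvd_trans[rotated]) simp
    then show "odd d" using that(1) by (metis dvd_diff dvd_mult odd_one)
  qed
  have main: "P a b c d" if "a * d - b * c = 1" "4 dvd c" for a b c d
    using that
  proof (induction "nat \<bar>c\<bar>" arbitrary: a b c d rule: less_induct)
    case (less c0 a0 b0 d0)
    note cd = cop[OF less.prems]
    show ?case
    proof (cases "c0 = 0")
      case True
      then have "a0 * d0 = 1" using less.prems by simp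
      then have "a0 = 1 \<and> d0 = 1 \<or> a0 = -1 \<and> d0 = -1" using zmult_eq_1_iff by blast
      then show ?thesis
      proof
        assume "a0 = 1 \<and> d0 = 1"
        then show ?thesis using True T' by (simp add: P_def moebius_int_def jfac_uminus_0)
      next
        assume *: "a0 = -1 \<and> d0 = -1"
        then have "moebius_int a0 b0 c0 d0 z = z + of_int (- b0)" for z
          using True by (simp add: moebius_int_def add_divide_distrib)
        then show ?thesis using True * T' by (simp add: P_def jfac_uminus_0 del: of_int_minus)
      qed
    next
      case False
      have pos: "P a b c d" if pr: "a * d - b * c = 1" "4 dvd c" and d: "d > 0" "2 * \<bar>d\<bar> < \<bar>c\<bar>" and c': "\<bar>c\<bar> = \<bar>c0\<bar>"
        for a b c d
      proof -
        \<comment> \<open>With this sign the absolute value of c + 4ed is that of |c| - 4d, which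
          lies strictly between -|c| and |c| because 0 < 2d < |c|.\<close>
        define e where "e = - sgn c"
        have c: "c \<noteq> 0" using d by auto
        then have e: "e = 1 \<or> e = -1" by (auto simp: e_def sgn_if)
        have "\<bar>c + 4 * e * d\<bar> < \<bar>c\<bar>" using c d by (auto simp: e_def sgn_if)
        then have P: "P (a + 4 * e * b) b (c + 4 * e * d) d" 
          using pr c' by (intro less.hyps) (auto simp: algebra_simps)
        show ?thesis unfolding P_def
        proof (intro allI impI)
          fix z assume z: "Im z > 0"
          define w where "w = z / (1 - 4 * of_int e * z)"
          have w': "w = moebius_int 1 0 (-4 * e) 1 z" by (simp add: w_def moebius_int_def)
          then have w: "Im w > 0" using Im_moebius_pos[of 1 1 0 "-4 * e" z] z by simp
          have "moebius_int (a + 4 * e * b) b (c + 4 * e * d) d w = moebius_int a b c d z"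
            unfolding w' using z by (subst moebius_comp) (auto simp: algebra_simps)
          then have "F (moebius_int a b c d z) = jfac (c + 4 * e * d) d w * F w"
            using P w unfolding P_def by metis
          also have "F w = (1 - 4 * of_int e * z) powr (3 / 2) * F z" unfolding w_def by (rule V'[OF z e])
          also have "jfac (c + 4 * e * d) d w * ((1 - 4 * of_int e * z) powr (3 / 2) * F z) =
             (jfac (c + 4 * e * d) d w * (1 - 4 * of_int e * z) powr (3 / 2)) * F z" by (simp only: mult.assoc)
          also have "\<dots> = jfac c d z * F z" unfolding w_def by (subst jfac_V[OF z d(1) e]) simp
          finally show "F (moebius_int a b c d z) = jfac c d z * F z" .
        qed
      qed
      define r where "r = d0 mod \<bar>c0\<bar>"
      \<comment> \<open>The multiple is chosen so that \<open>d1\<close> is the residue of least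
        absolute value.\<close>
      define m where "m = (if 2 * r < \<bar>c0\<bar> then - (d0 div \<bar>c0\<bar>) else - (d0 div \<bar>c0\<bar>) - 1)"
      define n where "n = m * sgn c0"
      define d1 where "d1 = d0 + n * c0"
      have r: "0 \<le> r" "r < \<bar>c0\<bar>" "d0 = (d0 div \<bar>c0\<bar>) * \<bar>c0\<bar> + r" using False by (auto simp: r_def)
      have "n * c0 = m * \<bar>c0\<bar>" by (simp add: n_def abs_sgn mult.assoc mult.commute)
      then have d1: "d1 = (if 2 * r < \<bar>c0\<bar> then r else r - \<bar>c0\<bar>)"
        using r(3) unfolding d1_def m_def by (auto simp: algebra_simps)
      have odd: "odd d1" using cd less.prems(2) unfolding d1_def by (auto dest: dvd_trans[of 2 4])
      \<comment> \<open>Equality would make \<open>r\<close>, and with it \<open>d1\<close>, even,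
        because 4 divides \<open>c0\<close>; but \<open>d1\<close> is odd.\<close>
      have "2 * r \<noteq> \<bar>c0\<bar>"
      proof
        assume *: "2 * r = \<bar>c0\<bar>"
        obtain k where "\<bar>c0\<bar> = 4 * k" using less.prems(2) by (metis dvd_abs_iff dvdE)
        then have "even r" "even \<bar>c0\<bar>" using * by auto
        then show False using odd d1 by (auto split: if_splits)
      qed
      then have d1b: "2 * \<bar>d1\<bar> < \<bar>c0\<bar>" "d1 \<noteq> 0" using d1 r odd by auto
      define b1 where "b1 = b0 + n * a0"
      have det: "a0 * d1 - b1 * c0 = 1" using less.prems(1) by (simp add: d1_def b1_def algebra_simps)
      have cd1: "coprime c0 d1" using cop[OF det less.prems(2)] by simp
      have P: "P a0 b1 c0 d1"
      proof (cases "d1 > 0")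
        case True
        then show ?thesis using det less.prems d1b by (intro pos) auto
      next
        case False
        then have "P (- a0) (- b1) (- c0) (- d1)" using det less.prems d1b by (intro pos) auto
        then show ?thesis using odd cd1 by (simp add: P_def mneg jfac_uminus)
      qed
      show ?thesis unfolding P_def
      proof (intro allI impI)
        fix z assume z: "Im z > 0"
        have "moebius_int a0 b1 c0 d1 (z - of_int n) = moebius_int a0 b0 c0 d0 z"
          by (simp add: moebius_int_def b1_def d1_def algebra_simps)
        moreover have "F (z - of_int n) = F z" using T'[of z "- n"] z by simp
        moreover have "jfac c0 d1 (z - of_int n) = jfac c0 d0 z"
          unfolding d1_def using cd less.prems(2) by (intro jfac_shift) auto
        ultimately show "F (moebius_int a0 b0 c0 d0 z) = jfac c0 d0 z * F z"
          using P[unfolded P_def, rule_format, of "z - of_int n"] z by simp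
      qed
    qed
  qed
  then show ?thesis using A z by (simp add: P_def)
qed

section \<open>The factor under the half translation\<close>

lemma shimura_symbol_4_mult:
  assumes "odd d"
  shows "shimura_symbol (4 * c) d = shimura_symbol c d"
proof -
  have n: "odd (nat \<bar>d\<bar>)" using assms by (simp add: even_nat_iff)
  then have "jacobi 2 (nat \<bar>d\<bar>) * jacobi 2 (nat \<bar>d\<bar>) = 1" by (simp add: jacobi_2')
  then have "jacobi 4 (nat \<bar>d\<bar>) = 1" using jacobi_mult_left[OF n, of 2 2] by simp
  then have J: "jacobi (4 * c) (nat \<bar>d\<bar>) = jacobi c (nat \<bar>d\<bar>)" using jacobi_mult_left[OF n, of 4 c] by simp
  have "4 * c < 0 \<longleftrightarrow> c < 0" by simp
  then show ?thesis unfolding shimura_symbol_def J by (rule arg_cong)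
qed

text \<open>As 4 is a square, the upper entry 16m may be replaced by 4m, of which the shift -8m is a
  multiple. The entry 4m is still divisible by 4, as the periodicity of the symbol demands;
  divisibility by 16 is used here.\<close>

lemma jfac_half_shift:
  assumes "odd d" "coprime (16 * m) d"
  shows "jfac (16 * m) (d - 8 * m) (z + 1 / 2) = jfac (16 * m) d z"
proof -
  have d': "odd (d - 8 * m)" using assms by simp
  have "coprime (2 ^ 2) d" using assms(1) by (metis coprime_left_2_iff_odd coprime_power_left_iff)
  then have "coprime (4 * m) d" using assms(2) by simp
  then have "shimura_symbol (4 * m) (d + (-2) * (4 * m)) = shimura_symbol (4 * m) d"
    using assms by (intro shimura_symbol_shift_mult) auto
  then have "shimura_symbol (16 * m) (d - 8 * m) = shimura_symbol (16 * m) d"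
    using shimura_symbol_4_mult[OF d', of "4 * m"] shimura_symbol_4_mult[OF assms(1), of "4 * m"] by simp
  moreover have "eps (d - 8 * m) = eps d"
  proof -
    have "d - 8 * m = d + (-2 * m) * 4" by simp
    then have "(d - 8 * m) mod 4 = d mod 4" by (metis mod_mult_self1)
    then show ?thesis by (simp add: eps_def)
  qed
  moreover have "of_int (16 * m) * (z + 1 / 2) + of_int (d - 8 * m) = of_int (16 * m) * z + (of_int d :: complex)"
    by (simp add: algebra_simps)
  ultimately show ?thesis by (simp only: jfac_def)
qed

section \<open>Gauss products and the overpartition series\<close>

lemma qpoch_0 [simp]: "qpoch a q 0 = 1" and qpoch_Suc: "qpoch a q (Suc n) = qpoch a q n * (1 - a * q ^ n)"
  by (simp_all add: qpoch_def)

locale nome =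
  fixes q :: complex
  assumes norm_q: "norm q < 1"
begin

abbreviation P where "P n \<equiv> qpoch q q n"
abbreviation N where "N n \<equiv> qpoch (- q) q n"
abbreviation A where "A n \<equiv> qpoch (- 1) q n"

lemma norm_power_Suc_less_1: "norm (q ^ Suc n) < 1"
proof -
  have "norm q ^ Suc n \<le> norm q ^ 1" using norm_q by (intro power_decreasing) auto
  then show ?thesis using norm_q by (simp add: norm_power norm_mult)
qed

lemma one_minus_nz: "n > 0 \<Longrightarrow> 1 - q ^ n \<noteq> 0" and one_plus_nz: "1 + q ^ n \<noteq> 0"
proof -
  assume "n > 0"
  then obtain m where m: "n = Suc m" by (cases n) auto
  show "1 - q ^ n \<noteq> 0"
  proof
    assume "1 - q ^ n = 0"
    then have "q ^ Suc m = 1" by (simp add: m)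
    then show False using norm_power_Suc_less_1[of m] by simp
  qed
next
  show "1 + q ^ n \<noteq> 0"
  proof (cases n)
    case (Suc m)
    show ?thesis
    proof
      assume "1 + q ^ n = 0"
      then have "q ^ Suc m = - 1" unfolding Suc by (simp only: add_eq_0_iff)
      then show False using norm_power_Suc_less_1[of m] by (metis norm_minus_cancel norm_one order_less_irrefl)
    qed
  qed simp
qed

lemma P_Suc: "P (Suc n) = P n * (1 - q ^ Suc n)" and N_Suc: "N (Suc n) = N n * (1 + q ^ Suc n)"
  and A_Suc: "A (Suc n) = A n * (1 + q ^ n)"
  by (simp_all add: qpoch_Suc)

lemma P_nz: "P n \<noteq> 0" and N_nz: "N n \<noteq> 0" and A_nz: "A n \<noteq> 0"
proof -
  have "1 - q ^ Suc n \<noteq> 0" "1 + q ^ n \<noteq> 0" for n by (rule one_minus_nz one_plus_nz; simp)+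
  then show "P n \<noteq> 0" "N n \<noteq> 0" "A n \<noteq> 0"
    by (induction n) (simp_all only: P_Suc N_Suc A_Suc mult_eq_0_iff, simp_all)
qed

lemma A_N: "A n * (1 + q ^ n) = 2 * N n"
proof (induction n)
  case (Suc n)
  have "A (Suc n) * (1 + q ^ Suc n) = (A n * (1 + q ^ n)) * (1 + q ^ Suc n)" by (simp add: A_Suc)
  also have "\<dots> = 2 * N (Suc n)" by (simp only: Suc N_Suc mult.assoc)
  finally show ?case .
qed simp

lemma qpoch_converges:
  assumes "\<And>n. 1 - a * q ^ n \<noteq> 0"
  shows "\<exists>L. L \<noteq> 0 \<and> (\<lambda>n. qpoch a q n) \<longlonglongrightarrow> L"
proof -
  have "summable (\<lambda>n. norm (- a * q ^ n))"
    using norm_q by (auto simp: norm_mult norm_power intro!: summable_mult summable_geometric)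
  then have "abs_convergent_prod (\<lambda>n. 1 + (- a * q ^ n))"
    by (intro summable_imp_abs_convergent_prod) simp
  then have cp: "convergent_prod (\<lambda>n. 1 - a * q ^ n)"
    using abs_convergent_prod_imp_convergent_prod by simp
  have "(\<lambda>n. \<Prod>i\<le>n. 1 - a * q ^ i) \<longlonglongrightarrow> prodinf (\<lambda>n. 1 - a * q ^ n)"
    using convergent_prod_LIMSEQ[OF cp] .
  then have "(\<lambda>n. \<Prod>i<n. 1 - a * q ^ i) \<longlonglongrightarrow> prodinf (\<lambda>n. 1 - a * q ^ n)"
    by (subst filterlim_sequentially_Suc[symmetric]) (simp add: lessThan_Suc_atMost)
  moreover have "prodinf (\<lambda>n. 1 - a * q ^ n) \<noteq> 0"
    using prodinf_nonzero[OF cp] assms by blast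
  ultimately show ?thesis unfolding qpoch_def by blast
qed

text \<open>Limits instead of infinite products: identities are proved for finite products and
  passed to the limit, and \<open>Pinf_prodinf\<close> makes the link with
  \<open>eta\<close>.\<close>

definition "Pinf = lim P"
definition "Ninf = lim N"

lemma P_lim: "P \<longlonglongrightarrow> Pinf" and Pinf_nz: "Pinf \<noteq> 0"
proof -
  have "1 - q * q ^ n \<noteq> 0" for n using one_minus_nz[of "Suc n"] by simp
  then obtain L where L: "L \<noteq> 0" "P \<longlonglongrightarrow> L" using qpoch_converges[of q] by blast
  then show "P \<longlonglongrightarrow> Pinf" "Pinf \<noteq> 0" by (simp_all add: Pinf_def limI)
qed

lemma N_lim: "N \<longlonglongrightarrow> Ninf" and Ninf_nz: "Ninf \<noteq> 0"
proof -
  have "1 - (- q) * q ^ n \<noteq> 0" for n using one_plus_nz[of "Suc n"] by simp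
  then obtain L where L: "L \<noteq> 0" "N \<longlonglongrightarrow> L" using qpoch_converges[of "- q"] by blast
  then show "N \<longlonglongrightarrow> Ninf" "Ninf \<noteq> 0" by (simp_all add: Ninf_def limI)
qed

lemma Pinf_prodinf: "Pinf = prodinf (\<lambda>n. 1 - q ^ Suc n)"
proof -
  have "summable (\<lambda>n. norm (- (q ^ Suc n)))"
    using norm_q by (auto simp: norm_mult norm_power intro!: summable_mult summable_geometric)
  then have "abs_convergent_prod (\<lambda>n. 1 + (- (q ^ Suc n)))"
    by (intro summable_imp_abs_convergent_prod) simp
  then have cp: "convergent_prod (\<lambda>n. 1 - q ^ Suc n)"
    using abs_convergent_prod_imp_convergent_prod by simp
  have "(\<lambda>n. \<Prod>i\<le>n. 1 - q ^ Suc i) \<longlonglongrightarrow> prodinf (\<lambda>n. 1 - q ^ Suc n)"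
    using convergent_prod_LIMSEQ[OF cp] .
  then have "(\<lambda>n. \<Prod>i<n. 1 - q ^ Suc i) \<longlonglongrightarrow> prodinf (\<lambda>n. 1 - q ^ Suc n)"
    by (subst filterlim_sequentially_Suc[symmetric]) (simp add: lessThan_Suc_atMost)
  then have "P \<longlonglongrightarrow> prodinf (\<lambda>n. 1 - q ^ Suc n)" by (simp add: qpoch_def)
  then show ?thesis using P_lim LIMSEQ_unique by blast
qed

lemma bounds:
  obtains K where "K > 0" "\<And>n. norm (P n) \<le> K" "\<And>n. norm (N n) \<le> K" "\<And>n. norm (A n) \<le> K"
    "\<And>n. norm (inverse (P n)) \<le> K" "\<And>n. norm (inverse (N n)) \<le> K"
proof -
  have b: "\<exists>K>0. \<forall>n. norm (f n) \<le> K" if "f \<longlonglongrightarrow> L" for f :: "nat \<Rightarrow> complex" and L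
    using that convergentI convergent_imp_Bseq BseqE by metis
  have "(\<lambda>n. A (Suc n)) = (\<lambda>n. 2 * N n)" by (auto simp: A_Suc A_N)
  then have "(\<lambda>n. A (Suc n)) \<longlonglongrightarrow> 2 * Ninf" using N_lim by (auto intro: tendsto_intros)
  then have Al: "A \<longlonglongrightarrow> 2 * Ninf" by (subst (asm) filterlim_sequentially_Suc)
  obtain K1 where 1: "K1 > 0" "\<And>n. norm (P n) \<le> K1" using b[OF P_lim] by blast
  obtain K2 where 2: "K2 > 0" "\<And>n. norm (N n) \<le> K2" using b[OF N_lim] by blast
  obtain K3 where 3: "K3 > 0" "\<And>n. norm (A n) \<le> K3" using b[OF Al] by blast
  obtain K4 where 4: "K4 > 0" "\<And>n. norm (inverse (P n)) \<le> K4" using b[OF tendsto_inverse[OF P_lim Pinf_nz]] by blast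
  obtain K5 where 5: "K5 > 0" "\<And>n. norm (inverse (N n)) \<le> K5" using b[OF tendsto_inverse[OF N_lim Ninf_nz]] by blast
  show ?thesis
  proof (rule that[of "K1 + K2 + K3 + K4 + K5"])
    fix n
    note b = 1(1) 2(1) 3(1) 4(1) 5(1) 1(2)[of n] 2(2)[of n] 3(2)[of n] 4(2)[of n] 5(2)[of n]
    show "norm (P n) \<le> K1 + K2 + K3 + K4 + K5" "norm (N n) \<le> K1 + K2 + K3 + K4 + K5"
      "norm (A n) \<le> K1 + K2 + K3 + K4 + K5" "norm (inverse (P n)) \<le> K1 + K2 + K3 + K4 + K5"
      "norm (inverse (N n)) \<le> K1 + K2 + K3 + K4 + K5" using b by linarith+
  qed (use 1 2 3 4 5 in simp)
qed

text \<open>Summand of a finite form of Gauss's product for theta_4: as \<open>n\<close> grows, the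
  term \<open>j = 0\<close> tends to the product and the others to 0.\<close>

definition "gauss_term n j = (-1) ^ j * (P n / N n) * (A j / P j) * q ^ (j * Suc n)"

text \<open>Creative telescoping: the increment of the summand in \<open>n\<close> is an increment
  of \<open>u\<close> in \<open>j\<close>, so only boundary terms remain in the induction, and they
  produce the new square.\<close>

lemma gauss_finite: "1 + 2 * (\<Sum>k<n. (-1) ^ Suc k * q ^ ((Suc k)\<^sup>2)) = (\<Sum>j\<le>n. gauss_term n j)"
proof (induction n)
  case 0
  show ?case by (simp add: gauss_term_def)
next
  case (Suc n)
  \<comment> \<open>The certificate is the summand times (1 - q^j) / (1 + q^(n+1)); the numerator
    makes it vanish at \<open>j = 0\<close>.\<close>
  define u where "u j = (-1) ^ j * (P n / N (Suc n)) * (A j * (1 - q ^ j) / P j) * q ^ (j * Suc n)" for j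
  have *: "gauss_term (Suc n) j - gauss_term n j = u (Suc j) - u j" for j
  proof -
    define x y where "x = q ^ j" and "y = q ^ Suc n"
    have nz: "1 + y \<noteq> 0" "1 - q * x \<noteq> 0" using one_plus_nz[of "Suc n"] one_minus_nz[of "Suc j"] by (simp_all add: x_def y_def)
    define c where "c = (-1) ^ j * P n / N n * A j / P j * q ^ (j * Suc n) / (1 + y)"
    have e1: "q ^ (j * Suc (Suc n)) = q ^ (j * Suc n) * x" by (simp add: x_def flip: power_add) (simp add: algebra_simps)
    have e2: "q ^ (Suc j * Suc n) = q ^ (j * Suc n) * y" by (simp add: y_def flip: power_add) (simp add: algebra_simps)
    have 1: "gauss_term (Suc n) j = c * (1 - y) * x"
      unfolding gauss_term_def e1 P_Suc N_Suc c_def y_def[symmetric] using nz by (simp add: mult_ac)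
    have 2: "gauss_term n j = c * (1 + y)"
      unfolding gauss_term_def c_def using nz by simp
    have 3: "u j = c * (1 - x)"
      unfolding u_def c_def N_Suc x_def[symmetric] y_def[symmetric] using nz by (simp add: mult_ac)
    have 4: "u (Suc j) = - c * (1 + x) * y"
      unfolding u_def c_def e2 N_Suc P_Suc A_Suc x_def[symmetric] y_def[symmetric] using nz by (simp add: mult_ac) (simp add: x_def mult_ac)
    show ?thesis unfolding 1 2 3 4 by (simp add: algebra_simps)
  qed
  have "(\<Sum>j\<le>Suc n. gauss_term (Suc n) j) - (\<Sum>j\<le>n. gauss_term n j)
      = gauss_term (Suc n) (Suc n) + (\<Sum>j\<le>n. u (Suc j) - u j)"
    by (simp add: * flip: sum_subtractf)
  also have "(\<Sum>j\<le>n. u (Suc j) - u j) = u (Suc n) - u 0"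
    using sum_lessThan_telescope[of u "Suc n"] by (simp add: lessThan_Suc_atMost)
  also have "u 0 = 0" by (simp add: u_def)
  also have "gauss_term (Suc n) (Suc n) + (u (Suc n) - 0) = 2 * ((-1) ^ Suc n * q ^ ((Suc n)\<^sup>2))"
  proof -
    define y where "y = q ^ Suc n"
    define z where "z = (-1) ^ Suc n * q ^ ((Suc n)\<^sup>2)"
    have nz: "1 - y \<noteq> 0" "1 + y \<noteq> 0" using one_minus_nz[of "Suc n"] one_plus_nz[of "Suc n"] by (simp_all add: y_def)
    have e: "q ^ (Suc n * Suc (Suc n)) = q ^ ((Suc n)\<^sup>2) * y" "q ^ (Suc n * Suc n) = q ^ ((Suc n)\<^sup>2)"
      by (simp_all add: y_def power2_eq_square flip: power_add) (simp add: algebra_simps)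
    have "gauss_term (Suc n) (Suc n) = z * (A (Suc n) / N (Suc n)) * y"
      unfolding gauss_term_def e z_def using P_nz[of "Suc n"] by simp
    moreover have "u (Suc n) = z * (A (Suc n) / N (Suc n))"
      unfolding u_def e z_def P_Suc[of n] y_def[symmetric] using P_nz[of n] nz by (simp add: mult_ac)
    ultimately have "gauss_term (Suc n) (Suc n) + (u (Suc n) - 0) = z * (A (Suc n) * (1 + y)) / N (Suc n)"
      by (simp add: ring_distribs add_divide_distrib mult_ac)
    also have "\<dots> = 2 * z" unfolding y_def A_N using N_nz by simp
    finally show ?thesis by (simp add: z_def)
  qed
  finally show ?case using Suc by (simp add: algebra_simps)
qed

text \<open>Terms with j >= 1 are dominated by a constant times |q|^(n+1) |q|^(j-1), so only
  \<open>j = 0\<close> survives in the limit of the finite identity.\<close>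

lemma gauss_sums: "(\<lambda>n. (-1) ^ Suc n * q ^ ((Suc n)\<^sup>2)) sums ((Pinf / Ninf - 1) / 2)"
proof -
  obtain K where K: "K > 0" "\<And>n. norm (P n) \<le> K" "\<And>n. norm (A n) \<le> K"
    "\<And>n. norm (inverse (P n)) \<le> K" "\<And>n. norm (inverse (N n)) \<le> K" using bounds by metis
  define r where "r = norm q"
  have r: "0 \<le> r" "r < 1" using norm_q by (simp_all add: r_def)
  have b: "norm (gauss_term n (Suc j)) \<le> K ^ 4 * r ^ Suc n * r ^ j" for n j
  proof -
    have "norm (gauss_term n (Suc j)) = norm (P n) * norm (inverse (N n)) * (norm (A (Suc j)) * norm (inverse (P (Suc j)))) * r ^ (Suc j * Suc n)"
      unfolding gauss_term_def by (simp add: norm_mult norm_power norm_divide r_def divide_inverse norm_inverse)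
    also have "\<dots> \<le> K * K * (K * K) * r ^ (Suc n + j)"
      using K r by (intro mult_mono power_decreasing) (auto simp: less_imp_le)
    finally show ?thesis by (simp add: power_add eval_nat_numeral mult_ac)
  qed
  have "(\<lambda>n. \<Sum>j<n. gauss_term n (Suc j)) \<longlonglongrightarrow> 0"
  proof (rule Lim_null_comparison)
    show "\<forall>\<^sub>F n in sequentially. norm (\<Sum>j<n. gauss_term n (Suc j)) \<le> K ^ 4 * r ^ Suc n * (1 / (1 - r))"
    proof (rule always_eventually, rule allI)
      fix n
      have "norm (\<Sum>j<n. gauss_term n (Suc j)) \<le> (\<Sum>j<n. K ^ 4 * r ^ Suc n * r ^ j)"
        using b by (intro sum_norm_le) auto
      also have "\<dots> = K ^ 4 * r ^ Suc n * (\<Sum>j<n. r ^ j)" by (simp add: sum_distrib_left)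
      also have "(\<Sum>j<n. r ^ j) \<le> 1 / (1 - r)"
        using sum_le_suminf[of "\<lambda>j. r ^ j" "{..<n}"] r by (simp add: suminf_geometric)
      finally show "norm (\<Sum>j<n. gauss_term n (Suc j)) \<le> K ^ 4 * r ^ Suc n * (1 / (1 - r))"
        using K r by (simp add: mult_left_mono)
    qed
    have "(\<lambda>n. r ^ Suc n) \<longlonglongrightarrow> 0" using r LIMSEQ_Suc[OF LIMSEQ_power_zero[of r]] by simp
    then show "(\<lambda>n. K ^ 4 * r ^ Suc n * (1 / (1 - r))) \<longlonglongrightarrow> 0"
      by (intro tendsto_mult_left_zero tendsto_mult_right_zero)
  qed
  moreover have "(\<lambda>n. gauss_term n 0) \<longlonglongrightarrow> Pinf / Ninf"
    unfolding gauss_term_def using tendsto_divide[OF P_lim N_lim Ninf_nz] by simp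
  ultimately have "(\<lambda>n. gauss_term n 0 + (\<Sum>j<n. gauss_term n (Suc j))) \<longlonglongrightarrow> Pinf / Ninf + 0"
    by (intro tendsto_add)
  moreover have "gauss_term n 0 + (\<Sum>j<n. gauss_term n (Suc j)) = 1 + 2 * (\<Sum>k<n. (-1) ^ Suc k * q ^ ((Suc k)\<^sup>2))" for n
    unfolding gauss_finite by (simp add: sum.atMost_shift)
  ultimately have "(\<lambda>n. 1 + 2 * (\<Sum>k<n. (-1) ^ Suc k * q ^ ((Suc k)\<^sup>2))) \<longlonglongrightarrow> Pinf / Ninf" by simp
  then have "(\<lambda>n. ((1 + 2 * (\<Sum>k<n. (-1) ^ Suc k * q ^ ((Suc k)\<^sup>2))) - 1) / 2) \<longlonglongrightarrow> (Pinf / Ninf - 1) / 2"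
    by (intro tendsto_intros) auto
  then show ?thesis unfolding sums_def by simp
qed

end

section \<open>A Bailey pair for the overpartition series\<close>

definition tri :: "nat \<Rightarrow> nat" where "tri n = n * (n + 1) div 2"

lemma tri_0 [simp]: "tri 0 = 0" and tri_Suc: "tri (Suc n) = tri n + Suc n"
proof -
  have "Suc n * (Suc n + 1) = n * (n + 1) + 2 * Suc n" by simp
  then show "tri (Suc n) = tri n + Suc n" 
    unfolding tri_def by (simp only: div_mult_self2[of 2 "n * (n + 1)" "Suc n"])
qed (simp add: tri_def)

lemma tri_double: "2 * tri n = n * (n + 1)"
  by (induction n) (auto simp: tri_Suc)

lemma tri_add: "tri (m + n) = tri m + tri n + m * n"
  by (induction n) (auto simp: tri_Suc)

lemma tri_ge: "n \<le> tri n"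
  by (induction n) (auto simp: tri_Suc)

lemma infsum_nat_suminf:
  fixes f :: "nat \<Rightarrow> 'a :: {comm_monoid_add, t2_space}"
  assumes "f summable_on UNIV"
  shows "infsum f UNIV = suminf f"
  using has_sum_imp_sums[OF has_sum_infsum[OF assms]] by (rule sums_unique)

text \<open>Geometric domination in both indices gives absolute summability over pairs, and (n, r)
  -> (r, n - r) is a bijection from the triangle r <= n.\<close>

lemma double_series_diagonal:
  fixes F :: "nat \<Rightarrow> nat \<Rightarrow> complex"
  assumes bound: "\<And>r m. norm (F r m) \<le> K * \<rho> ^ r * \<rho> ^ m" and rho: "0 \<le> \<rho>" "\<rho> < 1"
  shows "(\<Sum>n. \<Sum>r\<le>n. F r (n - r)) = (\<Sum>r. \<Sum>m. F r m)"
proof -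
  have K: "0 \<le> K" using order_trans[OF norm_ge_zero bound[of 0 0]] by simp
  have geo: "((\<lambda>n. c * \<rho> ^ n) has_sum c / (1 - \<rho>)) UNIV" if "c \<ge> 0" for c
    using rho that sums_mult[OF geometric_sums[of \<rho>], of c] by (intro norm_summable_imp_has_sum) (auto simp: norm_mult norm_power intro!: summable_mult summable_geometric)
  define g where "g x = K * \<rho> ^ fst x * \<rho> ^ snd x" for x :: "nat \<times> nat"
  have row_sum: "((\<lambda>m. norm (g (r, m))) has_sum (K * \<rho> ^ r) / (1 - \<rho>)) UNIV" for r
    using geo[of "K * \<rho> ^ r"] K rho by (simp add: g_def abs_mult)
  have "((\<lambda>r. K / (1 - \<rho>) * \<rho> ^ r) has_sum (K / (1 - \<rho>)) / (1 - \<rho>)) UNIV"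
    by (rule geo) (use K rho in simp)
  then have col_sum: "(\<lambda>r. norm ((K * \<rho> ^ r) / (1 - \<rho>))) summable_on UNIV"
    using has_sum_imp_summable K rho by (fastforce simp: abs_mult)
  have "(\<lambda>x. norm (g x)) summable_on (UNIV \<times> UNIV)"
  proof (rule Infinite_Sum.abs_summable_on_Sigma_iff[THEN iffD2], intro conjI ballI)
    fix r
    show "(\<lambda>m. norm (g (r, m))) summable_on UNIV" using has_sum_imp_summable[OF row_sum] .
  next
    show "(\<lambda>r. norm (\<Sum>\<^sub>\<infinity>m. norm (g (r, m)))) summable_on UNIV"
      unfolding infsumI[OF row_sum] by (rule col_sum)
  qed
  then have S: "(\<lambda>x. norm (case x of (r, m) \<Rightarrow> F r m)) summable_on (UNIV \<times> UNIV)"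
  proof (rule summable_on_comparison_test)
    fix x :: "nat \<times> nat"
    obtain r m where x: "x = (r, m)" by fastforce
    show "norm (case x of (r, m) \<Rightarrow> F r m) \<le> norm (g x)"
      using bound[of r m] K rho by (simp add: x g_def abs_mult)
  qed simp
  then have sum: "(\<lambda>(r, m). F r m) summable_on (UNIV \<times> UNIV)" by (rule abs_summable_summable)
  have row: "(\<lambda>m. F r m) summable_on UNIV" for r
  proof (rule norm_summable_imp_summable_on, rule summable_comparison_test')
    show "summable (\<lambda>m. K * \<rho> ^ r * \<rho> ^ m)" using rho by (intro summable_mult summable_geometric) auto
  qed (use bound in auto)
  have inf: "infsum (\<lambda>(r, m). F r m) (UNIV \<times> UNIV) = (\<Sum>r. \<Sum>m. F r m)"
  proof -
    have "infsum (\<lambda>(r, m). F r m) (UNIV \<times> UNIV) = (\<Sum>\<^sub>\<infinity>r. \<Sum>\<^sub>\<infinity>m. F r m)"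
      using infsum_Sigma'_banach[OF sum] by simp
    also have "\<dots> = (\<Sum>\<^sub>\<infinity>r. \<Sum>m. F r m)" using row by (simp add: infsum_nat_suminf)
    also have "\<dots> = (\<Sum>r. \<Sum>m. F r m)"
    proof (rule infsum_nat_suminf)
      have "(\<lambda>r. infsum (F r) UNIV) summable_on UNIV" using summable_on_Sigma_banach[OF sum] by simp
      then show "(\<lambda>r. \<Sum>m. F r m) summable_on UNIV" using row by (simp add: infsum_nat_suminf)
    qed
    finally show ?thesis .
  qed
  let ?S = "SIGMA n:UNIV. {..n::nat}"
  have bij: "bij_betw (\<lambda>(n, r). (r, n - r)) ?S (UNIV \<times> UNIV)"
    by (rule bij_betwI[where g = "\<lambda>(r, m). (r + m, r)"]) auto
  have sum2: "(\<lambda>(n, r). F r (n - r)) summable_on ?S"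
    using sum summable_on_reindex_bij_betw[OF bij, of "\<lambda>(r, m). F r m"] by (simp add: case_prod_unfold)
  have "infsum (\<lambda>(r, m). F r m) (UNIV \<times> UNIV) = infsum (\<lambda>(n, r). F r (n - r)) ?S"
    using infsum_reindex_bij_betw[OF bij, of "\<lambda>(r, m). F r m"] by (simp add: case_prod_unfold)
  also have "\<dots> = (\<Sum>\<^sub>\<infinity>n. \<Sum>\<^sub>\<infinity>r\<in>{..n}. F r (n - r))"
    using infsum_Sigma'_banach[OF sum2] by simp
  also have "\<dots> = (\<Sum>\<^sub>\<infinity>n. \<Sum>r\<le>n. F r (n - r))" by simp
  also have "\<dots> = (\<Sum>n. \<Sum>r\<le>n. F r (n - r))"
  proof (rule infsum_nat_suminf)
    show "(\<lambda>n. \<Sum>r\<le>n. F r (n - r)) summable_on UNIV" using summable_on_Sigma_banach[OF sum2] by simp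
  qed
  finally show ?thesis using inf by simp
qed

context nome
begin

text \<open>The sequence alpha_r of the Bailey pair relative to 1 with beta_n = 1 / (-q;q)_n^2. At
  \<open>r = 0\<close> it is half of the general expression, as usual for a folded two-sided
  sum.\<close>

definition "bailey r = (if r = 0 then 1 else 4 * (-1) ^ r * q ^ tri r / (1 + q ^ r))"

text \<open>The partial sums have a closed form whose factor 1 - q^(m-k) vanishes at
  \<open>k = m\<close>. This vanishing of the full sum drives the induction for the Bailey
  pair.\<close>

lemma bailey_aux:
  assumes "m > 0" "k \<le> m"
  shows "(\<Sum>r\<le>k. bailey r * q ^ (m - r) * (1 + q ^ r)\<^sup>2 / (P (m - r) * P (m + r))) =
    4 * q ^ m * ((-1) ^ k * q ^ tri k * (1 - q ^ (m - k)) / ((1 - q ^ m) * (P (m - k) * P (m + k))))"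
  using assms(2)
proof (induction k)
  case 0
  then show ?case using one_minus_nz[OF assms(1)] by (simp add: bailey_def)
next
  case (Suc k)
  define x y where "x = q ^ Suc k" and "y = q ^ (m - Suc k)"
  have m: "m - k = Suc (m - Suc k)" "m + Suc k = Suc (m + k)" using Suc.prems by auto
  have qm: "q ^ m = x * y" using Suc.prems by (simp add: x_def y_def flip: power_add power_Suc)
  have qmk: "q ^ (m - k) = q * y" by (simp add: m y_def)
  have qms: "q ^ Suc (m + k) = x * (x * y)" using qm by (simp add: x_def power_add mult_ac)
  have nz: "1 - x * y \<noteq> 0" "1 + x \<noteq> 0" "1 - x * (x * y) \<noteq> 0" "1 - q * y \<noteq> 0"
    using one_minus_nz[OF assms(1)] one_plus_nz[of "Suc k"] one_minus_nz[of "Suc (m + k)"] one_minus_nz[of "m - k"] Suc.prems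
    unfolding qm qms qmk x_def[symmetric] by simp_all
  define c where "c = (-1) ^ k * q ^ tri k / (P (m - Suc k) * P (m + k))"
  have 1: "bailey (Suc k) * q ^ (m - Suc k) * (1 + q ^ Suc k)\<^sup>2 / (P (m - Suc k) * P (m + Suc k)) =
     - 4 * c * (x * y * (1 + x)) / (1 - x * (x * y))"
  proof -
    have "bailey (Suc k) = - 4 * ((-1) ^ k * q ^ tri k * x) / (1 + x)"
      by (simp add: bailey_def tri_Suc x_def power_add mult_ac)
    then show ?thesis unfolding m(2) P_Suc[of "m + k"] qms x_def[symmetric] y_def[symmetric] c_def
      using nz by (simp add: power2_eq_square mult_ac)
  qed
  have 2: "(-1) ^ k * q ^ tri k * (1 - q ^ (m - k)) / ((1 - q ^ m) * (P (m - k) * P (m + k))) = c / (1 - x * y)"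
    unfolding m(1) P_Suc[of "m - Suc k"] unfolding m(1)[symmetric] qmk qm c_def using nz by (simp add: mult_ac)
  have 3: "(-1) ^ Suc k * q ^ tri (Suc k) * (1 - q ^ (m - Suc k)) / ((1 - q ^ m) * (P (m - Suc k) * P (m + Suc k))) =
    - c * x * (1 - y) / ((1 - x * y) * (1 - x * (x * y)))"
    unfolding m(2) P_Suc[of "m + k"] qms qm y_def[symmetric] c_def using nz by (simp add: tri_Suc power_add x_def mult_ac)
  have "(\<Sum>r\<le>Suc k. bailey r * q ^ (m - r) * (1 + q ^ r)\<^sup>2 / (P (m - r) * P (m + r))) =
    4 * q ^ m * (c / (1 - x * y)) + - 4 * c * (x * y * (1 + x)) / (1 - x * (x * y))"
    using Suc by (simp only: sum.atMost_Suc 1 2)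
  also have "\<dots> = 4 * q ^ m * (- c * x * (1 - y) / ((1 - x * y) * (1 - x * (x * y))))"
  proof -
    have "c / (1 - x * y) = c * (1 - x * (x * y)) / ((1 - x * y) * (1 - x * (x * y)))"
      "c * (1 + x) / (1 - x * (x * y)) = c * (1 + x) * (1 - x * y) / ((1 - x * y) * (1 - x * (x * y)))"
      using nz by (simp_all add: mult_ac)
    then have "c / (1 - x * y) - c * (1 + x) / (1 - x * (x * y)) = - c * x * (1 - y) / ((1 - x * y) * (1 - x * (x * y)))"
      by (simp add: algebra_simps flip: diff_divide_distrib)
    then have "4 * (x * y) * (c / (1 - x * y) - c * (1 + x) / (1 - x * (x * y))) =
       4 * (x * y) * (- c * x * (1 - y) / ((1 - x * y) * (1 - x * (x * y))))" by simp
    then show ?thesis unfolding qm by (simp add: right_diff_distrib mult_ac)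
  qed
  finally show ?case unfolding 3 .
qed

text \<open>Passing from \<open>n\<close> to \<open>n + 1\<close> must divide the sum by (1 +
  q^(n+1))^2. The discrepancy is the full sum of \<open>bailey_aux\<close>, hence 0.\<close>

lemma bailey_pair: "(\<Sum>r\<le>n. bailey r / (P (n - r) * P (n + r))) = 1 / (N n)\<^sup>2"
proof (induction n)
  case 0
  show ?case by (simp add: bailey_def)
next
  case (Suc n)
  define m where "m = Suc n"
  define y where "y = q ^ m"
  have y: "1 + y \<noteq> 0" unfolding y_def by (rule one_plus_nz)
  \<comment> \<open>With a = q^(m-r) and b = q^r this is (1 + ab)^2 - (1 - a)(1 - ab^2) = a (1 +
    b)^2.\<close>
  have diff: "bailey r * (1 + y)\<^sup>2 / (P (m - r) * P (m + r)) - bailey r / (P (n - r) * P (n + r)) =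
      bailey r * q ^ (m - r) * (1 + q ^ r)\<^sup>2 / (P (m - r) * P (m + r))" if r: "r \<le> n" for r
  proof -
    define a b where "a = q ^ (m - r)" and "b = q ^ r"
    have ab: "y = a * b" using r by (simp add: a_def b_def y_def m_def flip: power_add power_Suc)
    have m': "m - r = Suc (n - r)" "m + r = Suc (n + r)" using r by (auto simp: m_def)
    have qs: "q ^ Suc (n - r) = a" "q ^ Suc (n + r) = a * b * b"
      using ab unfolding a_def m'[symmetric] by (simp_all add: power_add b_def y_def)
    have nz: "1 - a \<noteq> 0" "1 - a * b * b \<noteq> 0"
      using one_minus_nz[of "Suc (n - r)"] one_minus_nz[of "Suc (n + r)"] unfolding qs by simp_all
    show ?thesis unfolding a_def[symmetric] b_def[symmetric] unfolding ab m' P_Suc qs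
    proof -
      let ?D = "P (n - r) * (1 - a) * (P (n + r) * (1 - a * b * b))"
      have "bailey r / (P (n - r) * P (n + r)) = bailey r * ((1 - a) * (1 - a * b * b)) / ?D"
        using nz by (simp add: mult_ac)
      moreover have "bailey r * (1 + a * b)\<^sup>2 - bailey r * ((1 - a) * (1 - a * b * b)) = bailey r * a * (1 + b)\<^sup>2"
        by (simp add: power2_eq_square algebra_simps)
      ultimately show "bailey r * (1 + a * b)\<^sup>2 / ?D - bailey r / (P (n - r) * P (n + r)) = bailey r * a * (1 + b)\<^sup>2 / ?D"
        by (metis diff_divide_distrib)
    qed
  qed
  have "(\<Sum>r\<le>m. bailey r * (1 + y)\<^sup>2 / (P (m - r) * P (m + r))) - (\<Sum>r\<le>n. bailey r / (P (n - r) * P (n + r))) =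
     (\<Sum>r\<le>m. bailey r * q ^ (m - r) * (1 + q ^ r)\<^sup>2 / (P (m - r) * P (m + r)))"
    using diff by (simp add: m_def sum.atMost_Suc y_def flip: sum_subtractf)
  also have "\<dots> = 0" using bailey_aux[of m m] by (simp add: m_def)
  finally have "(1 + y)\<^sup>2 * (\<Sum>r\<le>m. bailey r / (P (m - r) * P (m + r))) = 1 / (N n)\<^sup>2"
    using Suc by (simp add: sum_distrib_left mult_ac)
  moreover have "(1 + y)\<^sup>2 * S / (1 + y)\<^sup>2 = S" for S using y by simp
  ultimately have "(\<Sum>r\<le>m. bailey r / (P (m - r) * P (m + r))) = 1 / (N n)\<^sup>2 / (1 + y)\<^sup>2" by metis
  then show ?case unfolding m_def N_Suc by (simp add: y_def m_def power_mult_distrib)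
qed

text \<open>The inner summand once the series is expanded by the Bailey pair and n = r + m; there
  \<open>D\<close> equals \<open>r\<close>. Freeing \<open>D\<close> gives a first order recursion
  in \<open>D\<close> whose limit at infinity is explicit.\<close>

definition "gterm r D m = A (r + m) * q ^ (tri m + m * D) / (P m * P (r + D + m))"

lemma gterm_telescope:
  "gterm r D m - (1 + q ^ Suc D) * gterm r (Suc D) m = gterm r D m * (1 - q ^ m) - gterm r D (Suc m) * (1 - q ^ Suc m)"
proof -
  define x d s where "x = q ^ m" and "d = q ^ Suc D" and "s = q ^ r"
  have e: "q ^ Suc (r + D + m) = s * d * x" by (simp add: x_def d_def s_def power_add mult_ac)
  have nz: "1 - s * d * x \<noteq> 0" "1 - q * x \<noteq> 0" 
    using one_minus_nz[of "Suc (r + D + m)", unfolded e] one_minus_nz[of "Suc m"] by (simp_all add: x_def)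
  define c where "c = A (r + m) * q ^ (tri m + m * D) / (P m * P (r + D + m)) / (1 - s * d * x)"
  have 1: "gterm r D m = c * (1 - s * d * x)" using nz by (simp add: c_def gterm_def)
  have P': "P (r + Suc D + m) = P (r + D + m) * (1 - s * d * x)" "P (r + D + Suc m) = P (r + D + m) * (1 - s * d * x)"
    using P_Suc[of "r + D + m"] unfolding e by simp_all
  have e2: "q ^ (tri m + m * Suc D) = q ^ (tri m + m * D) * x" by (simp add: x_def power_add mult_ac)
  have e3: "q ^ (tri (Suc m) + Suc m * D) = q ^ (tri m + m * D) * (x * d)"
    by (simp add: x_def d_def power_add tri_Suc mult_ac)
  have 2: "gterm r (Suc D) m = c * x" unfolding gterm_def P' e2 c_def by (simp add: mult_ac)
  have 3: "gterm r D (Suc m) * (1 - q ^ Suc m) = c * (1 + s * x) * (x * d)"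
  proof -
    have "A (r + Suc m) = A (r + m) * (1 + s * x)" by (simp add: A_Suc s_def x_def power_add)
    moreover have "P (Suc m) = P m * (1 - q * x)" and e4: "q ^ Suc m = q * x" by (simp_all add: P_Suc x_def)
    ultimately show ?thesis unfolding gterm_def P' e3 e4 c_def using nz by (simp add: mult_ac)
  qed
  show ?thesis unfolding 1 2 3 d_def[symmetric] x_def[symmetric] by (simp add: algebra_simps)
qed

lemma gterm_bound:
  obtains K where "K > 0" "\<And>r D m. norm (gterm r D m) \<le> K * norm q ^ (tri m + m * D)"
proof -
  obtain K where K: "K > 0" "\<And>n. norm (A n) \<le> K" "\<And>n. norm (inverse (P n)) \<le> K" using bounds by metis
  have "norm (gterm r D m) \<le> (K * (K * K)) * norm q ^ (tri m + m * D)" for r D m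
  proof -
    have "norm (gterm r D m) = norm (A (r + m)) * (norm (inverse (P m)) * norm (inverse (P (r + D + m)))) * norm q ^ (tri m + m * D)"
      by (simp add: gterm_def norm_mult norm_power norm_divide divide_inverse norm_inverse)
    also have "\<dots> \<le> (K * (K * K)) * norm q ^ (tri m + m * D)"
      using K by (intro mult_mono) (auto simp: less_imp_le)
    finally show ?thesis .
  qed
  then show ?thesis using that[of "K * (K * K)"] K by simp
qed

lemma gterm_summable: "summable (gterm r D)"
proof -
  obtain K where K: "K > 0" "\<And>r D m. norm (gterm r D m) \<le> K * norm q ^ (tri m + m * D)" using gterm_bound by blast
  show ?thesis
  proof (rule summable_comparison_test')
    show "summable (\<lambda>m. K * norm q ^ m)" using norm_q by (intro summable_mult summable_geometric) auto
    fix m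
    have "norm q ^ (tri m + m * D) \<le> norm q ^ m" using norm_q tri_ge[of m] by (intro power_decreasing) auto
    then show "norm (gterm r D m) \<le> K * norm q ^ m" using K(2)[of r D m] K(1) by (meson mult_left_mono order_trans less_imp_le)
  qed
qed

text \<open>The combination telescopes in \<open>m\<close>: the boundary value at 0 vanishes through
  1 - q^0, the one at infinity because the terms tend to 0.\<close>

lemma gterm_step: "suminf (gterm r D) = (1 + q ^ Suc D) * suminf (gterm r (Suc D))"
proof -
  let ?w = "\<lambda>m. gterm r D m * (1 - q ^ m)"
  have "?w \<longlonglongrightarrow> 0 * (1 - 0)"
    using norm_q by (intro tendsto_intros summable_LIMSEQ_zero gterm_summable LIMSEQ_power_zero) auto
  then have "(\<lambda>m. ?w m - ?w (Suc m)) sums (?w 0 - 0)" by (intro telescope_sums') simp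
  then have "(\<lambda>m. gterm r D m - (1 + q ^ Suc D) * gterm r (Suc D) m) sums 0"
    unfolding gterm_telescope by simp
  moreover have "(\<lambda>m. gterm r D m - (1 + q ^ Suc D) * gterm r (Suc D) m) sums
     (suminf (gterm r D) - (1 + q ^ Suc D) * suminf (gterm r (Suc D)))"
    by (intro sums_diff sums_mult summable_sums gterm_summable)
  ultimately show ?thesis using sums_unique2 by fastforce
qed

lemma gterm_limit: "(\<lambda>D. suminf (gterm r D)) \<longlonglongrightarrow> A r / Pinf"
proof -
  obtain K where K: "K > 0" "\<And>r D m. norm (gterm r D m) \<le> K * norm q ^ (tri m + m * D)" using gterm_bound by blast
  let ?r = "norm q"
  have split: "suminf (gterm r D) = A r / P (r + D) + (\<Sum>m. gterm r D (Suc m))" for D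
    using suminf_split_head[OF gterm_summable[of r D]] by (simp add: gterm_def)
  have "(\<lambda>D. \<Sum>m. gterm r D (Suc m)) \<longlonglongrightarrow> 0"
  proof (rule Lim_null_comparison)
    show "\<forall>\<^sub>F D in sequentially. norm (\<Sum>m. gterm r D (Suc m)) \<le> K * (1 / (1 - ?r)) * ?r ^ D"
    proof (rule always_eventually, rule allI)
      fix D
      have "norm (\<Sum>m. gterm r D (Suc m)) \<le> (\<Sum>m. K * ?r ^ D * ?r ^ m)"
      proof (rule norm_suminf_le)
        fix m
        have "m + D \<le> tri (Suc m) + Suc m * D" using tri_ge[of "Suc m"] by simp
        then have "?r ^ (tri (Suc m) + Suc m * D) \<le> ?r ^ (m + D)"
          using norm_q by (intro power_decreasing) auto
        then show "norm (gterm r D (Suc m)) \<le> K * ?r ^ D * ?r ^ m"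
          using K(2)[of r D "Suc m"] K(1) by (smt (verit) mult.assoc mult.commute mult_left_mono power_add)
      qed (use norm_q in \<open>auto intro!: summable_mult summable_geometric\<close>)
      also have "\<dots> = K * (1 / (1 - ?r)) * ?r ^ D" using norm_q by (simp add: suminf_mult suminf_geometric)
      finally show "norm (\<Sum>m. gterm r D (Suc m)) \<le> K * (1 / (1 - ?r)) * ?r ^ D" .
    qed
    show "(\<lambda>D. K * (1 / (1 - ?r)) * ?r ^ D) \<longlonglongrightarrow> 0"
      using norm_q by (intro tendsto_mult_right_zero LIMSEQ_power_zero) auto
  qed
  moreover have "(\<lambda>D. P (r + D)) \<longlonglongrightarrow> Pinf" using LIMSEQ_ignore_initial_segment[OF P_lim, of r] by (simp add: add.commute)
  ultimately have "(\<lambda>D. A r / P (r + D) + (\<Sum>m. gterm r D (Suc m))) \<longlonglongrightarrow> A r / Pinf + 0"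
    using Pinf_nz by (intro tendsto_intros) auto
  then show ?thesis unfolding split by simp
qed

text \<open>Iterating the recursion from \<open>D = r\<close> to infinity multiplies the limit by
  the tail product Ninf / N r. This is the conjugate Bailey pair with one parameter -1 and the other
  sent to infinity.\<close>

lemma gterm_suminf: "suminf (gterm r r) = A r * Ninf / (N r * Pinf)"
proof -
  have "suminf (gterm r r) = N (r + k) / N r * suminf (gterm r (r + k))" for k
  proof (induction k)
    case (Suc k)
    then show ?case using gterm_step[of r "r + k"] by (simp add: N_Suc mult_ac)
  qed (simp add: N_nz)
  moreover have "(\<lambda>k. N (r + k) / N r * suminf (gterm r (r + k))) \<longlonglongrightarrow> Ninf / N r * (A r / Pinf)"
    using LIMSEQ_ignore_initial_segment[OF N_lim, of r] LIMSEQ_ignore_initial_segment[OF gterm_limit, of r r] N_nz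
    by (intro tendsto_intros) (auto simp: add.commute)
  ultimately have "(\<lambda>k. suminf (gterm r r)) \<longlonglongrightarrow> Ninf / N r * (A r / Pinf)" by simp
  then have "suminf (gterm r r) = Ninf / N r * (A r / Pinf)" using LIMSEQ_unique tendsto_const by blast
  then show ?thesis by simp
qed

text \<open>Insert the Bailey pair for 1 / (-q;q)_n^2, exchange the summations and evaluate the
  inner sums by \<open>gterm_suminf\<close>.\<close>

lemma overpartO_eq:
  "overpartO q = Ninf / Pinf * (\<Sum>r. bailey r * (2 * q ^ tri r / (1 + q ^ r)))"
  "summable (\<lambda>r. bailey r * (2 * q ^ tri r / (1 + q ^ r)))"
proof -
  obtain K where K: "K > 0" "\<And>r D m. norm (gterm r D m) \<le> K * norm q ^ (tri m + m * D)" using gterm_bound by blast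
  define F where "F r m = bailey r * (q ^ tri r * gterm r r m)" for r m
  have inv: "norm (1 / (1 + q ^ r)) \<le> 1 / (1 - norm q)" if "r > 0" for r
  proof -
    have "norm q ^ r \<le> norm q ^ 1" using that norm_q by (intro power_decreasing) auto
    then have "1 - norm q \<le> norm (1 + q ^ r)" using norm_diff_ineq[of 1 "q ^ r"] by (simp add: norm_power)
    then show ?thesis using norm_q by (simp add: norm_divide frac_le)
  qed
  define L where "L = 4 / (1 - norm q)"
  have L: "L \<ge> 1" using norm_q norm_ge_zero[of q] unfolding L_def by (simp add: field_simps del: norm_ge_zero)
  have bailey: "norm (bailey r) \<le> L" for r
  proof (cases "r = 0")
    case False
    have "norm (bailey r) = 4 * (norm q ^ tri r * norm (1 / (1 + q ^ r)))"
      using False by (simp add: bailey_def norm_mult norm_divide norm_power)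
    also have "\<dots> \<le> 4 * (1 * (1 / (1 - norm q)))"
      using norm_q False by (intro mult_left_mono mult_mono inv power_le_one) auto
    finally show ?thesis by (simp add: L_def)
  qed (use L in \<open>simp add: bailey_def\<close>)
  have bound: "norm (F r m) \<le> (L * K) * norm q ^ r * norm q ^ m" for r m
  proof -
    have "norm (F r m) = norm (bailey r) * (norm q ^ tri r * norm (gterm r r m))"
      by (simp add: F_def norm_mult norm_power)
    also have "\<dots> \<le> L * (norm q ^ r * (K * norm q ^ m))"
    proof (intro mult_mono bailey)
      show "norm q ^ tri r \<le> norm q ^ r" using norm_q tri_ge by (intro power_decreasing) auto
      have "norm q ^ (tri m + m * r) \<le> norm q ^ m" using norm_q tri_ge[of m] by (intro power_decreasing) auto
      then show "norm (gterm r r m) \<le> K * norm q ^ m" using K(2)[of r r m] K(1) by (meson mult_left_mono order_trans less_imp_le)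
    qed (use norm_q L in auto)
    finally show ?thesis by (simp add: mult_ac)
  qed
  have "qpoch (-1) q n * q ^ (n * (n + 1) div 2) / (qpoch (- q) q n)\<^sup>2 = (\<Sum>r\<le>n. F r (n - r))" for n
  proof -
    have "qpoch (-1) q n * q ^ (n * (n + 1) div 2) / (qpoch (- q) q n)\<^sup>2 = A n * q ^ tri n * (1 / (N n)\<^sup>2)"
      by (simp add: tri_def)
    also have "\<dots> = (\<Sum>r\<le>n. A n * q ^ tri n * (bailey r / (P (n - r) * P (n + r))))"
      unfolding bailey_pair[symmetric] by (simp add: sum_distrib_left)
    also have "\<dots> = (\<Sum>r\<le>n. F r (n - r))"
    proof (rule sum.cong[OF refl])
      fix r assume "r \<in> {..n}"
      then obtain m where m: "n = r + m" by (auto simp: le_iff_add)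
      have "q ^ tri (r + m) = q ^ tri r * q ^ (tri m + m * r)" by (simp add: tri_add power_add mult_ac)
      then show "A n * q ^ tri n * (bailey r / (P (n - r) * P (n + r))) = F r (n - r)"
        unfolding m F_def gterm_def by (simp add: mult_ac add_ac)
    qed
    finally show ?thesis .
  qed
  then have "overpartO q = (\<Sum>n. \<Sum>r\<le>n. F r (n - r))" by (simp add: overpartO_def)
  also have "\<dots> = (\<Sum>r. \<Sum>m. F r m)" by (rule double_series_diagonal[OF bound]) (use norm_q in auto)
  also have "(\<lambda>r. \<Sum>m. F r m) = (\<lambda>r. Ninf / Pinf * (bailey r * (2 * q ^ tri r / (1 + q ^ r))))"
  proof
    fix r
    have "(\<Sum>m. F r m) = bailey r * (q ^ tri r * suminf (gterm r r))"
      unfolding F_def by (simp add: suminf_mult gterm_summable summable_mult)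
    also have "suminf (gterm r r) = (A r / N r) * (Ninf / Pinf)" by (simp add: gterm_suminf)
    also have "A r / N r = 2 / (1 + q ^ r)" using A_N[of r] N_nz[of r] one_plus_nz[of r] by (simp add: field_simps)
    finally show "(\<Sum>m. F r m) = Ninf / Pinf * (bailey r * (2 * q ^ tri r / (1 + q ^ r)))" by (simp add: mult_ac)
  qed
  finally have O: "overpartO q = (\<Sum>r. Ninf / Pinf * (bailey r * (2 * q ^ tri r / (1 + q ^ r))))" .
  show S: "summable (\<lambda>r. bailey r * (2 * q ^ tri r / (1 + q ^ r)))"
  proof (rule summable_comparison_test'[where N = 1])
    show "summable (\<lambda>r. L * (2 * (1 / (1 - norm q))) * norm q ^ r)" using norm_q by (intro summable_mult summable_geometric) auto
    fix r :: nat assume "r \<ge> 1"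
    have "norm (bailey r * (2 * q ^ tri r / (1 + q ^ r))) = norm (bailey r) * (2 * norm (1 / (1 + q ^ r))) * norm q ^ tri r"
      by (simp add: norm_mult norm_divide norm_power)
    also have "\<dots> \<le> L * (2 * (1 / (1 - norm q))) * norm q ^ r"
      using norm_q L \<open>r \<ge> 1\<close> by (intro mult_mono bailey inv power_decreasing tri_ge) auto
    finally show "norm (bailey r * (2 * q ^ tri r / (1 + q ^ r))) \<le> L * (2 * (1 / (1 - norm q))) * norm q ^ r" .
  qed
  show "overpartO q = Ninf / Pinf * (\<Sum>r. bailey r * (2 * q ^ tri r / (1 + q ^ r)))"
    unfolding O by (rule suminf_mult[OF S])
qed

text \<open>The factor Pinf / Ninf is theta_4, which clears the prefactor of the rearranged series;
  the subtracted 1 is its term \<open>r = 0\<close>.\<close>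

theorem overpartO_times_theta:
  "(\<lambda>n. 8 * ((-1) ^ Suc n * q ^ ((Suc n)\<^sup>2 + Suc n) / (1 + q ^ Suc n)\<^sup>2)) sums (overpartO q * (Pinf / Ninf) - 1)"
proof -
  have "(\<lambda>r. bailey r * (2 * q ^ tri r / (1 + q ^ r))) sums (overpartO q * (Pinf / Ninf))"
    using summable_sums[OF overpartO_eq(2)] overpartO_eq(1) Pinf_nz Ninf_nz by simp
  then have "(\<lambda>r. bailey (Suc r) * (2 * q ^ tri (Suc r) / (1 + q ^ Suc r))) sums (overpartO q * (Pinf / Ninf) - 1)"
    by (subst sums_Suc_iff) (simp add: bailey_def)
  moreover have "bailey (Suc n) * (2 * q ^ tri (Suc n) / (1 + q ^ Suc n)) =
      8 * ((-1) ^ Suc n * q ^ ((Suc n)\<^sup>2 + Suc n) / (1 + q ^ Suc n)\<^sup>2)" for n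
  proof -
    have "q ^ ((Suc n)\<^sup>2 + Suc n) = q ^ tri (Suc n) * q ^ tri (Suc n)"
    proof -
      have "(Suc n)\<^sup>2 + Suc n = tri (Suc n) + tri (Suc n)" using tri_double[of "Suc n"] by (simp add: power2_eq_square)
      then show ?thesis by (simp only: power_add)
    qed
    then show ?thesis by (simp add: bailey_def power2_eq_square mult_ac)
  qed
  ultimately show ?thesis by simp
qed

end

section \<open>Fourier expansions and Gaussian integrals\<close>

text \<open>By the product-to-sum formula, a factor cos(2 pi x) moves the frequency by one in both
  directions, so powers can be removed one at a time.\<close>

lemma cos_power_orthogonal:
  fixes D :: "real \<Rightarrow> real"
  assumes D: "continuous_on {0..1/2} D"
    and 0: "\<And>n::nat. integral {0..1/2} (\<lambda>x. D x * cos (2 * pi * n * x)) = 0"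
  shows "integral {0..1/2} (\<lambda>x. D x * (cos (2 * pi * x) ^ k * cos (2 * pi * real n * x))) = 0"
proof (induction k arbitrary: n)
  case 0
  then show ?case using assms(2) by simp
next
  case (Suc k)
  have int: "(\<lambda>x. D x * (cos (2 * pi * x) ^ k * cos (2 * pi * real m * x))) integrable_on {0..1/2}" for m
    by (intro integrable_continuous_real continuous_intros D)
  show ?case
  proof (cases n)
    case 0
    then show ?thesis using Suc[of 1] by (simp add: mult_ac)
  next
    case (Suc m)
    have "cos (2 * pi * x) * cos (2 * pi * real n * x) = (cos (2 * pi * real m * x) + cos (2 * pi * real (m + 2) * x)) / 2" for x
    proof -
      have "cos (2 * pi * real n * x) * cos (2 * pi * x) = (cos (2 * pi * real n * x - 2 * pi * x) + cos (2 * pi * real n * x + 2 * pi * x)) / 2"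
        by (rule cos_times_cos)
      moreover have "2 * pi * real n * x - 2 * pi * x = 2 * pi * real m * x" "2 * pi * real n * x + 2 * pi * x = 2 * pi * real (m + 2) * x"
        using Suc by (simp_all add: algebra_simps)
      ultimately show ?thesis by (simp only: mult.commute)
    qed
    then have *: "D x * cos (2 * pi * x) ^ k * (cos (2 * pi * x) * cos (2 * pi * real n * x)) =
       D x * cos (2 * pi * x) ^ k * ((cos (2 * pi * real m * x) + cos (2 * pi * real (m + 2) * x)) / 2)" for x by (simp only:)
    have "D x * (cos (2 * pi * x) ^ Suc k * cos (2 * pi * real n * x)) =
       D x * (cos (2 * pi * x) ^ k * cos (2 * pi * real m * x)) / 2 + D x * (cos (2 * pi * x) ^ k * cos (2 * pi * real (m + 2) * x)) / 2" for x
      using *[of x] by (simp only: power_Suc add_divide_distrib distrib_left times_divide_eq_right mult_ac)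
    then show ?thesis using Suc.IH[of m] Suc.IH[of "m + 2"] int[of m] int[of "m + 2"]
      by (simp add: integral_add)
  qed
qed

text \<open>\<open>D\<close> is orthogonal to all polynomials in cos(2 pi x). Since the cosine is
  injective on the half period, such polynomials approximate \<open>D\<close> uniformly by
  Stone-Weierstrass, whence the integral of D^2 is 0.\<close>

lemma cosine_coefficients_unique:
  fixes D :: "real \<Rightarrow> real"
  assumes D: "continuous_on {0..1/2} D"
    and 0: "\<And>n::nat. integral {0..1/2} (\<lambda>x. D x * cos (2 * pi * n * x)) = 0"
    and x: "x \<in> {0..1/2}"
  shows "D x = 0"
proof -
  have poly: "integral {0..1/2} (\<lambda>x. D x * p (cos (2 * pi * x))) = 0" if rp: "real_polynomial_function p" for p
  proof -
    obtain a n where p: "p = (\<lambda>x. \<Sum>i\<le>n. a i * x ^ i)" using real_polynomial_function_imp_sum[OF rp] by blast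
    have "D x * p (cos (2 * pi * x)) = (\<Sum>i\<le>n. a i * (D x * (cos (2 * pi * x) ^ i * cos (2 * pi * real 0 * x))))" for x
      by (simp add: p sum_distrib_left mult_ac)
    then have "integral {0..1/2} (\<lambda>x. D x * p (cos (2 * pi * x))) =
      (\<Sum>i\<le>n. integral {0..1/2} (\<lambda>x. a i * (D x * (cos (2 * pi * x) ^ i * cos (2 * pi * real 0 * x)))))"
      by (simp only:) (intro integral_sum integrable_continuous_real continuous_intros D, auto)
    also have "\<dots> = 0" by (simp only: integral_mult_right cos_power_orthogonal[OF D 0]) simp
    finally show ?thesis .
  qed
  define H where "H t = D (arccos t / (2 * pi))" for t
  have H: "continuous_on {-1..1} H"
    unfolding H_def
    by (rule continuous_on_compose2[OF D]) (auto intro!: continuous_intros simp: arccos_lbound arccos_ubound field_simps)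
  have HD: "H (cos (2 * pi * x)) = D x" if "x \<in> {0..1/2}" for x
  proof -
    have "0 \<le> 2 * pi * x" "2 * pi * x \<le> pi" using that by (auto simp: field_simps)
    then show ?thesis by (simp add: H_def arccos_cos)
  qed
  have intD2: "(\<lambda>x. D x * D x) integrable_on {0..1/2}" by (intro integrable_continuous_real continuous_intros D)
  have "compact (D ` {0..1/2})" using D by (intro compact_continuous_image) auto
  then obtain B where B: "B > 0" "\<And>x. x \<in> {0..1/2} \<Longrightarrow> \<bar>D x\<bar> \<le> B"
    using compact_imp_bounded bounded_pos by (metis imageI real_norm_def)
  have le: "integral {0..1/2} (\<lambda>x. D x * D x) \<le> e" if e: "e > 0" for e
  proof -
    obtain p where p: "real_polynomial_function p" "\<And>t. t \<in> {-1..1} \<Longrightarrow> \<bar>H t - p t\<bar> < e / B"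
      using Stone_Weierstrass_real_polynomial_function[OF compact_Icc H, of "e / B"] e B by auto
    have cp: "continuous_on {0..1/2} (\<lambda>x. p (cos (2 * pi * x)))"
    proof (rule continuous_on_compose2[of UNIV p])
      show "continuous_on UNIV p" using p(1) by (simp add: continuous_on_polymonial_function real_polynomial_function_eq)
    qed (auto intro!: continuous_intros)
    have "integral {0..1/2} (\<lambda>x. D x * D x) = integral {0..1/2} (\<lambda>x. D x * D x - D x * p (cos (2 * pi * x)))"
      using poly[OF p(1)] intD2 by (subst integral_diff) (auto intro!: integrable_continuous_real continuous_intros D cp)
    also have "\<dots> \<le> integral {0..1/2} (\<lambda>x::real. e)"
    proof (rule integral_le)
      fix x :: real assume x: "x \<in> {0..1/2}"
      have "D x * D x - D x * p (cos (2 * pi * x)) = D x * (H (cos (2 * pi * x)) - p (cos (2 * pi * x)))"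
        using HD[OF x] by (simp add: algebra_simps)
      also have "\<dots> \<le> \<bar>D x\<bar> * \<bar>H (cos (2 * pi * x)) - p (cos (2 * pi * x))\<bar>" by (metis abs_ge_self abs_mult)
      also have "\<dots> \<le> B * (e / B)" using B(2)[OF x] p(2)[of "cos (2 * pi * x)"] B(1) by (intro mult_mono) auto
      finally show "D x * D x - D x * p (cos (2 * pi * x)) \<le> e" using B by simp
    qed (auto intro!: integrable_continuous_real continuous_intros D cp)
    also have "\<dots> \<le> e" using e by simp
    finally show ?thesis .
  qed
  have "integral {0..1/2} (\<lambda>x. D x * D x) \<le> 0" by (rule field_le_epsilon) (use le in auto)
  moreover have "integral {0..1/2} (\<lambda>x. D x * D x) \<ge> 0" by (intro integral_nonneg intD2) auto
  ultimately have "integral {0..1/2} (\<lambda>x. D x * D x) = 0" by simp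
  moreover have "continuous_on {0..1/2} (\<lambda>x. D x * D x)" by (intro continuous_intros D)
  ultimately have "D x * D x = 0"
    using integral_eq_0_iff[of 0 "1/2" "\<lambda>x. D x * D x"] x by simp
  then show ?thesis by simp
qed

section \<open>Lebesgue integrals over the half line\<close>

abbreviation hl :: "real measure" where "hl \<equiv> restrict_space lborel {0..}"

lemma space_hl [simp]: "space hl = {0..}"
  by (simp add: space_restrict_space)

text \<open>A restricted measure instead of indicators lets the convergence and Fubini theorems for
  general measures apply directly; this equivalence returns to the full line, where affine
  substitution is available.\<close>

lemma has_bochner_integral_hl_iff:
  fixes f :: "real \<Rightarrow> 'a :: {banach, second_countable_topology}"
  shows "has_bochner_integral hl f I \<longleftrightarrow> has_bochner_integral lborel (\<lambda>x. indicator {0..} x *\<^sub>R f x) I"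
  by (simp add: has_bochner_integral_iff integrable_restrict_space integral_restrict_space)

lemma hl_measurable_continuous:
  fixes f :: "real \<Rightarrow> 'a :: {real_normed_vector, second_countable_topology}"
  assumes "continuous_on {0..} f"
  shows "f \<in> borel_measurable hl"
proof -
  have "f \<in> borel_measurable (restrict_space borel {0..})"
    using assms by (rule borel_measurable_continuous_on_restrict)
  then show ?thesis by (simp cong: measurable_cong_sets sets_restrict_space_cong)
qed

lemma hl_even:
  fixes f :: "real \<Rightarrow> real"
  assumes even: "\<And>x. f (- x) = f x" and f: "has_bochner_integral lborel f I"
  shows "has_bochner_integral hl f (I / 2)"
proof -
  have int: "integrable lborel f" and I: "integral\<^sup>L lborel f = I" using f by (auto simp: has_bochner_integral_iff)
  have 1: "integrable lborel (\<lambda>x. indicator {0..} x *\<^sub>R f x)" "integrable lborel (\<lambda>x. indicator {..0} x *\<^sub>R f x)"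
    using int by (intro integrable_mult_indicator; simp)+
  have 2: "integral\<^sup>L lborel (\<lambda>x. indicator {..0} x *\<^sub>R f x) = integral\<^sup>L lborel (\<lambda>x. indicator {0..} x *\<^sub>R f x)"
  proof -
    have "integral\<^sup>L lborel (\<lambda>x. indicator {0..} x *\<^sub>R f x) = integral\<^sup>L lborel (\<lambda>x. indicator {0..} (- x) *\<^sub>R f (- x))"
      using lborel_integral_real_affine[of "-1" "\<lambda>x. indicator {0..} x *\<^sub>R f x" 0] by simp
    also have "\<dots> = integral\<^sup>L lborel (\<lambda>x. indicator {..0} x *\<^sub>R f x)"
      by (intro Bochner_Integration.integral_cong) (auto simp: even split: split_indicator)
    finally show ?thesis by simp
  qed
  have "I = integral\<^sup>L lborel (\<lambda>x. indicator {0..} x *\<^sub>R f x + indicator {..0} x *\<^sub>R f x)"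
    unfolding I[symmetric]
  proof (rule integral_cong_AE)
    \<comment> \<open>The two half lines overlap in the null set containing only 0.\<close>
    have "AE x in lborel. x \<noteq> (0::real)" by (rule AE_lborel_singleton)
    then show "AE x in lborel. f x = indicator {0..} x *\<^sub>R f x + indicator {..0} x *\<^sub>R f x"
      by eventually_elim (auto split: split_indicator)
  qed (use int 1 in \<open>auto intro: borel_measurable_integrable\<close>)
  also have "\<dots> = 2 * integral\<^sup>L lborel (\<lambda>x. indicator {0..} x *\<^sub>R f x)"
    using 1 2 by simp
  finally show ?thesis using 1 unfolding has_bochner_integral_hl_iff by (simp add: has_bochner_integral_iff)
qed

lemma normal_density_alt:
  assumes "\<alpha> > 0"
  shows "normal_density \<mu> (sqrt (1 / (2 * \<alpha>))) x = sqrt (\<alpha> / pi) * exp (- \<alpha> * (x - \<mu>)\<^sup>2)"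
  using assms by (simp add: normal_density_def real_sqrt_divide field_simps)

lemma gaussian_full:
  assumes a: "\<alpha> > 0"
  shows "has_bochner_integral lborel (\<lambda>x. exp (- \<alpha> * x\<^sup>2)) (sqrt (pi / \<alpha>))"
    and "has_bochner_integral lborel (\<lambda>x. exp (- \<alpha> * x\<^sup>2) * x\<^sup>2) (sqrt (pi / \<alpha>) / (2 * \<alpha>))"
    and "has_bochner_integral lborel (\<lambda>x. exp (- \<alpha> * (x - \<mu>)\<^sup>2) * x) (\<mu> * sqrt (pi / \<alpha>))"
proof -
  let ?s = "sqrt (1 / (2 * \<alpha>))"
  have s: "?s > 0" using a by simp
  have c: "sqrt (pi / \<alpha>) * sqrt (\<alpha> / pi) = 1" using a by (simp flip: real_sqrt_mult)
  have c': "sqrt (pi / \<alpha>) * (sqrt (\<alpha> / pi) * y) = y" for y using c by (simp flip: mult.assoc)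
  have "has_bochner_integral lborel (normal_density 0 ?s) 1"
    using s by (simp add: has_bochner_integral_iff integrable_normal_density integral_normal_density)
  from has_bochner_integral_mult_right[OF this, of "sqrt (pi / \<alpha>)"]
  show "has_bochner_integral lborel (\<lambda>x. exp (- \<alpha> * x\<^sup>2)) (sqrt (pi / \<alpha>))"
    by (simp add: normal_density_alt[OF a] c')
  have "has_bochner_integral lborel (\<lambda>x. normal_density 0 ?s x * (x - 0) ^ (2 * 1)) (fact (2 * 1) / ((2 / ?s\<^sup>2) ^ 1 * fact 1))"
    by (rule normal_moment_even) (rule s)
  from has_bochner_integral_mult_right[OF this, of "sqrt (pi / \<alpha>)"]
  show "has_bochner_integral lborel (\<lambda>x. exp (- \<alpha> * x\<^sup>2) * x\<^sup>2) (sqrt (pi / \<alpha>) / (2 * \<alpha>))"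
    using a by (simp add: normal_density_alt[OF a] c' mult.assoc)
  have "has_bochner_integral lborel (\<lambda>x. normal_density \<mu> ?s x * x) \<mu>"
    by (rule normal_moment_nz_1) (rule s)
  from has_bochner_integral_mult_right[OF this, of "sqrt (pi / \<alpha>)"]
  show "has_bochner_integral lborel (\<lambda>x. exp (- \<alpha> * (x - \<mu>)\<^sup>2) * x) (\<mu> * sqrt (pi / \<alpha>))"
    by (simp add: normal_density_alt[OF a] c' mult.assoc mult.commute[of _ \<mu>])
qed

lemma gaussian_hl:
  assumes a: "\<alpha> > 0"
  shows "has_bochner_integral hl (\<lambda>x. exp (- \<alpha> * x\<^sup>2)) (sqrt (pi / \<alpha>) / 2)"
    and "has_bochner_integral hl (\<lambda>x. exp (- \<alpha> * x\<^sup>2) * x\<^sup>2) (sqrt (pi / \<alpha>) / (4 * \<alpha>))"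
  using hl_even[OF _ gaussian_full(1)[OF a]] hl_even[OF _ gaussian_full(2)[OF a]] by simp_all

text \<open>Completing the square turns the two exponentials of sinh into Gaussians centred at
  \<open>m\<close> and \<open>- m\<close>, whose first moments are known; evenness then halves the
  integral.\<close>

lemma gaussian_sinh_hl:
  assumes a: "\<alpha> > 0"
  shows "has_bochner_integral hl (\<lambda>x. x * sinh (\<beta> * x) * exp (- \<alpha> * x\<^sup>2))
    (\<beta> / (4 * \<alpha>) * sqrt (pi / \<alpha>) * exp (\<beta>\<^sup>2 / (4 * \<alpha>)))"
proof -
  define m where "m = \<beta> / (2 * \<alpha>)"
  have e: "exp (- \<alpha> * (x - m)\<^sup>2) * exp (\<beta>\<^sup>2 / (4 * \<alpha>)) = exp (\<beta> * x) * exp (- \<alpha> * x\<^sup>2)"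
    "exp (- \<alpha> * (x - (- m))\<^sup>2) * exp (\<beta>\<^sup>2 / (4 * \<alpha>)) = exp (- (\<beta> * x)) * exp (- \<alpha> * x\<^sup>2)" for x
    using a by (simp_all add: m_def power2_eq_square field_simps flip: exp_add)
  have "has_bochner_integral lborel (\<lambda>x. (exp (- \<alpha> * (x - m)\<^sup>2) * x - exp (- \<alpha> * (x - (- m))\<^sup>2) * x) * (exp (\<beta>\<^sup>2 / (4 * \<alpha>)) / 2))
     ((m * sqrt (pi / \<alpha>) - (- m) * sqrt (pi / \<alpha>)) * (exp (\<beta>\<^sup>2 / (4 * \<alpha>)) / 2))"
    by (intro has_bochner_integral_mult_left has_bochner_integral_diff gaussian_full(3) a)
  moreover have "(exp (- \<alpha> * (x - m)\<^sup>2) * x - exp (- \<alpha> * (x - (- m))\<^sup>2) * x) * (exp (\<beta>\<^sup>2 / (4 * \<alpha>)) / 2) =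
      x * sinh (\<beta> * x) * exp (- \<alpha> * x\<^sup>2)" for x
  proof -
    have "(exp (- \<alpha> * (x - m)\<^sup>2) * x - exp (- \<alpha> * (x - (- m))\<^sup>2) * x) * (exp (\<beta>\<^sup>2 / (4 * \<alpha>)) / 2) =
       x / 2 * (exp (- \<alpha> * (x - m)\<^sup>2) * exp (\<beta>\<^sup>2 / (4 * \<alpha>)) - exp (- \<alpha> * (x - (- m))\<^sup>2) * exp (\<beta>\<^sup>2 / (4 * \<alpha>)))"
      by (simp add: algebra_simps)
    also have "\<dots> = x / 2 * (exp (\<beta> * x) * exp (- \<alpha> * x\<^sup>2) - exp (- (\<beta> * x)) * exp (- \<alpha> * x\<^sup>2))"
      unfolding e ..
    finally show ?thesis by (simp add: sinh_field_def algebra_simps)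
  qed
  ultimately have "has_bochner_integral lborel (\<lambda>x. x * sinh (\<beta> * x) * exp (- \<alpha> * x\<^sup>2))
     ((m * sqrt (pi / \<alpha>) - (- m) * sqrt (pi / \<alpha>)) * (exp (\<beta>\<^sup>2 / (4 * \<alpha>)) / 2))" by simp
  from hl_even[OF _ this] show ?thesis by (simp add: m_def)
qed

text \<open>The characteristic function of the standard normal distribution, rescaled by
  \<open>c\<close> and halved by evenness.\<close>

lemma gaussian_cos_hl:
  assumes a: "\<alpha> > 0"
  shows "has_bochner_integral hl (\<lambda>x. exp (- \<alpha> * x\<^sup>2) * cos (\<beta> * x)) (sqrt (pi / \<alpha>) / 2 * exp (- \<beta>\<^sup>2 / (4 * \<alpha>)))"
proof -
  define c where "c = sqrt (2 * \<alpha>)"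
  have c: "c > 0" "c\<^sup>2 = 2 * \<alpha>" using a by (simp_all add: c_def)
  define t where "t = \<beta> / c"
  interpret prob_space std_normal_distribution by (rule prob_space_normal_density) simp
  have int: "integrable std_normal_distribution (\<lambda>x. iexp (t * x))" 
    by (rule integrable_const_bound[where B = 1]) auto
  have "integral\<^sup>L std_normal_distribution (\<lambda>x. iexp (t * x)) = exp (- t\<^sup>2 / 2)"
    using fun_cong[OF char_std_normal_distribution, of t] by (simp add: char_def)
  then have "Re (integral\<^sup>L std_normal_distribution (\<lambda>x. iexp (t * x))) = exp (- t\<^sup>2 / 2)" by (simp add: Re_exp)
  then have "integral\<^sup>L std_normal_distribution (\<lambda>x. Re (iexp (t * x))) = exp (- t\<^sup>2 / 2)"
    using int by simp
  moreover have "integrable std_normal_distribution (\<lambda>x. Re (iexp (t * x)))" using int by (rule integrable_Re)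
  moreover have "Re (iexp (t * x)) = cos (t * x)" for x by (simp add: Re_exp)
  ultimately have "has_bochner_integral std_normal_distribution (\<lambda>x. cos (t * x)) (exp (- t\<^sup>2 / 2))"
    by (simp add: has_bochner_integral_iff)
  then have "has_bochner_integral lborel (\<lambda>x. std_normal_density x * cos (t * x)) (exp (- t\<^sup>2 / 2))"
    by (simp add: has_bochner_integral_iff integrable_density integral_density)
  then have "has_bochner_integral lborel (\<lambda>x. std_normal_density (0 + c * x) * cos (t * (0 + c * x))) (exp (- t\<^sup>2 / 2) /\<^sub>R \<bar>c\<bar>)"
    by (rule lborel_has_bochner_integral_real_affine_iff[THEN iffD1, rotated]) (use c in simp)
  from has_bochner_integral_mult_right[OF this, of "sqrt (2 * pi)"]
  have "has_bochner_integral lborel (\<lambda>x. exp (- \<alpha> * x\<^sup>2) * cos (\<beta> * x)) (sqrt (2 * pi) * (exp (- t\<^sup>2 / 2) /\<^sub>R \<bar>c\<bar>))"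
    using c by (simp add: std_normal_density_def power_mult_distrib t_def)
  from hl_even[OF _ this] have *: "has_bochner_integral hl (\<lambda>x. exp (- \<alpha> * x\<^sup>2) * cos (\<beta> * x)) (sqrt (2 * pi) * (exp (- t\<^sup>2 / 2) /\<^sub>R \<bar>c\<bar>) / 2)"
    by simp
  have "sqrt (2 * pi) / c = sqrt (pi / \<alpha>)" unfolding c_def by (simp flip: real_sqrt_divide)
  moreover have "- t\<^sup>2 / 2 = - \<beta>\<^sup>2 / (4 * \<alpha>)" using c by (simp add: t_def power_divide)
  moreover have "sqrt (2 * pi) * (E /\<^sub>R \<bar>c\<bar>) / 2 = (sqrt (2 * pi) / c) / 2 * E" for E using c(1) by (simp add: field_simps)
  ultimately show ?thesis using * by metis
qed

section \<open>Cosine series and the partial fractions of 1/sinh\<close>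

lemma uniform_series_integral:
  fixes f :: "nat \<Rightarrow> real \<Rightarrow> real"
  assumes cont: "\<And>k. continuous_on {a..b} (f k)"
    and bound: "\<And>k x. x \<in> {a..b} \<Longrightarrow> \<bar>f k x\<bar> \<le> M k" and M: "summable M"
  shows "continuous_on {a..b} (\<lambda>x. \<Sum>k. f k x)"
    and "(\<lambda>k. integral {a..b} (f k)) sums integral {a..b} (\<lambda>x. \<Sum>k. f k x)"
proof -
  have u: "uniform_limit {a..b} (\<lambda>n x. \<Sum>k<n. f k x) (\<lambda>x. \<Sum>k. f k x) sequentially"
    by (rule Weierstrass_m_test[OF _ M]) (use bound in auto)
  show "continuous_on {a..b} (\<lambda>x. \<Sum>k. f k x)"
    by (rule uniform_limit_theorem[OF _ u]) (auto intro!: always_eventually continuous_on_sum cont)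
  obtain I J where IJ: "\<And>n. ((\<lambda>x. \<Sum>k<n. f k x) has_integral I n) {a..b}"
    "((\<lambda>x. \<Sum>k. f k x) has_integral J) {a..b}" "I \<longlonglongrightarrow> J"
    by (rule uniform_limit_integral[OF u]) (auto intro!: continuous_on_sum cont)
  have "((\<lambda>x. \<Sum>k<n. f k x) has_integral (\<Sum>k<n. integral {a..b} (f k))) {a..b}" for n
    by (intro has_integral_sum integrable_integral integrable_continuous_real cont) auto
  then have "I n = (\<Sum>k<n. integral {a..b} (f k))" for n using IJ(1) has_integral_unique by blast
  then have "I = (\<lambda>n. \<Sum>k<n. integral {a..b} (f k))" by auto
  then show "(\<lambda>k. integral {a..b} (f k)) sums integral {a..b} (\<lambda>x. \<Sum>k. f k x)"
    using IJ(2,3) by (simp add: sums_def integral_unique)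
qed

lemma integral_cos_half_period:
  "((\<lambda>x. cos (2 * pi * real_of_int k * x)) has_integral (if k = 0 then 1/2 else 0)) {0..1/2}"
proof (cases "k = 0")
  case True
  then show ?thesis using has_integral_const_real[of "1::real" 0 "1/2"] by simp
next
  case False
  have "((\<lambda>x. cos (2 * pi * real_of_int k * x)) has_integral
      (sin (2 * pi * real_of_int k * (1/2)) / (2 * pi * k) - sin (2 * pi * real_of_int k * 0) / (2 * pi * k))) {0..1/2}"
    using False by (intro fundamental_theorem_of_calculus)
      (auto intro!: derivative_eq_intros simp flip: has_real_derivative_iff_has_vector_derivative)
  moreover have "sin (2 * pi * real_of_int k * (1/2)) = 0" by (simp add: sin_zero_iff_int2)
  ultimately show ?thesis using False by simp
qed

lemma integral_cos_cos:
  fixes n m :: nat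
  shows "integral {0..1/2} (\<lambda>x. cos (2 * pi * n * x) * cos (2 * pi * m * x)) = (if n = m then if n = 0 then 1/2 else 1/4 else 0)"
proof -
  have "cos (2 * pi * n * x) * cos (2 * pi * m * x) =
     cos (2 * pi * real_of_int (int n - int m) * x) / 2 + cos (2 * pi * real_of_int (int n + int m) * x) / 2" for x
    unfolding cos_times_cos by (simp add: algebra_simps add_divide_distrib)
  moreover have "((\<lambda>x. cos (2 * pi * real_of_int (int n - int m) * x) / 2 + cos (2 * pi * real_of_int (int n + int m) * x) / 2)
     has_integral ((if int n - int m = 0 then 1/2 else 0) / 2 + (if int n + int m = 0 then 1/2 else 0) / 2)) {0..1/2}"
    by (intro has_integral_add has_integral_divide integral_cos_half_period)
  ultimately have "integral {0..1/2} (\<lambda>x. cos (2 * pi * n * x) * cos (2 * pi * m * x)) =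
     ((if int n - int m = 0 then 1/2 else 0) / 2 + (if int n + int m = 0 then 1/2 else 0) / 2)"
    by (simp only: integral_unique)
  then show ?thesis by auto
qed

text \<open>An absolutely summable cosine series is continuous and can be integrated termwise, so
  its coefficients are the prescribed ones and uniqueness applies. The factors 1/2 and 1/4 are the
  squared norms of the cosines on the half period.\<close>

lemma cosine_series_eq:
  fixes a :: "nat \<Rightarrow> real"
  assumes a: "summable (\<lambda>n. \<bar>a n\<bar>)" and f: "continuous_on {0..1/2} f"
    and coeff: "\<And>n::nat. integral {0..1/2} (\<lambda>x. f x * cos (2 * pi * n * x)) = a n * (if n = 0 then 1/2 else 1/4)"
    and x: "x \<in> {0..1/2}"
  shows "(\<lambda>n. a n * cos (2 * pi * real n * x)) sums f x"
proof -
  define S where "S x = (\<Sum>n. a n * cos (2 * pi * real n * x))" for x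
  have le: "\<bar>a n * cos t\<bar> \<le> \<bar>a n\<bar>" for n t by (simp add: abs_mult mult_left_le)
  have summ: "summable (\<lambda>n. a n * cos (2 * pi * real n * x))" for x
    by (rule summable_comparison_test'[OF a]) (use le in auto)
  have S: "continuous_on {0..1/2} S" unfolding S_def
    by (rule uniform_series_integral[where M = "\<lambda>n. \<bar>a n\<bar>"]) (auto intro!: continuous_intros a le)
  have "integral {0..1/2} (\<lambda>x. S x * cos (2 * pi * real m * x)) = a m * (if m = 0 then 1/2 else 1/4)" for m
  proof -
    have e1: "S x * cos (2 * pi * real m * x) = (\<Sum>n. a n * cos (2 * pi * real n * x) * cos (2 * pi * real m * x))" for x
      unfolding S_def by (rule suminf_mult2[OF summ])
    have "(\<lambda>n. integral {0..1/2} (\<lambda>x. a n * cos (2 * pi * real n * x) * cos (2 * pi * real m * x))) sums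
       integral {0..1/2} (\<lambda>x. \<Sum>n. a n * cos (2 * pi * real n * x) * cos (2 * pi * real m * x))"
    proof (rule uniform_series_integral(2)[OF _ _ a])
      show "\<bar>a k * cos (2 * pi * real k * x) * cos (2 * pi * real m * x)\<bar> \<le> \<bar>a k\<bar>" for k x
        using le[of k "2 * pi * real k * x"] abs_cos_le_one[of "2 * pi * real m * x"]
        by (subst abs_mult) (meson abs_ge_zero mult_right_le_one_le order_trans)
    qed (auto intro!: continuous_intros)
    moreover have e2: "integral {0..1/2} (\<lambda>x. a n * cos (2 * pi * real n * x) * cos (2 * pi * real m * x)) =
       (if n = m then a m * (if m = 0 then 1/2 else 1/4) else 0)" for n
      unfolding mult.assoc integral_mult_right using integral_cos_cos[of n m] by (simp add: mult.assoc)
    ultimately have e3: "(\<lambda>n. if n = m then a m * (if m = 0 then 1/2 else 1/4) else 0) sums integral {0..1/2} (\<lambda>x. S x * cos (2 * pi * real m * x))"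
      unfolding e1 e2 by simp
    have "(\<lambda>n. if n = m then a m * (if m = 0 then 1/2 else 1/4) else 0) sums (a m * (if m = 0 then 1/2 else 1/4))"
      by (rule sums_single)
    from sums_unique2[OF e3 this] show ?thesis .
  qed
  then have "integral {0..1/2} (\<lambda>x. (f x - S x) * cos (2 * pi * real n * x)) = 0" for n
    unfolding left_diff_distrib using coeff[of n]
    by (subst integral_diff) (auto intro!: integrable_continuous_real continuous_intros f S)
  moreover have "continuous_on {0..1/2} (\<lambda>x. f x - S x)" by (intro continuous_on_diff f S)
  ultimately have "f x - S x = 0"
    using cosine_coefficients_unique[of "\<lambda>x. f x - S x" x] x by blast
  then show ?thesis using summable_sums[OF summ, of x] by (simp add: S_def)
qed

lemma csch_coeff:
  fixes b :: real and n :: nat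
  assumes b: "b > 0"
  shows "((\<lambda>x. cosh (2 * pi * b * x) * cos (2 * pi * n * x)) has_integral
    (b * sinh (pi * b) * (-1) ^ n / (2 * pi * (b\<^sup>2 + (real n)\<^sup>2)))) {0..1/2}"
proof -
  define F where "F x = (b * sinh (2 * pi * b * x) * cos (2 * pi * n * x) + n * cosh (2 * pi * b * x) * sin (2 * pi * n * x)) / (2 * pi * (b\<^sup>2 + (real n)\<^sup>2))" for x :: real
  have bn: "b\<^sup>2 + (real n)\<^sup>2 > 0" using b by (intro add_pos_nonneg) auto
  have "(F has_real_derivative cosh (2 * pi * b * x) * cos (2 * pi * n * x)) (at x within {0..1/2})" for x
  proof -
    have "cosh (2 * pi * b * x) * cos (2 * pi * n * x) =
      (2 * pi * (b\<^sup>2 + (real n)\<^sup>2) * (cosh (2 * pi * b * x) * cos (2 * pi * n * x))) / (2 * pi * (b\<^sup>2 + (real n)\<^sup>2))"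

    proof (rule nonzero_mult_div_cancel_left[symmetric])
      show "2 * pi * (b\<^sup>2 + (real n)\<^sup>2) \<noteq> 0" using b by simp
    qed
    then show ?thesis unfolding F_def[abs_def]
      by (rule ssubst) (intro DERIV_cdivide, auto intro!: derivative_eq_intros simp: algebra_simps power2_eq_square)
  qed
  then have "((\<lambda>x. cosh (2 * pi * b * x) * cos (2 * pi * n * x)) has_integral (F (1/2) - F 0)) {0..1/2}"
    by (intro fundamental_theorem_of_calculus) (auto simp flip: has_real_derivative_iff_has_vector_derivative)
  moreover have "cos (2 * pi * real n * (1/2)) = (-1) ^ n" "sin (2 * pi * real n * (1/2)) = 0"
    using cos_npi[of n] sin_npi[of n] by (simp_all add: mult.commute)
  then have "F (1/2) - F 0 = b * sinh (pi * b) * (-1) ^ n / (2 * pi * (b\<^sup>2 + (real n)\<^sup>2))"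
    unfolding F_def by simp
  ultimately show ?thesis by simp
qed

text \<open>The cosine expansion of pi cosh(2 pi b x) / (b sinh(pi b)) evaluated at x = 0, with the
  constant term 1 / b^2 moved to the other side.\<close>

lemma csch_partial_fractions:
  fixes b :: real
  assumes b: "b > 0"
  shows "(\<lambda>n. (-1) ^ Suc n / ((real (Suc n))\<^sup>2 + b\<^sup>2)) sums ((pi / (b * sinh (pi * b)) - 1 / b\<^sup>2) / 2)"
proof -
  define a where "a n = (if n = 0 then 1 / b\<^sup>2 else 2 * (-1) ^ n / (b\<^sup>2 + (real n)\<^sup>2))" for n :: nat
  have sh: "sinh (pi * b) > 0" using b by simp
  have "(\<lambda>n. a n * cos (2 * pi * real n * 0)) sums (pi * cosh (2 * pi * b * 0) / (b * sinh (pi * b)))"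
  proof (rule cosine_series_eq)
    show "summable (\<lambda>n. \<bar>a n\<bar>)"
    proof (rule summable_comparison_test'[where N = 1])
      show "summable (\<lambda>n. 2 * (1 / (real n)\<^sup>2))" by (intro summable_mult) (use inverse_power_summable[of 2, where 'a = real] in \<open>simp add: inverse_eq_divide\<close>)
      fix n :: nat assume n: "n \<ge> 1"
      have "0 < (real n)\<^sup>2" "(real n)\<^sup>2 \<le> b\<^sup>2 + (real n)\<^sup>2" using n by auto
      moreover from this have "0 < b\<^sup>2 + (real n)\<^sup>2" by linarith
      ultimately have "1 / (b\<^sup>2 + (real n)\<^sup>2) \<le> 1 / (real n)\<^sup>2" using n by (intro divide_left_mono mult_pos_pos) auto
      moreover have "\<bar>a n\<bar> = 2 * (1 / (b\<^sup>2 + (real n)\<^sup>2))" using n by (simp add: a_def abs_mult power_abs)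
      ultimately show "norm \<bar>a n\<bar> \<le> 2 * (1 / (real n)\<^sup>2)" by simp
    qed
    show "continuous_on {0..1/2} (\<lambda>x. pi * cosh (2 * pi * b * x) / (b * sinh (pi * b)))"
      using b sh by (intro continuous_intros) auto
    fix n :: nat
    have "((\<lambda>x. (pi / (b * sinh (pi * b))) * (cosh (2 * pi * b * x) * cos (2 * pi * n * x))) has_integral
      (pi / (b * sinh (pi * b))) * (b * sinh (pi * b) * (-1) ^ n / (2 * pi * (b\<^sup>2 + (real n)\<^sup>2)))) {0..1/2}"
      by (intro has_integral_mult_right csch_coeff b)
    moreover have "(pi / (b * sinh (pi * b))) * (b * sinh (pi * b) * (-1) ^ n / (2 * pi * (b\<^sup>2 + (real n)\<^sup>2))) = a n * (if n = 0 then 1/2 else 1/4)"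
    proof (cases "n = 0")
      case False
      have "(pi / (b * S)) * (b * S * s / (2 * pi * D)) = 2 * s / D * (1/4)" if "S > 0" for S s D :: real
        using b that by simp
      from this[OF sh] show ?thesis using False by (simp only: a_def if_False)
    qed (use b sh in \<open>simp add: a_def power2_eq_square\<close>)
    moreover have "(pi / (b * sinh (pi * b))) * (cosh (2 * pi * b * x) * cos (2 * pi * n * x)) =
      pi * cosh (2 * pi * b * x) / (b * sinh (pi * b)) * cos (2 * pi * real n * x)" for x by simp
    ultimately show "integral {0..1/2} (\<lambda>x. pi * cosh (2 * pi * b * x) / (b * sinh (pi * b)) * cos (2 * pi * real n * x)) = a n * (if n = 0 then 1/2 else 1/4)"
      by (simp only: integral_unique)
  qed simp
  then have "a sums (pi / (b * sinh (pi * b)))" by simp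
  then have "(\<lambda>n. a (Suc n)) sums (pi / (b * sinh (pi * b)) - a 0)" by (subst sums_Suc_iff) simp
  then have "(\<lambda>n. a (Suc n) / 2) sums ((pi / (b * sinh (pi * b)) - a 0) / 2)" by (rule sums_divide)
  moreover have "a (Suc n) / 2 = (-1) ^ Suc n / ((real (Suc n))\<^sup>2 + b\<^sup>2)" for n
  proof -
    have "2 * s / D / 2 = s / D" for s D :: real by simp
    then show ?thesis unfolding a_def by (simp only: nat.distinct if_False add.commute[of "b\<^sup>2"])
  qed
  ultimately show ?thesis by (simp add: a_def)
qed

section \<open>Laplace integrals and the Fourier transform of 1/cosh^2\<close>

lemma hl_FTC:
  fixes F f :: "real \<Rightarrow> 'a :: euclidean_space"
  assumes deriv: "\<And>x. 0 \<le> x \<Longrightarrow> (F has_vector_derivative f x) (at x)"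
    and int: "integrable hl f" and lim: "(F \<longlongrightarrow> L) at_top"
  shows "has_bochner_integral hl f (L - F 0)"
proof -
  have "((\<lambda>y. LINT x|lborel. indicator {..y} x *\<^sub>R (indicator {0..} x *\<^sub>R f x)) \<longlongrightarrow> (LINT x|lborel. indicator {0..} x *\<^sub>R f x)) at_top"
    using int by (intro tendsto_integral_at_top) (simp_all add: integrable_restrict_space)
  moreover have "\<forall>\<^sub>F y in at_top. (LINT x|lborel. indicator {..y} x *\<^sub>R (indicator {0..} x *\<^sub>R f x)) = F y - F 0"
    using eventually_ge_at_top[of 0]
  proof eventually_elim
    fix y :: real assume y: "0 \<le> y"
    have "(\<lambda>x. indicator {..y} x *\<^sub>R (indicator {0..} x *\<^sub>R f x)) = (\<lambda>x. indicator {0..y} x *\<^sub>R f x)"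
      by (auto split: split_indicator)
    moreover have "set_integrable lborel {0..y} f"
      unfolding set_integrable_def using int integrable_mult_indicator[of "{..y}" lborel "\<lambda>x. indicator {0..} x *\<^sub>R f x"] calculation
      by (simp add: integrable_restrict_space)
    then have "(LINT x:{0..y}|lborel. f x) = integral {0..y} f" by (rule set_borel_integral_eq_integral)
    moreover have "integral {0..y} f = F y - F 0"
      by (intro integral_unique fundamental_theorem_of_calculus y) (auto intro: has_vector_derivative_at_within deriv)
    ultimately show "(LINT x|lborel. indicator {..y} x *\<^sub>R (indicator {0..} x *\<^sub>R f x)) = F y - F 0"
      by (simp add: set_lebesgue_integral_def)
  qed
  ultimately have "((\<lambda>y. F y - F 0) \<longlongrightarrow> (LINT x|lborel. indicator {0..} x *\<^sub>R f x)) at_top"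
    by (rule Lim_transform_eventually)
  moreover have "((\<lambda>y. F y - F 0) \<longlongrightarrow> L - F 0) at_top" by (intro tendsto_intros lim)
  ultimately have "(LINT x|lborel. indicator {0..} x *\<^sub>R f x) = L - F 0"
    by (intro tendsto_unique[OF trivial_limit_at_top_linorder])
  then show ?thesis using int by (simp add: has_bochner_integral_iff integral_restrict_space)
qed

text \<open>Here integrability is itself a conclusion: the finite limit of the primitive
  \<open>F\<close> bounds the integral of the nonnegative \<open>f\<close>.\<close>

lemma hl_FTC_nonneg:
  fixes F f :: "real \<Rightarrow> real"
  assumes deriv: "\<And>x. 0 \<le> x \<Longrightarrow> (F has_real_derivative f x) (at x)"
    and nonneg: "\<And>x. 0 \<le> x \<Longrightarrow> 0 \<le> f x" and meas: "f \<in> borel_measurable borel" and lim: "(F \<longlongrightarrow> L) at_top"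
  shows "has_bochner_integral hl f (L - F 0)"
proof (rule hl_FTC)
  have "(\<integral>\<^sup>+x. ennreal (f x) * indicator {0 ..} x \<partial>lborel) = L - F 0"
    by (rule nn_integral_FTC_atLeast) (use assms in auto)
  moreover have "(\<integral>\<^sup>+x. ennreal (f x) * indicator {0 ..} x \<partial>lborel) = (\<integral>\<^sup>+x. ennreal (norm (indicator {0..} x *\<^sub>R f x)) \<partial>lborel)"
    using nonneg by (intro nn_integral_cong) (auto split: split_indicator)
  ultimately have "(\<integral>\<^sup>+x. ennreal (norm (indicator {0..} x *\<^sub>R f x)) \<partial>lborel) < \<infinity>" by simp
  then have "integrable lborel (\<lambda>x. indicator {0..} x *\<^sub>R f x)" using meas by (intro integrableI_bounded) auto
  then show "integrable hl f" by (simp add: integrable_restrict_space)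
qed (use assms in \<open>auto simp flip: has_real_derivative_iff_has_vector_derivative\<close>)

lemma hl_integrable_bound:
  fixes f :: "real \<Rightarrow> 'a :: {banach, second_countable_topology}"
  assumes "integrable hl g" "f \<in> borel_measurable hl" "\<And>x. 0 \<le> x \<Longrightarrow> norm (f x) \<le> g x"
  shows "integrable hl f"
  by (rule Bochner_Integration.integrable_bound[OF assms(1,2)])
     (auto intro!: AE_I2 order_trans[OF assms(3)])

lemma hl_x_exp:
  assumes "c > 0"
  shows "has_bochner_integral hl (\<lambda>x. x * exp (- (c * x))) (1 / c\<^sup>2)"
proof -
  have "((\<lambda>x. - (x / c + 1 / c\<^sup>2) * exp (- (c * x))) \<longlongrightarrow> 0) at_top" using assms by real_asymp
  then have "has_bochner_integral hl (\<lambda>x. x * exp (- (c * x))) (0 - (- (0 / c + 1 / c\<^sup>2) * exp (- (c * 0))))"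
    using assms
    by (intro hl_FTC_nonneg) (auto intro!: derivative_eq_intros simp: field_simps power2_eq_square)
  then show ?thesis by simp
qed

text \<open>The real part of the Laplace integral of x exp(-wx), which is 1 / w^2, at w = c -
  it.\<close>

lemma hl_x_exp_cos:
  assumes c: "c > 0"
  shows "has_bochner_integral hl (\<lambda>x. x * exp (- (c * x)) * cos (t * x)) (Re (1 / (complex_of_real c - \<i> * t)\<^sup>2))"
proof -
  define w where "w = complex_of_real c - \<i> * t"
  have w: "w \<noteq> 0" "Re w = c" using c by (auto simp: w_def complex_eq_iff)
  let ?f = "\<lambda>x. of_real x * exp (- w * of_real x)"
  let ?F = "\<lambda>x. - (of_real x / w + 1 / w\<^sup>2) * exp (- w * of_real x)"
  have n: "norm (exp (- w * of_real x)) = exp (- (c * x))" for x using w by simp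
  have "has_bochner_integral hl ?f (0 - ?F 0)"
  proof (rule hl_FTC)
    fix x :: real
    have "((\<lambda>z. - (z / w + 1 / w\<^sup>2) * exp (- w * z)) has_field_derivative (of_real x * exp (- w * of_real x))) (at (of_real x))"
      using w by (auto intro!: derivative_eq_intros simp: field_simps power2_eq_square)
    then show "(?F has_vector_derivative ?f x) (at x)"
      using has_vector_derivative_real_field by fastforce
  next
    show "integrable hl ?f"
    proof (rule hl_integrable_bound)
      show "integrable hl (\<lambda>x. x * exp (- (c * x)))" using hl_x_exp[OF c] by (rule integrable.intros)
      show "?f \<in> borel_measurable hl" by (intro hl_measurable_continuous continuous_intros)
      show "norm (?f x) \<le> x * exp (- (c * x))" if "0 \<le> x" for x using that unfolding norm_mult n by simp
    qed
  next
    show "(?F \<longlongrightarrow> 0) at_top"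
    proof (rule Lim_null_comparison)
      show "\<forall>\<^sub>F x in at_top. norm (?F x) \<le> (x / norm w + 1 / (norm w)\<^sup>2) * exp (- (c * x))"
        using eventually_ge_at_top[of 0]
      proof eventually_elim
        fix x :: real assume "0 \<le> x"
        then have "norm (of_real x / w + 1 / w\<^sup>2) \<le> x / norm w + 1 / (norm w)\<^sup>2"
          by (intro norm_triangle_le) (simp add: norm_divide norm_power)
        then show "norm (?F x) \<le> (x / norm w + 1 / (norm w)\<^sup>2) * exp (- (c * x))"
          unfolding norm_mult norm_minus_cancel n by (intro mult_right_mono) auto
      qed
      have "norm w > 0" using w by simp
      then show "((\<lambda>x. (x / norm w + 1 / (norm w)\<^sup>2) * exp (- (c * x))) \<longlongrightarrow> 0) at_top" using c by real_asymp
    qed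
  qed
  then have "has_bochner_integral hl ?f (1 / w\<^sup>2)" by simp
  then have "has_bochner_integral hl (\<lambda>x. Re (?f x)) (Re (1 / w\<^sup>2))"
    by (rule has_bochner_integral_bounded_linear[OF bounded_linear_Re])
  moreover have "(\<lambda>x. Re (?f x)) = (\<lambda>x. x * exp (- (c * x)) * cos (t * x))"
    by (rule ext) (simp add: w_def Re_exp algebra_simps)
  ultimately show ?thesis unfolding w_def by (simp only:)
qed

text \<open>The logarithmic derivative of Euler's reflection formula is the cotangent formula for
  \<open>Digamma\<close>; differentiate once more.\<close>

lemma Polygamma_1_reflection:
  fixes z :: complex
  assumes z: "z \<notin> \<int>"
  shows "Polygamma 1 z + Polygamma 1 (1 - z) = pi\<^sup>2 / (sin (pi * z))\<^sup>2"
proof -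
  have open_nonint: "open (- \<int> :: complex set)" using closed_Ints by (simp add: open_closed)
  have sinnz: "sin (pi * z) \<noteq> 0" if "z \<notin> \<int>" for z :: complex
  proof
    assume "sin (pi * z) = 0"
    then obtain n :: int where "of_real pi * z = of_real (n * pi)" unfolding sin_eq_0 by blast
    then have "of_real pi * z = of_real pi * of_int n" by (simp add: mult.commute)
    then have "z = of_int n" by (simp only: mult_cancel_left) simp
    then show False using that by simp
  qed
  have nonint: "1 - z \<notin> \<int>\<^sub>\<le>\<^sub>0" "z \<notin> \<int>\<^sub>\<le>\<^sub>0" if "z \<notin> \<int>" for z :: complex
  proof -
    show "z \<notin> \<int>\<^sub>\<le>\<^sub>0" using that by (meson nonpos_Ints_subset_Ints subsetD)
    show "1 - z \<notin> \<int>\<^sub>\<le>\<^sub>0"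
    proof
      assume "1 - z \<in> \<int>\<^sub>\<le>\<^sub>0"
      then have "1 - (1 - z) \<in> \<int>" by (meson nonpos_Ints_subset_Ints subsetD Ints_1 Ints_diff)
      then show False using that by simp
    qed
  qed
  have dig: "Digamma z - Digamma (1 - z) = - pi * cos (pi * z) / sin (pi * z)" if z: "z \<notin> \<int>" for z :: complex
  proof -
    have G: "Gamma z \<noteq> 0" "Gamma (1 - z) \<noteq> 0" using nonint[OF z] by (auto simp: Gamma_eq_zero_iff)
    have "((\<lambda>z. Gamma z * Gamma (1 - z)) has_field_derivative
       (Gamma z * Gamma (1 - z) * (Digamma z - Digamma (1 - z)))) (at z)"
      using nonint[OF z] by (auto intro!: derivative_eq_intros simp: algebra_simps)
    moreover have "((\<lambda>z. pi / sin (pi * z)) has_field_derivative (- pi * (pi * cos (pi * z)) / (sin (pi * z))\<^sup>2)) (at z)"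
      using sinnz[OF z] by (auto intro!: derivative_eq_intros simp: power2_eq_square)
    ultimately have "Gamma z * Gamma (1 - z) * (Digamma z - Digamma (1 - z)) = - pi * (pi * cos (pi * z)) / (sin (pi * z))\<^sup>2"
      using Gamma_reflection_complex DERIV_unique by fastforce
    then have *: "pi / sin (pi * z) * (Digamma z - Digamma (1 - z)) = - pi * (pi * cos (pi * z)) / (sin (pi * z))\<^sup>2"
      unfolding Gamma_reflection_complex .
    have "X = Y" if "p / s * X = - p * (p * c) / s\<^sup>2" "Y = - p * c / s" "s \<noteq> 0" "p \<noteq> 0" for X Y p s c :: complex
    proof -
      have "X = (s / p) * (p / s * X)" using that(3,4) by simp
      also have "\<dots> = Y" unfolding that(1,2) using that(3,4) by (simp add: power2_eq_square)
      finally show ?thesis .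
    qed
    from this[OF *[unfolded of_real_minus] refl sinnz[OF z]] show ?thesis by simp
  qed
  have "((\<lambda>z. Digamma z - Digamma (1 - z)) has_field_derivative (Polygamma 1 z + Polygamma 1 (1 - z))) (at z)"
    using nonint[OF z] by (auto intro!: derivative_eq_intros)
  moreover have "((\<lambda>z. - pi * cos (pi * z) / sin (pi * z)) has_field_derivative (pi\<^sup>2 / (sin (pi * z))\<^sup>2)) (at z)"
  proof -
    have alg: "- ((- (s * p * p * s) - p * c * (c * p)) / (s * s)) = p\<^sup>2 * (s\<^sup>2 + c\<^sup>2) / s\<^sup>2" for s p c :: complex
      by (simp add: power2_eq_square algebra_simps add_divide_distrib diff_divide_distrib)
    show ?thesis
      using sinnz[OF z] by (auto intro!: derivative_eq_intros simp: alg)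
  qed
  then have "((\<lambda>z. Digamma z - Digamma (1 - z)) has_field_derivative (pi\<^sup>2 / (sin (pi * z))\<^sup>2)) (at z)"
    by (rule has_field_derivative_transform_within_open[OF _ open_nonint]) (use z dig in auto)
  ultimately show ?thesis by (rule DERIV_unique)
qed

text \<open>For s = 1/2 - ix one has 1 - s = \<open>cnj s\<close> and sin(pi s) = cosh(pi x), so the
  trigamma reflection formula becomes a sum of twice a real part. The denominators are 2 pi (s +
  k).\<close>

lemma sech_partial_fractions:
  fixes x :: real
  shows "(\<lambda>k. Re (1 / (complex_of_real (real (Suc (2 * k)) * pi) - \<i> * complex_of_real (2 * pi * x))\<^sup>2)) sums (1 / (8 * (cosh (pi * x))\<^sup>2))"
proof -
  define s where "s = Complex (1/2) (- x)"
  have s1: "1 - s = cnj s" by (simp add: s_def complex_eq_iff)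
  have nint: "s \<notin> \<int>"
  proof
    assume "s \<in> \<int>"
    then obtain n where "s = of_int n" by (auto elim: Ints_cases)
    then have "Re s = of_int n" by simp
    then have "(1::real) = of_int (2 * n)" by (simp add: s_def)
    then have "1 = 2 * n" by (metis of_int_1 of_int_eq_iff)
    then show False by presburger
  qed
  have P: "(\<lambda>k. 1 / (w + of_nat k)\<^sup>2) sums Polygamma 1 w" if "w \<noteq> 0" for w :: complex
  proof -
    have "summable (\<lambda>k. inverse ((w + of_nat k) ^ Suc 1))" using Polygamma_converges'[OF that, of 2] by (simp only: Suc_1)
    moreover have "inverse ((w + of_nat k) ^ Suc 1) = 1 / (w + of_nat k)\<^sup>2" for k by (simp only: inverse_eq_divide Suc_1)
    ultimately have S: "summable (\<lambda>k. 1 / (w + of_nat k)\<^sup>2)" by simp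
    have "Polygamma 1 w = (\<Sum>k. inverse ((w + of_nat k) ^ Suc 1))" by (simp add: Polygamma_def)
    then have "Polygamma 1 w = (\<Sum>k. 1 / (w + of_nat k)\<^sup>2)" by (simp only: inverse_eq_divide Suc_1)
    then show ?thesis using S by (simp add: sums_iff)
  qed
  have nz: "s \<noteq> 0" "cnj s \<noteq> 0" by (simp_all add: s_def complex_eq_iff)
  have "(\<lambda>k. 1 / (s + of_nat k)\<^sup>2 + 1 / (cnj s + of_nat k)\<^sup>2) sums (pi\<^sup>2 / (sin (pi * s))\<^sup>2)"
    using sums_add[OF P[OF nz(1)] P[OF nz(2)]] Polygamma_1_reflection[OF nint] s1 by simp
  moreover have "1 / (s + of_nat k)\<^sup>2 + 1 / (cnj s + of_nat k)\<^sup>2 = of_real (2 * Re (1 / (s + of_nat k)\<^sup>2))" for k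
  proof -
    have "1 / (cnj s + of_nat k)\<^sup>2 = cnj (1 / (s + of_nat k)\<^sup>2)" by simp
    then show ?thesis using complex_add_cnj by metis
  qed
  moreover have "sin (pi * s) = of_real (cosh (pi * x))"
  proof -
    have "pi * s = of_real pi / 2 - \<i> * of_real (pi * x)" by (simp add: s_def complex_eq_iff)
    then have "sin (pi * s) = cos (\<i> * of_real (pi * x))" by (simp add: sin_diff cos_of_real sin_of_real)
    then show ?thesis 
    proof -
      have "cos (\<i> * of_real t) = of_real (cosh t)" for t
        by (simp add: cosh_field_def flip: cosh_conv_cos exp_of_real)
      then show "sin (pi * s) = cos (\<i> * of_real (pi * x)) \<Longrightarrow> ?thesis" by (simp del: of_real_mult)
    qed
  qed
  ultimately have "(\<lambda>k. complex_of_real (2 * Re (1 / (s + of_nat k)\<^sup>2))) sums of_real (pi\<^sup>2 / (cosh (pi * x))\<^sup>2)" by simp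
  then have "(\<lambda>k. 2 * Re (1 / (s + of_nat k)\<^sup>2)) sums (pi\<^sup>2 / (cosh (pi * x))\<^sup>2)" by (simp only: sums_of_real_iff)
  from sums_mult[OF this, of "1 / (8 * pi\<^sup>2)"]
  have "(\<lambda>k. 1 / (8 * pi\<^sup>2) * (2 * Re (1 / (s + of_nat k)\<^sup>2))) sums (1 / (8 * (cosh (pi * x))\<^sup>2))" by simp
  moreover have "1 / (8 * pi\<^sup>2) * (2 * Re (1 / (s + of_nat k)\<^sup>2)) =
      Re (1 / (complex_of_real (real (Suc (2 * k)) * pi) - \<i> * complex_of_real (2 * pi * x))\<^sup>2)" for k
  proof -
    have "complex_of_real (real (Suc (2 * k)) * pi) - \<i> * complex_of_real (2 * pi * x) = of_real (2 * pi) * (s + of_nat k)"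
      by (simp add: s_def complex_eq_iff algebra_simps)
    then have "1 / (complex_of_real (real (Suc (2 * k)) * pi) - \<i> * complex_of_real (2 * pi * x))\<^sup>2 =
       of_real (1 / (4 * pi\<^sup>2)) * (1 / (s + of_nat k)\<^sup>2)"
      by (simp add: power_mult_distrib)
    then show ?thesis by (simp only: times_complex.sel Re_complex_of_real Im_complex_of_real)
  qed
  ultimately show ?thesis by simp
qed

text \<open>Pointwise convergence is asked for at x > 0 only, which is almost everywhere: the theta
  series to which this is applied diverges at 0.\<close>

lemma hl_sums:
  fixes f :: "nat \<Rightarrow> real \<Rightarrow> real"
  assumes f: "\<And>k. has_bochner_integral hl (f k) (I k)"
    and g: "\<And>k. integrable hl (g k)" "\<And>k x. 0 \<le> x \<Longrightarrow> \<bar>f k x\<bar> \<le> g k x" "summable (\<lambda>k. integral\<^sup>L hl (g k))"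
    and s: "\<And>x. 0 < x \<Longrightarrow> summable (\<lambda>k. \<bar>f k x\<bar>)" "\<And>x. 0 < x \<Longrightarrow> (\<lambda>k. f k x) sums S x"
    and S: "S \<in> borel_measurable hl"
  shows "integrable hl S" "I sums integral\<^sup>L hl S"
proof -
  have ae: "AE x in hl. 0 < x"
  proof -
    have "AE x in lborel. x \<noteq> (0::real)" by (rule AE_lborel_singleton)
    then have "AE x in hl. x \<noteq> 0" by (subst AE_restrict_space_iff) auto
    then show ?thesis using AE_space by eventually_elim auto
  qed
  have int: "integrable hl (f k)" for k using f by (rule integrable.intros)
  have I: "integral\<^sup>L hl (f k) = I k" for k using f by (rule has_bochner_integral_integral_eq)
  have ae_s: "AE x in hl. summable (\<lambda>k. norm (f k x))" using ae by eventually_elim (use s in auto)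
  have norm_s: "summable (\<lambda>k. integral\<^sup>L hl (\<lambda>x. norm (f k x)))"
  proof (rule summable_comparison_test'[OF g(3)])
    fix k
    have "integral\<^sup>L hl (\<lambda>x. norm (f k x)) \<le> integral\<^sup>L hl (g k)"
      using int g by (intro integral_mono) auto
    then show "norm (integral\<^sup>L hl (\<lambda>x. norm (f k x))) \<le> integral\<^sup>L hl (g k)" by simp
  qed
  have eq: "AE x in hl. (\<Sum>k. f k x) = S x" using ae by eventually_elim (use s sums_unique in metis)
  note L = integrable_suminf[OF int ae_s norm_s] sums_integral[OF int ae_s norm_s]
  show "integrable hl S" using L(1) by (rule integrable_cong_AE_imp) (use eq S in \<open>auto simp: eq_commute\<close>)
  have "integral\<^sup>L hl (\<lambda>x. \<Sum>k. f k x) = integral\<^sup>L hl S"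
    by (intro integral_cong_AE eq S) (use L(1) in simp)
  then show "I sums integral\<^sup>L hl S" using L(2) by (simp add: I)
qed

lemma csch_geometric:
  fixes a :: real
  assumes "a > 0"
  shows "(\<lambda>k. 2 * exp (- (real (Suc (2 * k)) * pi * a))) sums (1 / sinh (pi * a))"
proof -
  define r where "r = exp (- (2 * pi * a))"
  have r: "0 < r" "r < 1" using assms by (simp_all add: r_def)
  have "(\<lambda>k. 2 * exp (- (pi * a)) * r ^ k) sums (2 * exp (- (pi * a)) * (1 / (1 - r)))"
    using r by (intro sums_mult geometric_sums) auto
  moreover have "2 * exp (- (pi * a)) * r ^ k = 2 * exp (- (real (Suc (2 * k)) * pi * a))" for k
    by (simp add: r_def algebra_simps flip: exp_of_nat_mult exp_add)
  moreover have "2 * exp (- (pi * a)) * (1 / (1 - r)) = 1 / sinh (pi * a)"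
  proof -
    have "r = exp (- (pi * a)) * exp (- (pi * a))" by (simp add: r_def flip: exp_add)
    moreover have "exp (- (pi * a)) * exp (pi * a) = 1" by (simp flip: exp_add)
    ultimately have "1 - r = exp (- (pi * a)) * (2 * sinh (pi * a))"
      by (simp add: sinh_field_def algebra_simps)
    then show ?thesis by simp
  qed
  ultimately show ?thesis by simp
qed

text \<open>Expanding 1/sinh as a geometric series produces Laplace integrals, whose values are the
  partial fractions of 1/cosh^2.\<close>

lemma sech_fourier:
  "has_bochner_integral hl (\<lambda>a. a * cos (2 * pi * x * a) / sinh (pi * a)) (1 / (4 * (cosh (pi * x))\<^sup>2))"
proof -
  define c where "c k = real (Suc (2 * k)) * pi" for k
  have c: "c k > 0" for k by (simp add: c_def)
  define f where "f k a = 2 * (a * exp (- (c k * a)) * cos (2 * pi * x * a))" for k a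
  define g where "g k a = 2 * (a * exp (- (c k * a)))" for k a
  define S where "S a = a * cos (2 * pi * x * a) / sinh (pi * a)" for a
  define I where "I k = 2 * Re (1 / (complex_of_real (c k) - \<i> * complex_of_real (2 * pi * x))\<^sup>2)" for k
  have f: "has_bochner_integral hl (f k) (I k)" for k
    unfolding f_def I_def by (intro has_bochner_integral_mult_right hl_x_exp_cos c)
  have g: "has_bochner_integral hl (g k) (2 * (1 / (c k)\<^sup>2))" for k
    unfolding g_def by (intro has_bochner_integral_mult_right hl_x_exp c)
  have fg: "\<bar>f k a\<bar> \<le> g k a" if "a \<ge> 0" for k a
  proof -
    have "\<bar>f k a\<bar> = g k a * \<bar>cos (2 * pi * x * a)\<bar>" using that by (simp add: f_def g_def abs_mult)
    also have "\<dots> \<le> g k a * 1" using that by (intro mult_left_mono abs_cos_le_one) (simp add: g_def)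
    finally show ?thesis by simp
  qed
  have gs: "(\<lambda>k. g k a) sums (a * (1 / sinh (pi * a)))" if "a > 0" for a
    using sums_mult[OF csch_geometric[OF that], of a] by (simp add: g_def c_def mult_ac)
  have sumg: "summable (\<lambda>k. integral\<^sup>L hl (g k))"
  proof (rule summable_comparison_test')
    show "summable (\<lambda>k. 2 * inverse (real (Suc k) ^ 2))"
      by (intro summable_mult) (use inverse_power_summable[of 2, where 'a = real] summable_Suc_iff[of "\<lambda>n. inverse (real n ^ 2)"] in simp)
    fix k
    have "real (Suc k) \<le> c k"
    proof -
      have "real (Suc k) * 1 \<le> real (Suc (2 * k)) * pi" using pi_ge_two by (intro mult_mono) auto
      then show ?thesis by (simp add: c_def)
    qed
    then have "(real (Suc k))\<^sup>2 \<le> (c k)\<^sup>2" by (intro power_mono) auto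
    then have "1 / (c k)\<^sup>2 \<le> 1 / (real (Suc k))\<^sup>2" using c[of k] by (intro divide_left_mono mult_pos_pos) auto
    then show "norm (integral\<^sup>L hl (g k)) \<le> 2 * inverse (real (Suc k) ^ 2)"
      using has_bochner_integral_integral_eq[OF g[of k]] by (simp add: inverse_eq_divide)
  qed
  have fs: "(\<lambda>k. f k a) sums S a" if "a > 0" for a
    using sums_mult2[OF gs[OF that], of "cos (2 * pi * x * a)"] by (simp add: f_def g_def S_def mult_ac)
  have meas: "S \<in> borel_measurable hl"
    unfolding S_def sinh_field_def by (intro measurable_restrict_space1) auto
  have fsum: "summable (\<lambda>k. \<bar>f k a\<bar>)" if "a > 0" for a
    by (rule summable_comparison_test'[OF sums_summable[OF gs[OF that]]]) (use fg[of a] that in auto)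
  note L = hl_sums[of f I g S, OF f integrable.intros[OF g] fg sumg fsum fs meas]
  have "(\<lambda>k. 2 * Re (1 / (complex_of_real (c k) - \<i> * complex_of_real (2 * pi * x))\<^sup>2)) sums (2 * (1 / (8 * (cosh (pi * x))\<^sup>2)))"
    unfolding c_def by (intro sums_mult sech_partial_fractions)
  then have "I sums (1 / (4 * (cosh (pi * x))\<^sup>2))" by (simp add: I_def[abs_def])
  then have "integral\<^sup>L hl S = 1 / (4 * (cosh (pi * x))\<^sup>2)" using L(2) sums_unique2 by blast
  then show ?thesis using L(1) by (simp add: has_bochner_integral_iff S_def[abs_def])
qed

lemma hl_integral_limit:
  fixes f :: "real \<Rightarrow> real"
  assumes f: "integrable hl f"
  shows "((\<lambda>y. integral {0..y} f) \<longlongrightarrow> integral\<^sup>L hl f) at_top"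
proof -
  have "((\<lambda>y. LINT x|lborel. indicator {..y} x *\<^sub>R (indicator {0..} x *\<^sub>R f x)) \<longlongrightarrow> (LINT x|lborel. indicator {0..} x *\<^sub>R f x)) at_top"
    using f by (intro tendsto_integral_at_top) (simp_all add: integrable_restrict_space)
  moreover have "(LINT x|lborel. indicator {..y} x *\<^sub>R (indicator {0..} x *\<^sub>R f x)) = integral {0..y} f" for y
  proof -
    have "(\<lambda>x. indicator {..y} x *\<^sub>R (indicator {0..} x *\<^sub>R f x)) = (\<lambda>x. indicator {0..y} x *\<^sub>R f x)"
      by (auto split: split_indicator)
    moreover have "set_integrable lborel {0..y} f"
      unfolding set_integrable_def using f integrable_mult_indicator[of "{..y}" lborel "\<lambda>x. indicator {0..} x *\<^sub>R f x"] calculation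
      by (simp add: integrable_restrict_space)
    then have "(LINT x:{0..y}|lborel. f x) = integral {0..y} f" by (rule set_borel_integral_eq_integral)
    ultimately show ?thesis by (simp add: set_lebesgue_integral_def)
  qed
  ultimately show ?thesis by (simp add: integral_restrict_space)
qed

section \<open>Poisson summation for Gaussians at half-integers\<close>

definition "gker y u = exp (- (pi / (2 * y)) * u\<^sup>2)" for y u :: real

lemma gker_le_geometric:
  assumes "y > 0" "u \<ge> real k"
  shows "gker y u \<le> exp (- (pi / (2 * y))) ^ k"
proof -
  have "real k \<le> (real k)\<^sup>2" by (cases k) (auto simp: power2_eq_square)
  also have "\<dots> \<le> u\<^sup>2" using assms by (intro power_mono) auto
  finally have "(pi / (2 * y)) * real k \<le> (pi / (2 * y)) * u\<^sup>2" using assms by (intro mult_left_mono) auto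
  then show ?thesis by (simp add: gker_def mult.commute flip: exp_of_nat_mult)
qed

lemma gker_summable:
  assumes "y > 0" "\<And>k. u k \<ge> real k"
  shows "summable (\<lambda>k. gker y (u k))"
  by (rule summable_comparison_test'[of "\<lambda>k. exp (- (pi / (2 * y))) ^ k"])
     (use assms gker_le_geometric[OF assms(1) assms(2)] in \<open>auto intro!: summable_geometric simp: gker_def\<close>)

text \<open>The unit intervals centred at \<open>k + 1/2\<close> tile the half line, so the sum over
  \<open>k\<close> telescopes to the Gaussian cosine integral. The sign (-1)^m comes from moving the
  cosine by a half-integer.\<close>

lemma gker_coeff:
  fixes m :: nat
  assumes y: "y > 0"
  shows "(\<lambda>k. integral {0..1/2} (\<lambda>x. (gker y (real k + 1/2 - x) + gker y (real k + 1/2 + x)) * cos (2 * pi * m * x)))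
    sums ((-1) ^ m * (sqrt (2 * y) / 2 * exp (- 2 * pi * (real m)\<^sup>2 * y)))"
proof -
  define P where "P u = gker y u * cos (2 * pi * m * u)" for u
  have P: "continuous_on A P" for A unfolding P_def gker_def by (intro continuous_intros)
  \<comment> \<open>The lower limit -1 keeps \<open>Q\<close> differentiable at 0, a point that is
    reached for \<open>k = 0\<close> and \<open>x = 1/2\<close>.\<close>
  define Q where "Q u = integral {-1..u} P" for u
  have Q: "(Q has_real_derivative P u) (at u)" if "u > -1" for u
  proof -
    have "(Q has_vector_derivative P u) (at u within {-1..u+1})"
      unfolding Q_def using that by (intro integral_has_vector_derivative P) auto
    moreover have "at u within {-1..u+1} = at u" using that by (intro at_within_Icc_at) auto
    ultimately show ?thesis by (simp add: has_real_derivative_iff_has_vector_derivative)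
  qed
  have "integral {0..1/2} (\<lambda>x. (gker y (real k + 1/2 - x) + gker y (real k + 1/2 + x)) * cos (2 * pi * m * x)) =
    (-1) ^ m * (Q (real (Suc k)) - Q (real k))" for k
  proof -
    define s where "s = real k + 1/2"
    have c: "cos (2 * pi * real m * (s + x)) = (-1) ^ m * cos (2 * pi * m * x)" for x
    proof -
      have "2 * pi * real m * (s + x) = (2 * pi * m * x + real m * pi) + 2 * pi * real_of_int (int (m * k))" by (simp add: s_def algebra_simps)
      then have "cos (2 * pi * real m * (s + x)) = cos (2 * pi * m * x + real m * pi)"
        using cos.plus_of_int[of "2 * pi * m * x + real m * pi" "int (m * k)"] by (simp add: mult_ac)
      then show ?thesis by (simp add: cos_add)
    qed
    have "((\<lambda>x. (-1) ^ m * (P (s + x) + P (s - x))) has_integral ((-1) ^ m * (Q (s + 1/2) - Q (s - 1/2)) - (-1) ^ m * (Q (s + 0) - Q (s - 0)))) {0..1/2}"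
    proof (rule fundamental_theorem_of_calculus)
      fix x :: real assume "x \<in> {0..1/2}"
      then have "s + x > -1" "s - x > -1" by (auto simp: s_def)
      from Q[OF this(1)] Q[OF this(2)]
      have "((\<lambda>x. (-1) ^ m * (Q (s + x) - Q (s - x))) has_real_derivative (-1) ^ m * (P (s + x) * 1 - P (s - x) * (-1))) (at x)"
        by (intro DERIV_cmult DERIV_diff DERIV_chain2[where f = Q]) (auto intro!: derivative_eq_intros)
      then show "((\<lambda>x. (-1) ^ m * (Q (s + x) - Q (s - x))) has_vector_derivative (-1) ^ m * (P (s + x) + P (s - x))) (at x within {0..1/2})"
        by (auto simp flip: has_real_derivative_iff_has_vector_derivative intro: has_field_derivative_at_within)
    qed simp
    moreover have "(-1) ^ m * (P (s + x) + P (s - x)) = (gker y (s - x) + gker y (s + x)) * cos (2 * pi * m * x)" for x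
    proof -
      have "(-1::real) ^ m * (-1) ^ m = 1" by (simp flip: power_add)
      then show ?thesis using c[of x] c[of "- x"] by (simp add: P_def algebra_simps)
    qed
    moreover have "s + 1/2 = real (Suc k)" "s - 1/2 = real k" by (simp_all add: s_def)
    ultimately show ?thesis by (simp add: s_def integral_unique)
  qed
  moreover have "(\<lambda>k. Q (real (Suc k)) - Q (real k)) sums ((sqrt (2 * y) / 2 * exp (- 2 * pi * (real m)\<^sup>2 * y) + Q 0) - Q (real 0))"
  proof (rule telescope_sums)
    have a: "pi / (2 * y) > 0" using y by simp
    have I: "has_bochner_integral hl P (sqrt (2 * y) / 2 * exp (- 2 * pi * (real m)\<^sup>2 * y))"
    proof -
      have "pi / (pi / (2 * y)) = 2 * y" "- (2 * pi * real m)\<^sup>2 / (4 * (pi / (2 * y))) = - 2 * pi * (real m)\<^sup>2 * y"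
        using y by (simp_all add: power2_eq_square)
      then show ?thesis using gaussian_cos_hl[OF a, of "2 * pi * m"] unfolding P_def gker_def by simp
    qed
    then have "((\<lambda>u. integral {0..u} P) \<longlongrightarrow> sqrt (2 * y) / 2 * exp (- 2 * pi * (real m)\<^sup>2 * y)) at_top"
      using hl_integral_limit[OF integrable.intros[OF I]] has_bochner_integral_integral_eq[OF I] by simp
    then have "(\<lambda>k. integral {0..real k} P) \<longlonglongrightarrow> sqrt (2 * y) / 2 * exp (- 2 * pi * (real m)\<^sup>2 * y)"
      by (rule filterlim_compose[OF _ filterlim_real_sequentially])
    then have "(\<lambda>k. integral {0..real k} P + Q 0) \<longlonglongrightarrow> sqrt (2 * y) / 2 * exp (- 2 * pi * (real m)\<^sup>2 * y) + Q 0"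
      by (intro tendsto_intros)
    moreover have "integral {0..real k} P + Q 0 = Q (real k)" for k
      unfolding Q_def using Henstock_Kurzweil_Integration.integral_combine[of "-1" 0 "real k" P] by (simp add: integrable_continuous_real P)
    ultimately show "(\<lambda>k. Q (real k)) \<longlonglongrightarrow> sqrt (2 * y) / 2 * exp (- 2 * pi * (real m)\<^sup>2 * y) + Q 0" by simp
  qed
  then have "(\<lambda>k. (-1) ^ m * (Q (real (Suc k)) - Q (real k))) sums ((-1) ^ m * (sqrt (2 * y) / 2 * exp (- 2 * pi * (real m)\<^sup>2 * y)))"
    by (intro sums_mult) simp
  ultimately show ?thesis by simp
qed

text \<open>As \<open>gker\<close> is even, the two terms together run over all half-integers: this
  is the periodisation of the Gaussian, displaced by 1/2.\<close>

definition "gkers y x = (\<Sum>k. gker y (real k + 1/2 - x) + gker y (real k + 1/2 + x))" for y x :: real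

lemma gker_even: "gker y (- u) = gker y u" by (simp add: gker_def)

lemma gker_summable_shift:
  assumes "y > 0"
  shows "summable (\<lambda>k. gker y (real k + c))"
proof -
  obtain n :: nat where n: "real n \<ge> - c" using real_arch_simple by blast
  have "summable (\<lambda>k. gker y (real (k + n) + c))" using n by (intro gker_summable assms) auto
  then show ?thesis by (simp only: summable_iff_shift[of "\<lambda>k. gker y (real k + c)" n])
qed

lemma gkers_summable: "y > 0 \<Longrightarrow> summable (\<lambda>k. gker y (real k + 1/2 - x) + gker y (real k + 1/2 + x))"
  using gker_summable_shift[of y "1/2 - x"] gker_summable_shift[of y "1/2 + x"] by (intro summable_add) (simp_all add: add.assoc add_diff_eq)

lemma gkers_shift:
  assumes y: "y > 0"
  shows "gkers y (x + 1) = gkers y x"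
proof -
  note S = gker_summable_shift[OF y]
  have 1: "gkers y t = (\<Sum>k. gker y (real k + (1/2 - t))) + (\<Sum>k. gker y (real k + (1/2 + t)))" for t
    unfolding gkers_def using suminf_add[OF S[of "1/2 - t"] S[of "1/2 + t"]] by (simp add: add.assoc add_diff_eq)
  have 2: "(\<Sum>k. gker y (real k + c)) = gker y c + (\<Sum>k. gker y (real k + (c + 1)))" for c
    using suminf_split_head[OF S[of c]] by (simp add: add_ac)
  have 3: "1/2 - (x + 1) + 1 = 1/2 - x" "1/2 + x + 1 = 1/2 + (x + 1)" by simp_all
  have 4: "gker y (1/2 - (x + 1)) = gker y (1/2 + x)" using gker_even[of y "1/2 + x"] by (simp add: add.commute)
  show ?thesis unfolding 1 using 2[of "1/2 - (x + 1)"] 2[of "1/2 + x"] unfolding 3 4 by simp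
qed

lemma gkers_even: "gkers y (- x) = gkers y x"
  by (simp add: gkers_def add.commute)

lemma theta_summable:
  assumes y: "y > 0"
  shows "summable (\<lambda>n. exp (- 2 * pi * (real n)\<^sup>2 * y))"
proof (rule summable_comparison_test')
  show "summable (\<lambda>n. exp (- 2 * pi * y) ^ n)" using y by (intro summable_geometric) simp
  fix n :: nat
  have "real n \<le> (real n)\<^sup>2" by (cases n) (auto simp: power2_eq_square)
  then have "2 * pi * y * real n \<le> 2 * pi * y * (real n)\<^sup>2" using y by (intro mult_left_mono) auto
  then show "norm (exp (- 2 * pi * (real n)\<^sup>2 * y)) \<le> exp (- 2 * pi * y) ^ n" by (simp add: mult_ac flip: exp_of_nat_mult)
qed

text \<open>Both sides are even and 1-periodic in \<open>x\<close>, so [0, 1/2] suffices, where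
  \<open>gker_coeff\<close> supplies the cosine coefficients of the periodised Gaussian.\<close>

theorem gauss_poisson:
  assumes y: "y > 0"
  shows "(\<lambda>n. 2 * ((-1) ^ Suc n * exp (- 2 * pi * (real (Suc n))\<^sup>2 * y) * cos (2 * pi * real (Suc n) * x))) sums (gkers y x / sqrt (2 * y) - 1)"
proof -
  define a where "a n = (if n = 0 then 1 else 2 * ((-1) ^ n * exp (- 2 * pi * (real n)\<^sup>2 * y)))" for n :: nat
  have sq: "sqrt (2 * y) > 0" using y by simp
  have main: "(\<lambda>n. a n * cos (2 * pi * real n * x)) sums (gkers y x / sqrt (2 * y))" if x: "x \<in> {0..1/2}" for x
  proof (rule cosine_series_eq[OF _ _ _ x])
    show "summable (\<lambda>n. \<bar>a n\<bar>)"
    proof (rule summable_comparison_test')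
      show "summable (\<lambda>n. 2 * exp (- 2 * pi * (real n)\<^sup>2 * y))" by (intro summable_mult theta_summable y)
    qed (simp add: a_def abs_mult)
    define h where "h k x = gker y (real k + 1/2 - x) + gker y (real k + 1/2 + x)" for k x
    have hb: "\<bar>h k x\<bar> \<le> 2 * exp (- (pi / (2 * y))) ^ k" if "x \<in> {0..1/2}" for k x
    proof -
      have "gker y (real k + 1/2 - x) \<le> exp (- (pi / (2 * y))) ^ k" "gker y (real k + 1/2 + x) \<le> exp (- (pi / (2 * y))) ^ k"
        using that by (intro gker_le_geometric y; simp)+
      moreover have "gker y u \<ge> 0" for u by (simp add: gker_def)
      ultimately show ?thesis by (simp add: h_def)
    qed
    have M: "summable (\<lambda>k. 2 * exp (- (pi / (2 * y))) ^ k)" using y by (intro summable_mult summable_geometric) simp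
    have hc: "continuous_on {0..1/2} (h k)" for k unfolding h_def gker_def by (intro continuous_intros)
    have gk: "gkers y x = (\<Sum>k. h k x)" for x by (simp add: gkers_def h_def)
    show "continuous_on {0..1/2} (\<lambda>x. gkers y x / sqrt (2 * y))"
      unfolding gk using uniform_series_integral(1)[OF hc hb M] sq by (intro continuous_intros) auto
    fix m :: nat
    have "(\<lambda>k. integral {0..1/2} (\<lambda>x. h k x * cos (2 * pi * m * x))) sums integral {0..1/2} (\<lambda>x. \<Sum>k. h k x * cos (2 * pi * m * x))"
    proof (rule uniform_series_integral(2)[OF _ _ M])
      show "continuous_on {0..1/2} (\<lambda>x. h k x * cos (2 * pi * m * x))" for k by (intro continuous_intros hc)
      show "\<bar>h k x * cos (2 * pi * m * x)\<bar> \<le> 2 * exp (- (pi / (2 * y))) ^ k" if "x \<in> {0..1/2}" for k x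
        using hb[OF that, of k] abs_cos_le_one[of "2 * pi * m * x"] unfolding abs_mult by (meson abs_ge_zero mult_right_le_one_le order_trans)
    qed
    moreover have "(\<Sum>k. h k x * cos (2 * pi * m * x)) = gkers y x * cos (2 * pi * m * x)" for x
      unfolding gk using gkers_summable[OF y] by (intro suminf_mult2[symmetric]) (simp add: h_def)
    ultimately have "(\<lambda>k. integral {0..1/2} (\<lambda>x. h k x * cos (2 * pi * m * x))) sums integral {0..1/2} (\<lambda>x. gkers y x * cos (2 * pi * m * x))"
      by simp
    from sums_unique2[OF this] gker_coeff[OF y, of m]
    have e1: "integral {0..1/2} (\<lambda>x. gkers y x * cos (2 * pi * m * x)) = (-1) ^ m * (sqrt (2 * y) / 2 * exp (- 2 * pi * (real m)\<^sup>2 * y))"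
      unfolding h_def by blast
    have e2: "integral {0..1/2} (\<lambda>x. gkers y x / sqrt (2 * y) * cos (2 * pi * real m * x)) =
       integral {0..1/2} (\<lambda>x. gkers y x * cos (2 * pi * m * x)) / sqrt (2 * y)"
      by (simp flip: integral_divide)
    show "integral {0..1/2} (\<lambda>x. gkers y x / sqrt (2 * y) * cos (2 * pi * real m * x)) = a m * (if m = 0 then 1/2 else 1/4)"
      unfolding e1 e2 using sq by (cases "m = 0") (simp_all add: a_def)
  qed
  have int: "gkers y (t + of_int i) = gkers y t" for t i
  proof (induction i rule: int_induct[of _ 0])
    case (step1 i) then show ?case using gkers_shift[OF y, of "t + of_int i"] by (simp add: add.assoc)
  next
    case (step2 i) then show ?case using gkers_shift[OF y, of "t + of_int (i - 1)"] by (simp add: add.assoc)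
  qed simp
  define i where "i = round x"
  define t where "t = \<bar>x - of_int i\<bar>"
  have t: "t \<in> {0..1/2}" using of_int_round_abs_le[of x] by (auto simp: t_def i_def abs_minus_commute)
  have c: "cos (2 * pi * real n * x) = cos (2 * pi * real n * t)" for n
  proof -
    have "cos (2 * pi * real n * t) = cos (2 * pi * real n * (x - of_int i))"
      by (auto simp: t_def abs_if) (metis cos_minus minus_diff_eq mult_minus_right)
    also have "2 * pi * real n * (x - of_int i) = 2 * pi * real n * x + 2 * pi * of_int (- int n * i)" by (simp add: algebra_simps)
    also have "cos \<dots> = cos (2 * pi * real n * x)" using cos.plus_of_int[of "2 * pi * real n * x" "- int n * i"] by (simp add: mult_ac)
    finally show ?thesis by simp
  qed
  have g: "gkers y x = gkers y t"
    using int[of "x - of_int i" i] gkers_even[of y "x - of_int i"] by (auto simp: t_def abs_if)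
  have "(\<lambda>n. a n * cos (2 * pi * real n * x)) sums (gkers y x / sqrt (2 * y))" unfolding c g by (rule main[OF t])
  then have "(\<lambda>n. a (Suc n) * cos (2 * pi * real (Suc n) * x)) sums (gkers y x / sqrt (2 * y) - a 0 * cos (2 * pi * real 0 * x))"
    by (subst sums_Suc_iff[of "\<lambda>n. a n * cos (2 * pi * real n * x)"]) simp
  then show ?thesis by (simp add: a_def mult.assoc)
qed

text \<open>Write 1 / (n^2 + b^2) as a Laplace integral in \<open>t\<close> and exchange by Tonelli.
  The integration in \<open>b\<close> is a Gaussian second moment with parameter 2 pi (t + y), and
  this is the origin of the period kernel (t + y)^(-3/2).\<close>

lemma gaussian_laplace:
  fixes y :: real and n :: nat
  assumes y: "y > 0" and n: "n > 0"
  shows "has_bochner_integral hl (\<lambda>b. exp (- (2 * pi * y) * b\<^sup>2) * (b\<^sup>2 / ((real n)\<^sup>2 + b\<^sup>2)))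
     (integral\<^sup>L hl (\<lambda>t. exp (- 2 * pi * (real n)\<^sup>2 * t) * (t + y) powr (- 3/2)) / (4 * sqrt 2))"
    and "integrable hl (\<lambda>t. exp (- 2 * pi * (real n)\<^sup>2 * t) * (t + y) powr (- 3/2))"
proof -
  have id [measurable]: "(\<lambda>x. x) \<in> borel_measurable hl" by (intro hl_measurable_continuous continuous_intros)
  interpret hl: sigma_finite_measure hl by (intro sigma_finite_measure_restrict_space sigma_finite_lborel) auto
  interpret pair_sigma_finite hl hl ..
  define h where "h b t = exp (- (2 * pi * y) * b\<^sup>2) * b\<^sup>2 * exp (- (2 * pi * ((real n)\<^sup>2 + b\<^sup>2)) * t)" for b t
  have [measurable]: "(\<lambda>(b, t). ennreal (h b t)) \<in> borel_measurable (hl \<Otimes>\<^sub>M hl)" unfolding h_def by measurable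
  have nb: "(real n)\<^sup>2 + b\<^sup>2 > 0" for b using n by (simp add: add_pos_nonneg)
  have i1: "has_bochner_integral hl (h b) (exp (- (2 * pi * y) * b\<^sup>2) * b\<^sup>2 * (1 / (2 * pi * ((real n)\<^sup>2 + b\<^sup>2))))" for b
    unfolding h_def
  proof (rule has_bochner_integral_mult_right)
    define c where "c = 2 * pi * ((real n)\<^sup>2 + b\<^sup>2)"
    have c: "c > 0" using nb[of b] by (simp add: c_def)
    have "((\<lambda>t. - exp (- c * t) / c) \<longlongrightarrow> 0) at_top" using c by real_asymp
    then have "has_bochner_integral hl (\<lambda>t. exp (- c * t)) (0 - (- exp (- c * 0) / c))"
      using c by (intro hl_FTC_nonneg) (auto intro!: derivative_eq_intros)
    then show "has_bochner_integral hl (\<lambda>t. exp (- (2 * pi * ((real n)\<^sup>2 + b\<^sup>2)) * t)) (1 / (2 * pi * ((real n)\<^sup>2 + b\<^sup>2)))"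
      by (simp add: c_def)
  qed
  have i2: "has_bochner_integral hl (\<lambda>b. h b t) (exp (- 2 * pi * (real n)\<^sup>2 * t) * (t + y) powr (- 3/2) / (8 * sqrt 2 * pi))" if t: "t \<ge> 0" for t
  proof -
    define u where "u = t + y"
    have u: "u > 0" using t y by (simp add: u_def)
    have a: "2 * pi * u > 0" using u by simp
    have e0: "has_bochner_integral hl (\<lambda>b. exp (- 2 * pi * (real n)\<^sup>2 * t) * (exp (- (2 * pi * u) * b\<^sup>2) * b\<^sup>2))
       (exp (- 2 * pi * (real n)\<^sup>2 * t) * (sqrt (pi / (2 * pi * u)) / (4 * (2 * pi * u))))"
      by (intro has_bochner_integral_mult_right gaussian_hl a)
    have e1: "exp (- 2 * pi * (real n)\<^sup>2 * t) * (exp (- (2 * pi * u) * b\<^sup>2) * b\<^sup>2) = h b t" for b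
      by (simp add: h_def u_def algebra_simps flip: exp_add)
    have e2: "sqrt (pi / (2 * pi * u)) / (4 * (2 * pi * u)) = u powr (- 3/2) / (8 * sqrt 2 * pi)"
    proof -
      have "u powr (- 3/2) = 1 / (u * sqrt u)"
        using u powr_add[of u "-1" "-1/2"] by (simp add: powr_minus_divide powr_half_sqrt)
      then show ?thesis using u by (simp add: real_sqrt_divide real_sqrt_mult)
    qed
    show ?thesis using e0 unfolding e1 e2 by (simp only: u_def times_divide_eq_right)
  qed
  have h0: "h b t \<ge> 0" for b t by (simp add: h_def)
  define A where "A b = exp (- (2 * pi * y) * b\<^sup>2) * b\<^sup>2 * (1 / (2 * pi * ((real n)\<^sup>2 + b\<^sup>2)))" for b
  define B where "B t = exp (- 2 * pi * (real n)\<^sup>2 * t) * (t + y) powr (- 3/2) / (8 * sqrt 2 * pi)" for t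
  have A0: "A b \<ge> 0" for b using nb[of b] by (simp add: A_def)
  have B0: "B t \<ge> 0" for t by (simp add: B_def)
  have "(\<integral>\<^sup>+ t. (\<integral>\<^sup>+ b. ennreal (h b t) \<partial>hl) \<partial>hl) = (\<integral>\<^sup>+ b. (\<integral>\<^sup>+ t. ennreal (h b t) \<partial>hl) \<partial>hl)"
    by (rule Fubini'[symmetric]) measurable
  moreover have "(\<integral>\<^sup>+ b. (\<integral>\<^sup>+ t. ennreal (h b t) \<partial>hl) \<partial>hl) = (\<integral>\<^sup>+ b. ennreal (A b) \<partial>hl)"
    using i1 h0 by (intro nn_integral_cong) (simp add: nn_integral_eq_integral has_bochner_integral_iff A_def)
  moreover have "(\<integral>\<^sup>+ t. (\<integral>\<^sup>+ b. ennreal (h b t) \<partial>hl) \<partial>hl) = (\<integral>\<^sup>+ t. ennreal (B t) \<partial>hl)"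
    using i2 h0 by (intro nn_integral_cong) (simp add: nn_integral_eq_integral has_bochner_integral_iff B_def)
  ultimately have eq: "(\<integral>\<^sup>+ t. ennreal (B t) \<partial>hl) = (\<integral>\<^sup>+ b. ennreal (A b) \<partial>hl)" by simp
  have mA: "A \<in> borel_measurable hl" unfolding A_def by measurable
  have mB: "B \<in> borel_measurable hl" unfolding B_def by measurable
  have intA: "integrable hl A"
  proof (rule hl_integrable_bound[OF _ mA])
    show "integrable hl (\<lambda>b. exp (- (2 * pi * y) * b\<^sup>2))" using gaussian_hl(1)[of "2 * pi * y"] y by (intro integrable.intros) auto
    fix b :: real
    have "b\<^sup>2 * (1 / (2 * pi * ((real n)\<^sup>2 + b\<^sup>2))) \<le> 1"
    proof -
      have "b\<^sup>2 \<le> 1 * ((real n)\<^sup>2 + b\<^sup>2)" by simp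
      also have "\<dots> \<le> (2 * pi) * ((real n)\<^sup>2 + b\<^sup>2)" using pi_ge_two nb[of b] by (intro mult_right_mono) auto
      finally show ?thesis using nb[of b] by simp
    qed
    then have "exp (- (2 * pi * y) * b\<^sup>2) * (b\<^sup>2 * (1 / (2 * pi * ((real n)\<^sup>2 + b\<^sup>2)))) \<le> exp (- (2 * pi * y) * b\<^sup>2) * 1" by (intro mult_left_mono) auto
    then show "norm (A b) \<le> exp (- (2 * pi * y) * b\<^sup>2)" using A0[of b] by (simp add: A_def)
  qed
  have "(\<integral>\<^sup>+ t. ennreal (B t) \<partial>hl) = ennreal (integral\<^sup>L hl A)"
    unfolding eq using intA A0 by (intro nn_integral_eq_integral) auto
  then have B: "has_bochner_integral hl B (integral\<^sup>L hl A)"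
    using mB B0 A0 by (intro has_bochner_integral_nn_integral) auto
  have B': "(\<lambda>t. exp (- 2 * pi * (real n)\<^sup>2 * t) * (t + y) powr (- 3/2)) = (\<lambda>t. (8 * sqrt 2 * pi) * B t)"
    by (auto simp: B_def)
  show "integrable hl (\<lambda>t. exp (- 2 * pi * (real n)\<^sup>2 * t) * (t + y) powr (- 3/2))"
    unfolding B' using B by (intro integrable_mult_right) (rule integrable.intros)
  have BB: "integral\<^sup>L hl (\<lambda>t. exp (- 2 * pi * (real n)\<^sup>2 * t) * (t + y) powr (- 3/2)) = (8 * sqrt 2 * pi) * integral\<^sup>L hl A"
    unfolding B' using has_bochner_integral_integral_eq[OF B] by simp
  have "has_bochner_integral hl (\<lambda>b. (2 * pi) * A b) ((2 * pi) * integral\<^sup>L hl A)"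
    using intA by (intro has_bochner_integral_mult_right) (rule has_bochner_integral_integrable)
  moreover have "(\<lambda>b. (2 * pi) * A b) = (\<lambda>b. exp (- (2 * pi * y) * b\<^sup>2) * (b\<^sup>2 / ((real n)\<^sup>2 + b\<^sup>2)))"
    by (auto simp: A_def fun_eq_iff simp del: sum_power2_eq_zero_iff)
  ultimately show "has_bochner_integral hl (\<lambda>b. exp (- (2 * pi * y) * b\<^sup>2) * (b\<^sup>2 / ((real n)\<^sup>2 + b\<^sup>2)))
     (integral\<^sup>L hl (\<lambda>t. exp (- 2 * pi * (real n)\<^sup>2 * t) * (t + y) powr (- 3/2)) / (4 * sqrt 2))"
  proof -
    have "(8 * sqrt 2 * pi * X) / (4 * sqrt 2) = (2 * pi) * X" for X by simp
    then show "has_bochner_integral hl (\<lambda>b. (2 * pi) * A b) ((2 * pi) * integral\<^sup>L hl A) \<Longrightarrow>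
      (\<lambda>b. (2 * pi) * A b) = (\<lambda>b. exp (- (2 * pi * y) * b\<^sup>2) * (b\<^sup>2 / ((real n)\<^sup>2 + b\<^sup>2))) \<Longrightarrow> ?thesis"
      unfolding BB by metis
  qed
qed

section \<open>The Mordell integral\<close>

text \<open>Real series for the imaginary axis: \<open>theta4_it y\<close> is \<open>th4\<close> at
  iy, \<open>sech_sum y\<close> is \<open>th4\<close> times the overpartition series there, because
  4 q^n / (1 + q^n)^2 = 1 / cosh(pi n y)^2 for q = exp(-2 pi y), and \<open>theta2_half y\<close> is
  half of \<open>th2\<close> at i/(4y).\<close>

definition "theta4_it y = 1 + (\<Sum>n. 2 * ((-1) ^ Suc n * exp (- 2 * pi * (real (Suc n))\<^sup>2 * y)))" for y :: real
definition "sech_sum y = 1 + (\<Sum>n. 2 * ((-1) ^ Suc n * exp (- 2 * pi * (real (Suc n))\<^sup>2 * y) / (cosh (pi * (real (Suc n) * y)))\<^sup>2))" for y :: real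
definition "theta2_half y = (\<Sum>k. gker y (real k + 1/2))" for y :: real

text \<open>Reached from two sides: it is a quarter of \<open>psi y 0\<close>, which occurs in the
  overpartition series, and a multiple of a period integral of theta.\<close>

definition mordell :: "real \<Rightarrow> real" where
  "mordell y = integral\<^sup>L hl (\<lambda>b. b / sinh (pi * b) * exp (- (2 * pi * y) * b\<^sup>2))"

lemma theta4_it_sums:
  assumes y: "y > 0"
  shows "(\<lambda>n. 2 * ((-1) ^ Suc n * exp (- 2 * pi * (real (Suc n))\<^sup>2 * y))) sums (theta4_it y - 1)"
proof -
  have "summable (\<lambda>n. exp (- 2 * pi * (real (Suc n))\<^sup>2 * y))" using theta_summable[OF y] by (subst summable_Suc_iff)
  have "summable (\<lambda>n. 2 * ((-1) ^ Suc n * exp (- 2 * pi * (real (Suc n))\<^sup>2 * y)))"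
  proof (rule summable_mult, rule summable_norm_cancel)
    have "norm ((-1) ^ Suc n * exp (- 2 * pi * (real (Suc n))\<^sup>2 * y)) = exp (- 2 * pi * (real (Suc n))\<^sup>2 * y)" for n
      by (simp only: real_norm_def abs_mult power_abs abs_minus_cancel abs_one power_one mult_1_left abs_exp_cancel)
    then show "summable (\<lambda>n. norm ((-1) ^ Suc n * exp (- 2 * pi * (real (Suc n))\<^sup>2 * y)))"
      using \<open>summable (\<lambda>n. exp (- 2 * pi * (real (Suc n))\<^sup>2 * y))\<close> by (simp only:)
  qed
  then show ?thesis by (simp add: theta4_it_def summable_sums)
qed

lemma theta4_it_eq: "y > 0 \<Longrightarrow> theta4_it y = 2 / sqrt (2 * y) * theta2_half y"
proof -
  assume y: "y > 0"
  have "(\<lambda>n. 2 * ((-1) ^ Suc n * exp (- 2 * pi * (real (Suc n))\<^sup>2 * y))) sums (gkers y 0 / sqrt (2 * y) - 1)"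
    using gauss_poisson[OF y, of 0] by simp
  from sums_unique2[OF this theta4_it_sums[OF y]] have "theta4_it y = gkers y 0 / sqrt (2 * y)" by simp
  moreover have "gkers y 0 = 2 * theta2_half y"
    unfolding gkers_def theta2_half_def using suminf_mult[OF gker_summable_shift[OF y, of "1/2"], of 2] by simp
  ultimately show ?thesis by simp
qed

lemma hl_a_over_sinh: "has_bochner_integral hl (\<lambda>a. a / sinh (pi * a)) (1/4)"
  using sech_fourier[of 0] by simp

text \<open>Each 1/cosh^2 is replaced by its Fourier integral over \<open>a\<close>; summation under
  the integral produces the Poisson sum at \<open>x = y * a\<close>.\<close>

lemma sech_sum_integral:
  assumes y: "y > 0"
  shows "has_bochner_integral hl (\<lambda>a. a / sinh (pi * a) * (gkers y (y * a) / sqrt (2 * y))) (sech_sum y / 4)"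
proof -
  define e where "e n = exp (- 2 * pi * (real (Suc n))\<^sup>2 * y)" for n
  have e0: "e n \<ge> 0" for n by (simp add: e_def)
  have es: "summable e" using theta_summable[OF y] unfolding e_def by (subst summable_Suc_iff)
  define W where "W a = a / sinh (pi * a)" for a :: real
  have W0: "W a \<ge> 0" if "a \<ge> 0" for a using that by (simp add: W_def)
  have W: "has_bochner_integral hl W (1/4)" unfolding W_def by (rule hl_a_over_sinh)
  define f where "f n a = 2 * ((-1) ^ Suc n * e n) * (a * cos (2 * pi * (real (Suc n) * y) * a) / sinh (pi * a))" for n a
  define I where "I n = 2 * ((-1) ^ Suc n * e n) * (1 / (4 * (cosh (pi * (real (Suc n) * y)))\<^sup>2))" for n
  define g where "g n a = 2 * e n * W a" for n a
  define S where "S a = W a * (gkers y (y * a) / sqrt (2 * y) - 1)" for a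
  have f: "has_bochner_integral hl (f n) (I n)" for n
    unfolding f_def I_def by (intro has_bochner_integral_mult_right sech_fourier)
  have g: "has_bochner_integral hl (g n) (2 * e n * (1/4))" for n
    unfolding g_def by (intro has_bochner_integral_mult_right W)
  have fW: "f n a = 2 * ((-1) ^ Suc n * e n * cos (2 * pi * real (Suc n) * (y * a))) * W a" for n a
    by (simp add: f_def W_def mult_ac)
  have fg: "\<bar>f n a\<bar> \<le> g n a" if "0 \<le> a" for n a
  proof -
    have "\<bar>f n a\<bar> = 2 * e n * W a * \<bar>cos (2 * pi * real (Suc n) * (y * a))\<bar>" unfolding fW using W0[OF that] e0[of n] by (simp add: abs_mult)
    also have "\<dots> \<le> 2 * e n * W a * 1" using W0[OF that] e0[of n] by (intro mult_left_mono abs_cos_le_one) auto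
    finally show ?thesis by (simp add: g_def)
  qed
  have sumg: "summable (\<lambda>n. integral\<^sup>L hl (g n))"
    unfolding has_bochner_integral_integral_eq[OF g] by (intro summable_mult2 summable_mult es)
  have fsum: "summable (\<lambda>n. \<bar>f n a\<bar>)" if "0 < a" for a
  proof (rule summable_comparison_test')
    show "summable (\<lambda>n. g n a)" unfolding g_def by (intro summable_mult2 summable_mult es)
  qed (use fg[of a] that in auto)
  have fs: "(\<lambda>n. f n a) sums S a" if "0 < a" for a
  proof -
    have "(\<lambda>n. 2 * ((-1) ^ Suc n * e n * cos (2 * pi * real (Suc n) * (y * a))) * W a) sums ((gkers y (y * a) / sqrt (2 * y) - 1) * W a)"
      unfolding e_def by (intro sums_mult2 gauss_poisson y)
    then show ?thesis unfolding fW S_def by (simp add: mult.commute)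
  qed
  have meas: "S \<in> borel_measurable hl"
    unfolding S_def W_def sinh_field_def gkers_def gker_def by (intro measurable_restrict_space1) auto
  note L = hl_sums[of f I g S, OF f integrable.intros[OF g] fg sumg fsum fs meas]
  have "(\<lambda>n. I n * 4) sums (integral\<^sup>L hl S * 4)" using L(2) by (rule sums_mult2)
  moreover have "I n * 4 = 2 * ((-1) ^ Suc n * exp (- 2 * pi * (real (Suc n))\<^sup>2 * y) / (cosh (pi * (real (Suc n) * y)))\<^sup>2)" for n
  proof -
    have "2 * (s * t) * (1 / (4 * D)) * 4 = 2 * (s * t / D)" for s t D :: real by simp
    then show ?thesis unfolding I_def e_def .
  qed
  ultimately have "integral\<^sup>L hl S * 4 = sech_sum y - 1" unfolding sech_sum_def by (simp only: sums_iff)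
  then have "integral\<^sup>L hl S = (sech_sum y - 1) / 4" by simp
  then have "has_bochner_integral hl S ((sech_sum y - 1) / 4)" using L(1) by (simp add: has_bochner_integral_iff)
  \<comment> \<open>Adding \<open>W\<close>, of integral 1/4, restores the constant terms 1 of
    \<open>sech_sum\<close> and of theta.\<close>
  from has_bochner_integral_add[OF this W]
  have "has_bochner_integral hl (\<lambda>a. S a + W a) (sech_sum y / 4)" by (simp add: diff_divide_distrib)
  moreover have "S a + W a = W a * (gkers y (y * a) / sqrt (2 * y))" for a by (simp add: S_def algebra_simps)
  ultimately show ?thesis by (simp add: W_def)
qed

text \<open>Completing the square turns the shifted Gaussians of the Poisson sum into hyperbolic cosines;
  consecutive moments then differ by multiples of \<open>sinh\<close>, which cancels the denominator.\<close>

definition "cosh_moment y k = integral\<^sup>L hl (\<lambda>a. a / sinh (pi * a) * (gker y (real k + 1/2 - y * a) + gker y (real k + 1/2 + y * a)))" for y :: real and k :: nat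

lemma gker_pair:
  assumes "y > 0"
  shows "gker y (s - y * a) + gker y (s + y * a) = gker y s * (2 * cosh (pi * s * a) * exp (- (pi * y / 2) * a\<^sup>2))"
proof -
  have "gker y (s - y * a) = gker y s * (exp (pi * s * a) * exp (- (pi * y / 2) * a\<^sup>2))"
    "gker y (s + y * a) = gker y s * (exp (- (pi * s * a)) * exp (- (pi * y / 2) * a\<^sup>2))"
    using assms by (simp_all add: gker_def power2_eq_square field_simps flip: exp_add)
  then show ?thesis by (simp add: cosh_field_def algebra_simps)
qed

lemma cosh_moment_integrable:
  assumes y: "y > 0"
  shows "integrable hl (\<lambda>a. a / sinh (pi * a) * (gker y (s - y * a) + gker y (s + y * a)))"
proof (rule hl_integrable_bound)
  show "integrable hl (\<lambda>a. 2 * (a / sinh (pi * a)))" using hl_a_over_sinh by (intro integrable_mult_right) (rule integrable.intros)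
  show "(\<lambda>a. a / sinh (pi * a) * (gker y (s - y * a) + gker y (s + y * a))) \<in> borel_measurable hl"
    unfolding sinh_field_def gker_def by (intro measurable_restrict_space1) auto
  fix a :: real assume a: "0 \<le> a"
  have "gker y u \<le> 1" "gker y u \<ge> 0" for u using y by (simp_all add: gker_def)
  from this[of "s - y * a"] this[of "s + y * a"]
  have "0 \<le> gker y (s - y * a) + gker y (s + y * a)" "gker y (s - y * a) + gker y (s + y * a) \<le> 2" by linarith+
  moreover have "a / sinh (pi * a) \<ge> 0" using a by simp
  ultimately show "norm (a / sinh (pi * a) * (gker y (s - y * a) + gker y (s + y * a))) \<le> 2 * (a / sinh (pi * a))"
    unfolding real_norm_def by (subst abs_of_nonneg) (auto simp only: mult.commute[of 2] intro: mult_left_mono mult_nonneg_nonneg)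
qed

text \<open>All integrands are nonnegative, so partial sums of the moments are bounded by the total
  integral; this yields summability and then termwise integration.\<close>

lemma sech_sum_moments:
  assumes y: "y > 0"
  shows "cosh_moment y sums (sqrt (2 * y) * (sech_sum y / 4))"
proof -
  define W where "W a = a / sinh (pi * a)" for a :: real
  have W0: "W a \<ge> 0" if "a \<ge> 0" for a using that by (simp add: W_def)
  define p where "p k a = gker y (real k + 1/2 - y * a) + gker y (real k + 1/2 + y * a)" for k a
  have p0: "p k a \<ge> 0" for k a by (simp add: p_def gker_def)
  have int: "integrable hl (\<lambda>a. W a * p k a)" for k
    unfolding W_def p_def by (rule cosh_moment_integrable[OF y])
  have I: "integral\<^sup>L hl (\<lambda>a. W a * p k a) = cosh_moment y k" for k by (simp add: cosh_moment_def W_def p_def)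
  have ps: "(\<lambda>k. p k a) sums gkers y (y * a)" for a
    unfolding p_def gkers_def by (intro summable_sums gkers_summable y)
  have tot: "has_bochner_integral hl (\<lambda>a. sqrt (2 * y) * (W a * (gkers y (y * a) / sqrt (2 * y)))) (sqrt (2 * y) * (sech_sum y / 4))"
    unfolding W_def by (intro has_bochner_integral_mult_right sech_sum_integral y)
  then have tot: "has_bochner_integral hl (\<lambda>a. W a * gkers y (y * a)) (sqrt (2 * y) * (sech_sum y / 4))" using y by simp
  have le: "(\<Sum>k<n. cosh_moment y k) \<le> sqrt (2 * y) * (sech_sum y / 4)" for n
  proof -
    have "(\<Sum>k<n. cosh_moment y k) = integral\<^sup>L hl (\<lambda>a. \<Sum>k<n. W a * p k a)" using int by (simp add: I)
    also have "\<dots> \<le> integral\<^sup>L hl (\<lambda>a. W a * gkers y (y * a))"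
    proof (rule integral_mono)
      show "integrable hl (\<lambda>a. W a * gkers y (y * a))" using tot by (rule integrable.intros)
      fix a :: real assume "a \<in> space hl"
      then have "W a * (\<Sum>k<n. p k a) \<le> W a * gkers y (y * a)"
        using sum_le_suminf[OF sums_summable[OF ps], of "{..<n}" a] sums_unique[OF ps[of a]] p0 W0 by (intro mult_left_mono) auto
      then show "(\<Sum>k<n. W a * p k a) \<le> W a * gkers y (y * a)" by (simp add: sum_distrib_left)
    qed (use int in auto)
    finally show ?thesis using has_bochner_integral_integral_eq[OF tot] by simp
  qed
  have nn: "cosh_moment y k \<ge> 0" for k unfolding I[symmetric] using W0 p0 by (intro Bochner_Integration.integral_nonneg) auto
  have summ: "summable (cosh_moment y)"
    by (rule bounded_imp_summable[of _ "sqrt (2 * y) * (sech_sum y / 4)"]) (use nn le[of "Suc _"] in \<open>auto simp: lessThan_Suc_atMost\<close>)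
  have "(\<lambda>k. cosh_moment y k) sums integral\<^sup>L hl (\<lambda>a. W a * gkers y (y * a))"
  proof (rule hl_sums(2)[where f = "\<lambda>k a. W a * p k a" and g = "\<lambda>k a. W a * p k a"])
    show "has_bochner_integral hl (\<lambda>a. W a * p k a) (cosh_moment y k)" for k using int I by (simp add: has_bochner_integral_iff)
    show "summable (\<lambda>k. integral\<^sup>L hl (\<lambda>a. W a * p k a))" using summ by (simp add: I)
    show "\<bar>W a * p k a\<bar> \<le> W a * p k a" if "0 \<le> a" for k a using W0[OF that] p0 by simp
    show "summable (\<lambda>k. \<bar>W a * p k a\<bar>)" if "0 < a" for a
      using W0[of a] p0 that sums_summable[OF ps[of a]] by (simp add: abs_mult summable_mult)
    show "(\<lambda>k. W a * p k a) sums (W a * gkers y (y * a))" for a by (intro sums_mult ps)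
    show "(\<lambda>a. W a * gkers y (y * a)) \<in> borel_measurable hl" using tot by (intro borel_measurable_integrable) (rule integrable.intros)
  qed (use int in auto)
  then show ?thesis using has_bochner_integral_integral_eq[OF tot] by simp
qed

lemma gker_pos: "gker y u > 0" by (simp add: gker_def)

text \<open>Dividing out the Gaussian value leaves the pure moment of cosh(pi (k + 1/2) a), for
  which indices at distance 2 are related.\<close>

definition "psi y k = cosh_moment y k / gker y (real k + 1/2)" for y :: real and k :: nat

lemma psi_integral:
  assumes y: "y > 0"
  shows "has_bochner_integral hl (\<lambda>a. a / sinh (pi * a) * (2 * cosh (pi * (real k + 1/2) * a) * exp (- (pi * y / 2) * a\<^sup>2))) (psi y k)"
proof -
  let ?s = "real k + 1/2"
  have "has_bochner_integral hl (\<lambda>a. a / sinh (pi * a) * (gker y (?s - y * a) + gker y (?s + y * a))) (cosh_moment y k)"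
    unfolding cosh_moment_def by (rule has_bochner_integral_integrable[OF cosh_moment_integrable[OF y]])
  then have "has_bochner_integral hl (\<lambda>a. a / sinh (pi * a) * (gker y (?s - y * a) + gker y (?s + y * a)) / gker y ?s) (psi y k)"
    unfolding psi_def by (rule has_bochner_integral_divide)
  moreover have "a / sinh (pi * a) * (gker y (?s - y * a) + gker y (?s + y * a)) / gker y ?s =
      a / sinh (pi * a) * (2 * cosh (pi * ?s * a) * exp (- (pi * y / 2) * a\<^sup>2))" for a
    unfolding gker_pair[OF y] using gker_pos[of y ?s] by simp
  ultimately show ?thesis by simp
qed

text \<open>The cosines hyperbolic at k + 3/2 and k - 1/2 differ by 2 sinh(pi (k + 1/2) a) sinh(pi
  a), which cancels the denominator and leaves a Gaussian integral.\<close>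

lemma psi_step:
  assumes y: "y > 0"
  shows "psi y (Suc k) - psi y (k - 1) = 2 / y * sqrt (2 / y) * ((real k + 1/2) / gker y (real k + 1/2))"
proof -
  define s where "s = real k + 1/2"
  have a: "pi * y / 2 > 0" using y by simp
  have "has_bochner_integral hl (\<lambda>a. a / sinh (pi * a) * (2 * cosh (pi * (real (Suc k) + 1/2) * a) * exp (- (pi * y / 2) * a\<^sup>2)) -
      a / sinh (pi * a) * (2 * cosh (pi * (real (k - 1) + 1/2) * a) * exp (- (pi * y / 2) * a\<^sup>2))) (psi y (Suc k) - psi y (k - 1))"
    by (intro has_bochner_integral_diff psi_integral y)
  moreover have "a / sinh (pi * a) * (2 * cosh (pi * (real (Suc k) + 1/2) * a) * exp (- (pi * y / 2) * a\<^sup>2)) -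
      a / sinh (pi * a) * (2 * cosh (pi * (real (k - 1) + 1/2) * a) * exp (- (pi * y / 2) * a\<^sup>2)) =
      4 * (a * sinh (pi * s * a) * exp (- (pi * y / 2) * a\<^sup>2))" for a
  proof -
    have "cosh (pi * (real (Suc k) + 1/2) * a) = cosh (pi * s * a + pi * a)" by (simp add: s_def algebra_simps)
    \<comment> \<open>For \<open>k = 0\<close> truncated subtraction gives index 0 instead of -1;
      the value is the same because cosh is even.\<close>
    moreover have "cosh (pi * (real (k - 1) + 1/2) * a) = cosh (pi * s * a - pi * a)"
    proof (cases k)
      case 0
      have "pi * s * a - pi * a = - (pi * (real (k - 1) + 1/2) * a)" by (simp add: s_def 0)
      then show ?thesis by (simp only: cosh_minus)
    qed (simp add: s_def algebra_simps)
    ultimately have c: "cosh (pi * (real (Suc k) + 1/2) * a) - cosh (pi * (real (k - 1) + 1/2) * a) = 2 * sinh (pi * s * a) * sinh (pi * a)"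
      by (simp only: cosh_add cosh_diff)
    have "w * (2 * A * e) - w * (2 * B * e) = 2 * w * e * (A - B)" for w A B e :: real by (simp add: algebra_simps)
    from this[of "a / sinh (pi * a)" "cosh (pi * (real (Suc k) + 1/2) * a)" "exp (- (pi * y / 2) * a\<^sup>2)" "cosh (pi * (real (k - 1) + 1/2) * a)"]
    show ?thesis unfolding c by (cases "a = 0") simp_all
  qed
  moreover have "has_bochner_integral hl (\<lambda>a. 4 * (a * sinh (pi * s * a) * exp (- (pi * y / 2) * a\<^sup>2)))
     (4 * (pi * s / (4 * (pi * y / 2)) * sqrt (pi / (pi * y / 2)) * exp ((pi * s)\<^sup>2 / (4 * (pi * y / 2)))))"
    by (intro has_bochner_integral_mult_right gaussian_sinh_hl a)
  ultimately have "psi y (Suc k) - psi y (k - 1) = 4 * (pi * s / (4 * (pi * y / 2)) * sqrt (pi / (pi * y / 2)) * exp ((pi * s)\<^sup>2 / (4 * (pi * y / 2))))"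
    by (simp only: has_bochner_integral_eq)
  moreover have "exp ((pi * s)\<^sup>2 / (4 * (pi * y / 2))) = 1 / gker y s"
  proof -
    have "(pi * s)\<^sup>2 / (4 * (pi * y / 2)) = pi / (2 * y) * s\<^sup>2" using y by (simp add: power2_eq_square)
    then show ?thesis by (simp add: gker_def exp_minus inverse_eq_divide)
  qed
  moreover have "pi / (pi * y / 2) = 2 / y" "4 * (pi * s / (4 * (pi * y / 2))) = 2 / y * s" using y by (simp_all add: field_simps)
  ultimately show ?thesis by (simp only: s_def) (simp add: mult_ac)
qed

text \<open>The exponent is (k + 1/2)^2 - (j + 1/2)^2, from a quotient of two Gaussians; the parity
  condition records that the recursion for \<open>psi\<close> moves in steps of 2.\<close>

definition "qmock q k = (\<Sum>j<k. if odd (k + j) then (of_nat j + 1/2) * q ^ ((k - j) * (k + j + 1)) else 0)"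
  for q :: "'a :: real_normed_field"

lemma psi_eq:
  assumes y: "y > 0"
  shows "psi y k = psi y 0 + 2 / y * sqrt (2 / y) * (\<Sum>j<k. if odd (k + j) then (real j + 1/2) / gker y (real j + 1/2) else 0)"
proof (induction k rule: less_induct)
  case (less k)
  show ?case
  proof (cases k)
    case (Suc m)
    \<comment> \<open>The summand \<open>j = m\<close> is split off and \<open>j = m - 1\<close> has
      the wrong parity, so the sum for \<open>m - 1\<close> remains; for \<open>m = 0\<close> it is
      empty by truncated subtraction.\<close>
    have "(\<Sum>j<Suc m. if odd (Suc m + j) then (real j + 1/2) / gker y (real j + 1/2) else 0) =
      (\<Sum>j<m - 1. if odd (m - 1 + j) then (real j + 1/2) / gker y (real j + 1/2) else 0) + (real m + 1/2) / gker y (real m + 1/2)"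
    proof (cases m)
      case (Suc l)
      show ?thesis by (simp add: Suc)
    qed simp
    moreover have "psi y (m - 1) = psi y 0 + 2 / y * sqrt (2 / y) * (\<Sum>j<m - 1. if odd (m - 1 + j) then (real j + 1/2) / gker y (real j + 1/2) else 0)"
      by (rule less) (simp add: Suc)
    ultimately show ?thesis using psi_step[OF y, of m] unfolding Suc by (simp only: distrib_left)
  qed simp
qed

lemma cosh_moment_eq:
  assumes y: "y > 0"
  shows "cosh_moment y k = psi y 0 * gker y (real k + 1/2) + 2 / y * sqrt (2 / y) * qmock (exp (- (pi / (2 * y)))) k"
proof -
  have "gker y (real k + 1/2) * (if odd (k + j) then (real j + 1/2) / gker y (real j + 1/2) else 0) =
     (if odd (k + j) then (real j + 1/2) * exp (- (pi / (2 * y))) ^ ((k - j) * (k + j + 1)) else 0)" if "j < k" for j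
  proof -
    have e: "(real k + 1/2)\<^sup>2 - (real j + 1/2)\<^sup>2 = real ((k - j) * (k + j + 1))"
    proof -
      have "real (k - j) = real k - real j" using that by (simp add: of_nat_diff)
      then show ?thesis by (simp only: of_nat_mult of_nat_add of_nat_1) (simp add: power2_eq_square algebra_simps)
    qed
    have "gker y (real k + 1/2) / gker y (real j + 1/2) = exp (- (pi / (2 * y)) * ((real k + 1/2)\<^sup>2 - (real j + 1/2)\<^sup>2))"
      unfolding gker_def right_diff_distrib exp_diff ..
    also have "\<dots> = exp (- (pi / (2 * y))) ^ ((k - j) * (k + j + 1))"
      unfolding e by (rule exp_of_nat2_mult)
    finally have eq: "gker y (real k + 1/2) / gker y (real j + 1/2) = exp (- (pi / (2 * y))) ^ ((k - j) * (k + j + 1))" .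
    have "G * (t / H) = t * (G / H)" for G t H :: real by simp
    then show ?thesis by (simp only: if_distrib[of "(*) (gker y (real k + 1/2))"] mult_zero_right eq)
  qed
  then have "gker y (real k + 1/2) * (\<Sum>j<k. if odd (k + j) then (real j + 1/2) / gker y (real j + 1/2) else 0) = qmock (exp (- (pi / (2 * y)))) k"
    unfolding sum_distrib_left qmock_def by (intro sum.cong) auto
  moreover have "cosh_moment y k = psi y k * gker y (real k + 1/2)" using gker_pos[of y "real k + 1/2"] by (simp add: psi_def)
  ultimately show ?thesis unfolding psi_eq[OF y, of k] by (simp add: algebra_simps)
qed

lemma hl_scale:
  fixes f :: "real \<Rightarrow> real"
  assumes "has_bochner_integral hl f I" "c > 0"
  shows "has_bochner_integral hl (\<lambda>x. f (c * x)) (I / c)"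
proof -
  have "has_bochner_integral lborel (\<lambda>x. indicator {0..} x *\<^sub>R f x) I" using assms(1) unfolding has_bochner_integral_hl_iff .
  then have "has_bochner_integral lborel (\<lambda>x. indicator {0..} (0 + c * x) *\<^sub>R f (0 + c * x)) (I /\<^sub>R \<bar>c\<bar>)"
    using lborel_has_bochner_integral_real_affine_iff[of c "\<lambda>x. indicator {0..} x *\<^sub>R f x" I 0] assms(2) by simp
  moreover have "(\<lambda>x. indicator {0..} (0 + c * x) *\<^sub>R f (0 + c * x)) = (\<lambda>x. indicator {0..} x *\<^sub>R f (c * x))"
    using assms(2) by (auto simp: indicator_def zero_le_mult_iff)
  moreover have "I /\<^sub>R \<bar>c\<bar> = I / c" using assms(2) by (simp add: divide_inverse_commute)
  ultimately show ?thesis unfolding has_bochner_integral_hl_iff by simp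
qed

text \<open>With a = 2b, the duplication sinh(2 pi b) = 2 sinh(pi b) cosh(pi b) removes the factor
  cosh from the moment of index 0.\<close>

lemma psi_0_mordell:
  assumes y: "y > 0"
  shows "has_bochner_integral hl (\<lambda>b. b / sinh (pi * b) * exp (- (2 * pi * y) * b\<^sup>2)) (psi y 0 / 4)"
proof -
  have "has_bochner_integral hl (\<lambda>b. (2 * b) / sinh (pi * (2 * b)) * (2 * cosh (pi * (real 0 + 1/2) * (2 * b)) * exp (- (pi * y / 2) * (2 * b)\<^sup>2)) / 2) (psi y 0 / 2 / 2)"
    using has_bochner_integral_divide[OF hl_scale[OF psi_integral[OF y, of 0], of 2], of 2] by (simp only: zero_less_numeral)
  moreover have "(2 * b) / sinh (pi * (2 * b)) * (2 * cosh (pi * (real 0 + 1/2) * (2 * b)) * exp (- (pi * y / 2) * (2 * b)\<^sup>2)) / 2 =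
     b / sinh (pi * b) * exp (- (2 * pi * y) * b\<^sup>2)" for b
  proof -
    have "pi * (2 * b) = pi * b + pi * b" "pi * (real 0 + 1/2) * (2 * b) = pi * b" "- (pi * y / 2) * (2 * b)\<^sup>2 = - (2 * pi * y) * b\<^sup>2"
      by (simp_all add: power2_eq_square algebra_simps)
    moreover have "2 * b / (S * C + C * S) * (2 * C * E) / 2 = b / S * E" if "C > 0" for S C E :: real
    proof -
      have "S * C + C * S = (2 * C) * S" by simp
      then show ?thesis using that by simp
    qed
    from this[OF cosh_real_pos[of "pi * b"]]
    show ?thesis unfolding calculation sinh_add .
  qed
  moreover have "psi y 0 / 2 / 2 = psi y 0 / 4" by simp
  ultimately show ?thesis by (simp only:)
qed

text \<open>Sum the formula for the moments over \<open>k\<close>: the multiples of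
  \<open>psi y 0\<close> collect to \<open>theta2_half\<close>, the corrections to the q-series.
  Dividing by \<open>theta4_it\<close>, a multiple of \<open>theta2_half\<close>, isolates the
  Mordell integral.\<close>

theorem sech_sum_mordell:
  assumes y: "y > 0"
  shows "sech_sum y / theta4_it y = 8 * mordell y + 4 / y * sqrt (2 / y) * ((\<Sum>k. qmock (exp (- (pi / (2 * y)))) k) / theta2_half y)"
    and "summable (qmock (exp (- (pi / (2 * y)))))" "theta2_half y > 0"
proof -
  define c where "c = 2 / y * sqrt (2 / y)"
  have c: "c > 0" using y by (simp add: c_def)
  let ?Q = "\<Sum>k. qmock (exp (- (pi / (2 * y)))) k"
  have gs: "(\<lambda>k. gker y (real k + 1/2)) sums theta2_half y"
    unfolding theta2_half_def by (intro summable_sums gker_summable_shift y)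
  show th: "theta2_half y > 0" unfolding theta2_half_def by (intro suminf_pos gker_summable_shift y gker_pos)
  have m: "psi y 0 = 4 * mordell y" unfolding mordell_def using has_bochner_integral_integral_eq[OF psi_0_mordell[OF y]] by simp
  have "(\<lambda>k. (cosh_moment y k - psi y 0 * gker y (real k + 1/2)) / c) sums ((sqrt (2 * y) * (sech_sum y / 4) - psi y 0 * theta2_half y) / c)"
    by (intro sums_divide sums_diff sums_mult gs sech_sum_moments y)
  moreover have "(cosh_moment y k - psi y 0 * gker y (real k + 1/2)) / c = qmock (exp (- (pi / (2 * y)))) k" for k
    using cosh_moment_eq[OF y, of k] c unfolding c_def[symmetric] by simp
  ultimately have q: "qmock (exp (- (pi / (2 * y)))) sums ((sqrt (2 * y) * (sech_sum y / 4) - psi y 0 * theta2_half y) / c)" by simp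
  then show "summable (qmock (exp (- (pi / (2 * y)))))" by (rule sums_summable)
  have "?Q = (sqrt (2 * y) * (sech_sum y / 4) - psi y 0 * theta2_half y) / c" using q by (simp add: sums_iff)
  then have "c * ?Q = sqrt (2 * y) * (sech_sum y / 4) - psi y 0 * theta2_half y" using c by simp
  then have s: "sech_sum y = 4 / sqrt (2 * y) * (4 * mordell y * theta2_half y + c * ?Q)"
    using y unfolding m by (simp add: field_simps)
  have "4 / r * (4 * mo * t + c * Q) / (2 / r * t) = 8 * mo + 2 * c * (Q / t)" if "r > 0" "t > 0" for r mo t c Q :: real
    using that by (simp add: field_simps)
  from this[of "sqrt (2 * y)" "theta2_half y" "mordell y" c ?Q]
  show "sech_sum y / theta4_it y = 8 * mordell y + 4 / y * sqrt (2 / y) * (?Q / theta2_half y)"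
    unfolding s theta4_it_eq[OF y] using th y by (simp add: c_def)
qed

section \<open>The Mordell integral as a period integral\<close>

lemma hl_powr_shift:
  assumes y: "y > 0"
  shows "has_bochner_integral hl (\<lambda>t. (t + y) powr (- 3/2)) (2 / sqrt y)"
proof -
  have "((\<lambda>t. - 2 * (t + y) powr (- 1/2)) \<longlongrightarrow> 0) at_top" using y by real_asymp
  then have "has_bochner_integral hl (\<lambda>t. (t + y) powr (- 3/2)) (0 - (- 2 * (0 + y) powr (- 1/2)))"
    using y by (intro hl_FTC_nonneg) (auto intro!: derivative_eq_intros)
  then show ?thesis using y by (simp add: powr_minus_divide powr_half_sqrt)
qed

text \<open>Partial fractions of 1/sinh turn the Mordell integral into a series of Gaussian
  integrals, each of which is an integral of exp(-2 pi n^2 t) against the period kernel; summing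
  over \<open>n\<close> puts theta_4 under the integral.\<close>

theorem mordell_theta_integral:
  assumes y: "y > 0"
  shows "has_bochner_integral hl (\<lambda>t. theta4_it t * (t + y) powr (- 3/2)) (4 * sqrt 2 * pi * mordell y)"
proof -
  define L where "L n = integral\<^sup>L hl (\<lambda>t. exp (- 2 * pi * (real (Suc n))\<^sup>2 * t) * (t + y) powr (- 3/2))" for n
  define E where "E b = exp (- (2 * pi * y) * b\<^sup>2)" for b
  have E: "has_bochner_integral hl E (1 / (2 * sqrt (2 * y)))"
  proof -
    have "sqrt (pi / (2 * pi * y)) / 2 = 1 / (2 * sqrt (2 * y))" using y by (simp add: real_sqrt_divide)
    moreover have "has_bochner_integral hl (\<lambda>x. exp (- (2 * pi * y) * x\<^sup>2)) (sqrt (pi / (2 * pi * y)) / 2)"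
      by (rule gaussian_hl) (use y in simp)
    ultimately show ?thesis unfolding E_def by (simp only:)
  qed
  have isq: "summable (\<lambda>n. 1 / (real (Suc n))\<^sup>2)"
    using inverse_power_summable[of 2, where 'a = real] summable_Suc_iff[of "\<lambda>n. inverse (real n ^ 2)"] by (simp add: inverse_eq_divide)
  \<comment> \<open>Termwise integration in \<open>b\<close>. The term 1 / b^2 of the partial
    fractions becomes the pure Gaussian integral subtracted on the right.\<close>
  have A: "(\<lambda>n. 2 * (-1) ^ Suc n * (L n / (4 * sqrt 2))) sums (pi * mordell y - 1 / (2 * sqrt (2 * y)))"
  proof -
    define f where "f n b = 2 * (-1) ^ Suc n * (E b * (b\<^sup>2 / ((real (Suc n))\<^sup>2 + b\<^sup>2)))" for n b
    define g where "g n b = 2 * (1 / (real (Suc n))\<^sup>2) * (E b * b\<^sup>2)" for n b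
    define S where "S b = pi * (b / sinh (pi * b) * E b) - E b" for b
    obtain I2 where I2: "has_bochner_integral hl (\<lambda>b. E b * b\<^sup>2) I2" unfolding E_def using gaussian_hl(2)[of "2 * pi * y"] y by auto
    have f: "has_bochner_integral hl (f n) (2 * (-1) ^ Suc n * (L n / (4 * sqrt 2)))" for n
      unfolding f_def L_def E_def by (intro has_bochner_integral_mult_right gaussian_laplace y) auto
    have g: "has_bochner_integral hl (g n) (2 * (1 / (real (Suc n))\<^sup>2) * I2)" for n
      unfolding g_def by (intro has_bochner_integral_mult_right I2)
    have Epos: "E b > 0" for b by (simp add: E_def)
    have fg: "\<bar>f n b\<bar> \<le> g n b" for n b
    proof -
      have "b\<^sup>2 / ((real (Suc n))\<^sup>2 + b\<^sup>2) \<le> b\<^sup>2 / (real (Suc n))\<^sup>2" by (intro divide_left_mono) (auto intro!: mult_pos_pos add_pos_nonneg)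
      then have "2 * (E b * (b\<^sup>2 / ((real (Suc n))\<^sup>2 + b\<^sup>2))) \<le> 2 * (E b * (b\<^sup>2 / (real (Suc n))\<^sup>2))"
        using Epos[of b] by (intro mult_left_mono) auto
      moreover have "\<bar>f n b\<bar> = 2 * (E b * (b\<^sup>2 / ((real (Suc n))\<^sup>2 + b\<^sup>2)))"
        unfolding f_def abs_mult power_abs using Epos[of b] by (simp add: abs_of_nonneg)
      moreover have "2 * (E b * (b\<^sup>2 / (real (Suc n))\<^sup>2)) = g n b" by (simp only: g_def) simp
      ultimately show ?thesis by linarith
    qed
    have fs: "(\<lambda>n. f n b) sums S b" if b: "0 < b" for b
    proof -
      have "(\<lambda>n. 2 * E b * b\<^sup>2 * ((-1) ^ Suc n / ((real (Suc n))\<^sup>2 + b\<^sup>2))) sums (2 * E b * b\<^sup>2 * ((pi / (b * sinh (pi * b)) - 1 / b\<^sup>2) / 2))"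
        by (intro sums_mult csch_partial_fractions b)
      moreover have "2 * E b * b\<^sup>2 * ((pi / (b * sinh (pi * b)) - 1 / b\<^sup>2) / 2) = S b"
        using b by (simp add: S_def field_simps power2_eq_square)
      moreover have "2 * E b * b\<^sup>2 * ((-1) ^ Suc n / ((real (Suc n))\<^sup>2 + b\<^sup>2)) = f n b" for n by (simp add: f_def)
      ultimately show ?thesis by simp
    qed
    have sumg: "summable (\<lambda>n. integral\<^sup>L hl (g n))"
      unfolding has_bochner_integral_integral_eq[OF g] by (intro summable_mult2 summable_mult isq)
    have fsum: "summable (\<lambda>n. \<bar>f n b\<bar>)" for b
    proof (rule summable_comparison_test')
      show "summable (\<lambda>n. g n b)" unfolding g_def by (intro summable_mult2 summable_mult isq)
    qed (use fg in auto)
    have S: "has_bochner_integral hl S (pi * mordell y - 1 / (2 * sqrt (2 * y)))"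
      unfolding S_def
    proof (intro has_bochner_integral_diff has_bochner_integral_mult_right E)
      show "has_bochner_integral hl (\<lambda>b. b / sinh (pi * b) * E b) (mordell y)" unfolding E_def mordell_def
        by (rule has_bochner_integral_integrable[OF integrable.intros[OF psi_0_mordell[OF y]]])
    qed
    have "(\<lambda>n. 2 * (-1) ^ Suc n * (L n / (4 * sqrt 2))) sums integral\<^sup>L hl S"
      by (rule hl_sums(2)[of f _ g, OF f integrable.intros[OF g] fg sumg fsum fs])
         (use S in \<open>auto intro: borel_measurable_integrable integrable.intros\<close>)
    then show ?thesis using has_bochner_integral_integral_eq[OF S] by simp
  qed
  define f where "f n t = 2 * (-1) ^ Suc n * (exp (- 2 * pi * (real (Suc n))\<^sup>2 * t) * (t + y) powr (- 3/2))" for n t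
  define g where "g n t = 2 * y powr (- 3/2) * exp (- 2 * pi * (real (Suc n))\<^sup>2 * t)" for n t
  define S where "S t = (theta4_it t - 1) * (t + y) powr (- 3/2)" for t
  have f: "has_bochner_integral hl (f n) (2 * (-1) ^ Suc n * L n)" for n
    unfolding f_def L_def
    by (intro has_bochner_integral_mult_right has_bochner_integral_integrable gaussian_laplace(2) y) auto
  have g: "has_bochner_integral hl (g n) (2 * y powr (- 3/2) * (1 / (2 * pi) * (1 / (real (Suc n))\<^sup>2)))" for n
    unfolding g_def
  proof (rule has_bochner_integral_mult_right)
    define c where "c = 2 * pi * (real (Suc n))\<^sup>2"
    have c: "c > 0" by (simp add: c_def)
    have "((\<lambda>t. - exp (- c * t) / c) \<longlongrightarrow> 0) at_top" using c by real_asymp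
    then have "has_bochner_integral hl (\<lambda>t. exp (- c * t)) (0 - (- exp (- c * 0) / c))"
      using c by (intro hl_FTC_nonneg) (auto intro!: derivative_eq_intros)
    then show "has_bochner_integral hl (\<lambda>t. exp (- 2 * pi * (real (Suc n))\<^sup>2 * t)) (1 / (2 * pi) * (1 / (real (Suc n))\<^sup>2))"
      by (simp add: c_def)
  qed
  have fg: "\<bar>f n t\<bar> \<le> g n t" if "0 \<le> t" for n t
  proof -
    have "(t + y) powr (- 3/2) \<le> y powr (- 3/2)" using that y by (intro powr_mono2') auto
    moreover have "\<bar>f n t\<bar> = 2 * (t + y) powr (- 3/2) * exp (- 2 * pi * (real (Suc n))\<^sup>2 * t)"
      unfolding f_def abs_mult power_abs by simp
    ultimately show ?thesis by (simp add: g_def)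
  qed
  have sumg: "summable (\<lambda>n. integral\<^sup>L hl (g n))"
    unfolding has_bochner_integral_integral_eq[OF g] by (intro summable_mult isq)
  have es: "summable (\<lambda>n. exp (- 2 * pi * (real (Suc n))\<^sup>2 * t))" if "t > 0" for t
    using theta_summable[OF that] by (subst summable_Suc_iff)
  have fsum: "summable (\<lambda>n. \<bar>f n t\<bar>)" if "0 < t" for t
  proof (rule summable_comparison_test')
    show "summable (\<lambda>n. g n t)" unfolding g_def by (intro summable_mult es that)
  qed (use fg[of t] that in auto)
  have fs: "(\<lambda>n. f n t) sums S t" if "0 < t" for t
  proof -
    have "(\<lambda>n. 2 * ((-1) ^ Suc n * exp (- 2 * pi * (real (Suc n))\<^sup>2 * t)) * (t + y) powr (- 3/2)) sums S t"
      unfolding S_def by (intro sums_mult2 theta4_it_sums that)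
    then show ?thesis by (simp add: f_def mult.assoc)
  qed
  have meas: "S \<in> borel_measurable hl"
    unfolding S_def theta4_it_def by (intro measurable_restrict_space1) auto
  note R = hl_sums[of f "\<lambda>n. 2 * (-1) ^ Suc n * L n" g S, OF f integrable.intros[OF g] fg sumg fsum fs meas]
  have "(\<lambda>n. 4 * sqrt 2 * (2 * (-1) ^ Suc n * (L n / (4 * sqrt 2)))) sums (4 * sqrt 2 * (pi * mordell y - 1 / (2 * sqrt (2 * y))))"
    by (intro sums_mult A)
  moreover have "4 * sqrt 2 * (2 * s * (l / (4 * sqrt 2))) = 2 * s * l" for s l :: real by simp
  ultimately have "(\<lambda>n. 2 * (-1) ^ Suc n * L n) sums (4 * sqrt 2 * (pi * mordell y - 1 / (2 * sqrt (2 * y))))" by (simp only:)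
  from sums_unique2[OF this R(2)] R(1)
  have "has_bochner_integral hl S (4 * sqrt 2 * (pi * mordell y - 1 / (2 * sqrt (2 * y))))" by (simp add: has_bochner_integral_iff)
  \<comment> \<open>The constant term of theta contributes \<open>2 / sqrt y\<close>, which cancels
    the Gaussian integral left over from the partial fractions.\<close>
  from has_bochner_integral_add[OF this hl_powr_shift[OF y]]
  have "has_bochner_integral hl (\<lambda>t. S t + (t + y) powr (- 3/2)) (4 * sqrt 2 * (pi * mordell y - 1 / (2 * sqrt (2 * y))) + 2 / sqrt y)" .
  moreover have "4 * sqrt 2 * (pi * mordell y - 1 / (2 * sqrt (2 * y))) + 2 / sqrt y = 4 * sqrt 2 * pi * mordell y"
    using y by (simp add: real_sqrt_mult right_diff_distrib)
  moreover have "S t + (t + y) powr (- 3/2) = theta4_it t * (t + y) powr (- 3/2)" for t by (simp add: S_def algebra_simps)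
  ultimately show ?thesis by simp
qed

section \<open>Holomorphic q-series on the upper half plane\<close>

lemma open_uhp: "open upper_half_plane"
  unfolding upper_half_plane_def by (rule open_halfspace_Im_gt)

lemma in_uhp: "z \<in> upper_half_plane \<longleftrightarrow> Im z > 0"
  by (simp add: upper_half_plane_def)

text \<open>Majorants on the half planes Im z >= \<open>\<epsilon>\<close> serve twice: small discs
  lie in such a half plane, which gives holomorphy, and the bound on the sum is uniform in the real
  part.\<close>

lemma holomorphic_series_uhp:
  fixes f :: "nat \<Rightarrow> complex \<Rightarrow> complex"
  assumes hol: "\<And>n. f n holomorphic_on upper_half_plane"
    and M: "\<And>\<epsilon>. \<epsilon> > 0 \<Longrightarrow> \<exists>M. summable M \<and> (\<forall>n z. Im z \<ge> \<epsilon> \<longrightarrow> norm (f n z) \<le> M n)"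
  shows "(\<lambda>z. \<Sum>n. f n z) holomorphic_on upper_half_plane"
    and "\<epsilon> > 0 \<Longrightarrow> \<exists>B. \<forall>z. Im z \<ge> \<epsilon> \<longrightarrow> norm (\<Sum>n. f n z) \<le> B"
    and "Im z > 0 \<Longrightarrow> summable (\<lambda>n. f n z)"
proof -
  show "(\<lambda>z. \<Sum>n. f n z) holomorphic_on upper_half_plane"
  proof (rule holomorphic_uniform_sequence[OF open_uhp])
    show "(\<lambda>z. \<Sum>i<n. f i z) holomorphic_on upper_half_plane" for n by (intro holomorphic_intros hol)
    fix z assume z: "z \<in> upper_half_plane"
    define d where "d = Im z / 2"
    have d: "d > 0" using z by (simp add: d_def in_uhp)
    have sub: "Im w \<ge> d" if "w \<in> cball z d" for w
    proof -
      have "\<bar>Im (z - w)\<bar> \<le> d" using that abs_Im_le_cmod[of "z - w"] by (simp add: dist_norm)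
      then have "Im z - Im w \<le> d" using abs_ge_self[of "Im (z - w)"] unfolding minus_complex.sel by (rule order_trans[rotated])
      moreover have "Im z = d + d" by (simp add: d_def)
      ultimately show ?thesis by linarith
    qed
    obtain M where M: "summable M" "\<And>n w. Im w \<ge> d \<Longrightarrow> norm (f n w) \<le> M n" using M[OF d] by blast
    have "uniform_limit (cball z d) (\<lambda>n w. \<Sum>i<n. f i w) (\<lambda>w. \<Sum>i. f i w) sequentially"
      by (rule Weierstrass_m_test[OF _ M(1)]) (use M(2) sub in blast)
    moreover have "cball z d \<subseteq> upper_half_plane" using sub d by (force simp: in_uhp)
    ultimately show "\<exists>d>0. cball z d \<subseteq> upper_half_plane \<and> uniform_limit (cball z d) (\<lambda>n w. \<Sum>i<n. f i w) (\<lambda>w. \<Sum>i. f i w) sequentially"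
      using d by blast
  qed
  show "\<exists>B. \<forall>z. Im z \<ge> \<epsilon> \<longrightarrow> norm (\<Sum>n. f n z) \<le> B" if e: "\<epsilon> > 0"
  proof -
    obtain M where M: "summable M" "\<And>n w. Im w \<ge> \<epsilon> \<Longrightarrow> norm (f n w) \<le> M n" using M[OF e] by blast
    then have "norm (\<Sum>n. f n z) \<le> suminf M" if "Im z \<ge> \<epsilon>" for z using that M(1) by (intro norm_suminf_le) simp_all
    then show ?thesis by blast
  qed
  show "summable (\<lambda>n. f n z)" if z: "Im z > 0"
  proof -
    obtain M where "summable M" "\<And>n w. Im w \<ge> Im z \<Longrightarrow> norm (f n w) \<le> M n" using M[OF z] by blast
    then show ?thesis by (rule summable_comparison_test'[of M 0]) simp
  qed
qed

section \<open>Theta series and the q-series of the companion\<close>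

lemma norm_qexp: "norm (qexp z) = exp (- 2 * pi * Im z)"
  by (simp add: qexp_def norm_exp_eq_Re)

lemma norm_qexp_less_1: "Im z > 0 \<Longrightarrow> norm (qexp z) < 1"
  by (simp add: norm_qexp)

lemma norm_qexp_le: "Im z \<ge> \<epsilon> \<Longrightarrow> norm (qexp z) \<le> exp (- 2 * pi * \<epsilon>)"
  by (simp add: norm_qexp)

lemma qexp_holomorphic: "qexp holomorphic_on A"
  unfolding qexp_def[abs_def] by (intro holomorphic_intros)

lemma qexp_power_bound:
  assumes "Im z \<ge> \<epsilon>" "\<epsilon> > 0" "n \<le> m"
  shows "norm (qexp z ^ m) \<le> exp (- 2 * pi * \<epsilon>) ^ n"
proof -
  have "norm (qexp z) ^ m \<le> exp (- 2 * pi * \<epsilon>) ^ m" using assms by (intro power_mono norm_qexp_le) auto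
  also have "\<dots> \<le> exp (- 2 * pi * \<epsilon>) ^ n" using assms by (intro power_decreasing) auto
  finally show ?thesis by (simp add: norm_power)
qed

lemma exp_neg_power_summable: "\<epsilon> > 0 \<Longrightarrow> summable (\<lambda>n. exp (- 2 * pi * \<epsilon>) ^ n)" for \<epsilon> :: real
  by (intro summable_geometric) simp

text \<open>In classical notation \<open>th4 z\<close> and \<open>th2 z\<close> are theta_4 and
  theta_2 at 2z, with the two-sided sums folded by symmetry.\<close>

definition th4 :: "complex \<Rightarrow> complex" where
  "th4 z = 1 + 2 * (\<Sum>n. (-1) ^ Suc n * qexp z ^ ((Suc n)\<^sup>2))"

definition th2 :: "complex \<Rightarrow> complex" where
  "th2 z = 2 * (\<Sum>k. exp (2 * of_real pi * \<i> * z * (of_nat k + 1/2)\<^sup>2))"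

definition qm :: "complex \<Rightarrow> complex" where
  "qm z = (\<Sum>k. qmock (qexp z) k)"

lemma th4_aux:
  "(\<lambda>z. \<Sum>n. (-1) ^ Suc n * qexp z ^ ((Suc n)\<^sup>2)) holomorphic_on upper_half_plane"
  "\<epsilon> > 0 \<Longrightarrow> \<exists>B. \<forall>z. Im z \<ge> \<epsilon> \<longrightarrow> norm (\<Sum>n. (-1) ^ Suc n * qexp z ^ ((Suc n)\<^sup>2)) \<le> B"
proof -
  have M: "\<exists>M. summable M \<and> (\<forall>n z. Im z \<ge> \<epsilon> \<longrightarrow> norm ((-1) ^ Suc n * qexp z ^ ((Suc n)\<^sup>2)) \<le> M n)" if "\<epsilon> > 0" for \<epsilon>
  proof (intro exI conjI allI impI)
    show "summable (\<lambda>n. exp (- 2 * pi * \<epsilon>) ^ n)" by (rule exp_neg_power_summable[OF that])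
    fix n z assume "Im z \<ge> \<epsilon>"
    then have "norm (qexp z ^ ((Suc n)\<^sup>2)) \<le> exp (- 2 * pi * \<epsilon>) ^ n"
      using that by (intro qexp_power_bound) (auto simp: power2_eq_square)
    then show "norm ((-1) ^ Suc n * qexp z ^ ((Suc n)\<^sup>2)) \<le> exp (- 2 * pi * \<epsilon>) ^ n"
      unfolding norm_mult by (simp only: norm_power norm_minus_cancel norm_one power_one mult_1_left)
  qed
  have h: "(\<lambda>z. (-1) ^ Suc n * qexp z ^ ((Suc n)\<^sup>2)) holomorphic_on upper_half_plane" for n
    by (intro holomorphic_intros qexp_holomorphic)
  note L = holomorphic_series_uhp[of "\<lambda>n z. (-1) ^ Suc n * qexp z ^ ((Suc n)\<^sup>2)", OF h M]
  show "(\<lambda>z. \<Sum>n. (-1) ^ Suc n * qexp z ^ ((Suc n)\<^sup>2)) holomorphic_on upper_half_plane" by (rule L(1))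
  show "\<epsilon> > 0 \<Longrightarrow> \<exists>B. \<forall>z. Im z \<ge> \<epsilon> \<longrightarrow> norm (\<Sum>n. (-1) ^ Suc n * qexp z ^ ((Suc n)\<^sup>2)) \<le> B" by (rule L(2))
qed

text \<open>Boundedness uniform in the real part makes the period integrals converge along vertical
  rays; being inherited by derivatives, it also permits differentiation under the integral.\<close>

definition bhol :: "(complex \<Rightarrow> complex) \<Rightarrow> bool" where
  "bhol g \<longleftrightarrow> g holomorphic_on upper_half_plane \<and> (\<forall>\<epsilon>>0. \<exists>B. \<forall>z. Im z \<ge> \<epsilon> \<longrightarrow> norm (g z) \<le> B)"

lemma bhol_th4: "bhol th4"
  unfolding bhol_def
proof (intro conjI allI impI)
  show "th4 holomorphic_on upper_half_plane" unfolding th4_def[abs_def] by (intro holomorphic_intros th4_aux(1))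
  fix \<epsilon> :: real assume "\<epsilon> > 0"
  then obtain B where B: "\<And>z. Im z \<ge> \<epsilon> \<Longrightarrow> norm (\<Sum>n. (-1) ^ Suc n * qexp z ^ ((Suc n)\<^sup>2)) \<le> B" using th4_aux(2) by blast
  have "norm (th4 z) \<le> 1 + 2 * B" if "Im z \<ge> \<epsilon>" for z
    unfolding th4_def using B[OF that] by (intro norm_triangle_le) (simp add: norm_mult)
  then show "\<exists>B. \<forall>z. Im z \<ge> \<epsilon> \<longrightarrow> norm (th4 z) \<le> B" by blast
qed

lemma th2_term_norm: "norm (exp (2 * of_real pi * \<i> * z * (of_nat k + 1/2)\<^sup>2)) = exp (- 2 * pi * Im z * (real k + 1/2)\<^sup>2)"
proof -
  have "(of_nat k + 1/2 :: complex)\<^sup>2 = of_real ((real k + 1/2)\<^sup>2)" by simp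
  then show ?thesis unfolding norm_exp_eq_Re by (simp only: Re_complex_of_real mult.assoc) simp
qed

lemma th2_aux:
  "(\<lambda>z. \<Sum>k. exp (2 * of_real pi * \<i> * z * (of_nat k + 1/2)\<^sup>2)) holomorphic_on upper_half_plane"
  "\<epsilon> > 0 \<Longrightarrow> \<exists>B. \<forall>z. Im z \<ge> \<epsilon> \<longrightarrow> norm (\<Sum>k. exp (2 * of_real pi * \<i> * z * (of_nat k + 1/2)\<^sup>2)) \<le> B"
  "Im z > 0 \<Longrightarrow> summable (\<lambda>k. exp (2 * of_real pi * \<i> * z * (of_nat k + 1/2)\<^sup>2))"
proof -
  have M: "\<exists>M. summable M \<and> (\<forall>n z. Im z \<ge> \<epsilon> \<longrightarrow> norm (exp (2 * of_real pi * \<i> * z * (of_nat n + 1/2)\<^sup>2)) \<le> M n)" if "\<epsilon> > 0" for \<epsilon>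
  proof (intro exI conjI allI impI)
    show "summable (\<lambda>n. exp (- 2 * pi * \<epsilon>) ^ n)" by (rule exp_neg_power_summable[OF that])
    fix n z assume z: "Im z \<ge> \<epsilon>"
    have "real n \<le> (real n + 1/2)\<^sup>2" by (simp add: power2_eq_square algebra_simps)
    then have "\<epsilon> * real n \<le> Im z * (real n + 1/2)\<^sup>2" using z that by (intro mult_mono) auto
    then have "2 * pi * (\<epsilon> * real n) \<le> 2 * pi * (Im z * (real n + 1/2)\<^sup>2)" by (intro mult_left_mono) auto
    then have "exp (- 2 * pi * Im z * (real n + 1/2)\<^sup>2) \<le> exp ((- 2 * pi * \<epsilon>) * real n)" by (simp only: exp_le_cancel_iff)
    also have "\<dots> = exp (- 2 * pi * \<epsilon>) ^ n" by (rule exp_of_nat2_mult)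
    finally show "norm (exp (2 * of_real pi * \<i> * z * (of_nat n + 1/2)\<^sup>2)) \<le> exp (- 2 * pi * \<epsilon>) ^ n"
      unfolding th2_term_norm .
  qed
  have h: "(\<lambda>z. exp (2 * of_real pi * \<i> * z * (of_nat n + 1/2)\<^sup>2)) holomorphic_on upper_half_plane" for n
    by (intro holomorphic_intros)
  note L = holomorphic_series_uhp[of "\<lambda>k z. exp (2 * of_real pi * \<i> * z * (of_nat k + 1/2)\<^sup>2)", OF h M]
  show "(\<lambda>z. \<Sum>k. exp (2 * of_real pi * \<i> * z * (of_nat k + 1/2)\<^sup>2)) holomorphic_on upper_half_plane" by (rule L(1))
  show "\<epsilon> > 0 \<Longrightarrow> \<exists>B. \<forall>z. Im z \<ge> \<epsilon> \<longrightarrow> norm (\<Sum>k. exp (2 * of_real pi * \<i> * z * (of_nat k + 1/2)\<^sup>2)) \<le> B" by (rule L(2))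
  show "Im z > 0 \<Longrightarrow> summable (\<lambda>k. exp (2 * of_real pi * \<i> * z * (of_nat k + 1/2)\<^sup>2))" by (rule L(3))
qed

lemma bhol_th2: "bhol th2"
  unfolding bhol_def
proof (intro conjI allI impI)
  show "th2 holomorphic_on upper_half_plane" unfolding th2_def[abs_def] by (intro holomorphic_intros th2_aux(1))
  fix \<epsilon> :: real assume "\<epsilon> > 0"
  then obtain B where B: "\<And>z. Im z \<ge> \<epsilon> \<Longrightarrow> norm (\<Sum>k. exp (2 * of_real pi * \<i> * z * (of_nat k + 1/2)\<^sup>2)) \<le> B" using th2_aux(2) by blast
  have "norm (th2 z) \<le> 2 * B" if "Im z \<ge> \<epsilon>" for z
    unfolding th2_def norm_mult using B[OF that] by simp
  then show "\<exists>B. \<forall>z. Im z \<ge> \<epsilon> \<longrightarrow> norm (th2 z) \<le> B" by blast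
qed

lemma nat_times_power_le:
  fixes t :: real
  assumes "0 \<le> t" "t < 1"
  shows "real k * t ^ k \<le> 1 / (1 - t)"
proof -
  have "real k * t ^ k = (\<Sum>j<k. t ^ k)" by simp
  also have "\<dots> \<le> (\<Sum>j<k. t ^ j)" using assms by (intro sum_mono power_decreasing) auto
  also have "\<dots> \<le> (\<Sum>j. t ^ j)" using assms by (intro sum_le_suminf summable_geometric) auto
  finally show ?thesis using assms by (simp add: suminf_geometric)
qed

lemma qm_holomorphic: "qm holomorphic_on upper_half_plane"
proof -
  have "\<exists>M. summable M \<and> (\<forall>k z. Im z \<ge> \<epsilon> \<longrightarrow> norm (qmock (qexp z) k) \<le> M k)" if e: "\<epsilon> > 0" for \<epsilon>
  proof (intro exI conjI allI impI)
    \<comment> \<open>The majorant is cut into three powers of \<open>t\<close>: two absorb the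
      growth k^2 from the number and the size of the summands, the third gives convergence.\<close>
    define t where "t = exp (- 2 * pi * (\<epsilon> / 3))"
    have t: "0 \<le> t" "t < 1" using e by (simp_all add: t_def)
    have t3: "exp (- 2 * pi * \<epsilon>) = t ^ 3" unfolding t_def by (simp flip: exp_of_nat_mult)
    show "summable (\<lambda>k. (1 / (1 - t)) * (1 / (1 - t)) * t ^ k)" using t by (intro summable_mult summable_geometric) auto
    fix k z assume z: "Im z \<ge> \<epsilon>"
    have "norm (qmock (qexp z) k) \<le> (\<Sum>j<k. real k * (t ^ 3) ^ k)"
      unfolding qmock_def
    proof (rule sum_norm_le)
      fix j assume j: "j \<in> {..<k}"
      have "k \<le> 1 * (k + j + 1)" by simp
      also have "\<dots> \<le> (k - j) * (k + j + 1)" using j by (intro mult_right_mono) auto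
      finally have "norm (qexp z ^ ((k - j) * (k + j + 1))) \<le> (t ^ 3) ^ k"
        using qexp_power_bound[OF z e] unfolding t3 by blast
      moreover have "norm (of_nat j + 1/2 :: complex) \<le> real k"
      proof -
        have "(of_nat j + 1/2 :: complex) = of_real (real j + 1/2)" by simp
        then have "norm (of_nat j + 1/2 :: complex) = real j + 1/2" by (simp only: norm_of_real)
        then show ?thesis using j by auto
      qed
      ultimately have "norm ((of_nat j + 1/2) * qexp z ^ ((k - j) * (k + j + 1))) \<le> real k * (t ^ 3) ^ k"
        unfolding norm_mult by (intro mult_mono) auto
      moreover have "0 \<le> real k * (t ^ 3) ^ k" using t by simp
      ultimately show "norm (if odd (k + j) then (of_nat j + 1/2) * qexp z ^ ((k - j) * (k + j + 1)) else 0) \<le> real k * (t ^ 3) ^ k"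
        by (simp split: if_splits)
    qed
    also have "\<dots> = (real k * t ^ k) * (real k * t ^ k) * t ^ k" by (simp add: power3_eq_cube power_mult_distrib)
    also have "\<dots> \<le> (1 / (1 - t)) * (1 / (1 - t)) * t ^ k"
      using nat_times_power_le[OF t] t by (intro mult_mono) auto
    finally show "norm (qmock (qexp z) k) \<le> (1 / (1 - t)) * (1 / (1 - t)) * t ^ k" .
  qed
  moreover have "(\<lambda>z. qmock (qexp z) k) holomorphic_on upper_half_plane" for k
  proof -
    have "(\<lambda>z. if odd (k + j) then (of_nat j + 1/2) * qexp z ^ ((k - j) * (k + j + 1)) else 0) holomorphic_on upper_half_plane" for j
      by (cases "odd (k + j)") (auto intro!: holomorphic_intros qexp_holomorphic)
    then show ?thesis unfolding qmock_def by (intro holomorphic_intros)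
  qed
  ultimately show ?thesis unfolding qm_def[abs_def] by (intro holomorphic_series_uhp(1))
qed

text \<open>Besides convergence this must control the growth as |q| tends to 1. The k-th factor of
  q^(n(n+1)/2) / (-q;q)_n is at most r / ((1 - r) k), so the products are terms of an exponential
  series in r / (1 - r).\<close>

lemma overpartO_term_bound:
  assumes r: "norm q \<le> r" "r < 1" "0 < r"
  shows "norm (qpoch (-1) q n * q ^ (n * (n + 1) div 2) / (qpoch (- q) q n)\<^sup>2) \<le> 2 / (1 - r) * ((r / (1 - r)) ^ n / fact n)"
proof -
  interpret nome q using r by unfold_locales simp
  have one_plus: "1 - r \<le> norm (1 + q ^ n)" for n
  proof (cases n)
    case (Suc m)
    have "norm (q ^ n) \<le> r ^ 1" using r unfolding norm_power Suc
      by (intro order_trans[OF power_decreasing[of 1 "Suc m" "norm q"]]) auto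
    then show ?thesis using norm_diff_ineq[of 1 "q ^ n"] by simp
  qed (use r in simp)
  have prod: "norm (q ^ tri n / N n) \<le> (r / (1 - r)) ^ n / fact n" for n
  proof (induction n)
    case (Suc n)
    define k where "k = Suc n"
    have f: "norm (q ^ k / (1 + q ^ k)) \<le> r / (1 - r) / real k"
    proof -
      let ?q = "norm q"
      \<comment> \<open>1 - r^k is (1 - r) times a sum of \<open>k\<close> powers of
        \<open>r\<close>, each at least r^(k-1).\<close>
      have "r ^ k * (real k * (1 - r)) \<le> r * (1 - r ^ k)"
      proof -
        have "1 - r ^ k = (1 - r) * (\<Sum>j<k. r ^ j)" by (rule one_diff_power_eq)
        also have "\<dots> \<ge> (1 - r) * (\<Sum>j<k. r ^ n)" using r by (intro mult_left_mono sum_mono power_decreasing) (auto simp: k_def)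
        finally have "r * ((1 - r) * (real k * r ^ n)) \<le> r * (1 - r ^ k)" using r by (intro mult_left_mono) auto
        then show ?thesis by (simp add: k_def mult_ac)
      qed
      moreover have rk: "r ^ k < 1" using r power_less_one_iff[of r k] by (simp add: k_def)
      moreover have "norm (1 + q ^ k) \<ge> 1 - r ^ k"
      proof -
        have "?q ^ k \<le> r ^ k" using r by (intro power_mono) auto
        then show ?thesis using norm_diff_ineq[of 1 "q ^ k"] by (simp add: norm_power)
      qed
      moreover have "norm (q ^ k / (1 + q ^ k)) \<le> r ^ k / (1 - r ^ k)"
        unfolding norm_divide norm_power using calculation r by (intro frac_le power_mono) auto
      moreover have "r ^ k / (1 - r ^ k) \<le> r / (1 - r) / real k"
      proof -
        have "a / u \<le> r' / w / k'" if "a * (k' * w) \<le> r' * u" "u > 0" "w > 0" "k' > 0" for a u r' w k' :: real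
          using that by (simp add: field_simps)
        then show ?thesis using calculation(1) rk r by (simp add: k_def)
      qed
      ultimately show ?thesis by linarith
    qed
    have "norm (q ^ tri (Suc n) / N (Suc n)) = norm (q ^ tri n / N n) * norm (q ^ k / (1 + q ^ k))"
      by (simp add: tri_Suc N_Suc power_add k_def norm_mult norm_divide)
    also have "\<dots> \<le> ((r / (1 - r)) ^ n / fact n) * (r / (1 - r) / real k)"
      using r by (intro mult_mono Suc f) auto
    also have "\<dots> = (r / (1 - r)) ^ Suc n / fact (Suc n)" by (simp add: k_def mult_ac)
    finally show ?case .
  qed simp
  have eq: "A n * q ^ tri n / (N n)\<^sup>2 = 2 / (1 + q ^ n) * (q ^ tri n / N n)"
  proof -
    have "A n = 2 * N n / (1 + q ^ n)" using A_N[of n] one_plus_nz[of n] by (simp add: field_simps)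
    then show ?thesis using N_nz[of n] by (simp add: power2_eq_square)
  qed
  have "norm (2 / (1 + q ^ n)) \<le> 2 / (1 - r)"
    unfolding norm_divide using one_plus[of n] r by (intro frac_le) auto
  then have "norm (2 / (1 + q ^ n)) * norm (q ^ tri n / N n) \<le> 2 / (1 - r) * ((r / (1 - r)) ^ n / fact n)"
    using r by (intro mult_mono prod) auto
  then show ?thesis using eq unfolding tri_def norm_mult[symmetric] by simp
qed

text \<open>With X = r / (1 - r) the majorants sum to 2 (1 + X) exp X, which is at most 2 exp(2X);
  and X <= 1 / (2 pi Im z), as r exp(2 pi Im z) = 1.\<close>

lemma overpartO_bound:
  assumes z: "Im z > 0"
  shows "norm (overpartO (qexp z)) \<le> 2 * exp (1 / (pi * Im z))"
proof -
  define r where "r = norm (qexp z)"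
  have r: "0 < r" "r < 1" using z by (simp_all add: r_def norm_qexp)
  define X where "X = r / (1 - r)"
  have X: "X > 0" "1 / (1 - r) = 1 + X" using r by (simp_all add: X_def field_simps)
  have e: "(\<lambda>n. 2 / (1 - r) * (X ^ n / fact n)) sums (2 / (1 - r) * exp X)"
    using exp_converges[of X] by (intro sums_mult) (simp add: divide_inverse mult.commute)
  have "norm (overpartO (qexp z)) \<le> (\<Sum>n. 2 / (1 - r) * (X ^ n / fact n))"
    unfolding overpartO_def
    by (rule norm_suminf_le) (use overpartO_term_bound[of "qexp z" r] r e in \<open>auto simp: r_def X_def sums_iff\<close>)
  also have "\<dots> = 2 * (1 + X) * exp X" using e X(2) by (simp add: sums_iff divide_inverse)
  also have "\<dots> \<le> 2 * exp X * exp X" using exp_ge_add_one_self[of X] X(1) by (intro mult_right_mono mult_left_mono) auto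
  also have "\<dots> = 2 * exp (2 * X)" by (simp flip: exp_add)
  also have "2 * X \<le> 1 / (pi * Im z)"
  proof -
    define u where "u = 2 * pi * Im z"
    have u: "u > 0" using z by (simp add: u_def)
    have "r * (1 + u) \<le> r * exp u" using exp_ge_add_one_self[of u] r by (intro mult_left_mono) auto
    also have "r * exp u = 1" unfolding r_def norm_qexp u_def by (simp flip: exp_add)
    finally have "r * u \<le> 1 - r" by (simp add: algebra_simps)
    then have "X \<le> 1 / u" using r u by (simp add: X_def field_simps)
    then show ?thesis by (simp add: u_def)
  qed
  finally show ?thesis by simp
qed

lemma overpartO_holomorphic: "(\<lambda>z. overpartO (qexp z)) holomorphic_on upper_half_plane"
  unfolding overpartO_def
proof (rule holomorphic_series_uhp(1))
  fix n
  have "qpoch (- qexp z) (qexp z) n \<noteq> 0" if "z \<in> upper_half_plane" for z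
  proof -
    interpret nome "qexp z" using that by unfold_locales (simp add: in_uhp norm_qexp_less_1)
    show ?thesis by (rule N_nz)
  qed
  moreover have "(\<lambda>z. qpoch (- 1) (qexp z) n) holomorphic_on upper_half_plane" "(\<lambda>z. qpoch (- qexp z) (qexp z) n) holomorphic_on upper_half_plane"
    unfolding qpoch_def by (intro holomorphic_intros qexp_holomorphic)+
  ultimately show "(\<lambda>z. qpoch (- 1) (qexp z) n * qexp z ^ (n * (n + 1) div 2) / (qpoch (- qexp z) (qexp z) n)\<^sup>2) holomorphic_on upper_half_plane"
    by (intro holomorphic_intros qexp_holomorphic) auto
next
  fix \<epsilon> :: real assume e: "\<epsilon> > 0"
  define r where "r = exp (- 2 * pi * \<epsilon>)"
  have r: "0 < r" "r < 1" using e by (simp_all add: r_def)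
  show "\<exists>M. summable M \<and> (\<forall>n z. Im z \<ge> \<epsilon> \<longrightarrow> norm (qpoch (- 1) (qexp z) n * qexp z ^ (n * (n + 1) div 2) / (qpoch (- qexp z) (qexp z) n)\<^sup>2) \<le> M n)"
  proof (intro exI conjI allI impI)
    show "summable (\<lambda>n. 2 / (1 - r) * ((r / (1 - r)) ^ n / fact n))"
      using exp_converges[of "r / (1 - r)"] by (intro summable_mult) (simp add: divide_inverse mult.commute sums_iff)
    fix n z assume "Im z \<ge> \<epsilon>"
    then show "norm (qpoch (- 1) (qexp z) n * qexp z ^ (n * (n + 1) div 2) / (qpoch (- qexp z) (qexp z) n)\<^sup>2) \<le> 2 / (1 - r) * ((r / (1 - r)) ^ n / fact n)"
      using norm_qexp_le[of \<epsilon> z] r by (intro overpartO_term_bound) (simp_all add: r_def)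
  qed
qed

section \<open>Nonholomorphic period integrals\<close>

text \<open>Cauchy's inequality on discs of radius \<open>\<epsilon> / 2\<close>, which stay in the
  half plane where \<open>g\<close> is bounded.\<close>

lemma bhol_deriv:
  assumes "bhol g"
  shows "bhol (deriv g)"
  unfolding bhol_def
proof (intro conjI allI impI)
  have hol: "g holomorphic_on upper_half_plane" using assms by (simp add: bhol_def)
  show "deriv g holomorphic_on upper_half_plane" by (rule holomorphic_deriv[OF hol open_uhp])
  fix \<epsilon> :: real assume e: "\<epsilon> > 0"
  obtain B where B: "\<And>z. Im z \<ge> \<epsilon> / 2 \<Longrightarrow> norm (g z) \<le> B"
    using assms e unfolding bhol_def by (meson half_gt_zero)
  have "norm (deriv g z) \<le> fact 1 * B / (\<epsilon> / 2) ^ 1" if z: "Im z \<ge> \<epsilon>" for z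
  proof -
    have sub: "Im w \<ge> \<epsilon> / 2" if "norm (z - w) \<le> \<epsilon> / 2" for w
      using abs_Im_le_cmod[of "z - w"] that z abs_ge_self[of "Im (z - w)"] by simp
    have "norm ((deriv ^^ 1) g z) \<le> fact 1 * B / (\<epsilon> / 2) ^ 1"
    proof (rule Cauchy_inequality)
      have c: "cball z (\<epsilon> / 2) \<subseteq> upper_half_plane"
      proof
        fix w assume "w \<in> cball z (\<epsilon> / 2)"
        then have "Im w \<ge> \<epsilon> / 2" by (intro sub) (simp add: dist_norm)
        then show "w \<in> upper_half_plane" using e by (simp add: in_uhp)
      qed
      show "g holomorphic_on ball z (\<epsilon> / 2)" using hol c ball_subset_cball holomorphic_on_subset by blast
      show "continuous_on (cball z (\<epsilon> / 2)) g"
        using holomorphic_on_imp_continuous_on[OF hol] c continuous_on_subset by blast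
      show "norm (g w) \<le> B" if "norm (z - w) = \<epsilon> / 2" for w using that by (intro B sub) simp
    qed (use e in simp)
    then show ?thesis by simp
  qed
  then show "\<exists>B. \<forall>z. Im z \<ge> \<epsilon> \<longrightarrow> norm (deriv g z) \<le> B" by blast
qed

lemma bhol_taylor:
  assumes g: "bhol g" and e: "\<epsilon> > 0"
  obtains C where "C \<ge> 0" "\<And>u v. Im u \<ge> \<epsilon> \<Longrightarrow> Im v \<ge> \<epsilon> \<Longrightarrow> norm (g v - (g u + deriv g u * (v - u))) \<le> C * norm (v - u) ^ 2"
proof -
  obtain B where B: "\<And>z. Im z \<ge> \<epsilon> \<Longrightarrow> norm (deriv (deriv g) z) \<le> B"
    using bhol_deriv[OF bhol_deriv[OF g]] e unfolding bhol_def by meson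
  have B0: "B \<ge> 0" using order_trans[OF norm_ge_zero B[of "Complex 0 \<epsilon>"]] by simp
  have D: "(h has_field_derivative deriv h x) (at x within {z. Im z \<ge> \<epsilon>})" if "bhol h" "Im x \<ge> \<epsilon>" for h x
    using holomorphic_derivI[of h upper_half_plane x] that e open_uhp by (auto simp: bhol_def in_uhp)
  define f where "f i = (if i = 0 then g else if i = 1 then deriv g else deriv (deriv g))" for i :: nat
  have conv: "convex {z. Im z \<ge> \<epsilon>}" by (rule convex_halfspace_Im_ge)
  have "norm (g v - (g u + deriv g u * (v - u))) \<le> B * norm (v - u) ^ 2" if "Im u \<ge> \<epsilon>" "Im v \<ge> \<epsilon>" for u v
  proof -
    have "norm (f 0 v - (\<Sum>i\<le>1. f i u * (v - u) ^ i / fact i)) \<le> B * norm (v - u) ^ Suc 1 / fact 1"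
    proof (rule complex_Taylor[OF conv])
      fix i :: nat and x assume x: "x \<in> {z. Im z \<ge> \<epsilon>}" "i \<le> 1"
      then have "i = 0 \<or> i = 1" by auto
      then show "(f i has_field_derivative f (Suc i) x) (at x within {z. Im z \<ge> \<epsilon>})"
        using D[OF g, of x] D[OF bhol_deriv[OF g], of x] x by (elim disjE) (simp_all add: f_def)
    next
      show "norm (f (Suc 1) x) \<le> B" if "x \<in> {z. Im z \<ge> \<epsilon>}" for x using B that by (simp add: f_def)
    qed (use that in simp_all)
    then show ?thesis by (simp add: f_def power2_eq_square)
  qed
  then show ?thesis using that B0 by blast
qed

lemma powr_taylor_1:
  assumes r: "r > 0"
  obtains C where "C \<ge> 0" "\<And>x::real. \<bar>x\<bar> \<le> 1/2 \<Longrightarrow> \<bar>(1 + x) powr (- r) - (1 - r * x)\<bar> \<le> C * x\<^sup>2"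
proof -
  define B where "B = r * (r + 1) * (1/2) powr (- r - 2)"
  define f where "f i w = (if i = 0 then w powr (- r) else if i = 1 then - r * w powr (- r - 1) else r * (r + 1) * w powr (- r - 2))" for i :: nat and w :: real
  have "\<bar>(1 + x) powr (- r) - (1 - r * x)\<bar> \<le> B * x\<^sup>2" if x: "\<bar>x\<bar> \<le> 1/2" for x :: real
  proof -
    have "norm (f 0 (1 + x) - (\<Sum>i\<le>1. f i 1 * (1 + x - 1) ^ i / fact i)) \<le> B * norm (1 + x - 1) ^ Suc 1 / fact 1"
    proof (rule field_Taylor[of "{1/2..}"])
      fix i :: nat and w :: real assume w: "w \<in> {1/2..}" "i \<le> 1"
      then have "i = 0 \<or> i = 1" "w > 0" by auto
      then show "(f i has_field_derivative f (Suc i) w) (at w within {1/2..})"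
        unfolding f_def by (elim disjE) (auto intro!: derivative_eq_intros simp: algebra_simps)
    next
      fix w :: real assume w: "w \<in> {1/2..}"
      then have "w powr (- r - 2) \<le> (1/2) powr (- r - 2)" using r by (intro powr_mono2') auto
      then show "norm (f (Suc 1) w) \<le> B" using r by (simp add: f_def B_def mult_left_mono)
    qed (use x in \<open>auto simp: abs_le_iff\<close>)
    then show ?thesis by (simp add: f_def power2_eq_square)
  qed
  moreover have "B \<ge> 0" using r by (simp add: B_def)
  ultimately show ?thesis using that by blast
qed

text \<open>Homogeneity in \<open>s\<close> reduces the estimate to increments
  \<open>x = d / s\<close> around 1.\<close>

lemma powr_taylor:
  assumes r: "r > 0"
  obtains C where "C \<ge> 0" "\<And>s d::real. s > 0 \<Longrightarrow> \<bar>d\<bar> \<le> s / 2 \<Longrightarrow>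
     \<bar>(s + d) powr (- r) - (s powr (- r) - r * s powr (- r - 1) * d)\<bar> \<le> C * s powr (- r - 2) * d\<^sup>2"
proof -
  obtain C where C: "C \<ge> 0" "\<And>x::real. \<bar>x\<bar> \<le> 1/2 \<Longrightarrow> \<bar>(1 + x) powr (- r) - (1 - r * x)\<bar> \<le> C * x\<^sup>2"
    using powr_taylor_1[OF r] by blast
  have "\<bar>(s + d) powr (- r) - (s powr (- r) - r * s powr (- r - 1) * d)\<bar> \<le> C * s powr (- r - 2) * d\<^sup>2"
    if s: "s > 0" and d: "\<bar>d\<bar> \<le> s / 2" for s d :: real
  proof -
    define x where "x = d / s"
    have x: "\<bar>x\<bar> \<le> 1/2" "d = s * x" using s d by (simp_all add: x_def divide_le_eq)
    have "(s + d) powr (- r) = s powr (- r) * (1 + x) powr (- r)"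
    proof -
      have "s + d = s * (1 + x)" by (simp add: x(2) algebra_simps)
      then show ?thesis using s x(1) by (simp add: powr_mult)
    qed
    moreover have "s powr (- r - 1) * s = s powr (- r)" "s powr (- r - 2) * s\<^sup>2 = s powr (- r)"
      using s by (simp_all add: powr_diff powr_numeral)
    then have "r * s powr (- r - 1) * d = s powr (- r) * (r * x)" "C * s powr (- r - 2) * d\<^sup>2 = s powr (- r) * (C * x\<^sup>2)"
      unfolding x(2) power_mult_distrib by (metis mult.assoc mult.commute)+
    moreover have "s powr (- r) * \<bar>(1 + x) powr (- r) - (1 - r * x)\<bar> \<le> s powr (- r) * (C * x\<^sup>2)"
      by (intro mult_left_mono C x(1)) simp
    moreover have "\<bar>s powr (- r) * (1 + x) powr (- r) - (s powr (- r) - s powr (- r) * (r * x))\<bar> =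
       s powr (- r) * \<bar>(1 + x) powr (- r) - (1 - r * x)\<bar>"
    proof -
      have "s powr (- r) * (1 + x) powr (- r) - (s powr (- r) - s powr (- r) * (r * x)) = s powr (- r) * ((1 + x) powr (- r) - (1 - r * x))"
        by (simp add: algebra_simps)
      then show ?thesis by (simp add: abs_mult)
    qed
    ultimately show ?thesis by (simp only:)
  qed
  then show ?thesis using that C(1) by blast
qed

text \<open>The ray is parametrised by the height \<open>v\<close> above \<open>- cnj z\<close>, so
  that -i(tau + z) is the positive real number 2 Im z + v. The exponent is variable because
  differentiation in z raises it by one, the function because inversion exchanges \<open>th4\<close>
  and \<open>th2\<close>.\<close>

definition Jint :: "(complex \<Rightarrow> complex) \<Rightarrow> real \<Rightarrow> complex \<Rightarrow> complex" where
  "Jint g r z = integral\<^sup>L hl (\<lambda>v. g (- cnj z + \<i> * of_real v) * of_real ((2 * Im z + v) powr (- r)))"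

lemma hl_powr:
  assumes s: "s > 0" and r: "r > 1"
  shows "integrable hl (\<lambda>v. (s + v) powr (- r))"
    and "integral\<^sup>L hl (\<lambda>v. (s + v) powr (- r)) = s powr (1 - r) / (r - 1)"
proof -
  have "((\<lambda>v. (s + v) powr (1 - r) / (1 - r)) \<longlongrightarrow> 0) at_top" using s r by real_asymp
  then have "has_bochner_integral hl (\<lambda>v. (s + v) powr (- r)) (0 - (s + 0) powr (1 - r) / (1 - r))"
  proof (intro hl_FTC_nonneg)
    fix v :: real assume v: "0 \<le> v"
    have "((\<lambda>v. (s + v) powr (1 - r)) has_real_derivative ((1 - r) * (s + v) powr (1 - r - of_nat 1) * 1)) (at v)"
      using s v by (intro DERIV_fun_powr) (auto intro!: derivative_eq_intros)
    from DERIV_cdivide[OF this, of "1 - r"] show "((\<lambda>v. (s + v) powr (1 - r) / (1 - r)) has_real_derivative (s + v) powr (- r)) (at v)"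
      using r by simp
  qed auto
  moreover have "- (x / (1 - r)) = x / (r - 1)" for x by (metis minus_diff_eq minus_divide_right)
  ultimately have "has_bochner_integral hl (\<lambda>v. (s + v) powr (- r)) (s powr (1 - r) / (r - 1))" by simp
  then show "integrable hl (\<lambda>v. (s + v) powr (- r))" "integral\<^sup>L hl (\<lambda>v. (s + v) powr (- r)) = s powr (1 - r) / (r - 1)"
    by (simp_all only: has_bochner_integral_iff)
qed

lemma hl_norm_integral_le:
  fixes f :: "real \<Rightarrow> complex"
  assumes "integrable hl f" "integrable hl g" "\<And>v. 0 \<le> v \<Longrightarrow> norm (f v) \<le> g v"
  shows "norm (integral\<^sup>L hl f) \<le> integral\<^sup>L hl g"
proof -
  have "norm (integral\<^sup>L hl f) \<le> integral\<^sup>L hl (\<lambda>v. norm (f v))" by (rule integral_norm_bound)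
  also have "\<dots> \<le> integral\<^sup>L hl g" using assms by (intro integral_mono) auto
  finally show ?thesis .
qed

lemma bhol_ray_measurable:
  assumes g: "bhol g" and z: "Im z > 0"
  shows "(\<lambda>v. g (- cnj z + \<i> * of_real v) * of_real ((2 * Im z + v) powr p)) \<in> borel_measurable hl"
proof (rule hl_measurable_continuous, rule continuous_on_mult)
  have "continuous_on upper_half_plane g" using g by (simp add: bhol_def holomorphic_on_imp_continuous_on)
  then show "continuous_on {0..} (\<lambda>v. g (- cnj z + \<i> * of_real v))"
    by (rule continuous_on_compose2) (use z in \<open>auto intro!: continuous_intros simp: in_uhp\<close>)
  show "continuous_on {0..} (\<lambda>v. complex_of_real ((2 * Im z + v) powr p))"
    using z by (intro continuous_intros) auto
qed

lemma Jint_integrable: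
  assumes g: "bhol g" and z: "Im z > 0" and r: "r > 1"
  shows "integrable hl (\<lambda>v. g (- cnj z + \<i> * of_real v) * of_real ((2 * Im z + v) powr (- r)))"
proof -
  obtain B where B: "\<And>w. Im w \<ge> Im z \<Longrightarrow> norm (g w) \<le> B" using g z unfolding bhol_def by meson
  show ?thesis
  proof (rule hl_integrable_bound)
    show "integrable hl (\<lambda>v. B * (2 * Im z + v) powr (- r))" using z r by (intro integrable_mult_right hl_powr) auto
    fix v :: real assume "0 \<le> v"
    then have "norm (g (- cnj z + \<i> * of_real v)) \<le> B" by (intro B) simp
    then show "norm (g (- cnj z + \<i> * of_real v) * of_real ((2 * Im z + v) powr (- r))) \<le> B * (2 * Im z + v) powr (- r)"
      unfolding norm_mult by (simp add: mult_right_mono)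
  qed (rule bhol_ray_measurable[OF g z])
qed

lemma Jint_bound:
  assumes "bhol g" and z: "Im z > 0" and B: "\<And>w. Im w \<ge> Im z \<Longrightarrow> norm (g w) \<le> B" and r: "r > 1"
  shows "norm (Jint g r z) \<le> B * integral\<^sup>L hl (\<lambda>v. (2 * Im z + v) powr (- r))"
proof -
  have "norm (Jint g r z) \<le> integral\<^sup>L hl (\<lambda>v. B * (2 * Im z + v) powr (- r))"
    unfolding Jint_def
  proof (rule hl_norm_integral_le)
    show "integrable hl (\<lambda>v. B * (2 * Im z + v) powr (- r))" using z r by (intro integrable_mult_right hl_powr) auto
    fix v :: real assume "0 \<le> v"
    then have "norm (g (- cnj z + \<i> * of_real v)) \<le> B" by (intro B) simp
    then show "norm (g (- cnj z + \<i> * of_real v) * of_real ((2 * Im z + v) powr (- r))) \<le> B * (2 * Im z + v) powr (- r)"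
      unfolding norm_mult by (simp add: mult_right_mono)
  qed (rule Jint_integrable[OF assms(1) z r])
  then show ?thesis by simp
qed

text \<open>\<open>A\<close> and \<open>B\<close> are the Wirtinger derivatives with respect to z
  and \<open>cnj z\<close>, expressed through real differentiability.\<close>

definition wirt :: "(complex \<Rightarrow> complex) \<Rightarrow> complex \<Rightarrow> complex \<Rightarrow> complex \<Rightarrow> bool" where
  "wirt f z A B \<longleftrightarrow> (f has_derivative (\<lambda>h. A * h + B * cnj h)) (at z)"

lemma wirt_quadratic:
  assumes "d > 0" "\<And>h. norm h \<le> d \<Longrightarrow> norm (f (z + h) - f z - (A * h + B * cnj h)) \<le> K * norm h ^ 2"
  shows "wirt f z A B"
  unfolding wirt_def has_derivative_at
proof
  show "bounded_linear (\<lambda>h. A * h + B * cnj h)"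
    by (intro bounded_linear_add bounded_linear_mult_right bounded_linear_compose[OF bounded_linear_mult_right bounded_linear_cnj])
  show "(\<lambda>h. norm (f (z + h) - f z - (A * h + B * cnj h)) / norm h) \<midarrow>0\<rightarrow> 0"
  proof (rule Lim_null_comparison)
    show "\<forall>\<^sub>F h in at 0. norm (norm (f (z + h) - f z - (A * h + B * cnj h)) / norm h) \<le> \<bar>K\<bar> * norm h"
      unfolding eventually_at
    proof (intro exI conjI ballI impI)
      fix h :: complex assume h: "h \<noteq> 0 \<and> dist h 0 < d"
      then have "norm (f (z + h) - f z - (A * h + B * cnj h)) \<le> K * norm h ^ 2" by (intro assms) simp
      also have "\<dots> \<le> \<bar>K\<bar> * norm h * norm h" by (simp add: power2_eq_square mult.assoc mult_right_mono)
      finally show "norm (norm (f (z + h) - f z - (A * h + B * cnj h)) / norm h) \<le> \<bar>K\<bar> * norm h"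
        using h by (simp add: divide_le_eq)
    qed (rule assms)
    show "((\<lambda>h. \<bar>K\<bar> * norm h) \<longlongrightarrow> 0) (at (0::complex))"
      by (intro tendsto_mult_right_zero tendsto_norm_zero tendsto_ident_at)
  qed
qed

text \<open>Differentiation under the integral with a quadratic error. The derivative of the
  integrand in \<open>cnj z\<close> is a total derivative in \<open>v\<close>, so its integral
  collapses to the boundary value at \<open>v = 0\<close>, the shadow; the derivative in z only
  meets the power.\<close>

lemma Jint_wirt:
  assumes g: "bhol g" and z: "Im z > 0" and r: "r > 1"
  shows "wirt (Jint g r) z (\<i> * of_real r * Jint g (r + 1) z) (- \<i> * g (- cnj z) * of_real ((2 * Im z) powr (- r)))"
proof -
  define y where "y = Im z"
  have y: "y > 0" using z by (simp add: y_def)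
  obtain B0 where B0: "\<And>w. Im w \<ge> y / 2 \<Longrightarrow> norm (g w) \<le> B0" using g y unfolding bhol_def by (meson half_gt_zero)
  obtain B1 where B1: "\<And>w. Im w \<ge> y / 2 \<Longrightarrow> norm (deriv g w) \<le> B1" using bhol_deriv[OF g] y unfolding bhol_def by (meson half_gt_zero)
  have Bnn: "B0 \<ge> 0" "B1 \<ge> 0" using order_trans[OF norm_ge_zero B0[of "Complex 0 y"]] order_trans[OF norm_ge_zero B1[of "Complex 0 y"]] y by simp_all
  obtain C where C: "C \<ge> 0" "\<And>u v. Im u \<ge> y / 2 \<Longrightarrow> Im v \<ge> y / 2 \<Longrightarrow> norm (g v - (g u + deriv g u * (v - u))) \<le> C * norm (v - u) ^ 2"
    using bhol_taylor[OF g, of "y / 2"] y by (metis half_gt_zero)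
  obtain P where P: "P \<ge> 0" "\<And>s d::real. s > 0 \<Longrightarrow> \<bar>d\<bar> \<le> s / 2 \<Longrightarrow>
     \<bar>(s + d) powr (- r) - (s powr (- r) - r * s powr (- r - 1) * d)\<bar> \<le> P * s powr (- r - 2) * d\<^sup>2"
    using powr_taylor[of r] r by auto
  define F where "F w v = g (- cnj w + \<i> * of_real v) * of_real ((2 * Im w + v) powr (- r))" for w v
  define u where "u v = - cnj z + \<i> * of_real v" for v
  define s where "s v = 2 * y + v" for v
  define Av where "Av v = \<i> * of_real r * (g (u v) * of_real (s v powr (- (r + 1))))" for v
  define Bv where "Bv v = - (deriv g (u v) * of_real (s v powr (- r))) - \<i> * of_real r * (g (u v) * of_real (s v powr (- (r + 1))))" for v
  have u: "Im (u v) = y + v" for v by (simp add: u_def y_def)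
  have spos: "s v \<ge> 2 * y" "s v > 0" if "v \<ge> 0" for v using that y by (simp_all add: s_def)
  have intA: "integrable hl Av" unfolding Av_def u_def s_def y_def
    using Jint_integrable[OF g z, of "r + 1"] r by (intro integrable_mult_right) simp
  have intD: "integrable hl (\<lambda>v. deriv g (u v) * of_real (s v powr (- r)))"
    unfolding u_def s_def y_def by (rule Jint_integrable[OF bhol_deriv[OF g] z r])
  have intB: "integrable hl Bv" unfolding Bv_def
    using intD intA unfolding Av_def by (intro Bochner_Integration.integrable_diff Bochner_Integration.integrable_minus) auto
  have IA: "integral\<^sup>L hl Av = \<i> * of_real r * Jint g (r + 1) z"
    unfolding Av_def Jint_def u_def s_def y_def by simp
  \<comment> \<open>\<open>Bv\<close> is the derivative in \<open>v\<close> of \<open>\<i>\<close>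
    g(u v) s(v)^(-r), which tends to 0 at infinity because \<open>g\<close> is bounded along the
    ray.\<close>
  have IB: "integral\<^sup>L hl Bv = - \<i> * g (- cnj z) * of_real ((2 * Im z) powr (- r))"
  proof -
    have "has_bochner_integral hl Bv (0 - \<i> * (g (u 0) * of_real (s 0 powr (- r))))"
    proof (rule hl_FTC[OF _ intB])
      fix v :: real assume v: "0 \<le> v"
      have "u v \<in> upper_half_plane" using u[of v] v y by (simp add: in_uhp)
      then have "(g has_field_derivative deriv g (u v)) (at (u v))"
        using g open_uhp by (intro holomorphic_derivI) (auto simp: bhol_def)
      moreover have "(u has_vector_derivative \<i>) (at v)"
        unfolding u_def by (auto intro!: derivative_eq_intros)
      ultimately have 1: "((\<lambda>v. g (u v)) has_vector_derivative \<i> * deriv g (u v)) (at v)"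
        using field_vector_diff_chain_at[of u \<i> v g "deriv g (u v)"] by (simp add: o_def)
      have "((\<lambda>v. s v powr (- r)) has_real_derivative (- r * s v powr (- (r + 1)))) (at v)"
      proof -
        have "((\<lambda>v. s v powr (- r)) has_real_derivative (- r * s v powr (- r - of_nat 1) * 1)) (at v)"
          by (rule DERIV_fun_powr) (use spos[OF v] in \<open>auto intro!: derivative_eq_intros simp: s_def\<close>)
        moreover have "- r - of_nat 1 = - (r + 1)" by simp
        ultimately show ?thesis by (simp only: mult_1_right)
      qed
      then have 2: "((\<lambda>v. complex_of_real (s v powr (- r))) has_vector_derivative of_real (- r * s v powr (- (r + 1)))) (at v)"
        by (intro has_vector_derivative_of_real) (simp add: has_real_derivative_iff_has_vector_derivative)
      have "((\<lambda>v. \<i> * (g (u v) * of_real (s v powr (- r)))) has_vector_derivative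
         \<i> * (g (u v) * of_real (- r * s v powr (- (r + 1))) + \<i> * deriv g (u v) * of_real (s v powr (- r)))) (at v)"
        by (intro has_vector_derivative_mult_right has_vector_derivative_mult 1 2)
      moreover have "\<i> * (g (u v) * of_real (- r * s v powr (- (r + 1))) + \<i> * deriv g (u v) * of_real (s v powr (- r))) = Bv v"
        by (simp add: Bv_def algebra_simps)
      ultimately show "((\<lambda>v. \<i> * (g (u v) * of_real (s v powr (- r)))) has_vector_derivative Bv v) (at v)" by simp
    next
      show "((\<lambda>v. \<i> * (g (u v) * of_real (s v powr (- r)))) \<longlongrightarrow> 0) at_top"
      proof (rule Lim_null_comparison)
        show "\<forall>\<^sub>F v in at_top. norm (\<i> * (g (u v) * of_real (s v powr (- r)))) \<le> B0 * s v powr (- r)"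
          using eventually_ge_at_top[of 0]
        proof eventually_elim
          fix v :: real assume "0 \<le> v"
          then have "norm (g (u v)) \<le> B0" using u[of v] y by (intro B0) simp
          then show "norm (\<i> * (g (u v) * of_real (s v powr (- r)))) \<le> B0 * s v powr (- r)"
            by (simp add: norm_mult mult_right_mono)
        qed
        show "((\<lambda>v. B0 * s v powr (- r)) \<longlongrightarrow> 0) at_top" unfolding s_def using r by real_asymp
      qed
    qed
    then show ?thesis using has_bochner_integral_integral_eq by (fastforce simp: u_def s_def y_def)
  qed
  \<comment> \<open>One term for each error in the increment of a product: second order in
    \<open>g\<close>, second order in the power, and the product of the two first order
    increments.\<close>
  define L where "L = C * 2 powr r + 4 * B0 * P / (2 * y)\<^sup>2 + 2 * B1 * (r / (2 * y) + P / (2 * y))"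
  define K where "K = L * integral\<^sup>L hl (\<lambda>v. s v powr (- r))"
  have ints: "integrable hl (\<lambda>v. s v powr (- r))" unfolding s_def using y r by (intro hl_powr) auto
  have pt: "norm (F (z + h) v - F z v - (Av v * h + Bv v * cnj h)) \<le> L * norm h ^ 2 * s v powr (- r)"
    if h: "norm h \<le> y / 2" and v: "v \<ge> 0" for h v
  proof -
    define d where "d = 2 * Im h"
    define \<delta> where "\<delta> = - cnj h"
    define p where "p t = complex_of_real (t powr (- r))" for t
    define p1 where "p1 = complex_of_real (- r * s v powr (- r - 1))"
    have hI: "\<bar>Im h\<bar> \<le> y / 2" using abs_Im_le_cmod[of h] h by linarith
    have sv: "s v > 0" "s v \<ge> 2 * y" using spos[OF v] by auto
    have dle: "\<bar>d\<bar> \<le> s v / 2" "\<bar>d\<bar> \<le> 2 * norm h" using hI sv abs_Im_le_cmod[of h] unfolding d_def by simp_all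
    have Fh: "F (z + h) v = g (u v + \<delta>) * p (s v + d)" "F z v = g (u v) * p (s v)"
      by (simp_all add: F_def u_def s_def p_def d_def \<delta>_def y_def algebra_simps)
    have e1: "- (r + 1) = - r - 1" by simp
    \<comment> \<open>The real increment 2 Im h equals \<open>- \<i> * (h - cnj h)\<close>, which
      distributes it over the two Wirtinger directions.\<close>
    have lin: "Av v * h + Bv v * cnj h = deriv g (u v) * \<delta> * p (s v) + g (u v) * (p1 * of_real d)"
    proof -
      have od: "complex_of_real d = - \<i> * (h - cnj h)" by (simp add: d_def complex_eq_iff)
      show ?thesis unfolding Av_def Bv_def p_def p1_def \<delta>_def e1 od by (simp add: algebra_simps)
    qed
    have dec: "F (z + h) v - F z v - (Av v * h + Bv v * cnj h) =
      (g (u v + \<delta>) - (g (u v) + deriv g (u v) * \<delta>)) * p (s v + d) + g (u v) * (p (s v + d) - (p (s v) + p1 * of_real d))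
      + deriv g (u v) * \<delta> * (p (s v + d) - p (s v))"
      unfolding Fh lin by (simp add: algebra_simps)
    have \<delta>: "norm \<delta> = norm h" by (simp add: \<delta>_def)
    have t1: "norm (g (u v + \<delta>) - (g (u v) + deriv g (u v) * \<delta>)) \<le> C * norm h ^ 2"
      using C(2)[of "u v" "u v + \<delta>"] u[of v] v y hI \<delta> by (simp add: \<delta>_def)
    have p_le: "norm (p (s v + d)) \<le> 2 powr r * s v powr (- r)"
    proof -
      have "(s v + d) powr (- r) \<le> (s v / 2) powr (- r)" using dle sv r by (intro powr_mono2') (auto simp: abs_le_iff)
      also have "\<dots> = 2 powr r * s v powr (- r)" using sv by (simp add: powr_divide powr_minus_divide)
      finally show ?thesis by (simp add: p_def)
    qed
    have s2: "s v powr (- r - 2) \<le> s v powr (- r) / (2 * y)\<^sup>2" "s v powr (- r - 1) \<le> s v powr (- r) / (2 * y)"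
    proof -
      have "s v powr (- r - 2) = s v powr (- r) / (s v)\<^sup>2" "s v powr (- r - 1) = s v powr (- r) / s v"
        using sv by (simp_all add: powr_diff powr_numeral)
      moreover have "(2 * y)\<^sup>2 \<le> (s v)\<^sup>2" "0 < (2 * y)\<^sup>2" using power_mono[OF sv(2), of 2] y by simp_all
      ultimately show "s v powr (- r - 2) \<le> s v powr (- r) / (2 * y)\<^sup>2" "s v powr (- r - 1) \<le> s v powr (- r) / (2 * y)"
        using sv y by (auto intro!: divide_left_mono mult_pos_pos simp del: power_mult_distrib)
    qed
    have ptay: "norm (p (s v + d) - (p (s v) + p1 * of_real d)) \<le> P * s v powr (- r - 2) * d\<^sup>2"
    proof -
      have "p (s v + d) - (p (s v) + p1 * of_real d) = of_real ((s v + d) powr (- r) - (s v powr (- r) - r * s v powr (- r - 1) * d))"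
        by (simp add: p_def p1_def)
      then show ?thesis using P(2)[OF sv(1) dle(1)] by (simp only: norm_of_real)
    qed
    have d2: "d\<^sup>2 \<le> 4 * norm h ^ 2"
      using power_mono[OF dle(2), of 2] by (simp add: power_mult_distrib)
    have t2: "norm (p (s v + d) - (p (s v) + p1 * of_real d)) \<le> 4 * P / (2 * y)\<^sup>2 * norm h ^ 2 * s v powr (- r)"
    proof -
      have "P * s v powr (- r - 2) * d\<^sup>2 \<le> P * (s v powr (- r) / (2 * y)\<^sup>2) * (4 * norm h ^ 2)"
        using P(1) s2 d2 by (intro mult_mono mult_left_mono) auto
      then show ?thesis using ptay by (simp add: mult_ac)
    qed
    have t3: "norm (p (s v + d) - p (s v)) \<le> (r / (2 * y) + P / (2 * y)) * (2 * norm h) * s v powr (- r)"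
    proof -
      have "norm (p (s v + d) - p (s v)) \<le> norm (p (s v + d) - (p (s v) + p1 * of_real d)) + norm (p1 * of_real d)"
        using norm_triangle_ineq[of "p (s v + d) - (p (s v) + p1 * of_real d)" "p1 * of_real d"] by simp
      also have "norm (p1 * of_real d) = r * s v powr (- r - 1) * \<bar>d\<bar>" using r by (simp add: p1_def norm_mult abs_mult)
      also have "P * s v powr (- r - 2) * d\<^sup>2 \<le> P * s v powr (- r - 1) * \<bar>d\<bar>"
      proof -
        have "s v powr (- r - 2) * s v = s v powr (- r - 1)" 
        proof -
          have "- r - 2 + 1 = - r - 1" by simp
          then show ?thesis using sv powr_add[of "s v" "- r - 2" 1] by (simp only: powr_one)
        qed
        then have "s v powr (- r - 2) * \<bar>d\<bar> \<le> s v powr (- r - 1)"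
          using dle(1) sv mult_left_mono[of "\<bar>d\<bar>" "s v" "s v powr (- r - 2)"] by simp
        then have "P * (s v powr (- r - 2) * \<bar>d\<bar>) * \<bar>d\<bar> \<le> P * s v powr (- r - 1) * \<bar>d\<bar>"
          using P(1) by (intro mult_right_mono mult_left_mono) auto
        then show ?thesis by (simp add: power2_eq_square mult.assoc)
      qed
      then have "norm (p (s v + d) - (p (s v) + p1 * of_real d)) + r * s v powr (- r - 1) * \<bar>d\<bar> \<le> (r + P) * s v powr (- r - 1) * \<bar>d\<bar>"
        using ptay by (simp add: distrib_right)
      also have "\<dots> \<le> (r + P) * (s v powr (- r) / (2 * y)) * (2 * norm h)"
        using P(1) r s2 dle y by (intro mult_mono mult_left_mono) auto
      also have "\<dots> = (r / (2 * y) + P / (2 * y)) * (2 * norm h) * s v powr (- r)" by (simp add: add_divide_distrib[symmetric])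
      finally show ?thesis by simp
    qed
    have gu: "norm (g (u v)) \<le> B0" "norm (deriv g (u v)) \<le> B1" using u[of v] v y by (intro B0 B1; simp)+
    have "norm (F (z + h) v - F z v - (Av v * h + Bv v * cnj h)) \<le>
       norm (g (u v + \<delta>) - (g (u v) + deriv g (u v) * \<delta>)) * norm (p (s v + d)) +
       norm (g (u v)) * norm (p (s v + d) - (p (s v) + p1 * of_real d)) + norm (deriv g (u v)) * norm h * norm (p (s v + d) - p (s v))"
      unfolding dec by (intro norm_triangle_le add_mono) (simp_all add: norm_mult \<delta>)
    also have "\<dots> \<le> C * norm h ^ 2 * (2 powr r * s v powr (- r)) + B0 * (4 * P / (2 * y)\<^sup>2 * norm h ^ 2 * s v powr (- r)) +
       B1 * norm h * ((r / (2 * y) + P / (2 * y)) * (2 * norm h) * s v powr (- r))"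
      using t1 t2 t3 p_le gu Bnn C(1) by (intro add_mono mult_mono mult_right_mono) auto
    also have "\<dots> = L * norm h ^ 2 * s v powr (- r)" unfolding L_def by (simp add: power2_eq_square algebra_simps)
    finally show ?thesis .
  qed
  have "wirt (Jint g r) z (integral\<^sup>L hl Av) (integral\<^sup>L hl Bv)"
  proof (rule wirt_quadratic)
    show "y / 2 > 0" using y by simp
    fix h :: complex assume h: "norm h \<le> y / 2"
    have "Im (z + h) > 0" using abs_Im_le_cmod[of h] h y by (simp add: y_def abs_le_iff)
    then have i1: "integrable hl (F (z + h))" unfolding F_def by (rule Jint_integrable[OF g _ r])
    have i2: "integrable hl (F z)" unfolding F_def by (rule Jint_integrable[OF g z r])
    have "Jint g r (z + h) - Jint g r z - (integral\<^sup>L hl Av * h + integral\<^sup>L hl Bv * cnj h) =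
       integral\<^sup>L hl (\<lambda>v. F (z + h) v - F z v - (Av v * h + Bv v * cnj h))"
    proof -
      have "Jint g r w = integral\<^sup>L hl (F w)" for w by (simp add: Jint_def F_def[abs_def])
      then show ?thesis using i1 i2 intA intB by simp
    qed
    also have "norm \<dots> \<le> integral\<^sup>L hl (\<lambda>v. L * norm h ^ 2 * s v powr (- r))"
    proof (rule hl_norm_integral_le)
      show "integrable hl (\<lambda>v. F (z + h) v - F z v - (Av v * h + Bv v * cnj h))"
        using i1 i2 intA intB by simp
      show "integrable hl (\<lambda>v. L * norm h ^ 2 * s v powr (- r))" by (intro integrable_mult_right ints)
    qed (use pt[OF h] in simp)
    also have "\<dots> = K * norm h ^ 2" by (simp add: K_def)
    finally show "norm (Jint g r (z + h) - Jint g r z - (integral\<^sup>L hl Av * h + integral\<^sup>L hl Bv * cnj h)) \<le> K * norm h ^ 2" .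
  qed
  then show ?thesis unfolding IA IB .
qed

section \<open>Wirtinger calculus, smoothness and the Laplacian\<close>

lemma wirt_add: "wirt f z A B \<Longrightarrow> wirt g z A' B' \<Longrightarrow> wirt (\<lambda>w. f w + g w) z (A + A') (B + B')"
  unfolding wirt_def using has_derivative_add[of f "\<lambda>h. A * h + B * cnj h" "at z" g "\<lambda>h. A' * h + B' * cnj h"]
  by (simp add: algebra_simps)

lemma wirt_cmult: "wirt f z A B \<Longrightarrow> wirt (\<lambda>w. c * f w) z (c * A) (c * B)"
  unfolding wirt_def using has_derivative_mult_right[of f "\<lambda>h. A * h + B * cnj h" "at z" c]
  by (simp add: algebra_simps)

lemma wirt_mult:
  assumes "wirt f z A B" "wirt g z A' B'"
  shows "wirt (\<lambda>w. f w * g w) z (f z * A' + A * g z) (f z * B' + B * g z)"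
  using has_derivative_mult[OF assms[unfolded wirt_def]] unfolding wirt_def by (simp add: algebra_simps)

lemma wirt_field: "(f has_field_derivative D) (at z) \<Longrightarrow> wirt f z D 0"
  by (simp add: wirt_def has_field_derivative_def)

lemma wirt_holomorphic: "f holomorphic_on upper_half_plane \<Longrightarrow> Im z > 0 \<Longrightarrow> wirt f z (deriv f z) 0"
  by (intro wirt_field holomorphic_derivI[OF _ open_uhp]) (auto simp: in_uhp)

lemma wirt_transform:
  assumes "wirt f z A B" "open S" "z \<in> S" "\<And>w. w \<in> S \<Longrightarrow> f w = g w"
  shows "wirt g z A B"
  using has_derivative_transform_within_open[OF assms(1)[unfolded wirt_def] assms(2,3,4)] by (simp add: wirt_def)

lemma wirt_compose:
  assumes "wirt f (m z) A B" "(m has_field_derivative D) (at z)"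
  shows "wirt (\<lambda>w. f (m w)) z (A * D) (B * cnj D)"
  using has_derivative_compose[OF assms(2)[unfolded has_field_derivative_def] assms(1)[unfolded wirt_def]]
  by (simp add: wirt_def mult_ac)

lemma wirt_anti:
  assumes "(h has_field_derivative D) (at (- cnj z))"
  shows "wirt (\<lambda>w. h (- cnj w)) z 0 (- D)"
proof -
  have "((\<lambda>w. - cnj w) has_derivative (\<lambda>h. - cnj h)) (at z)"
    by (intro has_derivative_minus bounded_linear_imp_has_derivative bounded_linear_cnj)
  from has_derivative_compose[OF this assms[unfolded has_field_derivative_def]]
  show ?thesis by (simp add: wirt_def)
qed

lemma wirt_Im_powr:
  assumes z: "Im z > 0"
  shows "wirt (\<lambda>w. of_real ((2 * Im w) powr s)) z (- \<i> * of_real (s * (2 * Im z) powr (s - 1))) (\<i> * of_real (s * (2 * Im z) powr (s - 1)))"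
proof -
  have "((\<lambda>w. 2 * Im w) has_derivative (\<lambda>h. 2 * Im h)) (at z)"
    by (intro has_derivative_mult_right bounded_linear_imp_has_derivative bounded_linear_Im)
  moreover have "((\<lambda>t. t powr s) has_derivative (\<lambda>h. h * (s * (2 * Im z) powr (s - 1)))) (at (2 * Im z))"
    using has_real_derivative_powr[of "2 * Im z" s] z by (simp add: has_field_derivative_def mult.commute[of _ "s * _"])
  ultimately have "((\<lambda>w. (2 * Im w) powr s) has_derivative (\<lambda>h. 2 * Im h * (s * (2 * Im z) powr (s - 1)))) (at z)"
    by (rule has_derivative_compose)
  then have "((\<lambda>w. complex_of_real ((2 * Im w) powr s)) has_derivative (\<lambda>h. of_real (2 * Im h * (s * (2 * Im z) powr (s - 1))))) (at z)"
    by (rule has_derivative_of_real)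
  moreover have "complex_of_real (2 * Im h * c) = - \<i> * of_real c * h + \<i> * of_real c * cnj h" for h c
    by (simp add: complex_eq_iff)
  ultimately show ?thesis by (simp only: wirt_def)
qed

lemma wirt_dx: "wirt f z A B \<Longrightarrow> dx f z = A + B"
proof -
  assume "wirt f z A B"
  then have f: "(f has_derivative (\<lambda>h. A * h + B * cnj h)) (at (z + of_real 0))" by (simp add: wirt_def)
  have "((\<lambda>t::real. z + of_real t) has_derivative (\<lambda>t. of_real t)) (at 0)"
    by (auto intro!: derivative_eq_intros)
  from has_derivative_compose[OF this f] have "((\<lambda>t::real. f (z + of_real t)) has_derivative (\<lambda>t. t *\<^sub>R (A + B))) (at 0)"
    by (simp add: scaleR_conv_of_real algebra_simps)
  then show ?thesis unfolding dx_def by (intro vector_derivative_at) (simp add: has_vector_derivative_def)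
qed

lemma wirt_dy: "wirt f z A B \<Longrightarrow> dy f z = \<i> * (A - B)"
proof -
  assume "wirt f z A B"
  then have f: "(f has_derivative (\<lambda>h. A * h + B * cnj h)) (at (z + \<i> * of_real 0))" by (simp add: wirt_def)
  have "((\<lambda>t::real. z + \<i> * of_real t) has_derivative (\<lambda>t. \<i> * of_real t)) (at 0)"
    by (auto intro!: derivative_eq_intros)
  from has_derivative_compose[OF this f] have "((\<lambda>t::real. f (z + \<i> * of_real t)) has_derivative (\<lambda>t. t *\<^sub>R (\<i> * (A - B)))) (at 0)"
    by (simp add: scaleR_conv_of_real algebra_simps)
  then show ?thesis unfolding dy_def by (intro vector_derivative_at) (simp add: has_vector_derivative_def)
qed

text \<open>Differentiating \<open>Jint\<close> in z raises its exponent, and differentiating in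
  \<open>cnj z\<close> yields boundary terms; \<open>anti\<close> is the shape of those terms and of
  their own derivatives.\<close>

inductive maass_class :: "(complex \<Rightarrow> complex) \<Rightarrow> (complex \<Rightarrow> complex) \<Rightarrow> bool" for g where
  hol: "f holomorphic_on upper_half_plane \<Longrightarrow> maass_class g f"
| Jint: "r > 1 \<Longrightarrow> maass_class g (Jint g r)"
| anti: "h holomorphic_on upper_half_plane \<Longrightarrow> maass_class g (\<lambda>z. h (- cnj z) * of_real ((2 * Im z) powr s))"
| add: "maass_class g f \<Longrightarrow> maass_class g f' \<Longrightarrow> maass_class g (\<lambda>z. f z + f' z)"
| cmult: "maass_class g f \<Longrightarrow> maass_class g (\<lambda>z. c * f z)"

text \<open>The class is closed under both Wirtinger derivatives, hence consists of smooth functions.\<close>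

lemma maass_class_wirt:
  assumes g: "bhol g" and f: "maass_class g f"
  shows "\<exists>A B. maass_class g A \<and> maass_class g B \<and> (\<forall>z. Im z > 0 \<longrightarrow> wirt f z (A z) (B z))"
  using f
proof induction
  case (hol f)
  have "maass_class g (deriv f)" "maass_class g (\<lambda>_. 0)"
    by (intro maass_class.hol holomorphic_deriv[OF hol open_uhp] holomorphic_intros)+
  then show ?case using wirt_holomorphic[OF hol] by blast
next
  case (Jint r)
  have "maass_class g (\<lambda>z. (\<i> * of_real r) * Jint g (r + 1) z)"
    using Jint by (intro maass_class.cmult maass_class.Jint) simp
  moreover have "maass_class g (\<lambda>z. (- \<i>) * (g (- cnj z) * of_real ((2 * Im z) powr (- r))))"
    using g by (intro maass_class.cmult maass_class.anti) (simp add: bhol_def)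
  moreover have "wirt (Jint g r) z ((\<i> * of_real r) * Jint g (r + 1) z) ((- \<i>) * (g (- cnj z) * of_real ((2 * Im z) powr (- r))))" if "Im z > 0" for z
    using Jint_wirt[OF g that Jint] by (simp add: mult.assoc)
  ultimately show ?case by blast
next
  case (anti h s)
  let ?A = "\<lambda>z. (- \<i> * of_real s) * (h (- cnj z) * of_real ((2 * Im z) powr (s - 1)))"
  let ?B = "\<lambda>z. (\<i> * of_real s) * (h (- cnj z) * of_real ((2 * Im z) powr (s - 1))) + (- 1) * (deriv h (- cnj z) * of_real ((2 * Im z) powr s))"
  have "maass_class g ?A" "maass_class g ?B"
    by (intro maass_class.add maass_class.cmult maass_class.anti anti holomorphic_deriv[OF anti open_uhp])+
  moreover have "wirt (\<lambda>z. h (- cnj z) * of_real ((2 * Im z) powr s)) z (?A z) (?B z)" if z: "Im z > 0" for z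
  proof -
    have "(h has_field_derivative deriv h (- cnj z)) (at (- cnj z))"
      using z by (intro holomorphic_derivI[OF anti open_uhp]) (simp add: in_uhp)
    from wirt_mult[OF wirt_anti[OF this] wirt_Im_powr[OF z, of s]] show ?thesis by (simp add: algebra_simps)
  qed
  ultimately show ?case by blast
next
  case (add f f')
  then obtain A B A' B' where "maass_class g A" "maass_class g B" "\<And>z. Im z > 0 \<Longrightarrow> wirt f z (A z) (B z)"
    "maass_class g A'" "maass_class g B'" "\<And>z. Im z > 0 \<Longrightarrow> wirt f' z (A' z) (B' z)" by blast
  then show ?case
    by (intro exI[of _ "\<lambda>z. A z + A' z"] exI[of _ "\<lambda>z. B z + B' z"]) (auto intro: maass_class.add wirt_add)
next
  case (cmult f c)
  then obtain A B where "maass_class g A" "maass_class g B" "\<And>z. Im z > 0 \<Longrightarrow> wirt f z (A z) (B z)" by blast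
  then show ?case
    by (intro exI[of _ "\<lambda>z. c * A z"] exI[of _ "\<lambda>z. c * B z"]) (auto intro: maass_class.cmult wirt_cmult)
qed

text \<open>\<open>f\<close> is known only on the half plane, whereas \<open>pdiff\<close> acts on
  functions on all of the plane; openness transfers the derivatives, and closure of the class under
  \<open>dx\<close> and \<open>dy\<close> carries the induction on the list.\<close>

lemma maass_class_smooth:
  assumes g: "bhol g" and f': "maass_class g f'" and eq: "\<And>z. Im z > 0 \<Longrightarrow> f z = f' z"
  shows "smooth_on upper_half_plane f"
proof -
  have main: "\<exists>F. maass_class g F \<and> (\<forall>z\<in>upper_half_plane. pdiff bs f z = F z)" for bs
  proof (induction bs)
    case Nil
    show ?case using f' eq by (intro exI[of _ f']) (simp add: in_uhp)
  next
    case (Cons b bs)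
    then obtain F where F: "maass_class g F" "\<And>z. z \<in> upper_half_plane \<Longrightarrow> pdiff bs f z = F z" by blast
    obtain A B where AB: "maass_class g A" "maass_class g B" "\<And>z. Im z > 0 \<Longrightarrow> wirt F z (A z) (B z)"
      using maass_class_wirt[OF g F(1)] by blast
    have w: "wirt (pdiff bs f) z (A z) (B z)" if "z \<in> upper_half_plane" for z
      by (rule wirt_transform[OF AB(3) open_uhp that]) (use that F(2) in \<open>simp_all add: in_uhp\<close>)
    show ?case
    proof (cases b)
      case True
      then show ?thesis using maass_class.add[OF AB(1,2)] wirt_dx[OF w] by (intro exI[of _ "\<lambda>z. A z + B z"]) simp
    next
      case False
      have "maass_class g (\<lambda>z. \<i> * (A z + (- 1) * B z))" by (intro maass_class.add maass_class.cmult AB(1,2))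
      then show ?thesis using False wirt_dy[OF w] by (intro exI[of _ "\<lambda>z. \<i> * (A z + (- 1) * B z)"]) simp
    qed
  qed
  show ?thesis unfolding smooth_on_def
  proof (intro allI ballI)
    fix bs z assume z: "z \<in> upper_half_plane"
    obtain F where F: "maass_class g F" "\<And>z. z \<in> upper_half_plane \<Longrightarrow> pdiff bs f z = F z" using main by blast
    obtain A B where AB: "\<And>z. Im z > 0 \<Longrightarrow> wirt F z (A z) (B z)"
      using maass_class_wirt[OF g F(1)] by blast
    have "wirt (pdiff bs f) z (A z) (B z)"
      by (rule wirt_transform[OF AB open_uhp z]) (use z F(2) in \<open>simp_all add: in_uhp\<close>)
    then show "pdiff bs f differentiable (at z)" unfolding wirt_def differentiable_def by blast
  qed
qed

text \<open>In Wirtinger form the Laplacian is -4 y^2 times the mixed derivative plus 2iky times the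
  derivative in \<open>cnj z\<close>. The latter is antiholomorphic times y^(-3/2), and since this
  exponent matches the weight the two terms cancel.\<close>

lemma laplacian_Jint:
  assumes g: "bhol g" and o: "F holomorphic_on upper_half_plane" and z: "Im z > 0"
    and eq: "\<And>w. Im w > 0 \<Longrightarrow> f w = F w + c * Jint g (3/2) w"
  shows "hyp_laplacian (3/2) f z = 0"
proof -
  define p where "p s w = complex_of_real ((2 * Im w) powr s)" for s w
  define A where "A w = deriv F w + c * (\<i> * of_real (3/2) * Jint g (5/2) w)" for w
  define B where "B w = c * (- \<i> * g (- cnj w) * p (- 3/2) w)" for w
  have f: "wirt f w (A w) (B w)" if "Im w > 0" for w
  proof -
    have "wirt (\<lambda>w. F w + c * Jint g (3/2) w) w (deriv F w + c * (\<i> * of_real (3/2) * Jint g (3/2 + 1) w)) (0 + c * (- \<i> * g (- cnj w) * of_real ((2 * Im w) powr (- (3/2)))))"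
      by (intro wirt_add wirt_cmult wirt_holomorphic[OF o that] Jint_wirt[OF g that]) simp
    then have "wirt (\<lambda>w. F w + c * Jint g (3/2) w) w (A w) (B w)" by (simp add: A_def B_def p_def)
    then show ?thesis by (rule wirt_transform[OF _ open_uhp]) (use that eq in \<open>simp_all add: in_uhp\<close>)
  qed
  \<comment> \<open>The mixed derivative, found below both from \<open>A\<close> and from
    \<open>B\<close>.\<close>
  define L where "L = c * (of_real (3/2) * g (- cnj z) * p (- 5/2) z)"
  define A1 where "A1 = deriv (deriv F) z + c * (\<i> * of_real (3/2) * (\<i> * of_real (5/2) * Jint g (5/2 + 1) z))"
  define B1 where "B1 = c * (- \<i> * (g (- cnj z) * (\<i> * of_real ((- 3/2) * (2 * Im z) powr (- 3/2 - 1))) + (- deriv g (- cnj z)) * p (- 3/2) z))"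
  have wA: "wirt A z A1 L"
  proof -
    have "wirt A z (deriv (deriv F) z + c * (\<i> * of_real (3/2) * (\<i> * of_real (5/2) * Jint g (5/2 + 1) z)))
       (0 + c * (\<i> * of_real (3/2) * (- \<i> * g (- cnj z) * of_real ((2 * Im z) powr (- (5/2))))))"
      unfolding A_def by (intro wirt_add wirt_cmult wirt_holomorphic[OF holomorphic_deriv[OF o open_uhp] z] Jint_wirt[OF g z]) simp
    moreover have "0 + c * (\<i> * of_real (3/2) * (- \<i> * g (- cnj z) * of_real ((2 * Im z) powr (- (5/2))))) = L"
      by (simp add: L_def p_def algebra_simps)
    ultimately show ?thesis by (simp only: A1_def)
  qed
  have wB: "wirt B z L B1"
  proof -
    have "(g has_field_derivative deriv g (- cnj z)) (at (- cnj z))"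
      using z g by (intro holomorphic_derivI[OF _ open_uhp]) (auto simp: in_uhp bhol_def)
    note W = wirt_cmult[OF wirt_cmult[OF wirt_mult[OF wirt_anti[OF this] wirt_Im_powr[OF z, of "- 3/2"]], of "- \<i>"], of c]
    have "c * (- \<i> * (g (- cnj z) * (- \<i> * of_real (- 3 / 2 * (2 * Im z) powr (- 3 / 2 - 1))) + 0 * of_real ((2 * Im z) powr (- 3 / 2)))) = L"
      by (simp add: L_def p_def algebra_simps)
    then show ?thesis using W unfolding B_def[abs_def] p_def B1_def by (simp only: mult.assoc)
  qed
  have 1: "wirt (dx f) z (A1 + L) (L + B1)"
    by (rule wirt_transform[OF wirt_add[OF wA wB] open_uhp]) (use z in \<open>auto simp: in_uhp wirt_dx[OF f]\<close>)
  have 2: "wirt (dy f) z (\<i> * (A1 + (- 1) * L)) (\<i> * (L + (- 1) * B1))"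
    by (rule wirt_transform[OF wirt_cmult[OF wirt_add[OF wA wirt_cmult[OF wB, of "- 1"]]] open_uhp]) (use z in \<open>auto simp: in_uhp wirt_dy[OF f]\<close>)
  have p: "p (- 3/2) z = of_real (2 * Im z) * p (- 5/2) z"
  proof -
    have "(2 * Im z) powr (- 3/2) = (2 * Im z) powr 1 * (2 * Im z) powr (- 5/2)" using powr_add[of "2 * Im z" 1 "- 5/2"] by simp
    then show ?thesis using z by (simp add: p_def)
  qed
  have s: "dx (dx f) z + dy (dy f) z = 4 * L" unfolding wirt_dx[OF 1] wirt_dy[OF 2] by (simp add: algebra_simps)
  have t: "dx f z + \<i> * dy f z = 2 * B z" unfolding wirt_dx[OF f[OF z]] wirt_dy[OF f[OF z]] by (simp add: algebra_simps)
  show ?thesis unfolding hyp_laplacian_def s t unfolding L_def B_def p by (simp add: power2_eq_square algebra_simps)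
qed

section \<open>The inversion formula\<close>

lemma nome_qexp: "Im z > 0 \<Longrightarrow> nome (qexp z)"
  by unfold_locales (rule norm_qexp_less_1)

text \<open>Nonvanishing is visible on the product side only.\<close>

lemma th4_product:
  assumes z: "Im z > 0"
  shows "th4 z = nome.Pinf (qexp z) / nome.Ninf (qexp z)" "th4 z \<noteq> 0"
proof -
  interpret nome "qexp z" using z by (rule nome_qexp)
  have "(\<Sum>n. (-1) ^ Suc n * qexp z ^ ((Suc n)\<^sup>2)) = (Pinf / Ninf - 1) / 2" using gauss_sums by (simp only: sums_iff)
  then show *: "th4 z = Pinf / Ninf" unfolding th4_def by (simp only:) (simp add: diff_divide_distrib)
  show "th4 z \<noteq> 0" unfolding * using Pinf_nz Ninf_nz by simp
qed

text \<open>(q^2;q^2)_n = (q;q)_n (-q;q)_n, and the prefactors q^(1/24) cancel; Gauss's product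
  remains.\<close>

lemma eta_quotient:
  assumes z: "Im z > 0"
  shows "eta z ^ 2 / eta (2 * z) = th4 z"
proof -
  interpret nome "qexp z" using z by (rule nome_qexp)
  have q2: "qexp (2 * z) = (qexp z)\<^sup>2" by (simp add: qexp_def mult_2 power2_eq_square exp_add[symmetric] algebra_simps)
  interpret n2: nome "(qexp z)\<^sup>2" using nome_qexp[of "2 * z"] z by (simp add: q2)
  have "qpoch ((qexp z)\<^sup>2) ((qexp z)\<^sup>2) n = P n * N n" for n
  proof (induction n)
    case (Suc n)
    have "1 - (qexp z)\<^sup>2 * ((qexp z)\<^sup>2) ^ n = (1 - qexp z ^ Suc n) * (1 + qexp z ^ Suc n)"
      by (simp add: power2_eq_square power_mult_distrib algebra_simps)
    then show ?case using Suc by (simp add: qpoch_Suc)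
  qed simp
  then have "(\<lambda>n. P n * N n) \<longlonglongrightarrow> n2.Pinf" using n2.P_lim by simp
  moreover have "(\<lambda>n. P n * N n) \<longlonglongrightarrow> Pinf * Ninf" by (intro tendsto_mult P_lim N_lim)
  ultimately have PN: "n2.Pinf = Pinf * Ninf" using LIMSEQ_unique by blast
  have e1: "eta z = exp (2 * of_real pi * \<i> * z / 24) * Pinf" by (simp only: eta_def Pinf_prodinf)
  have e2: "eta (2 * z) = exp (2 * of_real pi * \<i> * z / 24) ^ 2 * (Pinf * Ninf)"
  proof -
    have "exp (2 * of_real pi * \<i> * (2 * z) / 24) = exp (2 * of_real pi * \<i> * z / 24) ^ 2"
      by (simp add: power2_eq_square flip: exp_add)
    then show ?thesis unfolding PN[symmetric] by (simp only: eta_def q2 n2.Pinf_prodinf)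
  qed
  show ?thesis unfolding e1 e2 th4_product(1)[OF z] using Pinf_nz by (simp add: power2_eq_square)
qed

lemma qexp_imag: "qexp (\<i> * of_real y) = of_real (exp (- 2 * pi * y))"
  by (simp add: qexp_def exp_of_real[symmetric] algebra_simps)

lemma exp_power_square: "exp (- 2 * pi * y) ^ m = exp (- 2 * pi * real m * y)" for y :: real
  by (simp add: mult_ac flip: exp_of_nat_mult)

lemma th4_imag:
  assumes y: "y > 0"
  shows "th4 (\<i> * of_real y) = of_real (theta4_it y)"
proof -
  have "(\<lambda>n. complex_of_real (2 * ((-1) ^ Suc n * exp (- 2 * pi * (real (Suc n))\<^sup>2 * y)))) sums of_real (theta4_it y - 1)"
    by (intro sums_of_real theta4_it_sums y)
  moreover have "complex_of_real (2 * ((-1) ^ Suc n * exp (- 2 * pi * (real (Suc n))\<^sup>2 * y))) =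
      2 * ((-1) ^ Suc n * qexp (\<i> * of_real y) ^ ((Suc n)\<^sup>2))" for n
    unfolding qexp_imag of_real_power[symmetric] exp_power_square by simp
  ultimately have "(\<lambda>n. 2 * ((-1) ^ Suc n * qexp (\<i> * of_real y) ^ ((Suc n)\<^sup>2))) sums of_real (theta4_it y - 1)" by (simp only:)
  from sums_mult[OF this, of "1/2"]
  have "(\<Sum>n. (-1) ^ Suc n * qexp (\<i> * of_real y) ^ ((Suc n)\<^sup>2)) = of_real (theta4_it y - 1) / 2"
    by (simp only: sums_iff) simp
  then show ?thesis unfolding th4_def by (simp only:) (simp add: diff_divide_distrib)
qed

lemma overpartO_imag:
  assumes y: "y > 0"
  shows "overpartO (qexp (\<i> * of_real y)) = of_real (sech_sum y / theta4_it y)"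
proof -
  define q where "q = qexp (\<i> * of_real y)"
  have z: "Im (\<i> * complex_of_real y) > 0" using y by simp
  interpret nome q unfolding q_def using z by (rule nome_qexp)
  have th: "Pinf / Ninf = of_real (theta4_it y)" using th4_product(1)[OF z] th4_imag[OF y] by (simp add: q_def)
  have "8 * ((-1) ^ Suc n * q ^ ((Suc n)\<^sup>2 + Suc n) / (1 + q ^ Suc n)\<^sup>2) =
      of_real (2 * ((-1) ^ Suc n * exp (- 2 * pi * (real (Suc n))\<^sup>2 * y) / (cosh (pi * (real (Suc n) * y)))\<^sup>2))" for n
  proof -
    define t where "t = exp (- 2 * pi * real (Suc n) * y)"
    define c where "c = cosh (pi * (real (Suc n) * y))"
    have qm: "q ^ m = of_real (exp (- 2 * pi * real m * y))" for m
      unfolding q_def qexp_imag of_real_power[symmetric] exp_power_square ..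
    have "1 + exp (- (2 * u)) = 2 * cosh u * exp (- u)" for u :: real
      by (simp add: cosh_field_def algebra_simps flip: exp_add)
    from this[of "pi * (real (Suc n) * y)"] have t1: "1 + t = 2 * c * exp (- (pi * (real (Suc n) * y)))"
      by (simp only: t_def c_def mult_minus_left mult.assoc)
    have t2: "t = (exp (- (pi * (real (Suc n) * y))))\<^sup>2" by (simp add: t_def power2_eq_square algebra_simps flip: exp_add)
    have tc: "4 * t / (1 + t)\<^sup>2 = 1 / c\<^sup>2"
      unfolding t1 unfolding t2 by (simp add: power_mult_distrib)
    have "8 * ((-1) ^ Suc n * q ^ ((Suc n)\<^sup>2 + Suc n) / (1 + q ^ Suc n)\<^sup>2) =
       of_real (2 * ((-1) ^ Suc n * exp (- 2 * pi * (real (Suc n))\<^sup>2 * y)) * (4 * t / (1 + t)\<^sup>2))"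
      unfolding power_add qm t_def[symmetric] by simp
    then show ?thesis unfolding tc c_def by simp
  qed
  then have "(\<lambda>n. complex_of_real (2 * ((-1) ^ Suc n * exp (- 2 * pi * (real (Suc n))\<^sup>2 * y) / (cosh (pi * (real (Suc n) * y)))\<^sup>2))) sums (overpartO q * of_real (theta4_it y) - 1)"
    using overpartO_times_theta unfolding th by (simp only:)
  moreover from sums_summable[OF this] have "(\<lambda>n. complex_of_real (2 * ((-1) ^ Suc n * exp (- 2 * pi * (real (Suc n))\<^sup>2 * y) / (cosh (pi * (real (Suc n) * y)))\<^sup>2))) sums of_real (sech_sum y - 1)"
    unfolding sech_sum_def by (simp only: summable_of_real_iff) (simp only: add_diff_cancel_left' sums_of_real_iff summable_sums)
  ultimately have "overpartO q * of_real (theta4_it y) - 1 = of_real (sech_sum y - 1)" by (rule sums_unique2)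
  then have "overpartO q * of_real (theta4_it y) = of_real (sech_sum y)" by simp
  moreover have "theta4_it y \<noteq> 0" using th4_product(2)[OF z] th4_imag[OF y] by auto
  ultimately show ?thesis unfolding q_def by (simp add: field_simps)
qed

lemma gker_quarter: "y > 0 \<Longrightarrow> gker (1 / (4 * y)) u = exp (- 2 * pi * y * u\<^sup>2)"
  by (simp add: gker_def)

lemma th2_imag:
  assumes y: "y > 0"
  shows "th2 (\<i> * of_real y) = of_real (2 * theta2_half (1 / (4 * y)))"
proof -
  have y4: "1 / (4 * y) > 0" using y by simp
  have "(\<lambda>k. complex_of_real (gker (1 / (4 * y)) (real k + 1/2))) sums of_real (theta2_half (1 / (4 * y)))"
    unfolding theta2_half_def by (intro sums_of_real summable_sums gker_summable_shift y4)
  moreover have "complex_of_real (gker (1 / (4 * y)) (real k + 1/2)) = exp (2 * of_real pi * \<i> * (\<i> * of_real y) * (of_nat k + 1/2)\<^sup>2)" for k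
  proof -
    have *: "2 * of_real pi * \<i> * (\<i> * of_real y) * (of_real u)\<^sup>2 = complex_of_real (- 2 * pi * y * u\<^sup>2)" for u
      by (simp add: algebra_simps)
    have "complex_of_real (real k + 1/2) = of_nat k + 1/2" by simp
    from *[of "real k + 1/2", unfolded this]
    have "2 * of_real pi * \<i> * (\<i> * of_real y) * (of_nat k + 1/2)\<^sup>2 = complex_of_real (- 2 * pi * y * (real k + 1/2)\<^sup>2)" .
    then show ?thesis unfolding gker_quarter[OF y] by (simp only: exp_of_real)
  qed
  ultimately have "(\<lambda>k. exp (2 * of_real pi * \<i> * (\<i> * of_real y) * (of_nat k + 1/2)\<^sup>2)) sums complex_of_real (theta2_half (1 / (4 * y)))" by (simp only:)
  then have "(\<Sum>k. exp (2 * of_real pi * \<i> * (\<i> * of_real y) * (of_nat k + 1/2)\<^sup>2)) = complex_of_real (theta2_half (1 / (4 * y)))" by (rule sums_unique[symmetric])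
  then show ?thesis unfolding th2_def by (simp only: of_real_mult of_real_numeral)
qed

lemma qm_imag:
  assumes y: "y > 0"
  shows "qm (\<i> * of_real y) = of_real (\<Sum>k. qmock (exp (- (pi / (2 * (1 / (4 * y)))))) k)"
proof -
  have e: "- (pi / (2 * (1 / (4 * y)))) = - 2 * pi * y" by simp
  have y4: "1 / (4 * y) > 0" using y by simp
  have "qmock (qexp (\<i> * of_real y)) = (\<lambda>k. of_real (qmock (exp (- (pi / (2 * (1 / (4 * y)))))) k))"
    unfolding qmock_def qexp_imag e of_real_sum by (intro ext sum.cong refl) simp
  then show ?thesis unfolding qm_def by (simp only: suminf_of_real[OF sech_sum_mordell(2)[OF y4]])
qed

text \<open>The points i(1 + 1/(n+1)) accumulate at i inside the half plane, so values on the
  imaginary axis determine a holomorphic function.\<close>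

lemma uhp_identity:
  assumes "f holomorphic_on upper_half_plane" "g holomorphic_on upper_half_plane"
    and eq: "\<And>y. y > 0 \<Longrightarrow> f (\<i> * of_real y) = g (\<i> * of_real y)" and z: "Im z > 0"
  shows "f z = g z"
proof -
  define U where "U = (\<lambda>n. \<i> * complex_of_real (1 + 1 / real (Suc n))) ` UNIV"
  have "f z - g z = 0"
  proof (rule analytic_continuation[where U = U and \<xi> = \<i> and f = "\<lambda>z. f z - g z" and S = upper_half_plane])
    show "connected upper_half_plane" unfolding upper_half_plane_def by (intro convex_connected convex_halfspace_Im_gt)
    show "U \<subseteq> upper_half_plane" by (auto simp: U_def in_uhp add_pos_nonneg)
    have lim: "(\<lambda>n. \<i> * complex_of_real (1 + 1 / real (Suc n))) \<longlonglongrightarrow> \<i> * complex_of_real (1 + 0)"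
      by (intro tendsto_intros LIMSEQ_Suc lim_1_over_n)
    show "\<i> islimpt U" unfolding islimpt_sequential
    proof (intro exI conjI allI)
      show "\<i> * complex_of_real (1 + 1 / real (Suc n)) \<in> U - {\<i>}" for n by (auto simp: U_def complex_eq_iff)
      show "(\<lambda>n. \<i> * complex_of_real (1 + 1 / real (Suc n))) \<longlonglongrightarrow> \<i>" using lim by simp
    qed
    show "f w - g w = 0" if "w \<in> U" for w using that eq by (auto simp: U_def add_pos_nonneg simp del: of_real_add)
  qed (use assms open_uhp z in \<open>auto intro!: holomorphic_intros simp: in_uhp\<close>)
  then show ?thesis by simp
qed

lemma Im_fricke: "Im (- 1 / (4 * z)) = Im z / (4 * (norm z)\<^sup>2)"
proof -
  have "4 * b / (16 * u + 16 * v) = b / (4 * (u + v))" for b u v :: real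
  proof -
    have "16 * u + 16 * v = 4 * (4 * (u + v))" by simp
    then show ?thesis by (simp only: mult_divide_mult_cancel_left_if) simp
  qed
  then show ?thesis by (simp add: Im_divide cmod_power2 power_mult_distrib)
qed

lemma fricke_uhp: "Im z > 0 \<Longrightarrow> Im (- 1 / (4 * z)) > 0"
  unfolding Im_fricke by (cases "z = 0") auto

lemma fricke_holomorphic: "(\<lambda>z. - 1 / (4 * z)) holomorphic_on upper_half_plane"
  by (intro holomorphic_intros) (auto simp: in_uhp)

text \<open>On the imaginary axis this is \<open>theta4_it_eq\<close>, that is, Poisson summation;
  the root is holomorphic since -2iz stays in the right half plane.\<close>

theorem theta_inversion:
  assumes z: "Im z > 0"
  shows "th4 (- 1 / (4 * z)) = csqrt (- 2 * \<i> * z) * th2 z"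
proof (rule uhp_identity[OF _ _ _ z])
  show "(\<lambda>z. th4 (- 1 / (4 * z))) holomorphic_on upper_half_plane"
    by (rule holomorphic_on_compose_gen[OF fricke_holomorphic, of th4 upper_half_plane, unfolded o_def])
       (use bhol_th4 fricke_uhp in \<open>auto simp: bhol_def in_uhp\<close>)
  have "- 2 * \<i> * w \<notin> \<real>\<^sub>\<le>\<^sub>0" if "Im w > 0" for w using that by (auto simp: complex_nonpos_Reals_iff)
  then show "(\<lambda>z. csqrt (- 2 * \<i> * z) * th2 z) holomorphic_on upper_half_plane"
    using bhol_th2 by (intro holomorphic_intros) (auto simp: bhol_def in_uhp)
  fix y :: real assume y: "y > 0"
  have y4: "1 / (4 * y) > 0" using y by simp
  have m: "- 1 / (4 * (\<i> * complex_of_real y)) = \<i> * of_real (1 / (4 * y))" using y by (simp add: field_simps)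
  have c: "csqrt (- 2 * \<i> * (\<i> * of_real y)) = of_real (sqrt (2 * y))"
  proof -
    have "- 2 * \<i> * (\<i> * of_real y) = complex_of_real (2 * y)" by simp
    then show ?thesis using y by (simp only: csqrt_of_real_nonneg) (simp add: csqrt_of_real_nonneg del: of_real_mult)
  qed
  have "2 / sqrt (2 * (1 / (4 * y))) = sqrt (2 * y) * 2"
  proof -
    have "sqrt (2 * (1 / (4 * y))) * sqrt (2 * y) = 1" using y by (simp flip: real_sqrt_mult)
    then show ?thesis using y by (simp add: field_simps)
  qed
  then show "th4 (- 1 / (4 * (\<i> * of_real y))) = csqrt (- 2 * \<i> * (\<i> * of_real y)) * th2 (\<i> * of_real y)"
    unfolding m c th4_imag[OF y4] th2_imag[OF y] theta4_it_eq[OF y4] by (simp only: of_real_mult[symmetric] mult.assoc)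
qed

text \<open>Inherited from the product form of \<open>th4\<close> through inversion; it makes the
  quotient \<open>qm z / th2 z\<close> holomorphic.\<close>

lemma th2_nonzero:
  assumes z: "Im z > 0"
  shows "th2 z \<noteq> 0"
  using theta_inversion[OF z] th4_product(2)[OF fricke_uhp[OF z]] by auto

text \<open>The substitution t = Im z + v, combined with the passage from the gauge integral of the
  definition to the Lebesgue integral. The factor \<open>\<i>\<close> of d tau cancels the one in
  the prefactor.\<close>

lemma nonholI_Jint:
  assumes z: "Im z > 0"
  shows "nonholI z = of_real (sqrt 2 / pi) * Jint th4 (3/2) z"
proof -
  define y where "y = Im z"
  define G where "G t = th4 (Complex (- Re z) t) * of_real ((t + y) powr (- (3/2))) * \<i>" for t
  have y: "y > 0" using z by (simp add: y_def)
  have "integral {y..} (\<lambda>t. let \<tau> = Complex (- Re z) t in eta \<tau> ^ 2 / (eta (2 * \<tau>) * (- \<i> * (\<tau> + z)) powr (3 / 2)) * \<i>) = integral {y..} G"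
  proof (rule integral_cong)
    fix t assume "t \<in> {y..}"
    then have t: "t > 0" using y by simp
    define \<tau> where "\<tau> = Complex (- Re z) t"
    have "- \<i> * (\<tau> + z) = of_real (t + y)" by (simp add: \<tau>_def y_def complex_eq_iff)
    then have 1: "(- \<i> * (\<tau> + z)) powr (3 / 2) = of_real ((t + y) powr (3/2))"
      using t y powr_of_real[of "t + y" "3/2"] by simp
    have 2: "(t + y) powr (- (3/2)) = 1 / (t + y) powr (3/2)" by (simp only: powr_minus_divide)
    have 3: "th4 \<tau> = eta \<tau> ^ 2 / eta (2 * \<tau>)" using t by (intro eta_quotient[symmetric]) (simp add: \<tau>_def)
    have 4: "u / (v * of_real p) * \<i> = u / v * of_real (1 / p) * \<i>" for u v and p :: real by simp
    show "(let \<tau> = Complex (- Re z) t in eta \<tau> ^ 2 / (eta (2 * \<tau>) * (- \<i> * (\<tau> + z)) powr (3 / 2)) * \<i>) = G t"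
      unfolding Let_def G_def \<tau>_def[symmetric] 1 2 3 by (rule 4)
  qed
  also have "\<dots> = \<i> * Jint th4 (3/2) z"
  proof -
    let ?f = "\<lambda>v. th4 (- cnj z + \<i> * of_real v) * of_real ((2 * Im z + v) powr (- (3/2))) * \<i>"
    have I: "has_bochner_integral hl ?f (Jint th4 (3/2) z * \<i>)" unfolding Jint_def
      by (intro has_bochner_integral_mult_left has_bochner_integral_integrable Jint_integrable bhol_th4 z) simp
    then have "has_bochner_integral lborel (\<lambda>v. indicator {0..} v *\<^sub>R ?f v) (Jint th4 (3/2) z * \<i>)"
      unfolding has_bochner_integral_hl_iff .
    moreover have "(\<lambda>v. indicator {0..} v *\<^sub>R ?f v) = (\<lambda>v. indicator {y..} (y + 1 * v) *\<^sub>R G (y + 1 * v))"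
    proof
      fix v
      have "- cnj z + \<i> * of_real v = Complex (- Re z) (y + 1 * v)" "2 * Im z + v = y + 1 * v + y" by (simp_all add: complex_eq_iff y_def)
      then show "indicator {0..} v *\<^sub>R ?f v = indicator {y..} (y + 1 * v) *\<^sub>R G (y + 1 * v)"
        unfolding G_def by (simp add: indicator_def)
    qed
    ultimately have "has_bochner_integral lborel (\<lambda>v. indicator {y..} (y + 1 * v) *\<^sub>R G (y + 1 * v)) ((Jint th4 (3/2) z * \<i>) /\<^sub>R \<bar>1\<bar>)" by simp
    then have "has_bochner_integral lborel (\<lambda>v. indicator {y..} v *\<^sub>R G v) (Jint th4 (3/2) z * \<i>)"
      using lborel_has_bochner_integral_real_affine_iff[of 1 "\<lambda>v. indicator {y..} v *\<^sub>R G v" "Jint th4 (3/2) z * \<i>" y] by simp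
    then have A: "set_integrable lborel {y..} G" and B: "(LINT t:{y..}|lborel. G t) = Jint th4 (3/2) z * \<i>"
      by (simp_all only: set_integrable_def set_lebesgue_integral_def has_bochner_integral_iff)
    show ?thesis unfolding set_borel_integral_eq_integral(2)[OF A, symmetric] B by (rule mult.commute)
  qed
  finally have *: "integral {y..} (\<lambda>t. let \<tau> = Complex (- Re z) t in eta \<tau> ^ 2 / (eta (2 * \<tau>) * (- \<i> * (\<tau> + z)) powr (3 / 2)) * \<i>) = \<i> * Jint th4 (3/2) z" .
  show ?thesis unfolding nonholI_def y_def[symmetric] * by simp
qed

section \<open>Translations and the companion function\<close>

lemma qexp_shift: "qexp (z + 1) = qexp z"
  by (simp add: qexp_def distrib_left exp_add)

lemma th4_shift: "th4 (z + 1) = th4 z"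
  by (simp add: th4_def qexp_shift)

text \<open>(k + 1/2)^2 is an integer plus 1/4, so every term gains exp(2 pi i / 4).\<close>

lemma th2_shift:
  assumes z: "Im z > 0"
  shows "th2 (z + 1) = \<i> * th2 z"
proof -
  have "exp (2 * of_real pi * \<i> * (z + 1) * (of_nat k + 1/2)\<^sup>2) = \<i> * exp (2 * of_real pi * \<i> * z * (of_nat k + 1/2)\<^sup>2)" for k
  proof -
    have g: "c * (z + 1) * S = c * z * S + (N * c + c / 4)" if "S = N + 1 / 4" for c S N :: complex
      unfolding that by (simp add: algebra_simps)
    have S: "(of_nat k + 1/2 :: complex)\<^sup>2 = of_nat (k * k + k) + 1 / 4" by (simp add: power2_eq_square algebra_simps)
    have 1: "exp (of_nat (k * k + k) * (2 * of_real pi * \<i>)) = 1" unfolding exp_of_nat_mult by simp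
    have "exp (2 * of_real pi * \<i> / 4) = cis (pi / 2)" by (simp add: cis_conv_exp mult.commute)
    then have 2: "exp (2 * of_real pi * \<i> / 4) = \<i>" by simp
    show ?thesis unfolding g[OF S] exp_add 1 2 by simp
  qed
  then show ?thesis unfolding th2_def using suminf_mult[OF th2_aux(3)[OF z], of \<i>] by simp
qed

text \<open>Conjugation reverses the translation: - cnj (z + 1) = - cnj z - 1, hence the hypothesis
  on \<open>w - 1\<close>.\<close>

lemma Jint_shift:
  assumes z: "Im z > 0" and g: "\<And>w. Im w > 0 \<Longrightarrow> g (w - 1) = c * g w"
  shows "Jint g r (z + 1) = c * Jint g r z"
proof -
  have "Jint g r (z + 1) = integral\<^sup>L hl (\<lambda>v. c * (g (- cnj z + \<i> * of_real v) * of_real ((2 * Im z + v) powr (- r))))"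
    unfolding Jint_def
  proof (rule Bochner_Integration.integral_cong[OF refl])
    fix v assume "v \<in> space hl"
    then have v: "v \<ge> 0" by simp
    have "- cnj (z + 1) + \<i> * of_real v = (- cnj z + \<i> * of_real v) - 1" by simp
    moreover have "g ((- cnj z + \<i> * of_real v) - 1) = c * g (- cnj z + \<i> * of_real v)" using z v by (intro g) simp
    moreover have "Im (z + 1) = Im z" by simp
    ultimately show "g (- cnj (z + 1) + \<i> * of_real v) * of_real ((2 * Im (z + 1) + v) powr (- r)) =
        c * (g (- cnj z + \<i> * of_real v) * of_real ((2 * Im z + v) powr (- r)))" by (simp only: mult.assoc)
  qed
  then show ?thesis by (simp add: Jint_def)
qed

text \<open>The two constants are what remains on the imaginary axis once y^(-3/2) is taken out, see
  \<open>mockM_imag\<close>.\<close>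

definition dual_mock :: "complex \<Rightarrow> complex" where
  "dual_mock w = of_real (8 * sqrt 2) * (qm w / th2 w) + of_real (1 / (2 * pi)) * Jint th2 (3/2) w"

text \<open>\<open>qm\<close> is periodic and the reciprocal of \<open>th2\<close> gains
  \<open>1 / \<i>\<close>. The period integral gains the inverse multiplier of \<open>th2\<close>,
  which is the same number, because its ray starts at \<open>- cnj z\<close>.\<close>

lemma dual_mock_shift:
  assumes z: "Im z > 0"
  shows "dual_mock (z + 1) = - \<i> * dual_mock z"
proof -
  have "th2 (w - 1) = - \<i> * th2 w" if "Im w > 0" for w
  proof -
    have "th2 w = \<i> * th2 (w - 1)" using th2_shift[of "w - 1"] that by simp
    then show ?thesis by simp
  qed
  from Jint_shift[where g = th2 and c = "- \<i>", OF z this] have J: "Jint th2 (3/2) (z + 1) = - \<i> * Jint th2 (3/2) z" .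
  have q: "qm (z + 1) = qm z" by (simp only: qm_def qexp_shift)
  have "a * (u / (\<i> * t)) + b * (- \<i> * j) = - \<i> * (a * (u / t) + b * j)" for a b u t j :: complex
    by (cases "t = 0") (simp_all add: field_simps)
  then show ?thesis unfolding dual_mock_def th2_shift[OF z] J q .
qed

lemma mockM_Jint:
  assumes "Im z > 0"
  shows "mockM z = overpartO (qexp z) + (- of_real (sqrt 2 / pi)) * Jint th4 (3/2) z"
  unfolding mockM_def nonholI_Jint[OF assms] by simp

lemma mockM_shift:
  assumes z: "Im z > 0"
  shows "mockM (z + 1) = mockM z"
proof -
  have "th4 (w - 1) = 1 * th4 w" for w using th4_shift[of "w - 1"] by simp
  from Jint_shift[where g = th4 and c = 1, OF z this] have J: "Jint th4 (3/2) (z + 1) = 1 * Jint th4 (3/2) z" .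
  have "Im (z + 1) > 0" using z by simp
  then show ?thesis using z J by (simp add: mockM_Jint qexp_shift)
qed

lemma Re_csqrt_pos: "Re u > 0 \<Longrightarrow> Re (csqrt u) > 0"
  by (simp add: add_nonneg_pos)

text \<open>Expressed through \<open>csqrt\<close>, branch questions become sign conditions that
  \<open>csqrt_unique\<close> can settle.\<close>

lemma powr_three_halves:
  assumes "u \<noteq> 0"
  shows "u powr (3/2) = csqrt u ^ 3" "u powr (- (3/2)) = 1 / csqrt u ^ 3"
proof -
  have "csqrt u ^ 3 = exp (of_nat 3 * (Ln u / 2))" unfolding csqrt_exp_Ln[OF assms] exp_of_nat_mult ..
  also have "of_nat 3 * (Ln u / 2) = 3/2 * Ln u" by simp
  finally have "csqrt u ^ 3 = exp (3/2 * Ln u)" .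
  then show 1: "u powr (3/2) = csqrt u ^ 3" using assms by (simp add: powr_def)
  show "u powr (- (3/2)) = 1 / csqrt u ^ 3" unfolding powr_minus 1 by (simp add: inverse_eq_divide)
qed

text \<open>The derivatives in \<open>cnj z\<close> of the two sides of the inversion formula. With
  \<open>s = csqrt (- \<i> * z)\<close> and its conjugate \<open>c\<close>, the theta factor, the
  norm of z and the Jacobian all become monomials in \<open>s\<close> and \<open>c\<close> up to
  constants, and the claim is algebra.\<close>

lemma shadow_match:
  assumes z: "Im z > 0"
  shows "(- of_real (sqrt 2 / pi)) * (- \<i> * th4 (- cnj z) * of_real ((2 * Im z) powr (- (3/2)))) =
    (- \<i> * z) powr (- (3/2)) * (of_real (1 / (2 * pi)) *
      (- \<i> * th2 (- cnj (- 1 / (4 * z))) * of_real ((2 * Im (- 1 / (4 * z))) powr (- (3/2)))) * cnj (1 / (4 * z\<^sup>2)))"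
proof -
  define s where "s = csqrt (- \<i> * z)"
  define c where "c = cnj s"
  define w where "w = - cnj (- 1 / (4 * z))"
  define P where "P = (2 * Im z) powr (- (3/2))"
  have z0: "z \<noteq> 0" using z by auto
  have s2: "s\<^sup>2 = - \<i> * z" by (simp add: s_def)
  have "Re s > 0" unfolding s_def by (rule Re_csqrt_pos) (use z in simp)
  then have Rc: "Re c > 0" and s0: "s \<noteq> 0" and c0: "c \<noteq> 0" by (auto simp: c_def)
  have c2: "c\<^sup>2 = \<i> * cnj z" unfolding c_def by (metis complex_cnj_power s2 complex_cnj_mult complex_cnj_minus complex_cnj_i minus_minus)
  have cz: "cnj z = - \<i> * c\<^sup>2" unfolding c2 by simp
  have w: "w = \<i> / (4 * c\<^sup>2)" unfolding w_def c2 by (simp add: divide_simps z0)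
  have "Im (- cnj m) = Im m" for m by simp
  then have Iw: "Im w > 0" using fricke_uhp[OF z] unfolding w_def by (simp only:)
  have "- 1 / (4 * w) = \<i> * c\<^sup>2" unfolding w using c0 by (simp add: field_simps)
  \<comment> \<open>Theta inversion is applied at \<open>w\<close>, where -1/(4w) is
    \<open>- cnj z\<close>.\<close>
  then have "th4 (- cnj z) = csqrt (- 2 * \<i> * w) * th2 w" using theta_inversion[OF Iw] by (simp add: cz)
  moreover have "csqrt (- 2 * \<i> * w) = 1 / (of_real (sqrt 2) * c)"
  proof (rule csqrt_unique)
    have "(of_real (sqrt 2) :: complex)\<^sup>2 = 2" by (simp flip: of_real_power)
    then show "(1 / (of_real (sqrt 2) * c))\<^sup>2 = - 2 * \<i> * w" unfolding w using c0 by (simp add: power_divide power_mult_distrib field_simps)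
    have "1 / (of_real (sqrt 2) * c) = of_real (1 / sqrt 2) * inverse c" by (simp add: inverse_eq_divide)
    then have "Re (1 / (of_real (sqrt 2) * c)) = 1 / sqrt 2 * (Re c / ((Re c)\<^sup>2 + (Im c)\<^sup>2))"
      by (simp only: Re_complex_of_real Im_complex_of_real times_complex.simps inverse_complex.simps)
    moreover have "(Re c)\<^sup>2 + (Im c)\<^sup>2 > 0" using Rc by (simp add: add_pos_nonneg)
    ultimately have "0 < Re (1 / (of_real (sqrt 2) * c))" using Rc by simp
    then show "0 < Re (1 / (of_real (sqrt 2) * c)) \<or> Re (1 / (of_real (sqrt 2) * c)) = 0 \<and> 0 \<le> Im (1 / (of_real (sqrt 2) * c))"
 ..
  qed
  ultimately have t4: "th4 (- cnj z) = 1 / (of_real (sqrt 2) * c) * th2 w" by simp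
  have n: "of_real (norm z) = s * c"
  proof -
    have "norm z = (norm s)\<^sup>2" using arg_cong[OF s2, of norm] by (simp add: norm_power norm_mult)
    then show ?thesis by (simp only: c_def complex_norm_square)
  qed
  have pI: "(2 * Im (- 1 / (4 * z))) powr (- (3/2)) = P * (8 * norm z ^ 3)"
  proof -
    have np: "norm z > 0" using z0 by simp
    have 1: "2 * Im (- 1 / (4 * z)) = (2 * Im z) / (2 * norm z)\<^sup>2" unfolding Im_fricke by (simp add: power_mult_distrib)
    have 2: "((2 * norm z)\<^sup>2) powr (- (3/2)) = 1 / (8 * norm z ^ 3)"
    proof -
      have sq: "(2 * norm z)\<^sup>2 = (2 * norm z) powr 2" by simp
      have "((2 * norm z)\<^sup>2) powr (- (3/2)) = (2 * norm z) powr (- 3)" unfolding sq powr_powr by simp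
      also have "\<dots> = 1 / (2 * norm z) powr 3" using powr_minus_divide[of "2 * norm z" 3] by simp
      also have "\<dots> = 1 / (2 * norm z) ^ 3" using np by simp
      finally show ?thesis by (simp add: power_mult_distrib)
    qed
    have "(2 * Im z / (2 * norm z)\<^sup>2) powr (- (3/2)) = P / ((2 * norm z)\<^sup>2) powr (- (3/2))"
      unfolding P_def by (rule powr_divide)
    then show ?thesis unfolding 1 2 by simp
  qed
  have pz: "(- \<i> * z) powr (- (3/2)) = 1 / s ^ 3" unfolding s_def by (rule powr_three_halves(2)) (use z0 in simp)
  have D: "cnj (1 / (4 * z\<^sup>2)) = - 1 / (4 * c ^ 4)"
  proof -
    have "c ^ 4 = (c\<^sup>2)\<^sup>2" by simp
    then have "c ^ 4 = - (cnj z)\<^sup>2" unfolding c2 by (simp add: power_mult_distrib)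
    then show ?thesis by (simp add: divide_simps z0)
  qed
  have rt: "of_real (sqrt 2) * (of_real (sqrt 2)) = (2 :: complex)" by (simp flip: of_real_mult)
  have alg: "(- (r / p)) * (- \<i> * (1 / (r * c) * t) * q) = 1 / s ^ 3 * ((1 / (2 * p)) * (- \<i> * t * (q * (8 * (s * c) ^ 3))) * (- 1 / (4 * c ^ 4)))"
    if "r \<noteq> 0" "p \<noteq> 0" for r p t q :: complex
    using that c0 s0 by (simp add: divide_simps power_mult_distrib) (simp add: power4_eq_xxxx power3_eq_cube)
  show ?thesis unfolding w_def[symmetric] t4 pI pz D P_def[symmetric] of_real_mult of_real_divide of_real_power n
    using alg[of "of_real (sqrt 2)" "of_real pi" "th2 w" "of_real P"] by simp
qed

section \<open>Splitting the period integral on the imaginary axis\<close>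

lemma theta4_it_continuous: "continuous_on {0<..} theta4_it"
proof -
  have "continuous_on upper_half_plane th4" using bhol_th4 by (simp add: bhol_def holomorphic_on_imp_continuous_on)
  then have "continuous_on {0<..} (\<lambda>t. th4 (\<i> * of_real t))"
    by (rule continuous_on_compose2) (auto intro!: continuous_intros simp: in_uhp)
  then have "continuous_on {0<..} (\<lambda>t. Re (th4 (\<i> * of_real t)))" by (intro continuous_intros)
  then show ?thesis by (rule continuous_on_eq) (simp add: th4_imag)
qed

definition period_kernel :: "real \<Rightarrow> real \<Rightarrow> real" where
  "period_kernel y t = theta4_it t * (t + y) powr (- 3/2)"

lemma period_kernel_continuous: "y > 0 \<Longrightarrow> continuous_on {0<..} (period_kernel y)"
  unfolding period_kernel_def[abs_def] by (intro continuous_intros theta4_it_continuous) auto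

lemma period_kernel_integrable:
  "y > 0 \<Longrightarrow> integrable hl (period_kernel y)"
  "y > 0 \<Longrightarrow> integral\<^sup>L hl (period_kernel y) = 4 * sqrt 2 * pi * mordell y"
  using mordell_theta_integral[of y] unfolding period_kernel_def[abs_def] by (simp_all only: has_bochner_integral_iff)

text \<open>Continuity is available on the open half line only; integrability up to 0 comes from the
  convergent full period integral.\<close>

lemma period_kernel_integrable_on:
  assumes y: "y > 0"
  shows "period_kernel y integrable_on {0..x}"
proof -
  have "set_integrable lborel {0..} (period_kernel y)"
    unfolding set_integrable_def using period_kernel_integrable(1)[OF y] by (simp add: integrable_restrict_space)
  then have "set_integrable lborel {0..x} (period_kernel y)" by (rule set_integrable_subset) auto
  then show ?thesis by (rule set_borel_integral_eq_integral)
qed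

lemma period_primitive_deriv:
  assumes y: "y > 0" and x: "x > 0"
  shows "((\<lambda>x. integral {0..x} (period_kernel y)) has_real_derivative period_kernel y x) (at x)"
proof -
  have "isCont (period_kernel y) x"
    using period_kernel_continuous[OF y] x by (simp add: continuous_on_eq_continuous_at)
  then have "continuous (at x within {0..x + 1} - {}) (period_kernel y)" by (rule continuous_at_imp_continuous_within)
  from integral_has_vector_derivative_continuous_at[OF period_kernel_integrable_on[OF y] _ _ this]
  have "((\<lambda>u. integral {0..u} (period_kernel y)) has_vector_derivative period_kernel y x) (at x within {0..x + 1})"
    using x by simp
  moreover have "at x within {0..x + 1} = at x" using x by (intro at_within_interior) simp
  ultimately show ?thesis by (simp add: has_real_derivative_iff_has_vector_derivative)
qed

lemma Jint_th4_imag: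
  assumes y: "y > 0"
  shows "integrable hl (\<lambda>v. period_kernel y (y + v))"
    "Jint th4 (3/2) (\<i> * of_real y) = of_real (integral\<^sup>L hl (\<lambda>v. period_kernel y (y + v)))"
proof -
  let ?f = "\<lambda>v. th4 (- cnj (\<i> * of_real y) + \<i> * of_real v) * of_real ((2 * Im (\<i> * of_real y) + v) powr (- (3/2)))"
  have f: "?f v = of_real (period_kernel y (y + v))" if "v \<in> space hl" for v
  proof -
    have "- cnj (\<i> * of_real y) + \<i> * of_real v = \<i> * of_real (y + v)" by (simp add: algebra_simps)
    moreover have "2 * Im (\<i> * complex_of_real y) + v = y + v + y" by simp
    moreover have "th4 (\<i> * of_real (y + v)) = of_real (theta4_it (y + v))" using that y by (intro th4_imag) simp
    ultimately show ?thesis unfolding period_kernel_def minus_divide_left by (simp only: of_real_mult)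
  qed
  have "integrable hl ?f" using y by (intro Jint_integrable bhol_th4) auto
  then have "integrable hl (\<lambda>v. complex_of_real (period_kernel y (y + v)))"
    using Bochner_Integration.integrable_cong[where M = hl and N = hl and f = ?f and g = "\<lambda>v. complex_of_real (period_kernel y (y + v))", OF refl f] by blast
  then have "integrable hl (\<lambda>v. Re (complex_of_real (period_kernel y (y + v))))" by (rule integrable_Re)
  then show "integrable hl (\<lambda>v. period_kernel y (y + v))" by simp
  have "Jint th4 (3/2) (\<i> * of_real y) = integral\<^sup>L hl (\<lambda>v. complex_of_real (period_kernel y (y + v)))"
    unfolding Jint_def by (rule Bochner_Integration.integral_cong[OF refl f])
  then show "Jint th4 (3/2) (\<i> * of_real y) = of_real (integral\<^sup>L hl (\<lambda>v. period_kernel y (y + v)))" by simp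
qed

text \<open>The ray starting at iy covers t >= y, so its integral is the full period integral, known
  through the Mordell integral, minus the part below \<open>y\<close>.\<close>

lemma period_upper:
  assumes y: "y > 0"
  shows "integral\<^sup>L hl (\<lambda>v. period_kernel y (y + v)) = 4 * sqrt 2 * pi * mordell y - integral {0..y} (period_kernel y)"
    (is "_ = ?L - _")
proof -
  let ?F = "\<lambda>v. integral {0..y + v} (period_kernel y)"
  have "has_bochner_integral hl (\<lambda>v. period_kernel y (y + v)) (?L - ?F 0)"
  proof (rule hl_FTC[where F = ?F])
    fix v :: real assume "0 \<le> v"
    then have v: "y + v > 0" using y by simp
    have "((\<lambda>v. y + v) has_real_derivative 1) (at v)" by (auto intro!: derivative_eq_intros)
    from DERIV_chain2[OF period_primitive_deriv[OF y v] this]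
    show "(?F has_vector_derivative period_kernel y (y + v)) (at v)" by (simp add: has_real_derivative_iff_has_vector_derivative)
  next
    have "filterlim (\<lambda>v. y + v) at_top at_top" by real_asymp
    from filterlim_compose[OF hl_integral_limit[OF period_kernel_integrable(1)[OF y]] this]
    show "(?F \<longlongrightarrow> ?L) at_top" by (simp only: period_kernel_integrable(2)[OF y])
  qed (rule Jint_th4_imag(1)[OF y])
  then show ?thesis by (simp add: has_bochner_integral_iff)
qed

definition dual_kernel :: "real \<Rightarrow> real \<Rightarrow> real" where
  "dual_kernel w v = 2 * theta2_half (1 / (4 * (w + v))) * (2 * w + v) powr (- (3/2))"

lemma Jint_th2_imag:
  assumes w: "w > 0"
  shows "integrable hl (dual_kernel w)" "Jint th2 (3/2) (\<i> * of_real w) = of_real (integral\<^sup>L hl (dual_kernel w))"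
proof -
  let ?f = "\<lambda>v. th2 (- cnj (\<i> * of_real w) + \<i> * of_real v) * of_real ((2 * Im (\<i> * of_real w) + v) powr (- (3/2)))"
  have f: "?f v = of_real (dual_kernel w v)" if "v \<in> space hl" for v
  proof -
    have "- cnj (\<i> * of_real w) + \<i> * of_real v = \<i> * of_real (w + v)" by (simp add: algebra_simps)
    moreover have "2 * Im (\<i> * complex_of_real w) + v = 2 * w + v" by simp
    moreover have "th2 (\<i> * of_real (w + v)) = of_real (2 * theta2_half (1 / (4 * (w + v))))" using that w by (intro th2_imag) simp
    ultimately show ?thesis unfolding dual_kernel_def by (simp only: of_real_mult)
  qed
  have "integrable hl ?f" using w by (intro Jint_integrable bhol_th2) auto
  then have "integrable hl (\<lambda>v. complex_of_real (dual_kernel w v))"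
    using Bochner_Integration.integrable_cong[where M = hl and N = hl and f = ?f and g = "\<lambda>v. complex_of_real (dual_kernel w v)", OF refl f] by blast
  then have "integrable hl (\<lambda>v. Re (complex_of_real (dual_kernel w v)))" by (rule integrable_Re)
  then show "integrable hl (dual_kernel w)" by simp
  have "Jint th2 (3/2) (\<i> * of_real w) = integral\<^sup>L hl (\<lambda>v. complex_of_real (dual_kernel w v))"
    unfolding Jint_def by (rule Bochner_Integration.integral_cong[OF refl f])
  then show "Jint th2 (3/2) (\<i> * of_real w) = of_real (integral\<^sup>L hl (dual_kernel w))" by simp
qed

text \<open>Under t = 1/(4u), theta inversion contributes u^(1/2) and the kernel contributes u^(3/2)
  w^(3/2); the resulting u^2 cancels the Jacobian 1/(4u^2) up to a constant.\<close>

lemma period_dual: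
  assumes w: "w > 0" and u: "u \<ge> w"
  shows "period_kernel (1 / (4 * w)) (1 / (4 * u)) / (4 * u\<^sup>2) = 2 * sqrt 2 * w powr (3/2) * dual_kernel w (u - w)"
proof -
  have u0: "u > 0" using w u by simp
  have t: "theta4_it (1 / (4 * u)) = 2 * sqrt 2 * u powr (1/2) * theta2_half (1 / (4 * u))"
  proof -
    have "sqrt (2 * (1 / (4 * u))) * sqrt (2 * u) = 1" using u0 by (simp flip: real_sqrt_mult)
    then have "2 / sqrt (2 * (1 / (4 * u))) = 2 * sqrt (2 * u)" using u0 by (simp add: field_simps)
    moreover have "sqrt (2 * u) = sqrt 2 * u powr (1/2)" using u0 by (simp only: real_sqrt_mult powr_half_sqrt)
    moreover have "1 / (4 * u) > 0" using u0 by simp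
    ultimately show ?thesis using theta4_it_eq by (simp only: mult.assoc)
  qed
  have e: "1 / (4 * u) + 1 / (4 * w) = (u + w) / (4 * (u * w))" using u0 w by (simp add: field_simps)
  have "4 powr (3/2) = ((2::real) powr 2) powr (3/2)" by simp
  also have "\<dots> = 2 powr 3" unfolding powr_powr by simp
  finally have f: "4 powr (3/2) = (8::real)" by simp
  have p: "(1 / (4 * u) + 1 / (4 * w)) powr (- 3/2) = (u + w) powr (- (3/2)) * (8 * (u powr (3/2) * w powr (3/2)))"
  proof -
    have "(4 * (u * w)) powr (- (3/2)) = 1 / (8 * (u powr (3/2) * w powr (3/2)))"
      unfolding powr_minus_divide powr_mult f ..
    then show ?thesis unfolding e minus_divide_left[symmetric] powr_divide by simp
  qed
  have h: "u powr (3/2) * u powr (1/2) = u\<^sup>2" using u0 by (simp flip: powr_add)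
  have "2 * w + (u - w) = u + w" by simp
  moreover have "w + (u - w) = u" by simp
  ultimately have "dual_kernel w (u - w) = 2 * theta2_half (1 / (4 * u)) * (u + w) powr (- (3/2))" unfolding dual_kernel_def by (simp only:)
  moreover have "period_kernel (1 / (4 * w)) (1 / (4 * u)) =
      2 * sqrt 2 * theta2_half (1 / (4 * u)) * (u + w) powr (- (3/2)) * 8 * w powr (3/2) * (u powr (3/2) * u powr (1/2))"
    unfolding period_kernel_def t p by (simp only: mult_ac)
  moreover have "a * b * c * 8 * d * u\<^sup>2 / (4 * u\<^sup>2) = a * d * (2 * b * c)" for a b c d :: real using u0 by simp
  ultimately show ?thesis unfolding h by (simp only:)
qed

text \<open>The substitution t = 1/(4(w + v)) carries the half line v >= 0 to (0, 1/(4w)], so the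
  part of the theta integral near 0 becomes a period integral of \<open>th2\<close>.\<close>

lemma period_lower:
  assumes w: "w > 0"
  shows "integral {0..1 / (4 * w)} (period_kernel (1 / (4 * w))) = 2 * sqrt 2 * w powr (3/2) * integral\<^sup>L hl (dual_kernel w)"
proof -
  define y where "y = 1 / (4 * w)"
  have y: "y > 0" using w by (simp add: y_def)
  define \<Psi> where "\<Psi> x = integral {0..x} (period_kernel y)" for x
  let ?F = "\<lambda>v. - \<Psi> (1 / (4 * (w + v)))"
  let ?f = "\<lambda>v. 2 * sqrt 2 * w powr (3/2) * dual_kernel w v"
  have "has_bochner_integral hl ?f (0 - ?F 0)"
  proof (rule hl_FTC[where F = ?F])
    show "integrable hl ?f" by (intro integrable_mult_right Jint_th2_imag w)
    fix v :: real assume v: "0 \<le> v"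
    then have u: "w + v > 0" using w by simp
    have "((\<lambda>v. 1 / (4 * (w + v))) has_real_derivative - (1 / (4 * (w + v)\<^sup>2))) (at v)"
      using u by (auto intro!: derivative_eq_intros simp: power2_eq_square divide_simps) (simp add: algebra_simps)
    moreover have "1 / (4 * (w + v)) > 0" using u by simp
    ultimately have "((\<lambda>v. \<Psi> (1 / (4 * (w + v)))) has_real_derivative period_kernel y (1 / (4 * (w + v))) * - (1 / (4 * (w + v)\<^sup>2))) (at v)"
      unfolding \<Psi>_def by (intro DERIV_chain2[OF period_primitive_deriv[OF y]])
    from DERIV_minus[OF this] have "(?F has_real_derivative period_kernel y (1 / (4 * (w + v))) / (4 * (w + v)\<^sup>2)) (at v)" by simp
    moreover have "period_kernel y (1 / (4 * (w + v))) / (4 * (w + v)\<^sup>2) = ?f v"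
      using period_dual[OF w, of "w + v"] v by (simp add: y_def)
    ultimately show "(?F has_vector_derivative ?f v) (at v)" by (simp add: has_real_derivative_iff_has_vector_derivative)
  next
    \<comment> \<open>\<open>v\<close> at infinity corresponds to t = 0, and continuity of the
      primitive there supplies the limit, with no knowledge of the kernel at 0 itself.\<close>
    have "continuous_on {0..y} \<Psi>" unfolding \<Psi>_def by (intro indefinite_integral_continuous_1 period_kernel_integrable_on y)
    then have "(\<Psi> \<longlongrightarrow> \<Psi> 0) (at 0 within {0..y})" using y by (simp add: continuous_on_def)
    moreover have "filterlim (\<lambda>v. 1 / (4 * (w + v))) (at 0 within {0..y}) at_top"
      unfolding filterlim_at
    proof
      show "((\<lambda>v. 1 / (4 * (w + v))) \<longlongrightarrow> 0) at_top" using w by real_asymp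
      show "\<forall>\<^sub>F v in at_top. 1 / (4 * (w + v)) \<in> {0..y} \<and> 1 / (4 * (w + v)) \<noteq> 0"
        using eventually_ge_at_top[of 0]
      proof eventually_elim
        case (elim v)
        then have "w + v > 0" "w + v \<ge> w" using w by auto
        then show ?case using w by (auto simp: y_def field_simps)
      qed
    qed
    ultimately have "((\<lambda>v. \<Psi> (1 / (4 * (w + v)))) \<longlongrightarrow> \<Psi> 0) at_top" by (rule filterlim_compose)
    from tendsto_minus[OF this] show "(?F \<longlongrightarrow> 0) at_top" by (simp add: \<Psi>_def)
  qed
  then have "integral\<^sup>L hl ?f = \<Psi> y" by (simp add: has_bochner_integral_iff y_def)
  then show ?thesis unfolding \<Psi>_def y_def by simp
qed

text \<open>The overpartition series contributes \<open>8 * mordell y\<close>, and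
  \<open>sqrt 2 / pi\<close> times the full period integral
  \<open>4 * sqrt 2 * pi * mordell y\<close> is the same number. What survives is the quotient of
  \<open>qmock\<close> by theta and the part of the integral below \<open>y\<close>.\<close>

lemma mockM_imag:
  assumes y: "y > 0"
  shows "mockM (\<i> * of_real y) = (- \<i> * (\<i> * of_real y)) powr (- (3/2)) * dual_mock (- 1 / (4 * (\<i> * of_real y)))"
proof -
  define w where "w = 1 / (4 * y)"
  define R where "R = y powr (- (3/2))"
  define M where "M = mordell y"
  define Q where "Q = (\<Sum>k. qmock (exp (- (pi / (2 * y)))) k)"
  define \<theta> where "\<theta> = theta2_half y"
  define K where "K = integral\<^sup>L hl (dual_kernel w)"
  have z: "Im (\<i> * complex_of_real y) > 0" using y by simp
  have w: "w > 0" and yw: "1 / (4 * w) = y" using y by (simp_all add: w_def)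
  have m: "- 1 / (4 * (\<i> * complex_of_real y)) = \<i> * of_real w" using y by (simp add: w_def field_simps)
  have "- \<i> * (\<i> * of_real y) = complex_of_real y" by simp
  then have p: "(- \<i> * (\<i> * of_real y)) powr (- (3/2)) = complex_of_real R"
    using powr_of_real[of y "- (3/2)"] y by (simp add: R_def)
  have f: "4 powr (3/2) = (8::real)"
  proof -
    have "4 powr (3/2) = ((2::real) powr 2) powr (3/2)" by simp
    also have "\<dots> = 2 powr 3" unfolding powr_powr by simp
    finally show ?thesis by simp
  qed
  have wR: "w powr (3/2) = R / 8" unfolding w_def R_def powr_divide powr_mult f powr_minus_divide by simp
  have yR: "4 / y * sqrt (2 / y) = 4 * sqrt 2 * R"
  proof -
    have "y powr (3/2) = y powr 1 * y powr (1/2)" unfolding powr_add[symmetric] by simp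
    then have "R = 1 / (y * sqrt y)" using y unfolding R_def powr_minus_divide by (simp add: powr_half_sqrt)
    then show ?thesis using y by (simp add: real_sqrt_divide)
  qed
  have J: "integral\<^sup>L hl (\<lambda>v. period_kernel y (y + v)) = 4 * sqrt 2 * pi * M - 2 * sqrt 2 * (R / 8) * K"
    using period_upper[OF y] period_lower[OF w] by (simp only: yw wR M_def K_def)
  have "mockM (\<i> * of_real y) = of_real (8 * M + 4 * sqrt 2 * R * (Q / \<theta>)) + (- of_real (sqrt 2 / pi)) * of_real (4 * sqrt 2 * pi * M - 2 * sqrt 2 * (R / 8) * K)"
    unfolding mockM_Jint[OF z] overpartO_imag[OF y] Jint_th4_imag(2)[OF y] J sech_sum_mordell(1)[OF y] yR M_def Q_def \<theta>_def ..
  also have "\<dots> = of_real (8 * M + 4 * sqrt 2 * R * (Q / \<theta>) - sqrt 2 / pi * (4 * sqrt 2 * pi * M - 2 * sqrt 2 * (R / 8) * K))" by (simp only: of_real_diff of_real_mult) simp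
  also have "8 * M + 4 * sqrt 2 * R * (Q / \<theta>) - sqrt 2 / pi * (4 * sqrt 2 * pi * M - 2 * sqrt 2 * (R / 8) * K) =
     R * (8 * sqrt 2 * (Q / (2 * \<theta>)) + 1 / (2 * pi) * K)"
  proof -
    \<comment> \<open>Here \<open>r\<close> stands for \<open>sqrt 2\<close>; r^2 = 2 removes
      \<open>M\<close>.\<close>
    have "8 * M + 4 * r * R * X - r / q * (4 * r * q * M - 2 * r * (R / 8) * K) = 8 * M - 4 * (r * r) * M + 4 * r * R * X + (r * r) * R * K / (4 * q)"
      if "q \<noteq> 0" for r q X using that by (simp add: field_simps)
    from this[of pi "sqrt 2" "Q / \<theta>"] show ?thesis by (simp add: algebra_simps)
  qed
  also have "of_real (R * (8 * sqrt 2 * (Q / (2 * \<theta>)) + 1 / (2 * pi) * K)) = complex_of_real R * dual_mock (\<i> * of_real w)"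
    unfolding dual_mock_def th2_imag[OF w] qm_imag[OF w] Jint_th2_imag(2)[OF w] yw Q_def[symmetric] \<theta>_def[symmetric] K_def[symmetric]
    by (simp only: of_real_mult of_real_add of_real_divide)
  finally show ?thesis unfolding m p .
qed

lemma holomorphic_on_uhp_wirt:
  assumes "\<And>z. Im z > 0 \<Longrightarrow> \<exists>A. wirt f z A 0"
  shows "f holomorphic_on upper_half_plane"
  unfolding holomorphic_on_def
proof
  fix z assume "z \<in> upper_half_plane"
  then obtain A where "wirt f z A 0" using assms by (auto simp: in_uhp)
  then have "(f has_field_derivative A) (at z)" by (simp add: wirt_def has_field_derivative_def)
  then show "f field_differentiable (at z within upper_half_plane)"
    using field_differentiable_def field_differentiable_at_within by blast
qed

lemma fricke_factor_holomorphic: "(\<lambda>z. (- \<i> * z) powr (- (3/2))) holomorphic_on upper_half_plane"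
  by (intro holomorphic_intros) (auto simp: in_uhp complex_nonpos_Reals_iff)

text \<open>The difference of both sides is killed by the antiholomorphic Wirtinger derivative, as the
  shadows of both sides agree by the inversion formula of theta functions; so it is holomorphic,
  and it vanishes on the imaginary axis.\<close>

theorem mockM_inversion:
  assumes z: "Im z > 0"
  shows "mockM z = (- \<i> * z) powr (- (3/2)) * dual_mock (- 1 / (4 * z))"
proof -
  define c1 where "c1 = - complex_of_real (sqrt 2 / pi)"
  define c2 where "c2 = complex_of_real (1 / (2 * pi))"
  define E where "E w = (overpartO (qexp w) + c1 * Jint th4 (3/2) w) + (- 1) * ((- \<i> * w) powr (- (3/2)) * dual_mock (- 1 / (4 * w)))" for w
  define G where "G w = of_real (8 * sqrt 2) * (qm w / th2 w)" for w
  have G: "G holomorphic_on upper_half_plane" unfolding G_def[abs_def]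
    using bhol_th2 th2_nonzero by (intro holomorphic_intros qm_holomorphic) (auto simp: bhol_def in_uhp)
  have "E holomorphic_on upper_half_plane"
  proof (rule holomorphic_on_uhp_wirt)
    fix w assume w: "Im w > 0"
    define m where "m = - 1 / (4 * w)"
    have m: "Im m > 0" unfolding m_def by (rule fricke_uhp[OF w])
    have dm: "dual_mock = (\<lambda>u. G u + c2 * Jint th2 (3/2) u)" unfolding dual_mock_def G_def c2_def ..
    obtain D0 where D: "wirt dual_mock m D0 (0 + c2 * (- \<i> * th2 (- cnj m) * of_real ((2 * Im m) powr (- (3/2)))))"
      unfolding dm using wirt_add[OF wirt_holomorphic[OF G m] wirt_cmult[OF Jint_wirt[OF bhol_th2 m, of "3/2"], of c2]] by auto
    have w0: "w \<noteq> 0" using w by auto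
    have "((\<lambda>w. - 1 / (4 * w)) has_field_derivative 1 / (4 * w\<^sup>2)) (at w)"
      using w0 by (auto intro!: derivative_eq_intros simp: power2_eq_square divide_simps)
    note C = wirt_compose[OF D[unfolded m_def] this]
    note P = wirt_mult[OF wirt_holomorphic[OF fricke_factor_holomorphic w] C]
    note L = wirt_add[OF wirt_holomorphic[OF overpartO_holomorphic w] wirt_cmult[OF Jint_wirt[OF bhol_th4 w, of "3/2"], of c1]]
    obtain A where A: "wirt E w A (0 + c1 * (- \<i> * th4 (- cnj w) * of_real ((2 * Im w) powr (- (3/2)))) +
        (- 1) * ((- \<i> * w) powr (- (3/2)) * ((0 + c2 * (- \<i> * th2 (- cnj (- 1 / (4 * w))) * of_real ((2 * Im (- 1 / (4 * w))) powr (- (3/2))))) * cnj (1 / (4 * w\<^sup>2)))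
          + 0 * dual_mock (- 1 / (4 * w))))"
      using wirt_add[OF L wirt_cmult[OF P, of "- 1"]] unfolding E_def[abs_def] by auto
    have "X + (- 1) * Y = 0" if "X = Y" for X Y :: complex using that by simp
    from this[OF shadow_match[OF w]] A have "wirt E w A 0"
      unfolding c1_def c2_def by (simp only: add_0 mult_zero_left add_0_right)
    then show "\<exists>A. wirt E w A 0" ..
  qed
  moreover have "E (\<i> * of_real y) = 0" if y: "y > 0" for y
  proof -
    have "Im (\<i> * complex_of_real y) > 0" using y by simp
    from mockM_Jint[OF this] have "overpartO (qexp (\<i> * of_real y)) + c1 * Jint th4 (3/2) (\<i> * of_real y) = mockM (\<i> * of_real y)"
      unfolding c1_def by (rule sym)
    then show ?thesis unfolding E_def using mockM_imag[OF y] by simp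
  qed
  ultimately have "E z = 0" using uhp_identity[where f = E and g = "\<lambda>_. 0", OF _ _ _ z] by auto
  then show ?thesis unfolding E_def mockM_Jint[OF z] c1_def by simp
qed

text \<open>Both roots on the right have argument below pi/4 in absolute value, so their quotient
  has positive real part and \<open>\<i>\<close> times it positive imaginary part. Its square
  \<open>v\<close> lies in the upper half plane, which then forces the real part to be positive too:
  the root is the principal one.\<close>

lemma csqrt_quotient:
  assumes "Re p > 0" "Re q > 0" "q * v = - p" "Im v > 0"
  shows "csqrt v = \<i> * (csqrt p / csqrt q)"
proof (rule csqrt_unique)
  define a where "a = csqrt p"
  define b where "b = csqrt q"
  have ab: "Re a > 0" "Re b > 0" unfolding a_def b_def by (rule Re_csqrt_pos[OF assms(1)], rule Re_csqrt_pos[OF assms(2)])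
  have b0: "b \<noteq> 0" using ab by auto
  have sq: "a\<^sup>2 = p" "b\<^sup>2 = q" by (simp_all add: a_def b_def)
  have k2: "(\<i> * (a / b))\<^sup>2 = v"
  proof -
    have "v = - p / q" using assms b0 sq by (metis nonzero_mult_div_cancel_left zero_power2 power_eq_0_iff)
    then show ?thesis by (simp add: power_mult_distrib power_divide sq)
  qed
  then show "(\<i> * (csqrt p / csqrt q))\<^sup>2 = v" by (simp only: a_def b_def)
  have lt: "\<bar>Im a\<bar> < Re a" "\<bar>Im b\<bar> < Re b"
  proof -
    have "Re (a\<^sup>2) > 0" "Re (b\<^sup>2) > 0" unfolding sq using assms by auto
    then have "\<bar>Im a\<bar>\<^sup>2 < (Re a)\<^sup>2" "\<bar>Im b\<bar>\<^sup>2 < (Re b)\<^sup>2" by (simp_all add: Re_power2)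
    then show "\<bar>Im a\<bar> < Re a" "\<bar>Im b\<bar> < Re b" using ab power2_less_imp_less less_imp_le by blast+
  qed
  have "\<bar>Im a * Im b\<bar> < Re a * Re b" unfolding abs_mult using lt by (intro mult_strict_mono') auto
  then have "Re a * Re b + Im a * Im b > 0" by linarith
  moreover have "(Re b)\<^sup>2 + (Im b)\<^sup>2 > 0" using ab by (simp add: add_pos_nonneg)
  ultimately have "Re (a / b) > 0" by (simp add: Re_divide)
  moreover have "Im (\<i> * x) = Re x" for x by simp
  ultimately have I: "Im (\<i> * (a / b)) > 0" by (simp only:)
  have pos: "Re k > 0" if "Im k > 0" "Im (k\<^sup>2) > 0" for k
    using that by (simp add: Im_power2 zero_less_mult_iff)
  have "Im ((\<i> * (a / b))\<^sup>2) > 0" unfolding k2 by (rule assms)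
  from pos[OF I this] have "Re (\<i> * (a / b)) > 0" .
  then show "0 < Re (\<i> * (csqrt p / csqrt q)) \<or> Re (\<i> * (csqrt p / csqrt q)) = 0 \<and> 0 \<le> Im (\<i> * (csqrt p / csqrt q))"
    unfolding a_def b_def ..
qed

text \<open>For u = z/(4z+1) - 1/2 and w = -1/(4(z + 1/2)) one has u (4z+1) = -(z + 1/2) and -1/(4u)
  = w + 1. Hence the map is inversion, translation of the companion by 1, and inversion back; z -
  1/2 and z + 1/2 are interchangeable by periodicity.\<close>

lemma mockM_half_V:
  assumes z: "Im z > 0"
  shows "mockM (z / (4 * z + 1) - 1/2) = (4 * z + 1) powr (3/2) * mockM (z - 1/2)"
proof -
  define v where "v = 4 * z + 1"
  define u where "u = z / v - 1/2"
  define w where "w = - 1 / (4 * (z + 1/2))"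
  define a where "a = csqrt (- \<i> * (z + 1/2))"
  define b where "b = csqrt (- \<i> * u)"
  have Iv: "Im v > 0" using z by (simp add: v_def)
  have v0: "v \<noteq> 0" using Iv by auto
  have z2: "Im (z + 1/2) > 0" using z by simp
  then have z20: "z + 1/2 \<noteq> 0" by (metis less_irrefl zero_complex.simps(2))
  have uv: "u * v = - (z + 1/2)"
  proof -
    have "u * v = z - v / 2" unfolding u_def using v0 by (simp add: left_diff_distrib)
    then show ?thesis by (simp add: v_def field_simps)
  qed
  have Iu: "Im u > 0"
  proof -
    have "u = z / v - of_real (1/2)" by (simp add: u_def)
    then have "Im u = Im (z / v)" by (simp only: minus_complex.simps Im_complex_of_real diff_0_right)
    also have "\<dots> = Im z / ((Re v)\<^sup>2 + (Im v)\<^sup>2)" by (simp add: Im_divide v_def algebra_simps)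
    also have "\<dots> > 0" using z Iv by (simp add: add_nonneg_pos)
    finally show ?thesis .
  qed
  have u0: "u \<noteq> 0" using Iu by auto
  have wu: "- 1 / (4 * u) = w + 1"
  proof -
    have "u = - (z + 1/2) / v" using uv v0 by (metis nonzero_mult_div_cancel_right)
    moreover have "- 1 / (4 * (- s / v)) = v / (4 * s)" for s v :: complex by simp
    ultimately have "- 1 / (4 * u) = v / (4 * (z + 1/2))" by (simp only:)
    also have "\<dots> = (4 * (z + 1/2) - 1) / (4 * (z + 1/2))" by (simp add: v_def)
    also have "\<dots> = 1 + w"
    proof -
      have "(4 * s - 1) / (4 * s) = 1 + - 1 / (4 * s)" if "s \<noteq> 0" for s :: complex using that by (simp add: diff_divide_distrib)
      from this[OF z20] show ?thesis by (simp only: w_def)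
    qed
    finally show ?thesis by simp
  qed
  have Iw: "Im w > 0" unfolding w_def by (rule fricke_uhp[OF z2])
  have nz: "- \<i> * (z + 1/2) \<noteq> 0" "- \<i> * u \<noteq> 0" using z20 u0 by auto
  have ab: "a \<noteq> 0" "b \<noteq> 0" using nz by (simp_all add: a_def b_def)
  have v: "csqrt v = \<i> * (a / b)" unfolding a_def b_def
  proof (rule csqrt_quotient)
    show "- \<i> * u * v = - (- \<i> * (z + 1/2))" unfolding mult.assoc uv by (simp only: mult_minus_left mult_minus_right)
  qed (use z2 Iu Iv in simp_all)
  have "mockM u = 1 / b ^ 3 * (- \<i> * dual_mock w)"
    unfolding mockM_inversion[OF Iu] powr_three_halves(2)[OF nz(2)] wu dual_mock_shift[OF Iw] b_def ..
  moreover have "mockM (z - 1/2) = 1 / a ^ 3 * dual_mock w"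
  proof -
    have "Im (z - 1/2) > 0" using z by simp
    moreover have "z - 1/2 + 1 = z + 1/2" by simp
    ultimately have "mockM (z - 1/2) = mockM (z + 1/2)" using mockM_shift[of "z - 1/2"] by (simp only:)
    then show ?thesis unfolding mockM_inversion[OF z2] powr_three_halves(2)[OF nz(1)] w_def a_def by simp
  qed
  moreover have "v powr (3/2) = (\<i> * (a / b)) ^ 3" unfolding powr_three_halves(1)[OF v0] v ..
  \<comment> \<open>The cube of the \<open>\<i>\<close> from the principal root is exactly the
    multiplier of \<open>dual_mock\<close> under translation.\<close>
  moreover have "\<i> ^ 3 = - \<i>" by (simp add: power3_eq_cube)
  then have "1 / b ^ 3 * (- \<i> * X) = (\<i> * (a / b)) ^ 3 * (1 / a ^ 3 * X)" for X
    using ab by (simp add: power_mult_distrib power_divide) 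
  ultimately show ?thesis unfolding u_def v_def by (simp only:)
qed

section \<open>Automorphy and growth\<close>

text \<open>Conjugation by z -> z + 1/2 moves the matrix into \<open>Gamma0 4\<close>, where the
  generators apply to the shifted function, and \<open>jfac_half_shift\<close> brings the factor
  back.\<close>

lemma mockM_Gamma0_16:
  assumes A: "a * d - b * c = (1::int)" "16 dvd c" and z: "Im z > 0"
  shows "mockM (moebius_int a b c d z) = jfac c d z * mockM z"
proof -
  obtain m where c: "c = 16 * m" using A(2) by blast
  define F where "F w = mockM (w - 1/2)" for w
  have T: "F (w + 1) = F w" if "Im w > 0" for w
  proof -
    have "w + 1 - 1/2 = (w - 1/2) + 1" by simp
    then show ?thesis unfolding F_def using mockM_shift[of "w - 1/2"] that by simp
  qed
  have V: "F (w / (4 * w + 1)) = (4 * w + 1) powr (3 / 2) * F w" if "Im w > 0" for w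
    unfolding F_def by (rule mockM_half_V[OF that])
  have "a * d = b * c + 1" using A by simp
  then have "odd (a * d)" using c by simp
  then have odd: "odd a" "odd d" by auto
  then have "even (d - a)" by simp
  \<comment> \<open>The conjugated matrix has rows (a + c/2, b + (d - a)/2 - c/4) and (c, d - c/2);
    this makes its upper right entry integral.\<close>
  then obtain k where k: "d - a = 2 * k" by blast
  have "coprime c d"
  proof (rule coprimeI)
    fix e assume "e dvd c" "e dvd d"
    then have "e dvd a * d - b * c" by (intro dvd_diff dvd_mult)
    then show "is_unit e" by (simp add: A)
  qed
  then have cop: "coprime (16 * m) d" by (simp add: c)
  have det: "(a + 8 * m) * (d - 8 * m) - (b + k - 4 * m) * (16 * m) = 1"
  proof -
    have "(a + 8 * m) * (d - 8 * m) - (b + k - 4 * m) * (16 * m) = (a * d - b * (16 * m)) + 8 * m * ((d - a) - 2 * k)"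
      by (simp add: algebra_simps)
    then show ?thesis using A unfolding c k by simp
  qed
  have mo: "moebius_int (a + 8 * m) (b + k - 4 * m) (16 * m) (d - 8 * m) (z + 1/2) = moebius_int a b c d z + 1/2"
  proof -
    have "of_int c * z + of_int d \<noteq> (0::complex)" using A by (intro moebius_denom_nonzero z) auto
    then have nz: "of_int (16 * m) * z + of_int d \<noteq> (0::complex)" by (simp add: c)
    have d: "d = a + 2 * k" using k by simp
    have N: "of_int (a + 8 * m) * (z + 1/2) + of_int (b + k - 4 * m) = of_int a * z + of_int b + (of_int (16 * m) * z + of_int d) * (1/2)"
      unfolding d by (simp add: algebra_simps)
    have D: "of_int (16 * m) * (z + 1/2) + of_int (d - 8 * m) = of_int (16 * m) * z + of_int d"
      by (simp add: algebra_simps)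
    have "(p + q * (1/2)) / q = p / q + 1/2" if "q \<noteq> 0" for p q :: complex using that by (simp add: add_divide_distrib)
    from this[OF nz] show ?thesis unfolding moebius_int_def N D c .
  qed
  have "Im (z + 1/2) > 0" using z by simp
  from Gamma0_4_automorphy[of F, OF T V det _ this]
  have "F (moebius_int a b c d z + 1/2) = jfac (16 * m) (d - 8 * m) (z + 1/2) * F (z + 1/2)" unfolding mo by simp
  then show ?thesis unfolding jfac_half_shift[OF odd(2) cop] by (simp add: F_def c)
qed

section \<open>Growth at the cusps\<close>

lemma jacobi_abs: "\<bar>jacobi a n\<bar> \<le> 1"
proof -
  have "\<bar>Legendre a p\<bar> \<le> 1" for p by (simp add: Legendre_def)
  then show ?thesis unfolding jacobi_def abs_prod power_abs by (intro prod_le_1 conjI power_le_one zero_le_power) auto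
qed

text \<open>Bounding the symbol by 1 avoids any coprimality argument; growth estimates ask for an
  upper bound only.\<close>

lemma norm_jfac_le:
  assumes "of_int c * z + of_int d \<noteq> (0::complex)"
  shows "norm (jfac c d z) \<le> norm (of_int c * z + of_int d) powr (3/2)"
proof -
  have "\<bar>shimura_symbol c d\<bar> \<le> 1" by (simp add: shimura_symbol_def jacobi_abs)
  then have s: "norm (of_int (shimura_symbol c d) :: complex) \<le> 1" by simp
  have "norm (of_int (shimura_symbol c d) powi 3 :: complex) = norm (of_int (shimura_symbol c d) :: complex) ^ 3" by (simp add: norm_power)
  also have "\<dots> \<le> 1" by (rule power_le_one[OF norm_ge_zero s])
  finally have "norm (of_int (shimura_symbol c d) powi 3 :: complex) \<le> 1" .
  moreover have "norm (eps d powi (-3)) = 1" by (simp add: norm_power_int eps_def)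
  moreover have "norm ((of_int c * z + of_int d) powr (3/2)) = norm (of_int c * z + of_int d) powr (3/2)"
    using assms by (simp add: powr_def norm_exp_eq_Re)
  ultimately show ?thesis unfolding jfac_def norm_mult by (simp add: mult_left_le_one_le)
qed

text \<open>The dependence on \<open>v\<close> is explicit because points near the real axis matter
  at the cusps: the geometric majorant r / (1 - r) is at most 1/(2v), as exp(2 pi v) >= 1 +
  2v.\<close>

lemma th4_bound:
  assumes v: "v > 0" and w: "Im w \<ge> v"
  shows "norm (th4 w) \<le> 1 + 1 / v"
proof -
  define r where "r = exp (- 2 * pi * v)"
  have r: "0 < r" "r < 1" using v by (simp_all add: r_def)
  have "(\<lambda>n. r * r ^ n) sums (r * (1 / (1 - r)))" using r by (intro sums_mult geometric_sums) simp
  then have S: "(\<lambda>n. r ^ Suc n) sums (r / (1 - r))" by simp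
  have "norm (\<Sum>n. (-1) ^ Suc n * qexp w ^ ((Suc n)\<^sup>2)) \<le> (\<Sum>n. r ^ Suc n)"
  proof (rule norm_suminf_le)
    fix n
    have "norm (qexp w ^ ((Suc n)\<^sup>2)) \<le> r ^ Suc n" unfolding r_def by (rule qexp_power_bound[OF w v]) (simp add: power2_eq_square)
    then show "norm ((-1) ^ Suc n * qexp w ^ ((Suc n)\<^sup>2)) \<le> r ^ Suc n" by (simp add: norm_mult norm_power)
  next
    show "summable (\<lambda>n. r ^ Suc n)" using S by (rule sums_summable)
  qed
  also have "(\<Sum>n. r ^ Suc n) = r / (1 - r)" using S by (rule sums_unique[symmetric])
  also have "\<dots> \<le> 1 / (2 * v)"
  proof -
    have "1 + 2 * pi * v \<le> exp (2 * pi * v)" by (rule exp_ge_add_one_self)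
    moreover have "2 * v \<le> 2 * pi * v" using v pi_ge_two by simp
    moreover have "exp (2 * pi * v) * r = 1" unfolding r_def by (simp flip: exp_add)
    moreover have "(1 + 2 * v) * r \<le> exp (2 * pi * v) * r" using calculation r by (intro mult_right_mono) linarith+
    ultimately have "(1 + 2 * v) * r \<le> 1" by (simp only:)
    then show ?thesis using r v by (simp add: field_simps)
  qed
  finally have *: "norm (\<Sum>n. (-1) ^ Suc n * qexp w ^ ((Suc n)\<^sup>2)) \<le> 1 / (2 * v)" .
  have "norm (th4 w) \<le> norm (1 :: complex) + norm (2 * (\<Sum>n. (-1) ^ Suc n * qexp w ^ ((Suc n)\<^sup>2)))"
    unfolding th4_def by (rule norm_triangle_ineq)
  also have "\<dots> \<le> 1 + 2 * (1 / (2 * v))" unfolding norm_mult using * by (intro add_mono mult_mono) auto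
  finally show ?thesis by simp
qed

text \<open>With e = exp(1/v), the inequality 1 + 1/v <= e absorbs the powers of 1/v from the theta
  bound and from the kernel integral; each part is then at most 2 e^2.\<close>

lemma mockM_bound:
  assumes z: "Im z > 0"
  shows "norm (mockM z) \<le> 4 * exp (2 / Im z)"
proof -
  define v where "v = Im z"
  define e where "e = exp (1 / v)"
  have v: "v > 0" using z by (simp add: v_def)
  have e1: "1 + 1 / v \<le> e" unfolding e_def by (rule exp_ge_add_one_self)
  then have e0: "1 \<le> e" using v by (smt (verit) divide_pos_pos)
  have o: "norm (overpartO (qexp z)) \<le> 2 * e"
  proof -
    have "1 / (pi * v) \<le> 1 / v" using v pi_ge_two by (intro divide_left_mono) auto
    then have "exp (1 / (pi * v)) \<le> e" unfolding e_def by simp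
    then show ?thesis using overpartO_bound[OF z] by (simp add: v_def)
  qed
  have J: "norm (Jint th4 (3/2) z) \<le> 2 * e * e"
  proof -
    have "norm (Jint th4 (3/2) z) \<le> (1 + 1 / v) * integral\<^sup>L hl (\<lambda>t. (2 * Im z + t) powr (- (3/2)))"
      by (rule Jint_bound[OF bhol_th4 z]) (use th4_bound[OF v] in \<open>auto simp: v_def\<close>)
    also have "integral\<^sup>L hl (\<lambda>t. (2 * Im z + t) powr (- (3/2))) = 2 * (2 * v) powr (- (1/2))"
      using hl_powr(2)[of "2 * v" "3/2"] v by (simp add: v_def)
    also have "(2 * v) powr (- (1/2)) \<le> e"
    proof -
      have "(2 * v) powr (- (1/2)) = sqrt (1 / (2 * v))" using v by (simp add: powr_minus_divide powr_half_sqrt real_sqrt_divide)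
      also have "\<dots> \<le> 1 + 1 / v"
      proof (rule real_le_lsqrt)
        have "1 / (2 * v) \<le> 1 / v" using v by (intro divide_left_mono) auto
        also have "\<dots> \<le> (1 + 1 / v)\<^sup>2"
        proof -
          have "1 / v \<le> 1 + 1 / v" by simp
          also have "\<dots> \<le> (1 + 1 / v)\<^sup>2" using v by (intro self_le_power) simp_all
          finally show ?thesis .
        qed
        finally show "1 / (2 * v) \<le> (1 + 1 / v)\<^sup>2" .
      qed (use v in auto)
      finally show ?thesis using e1 by simp
    qed
    then have "(1 + 1 / v) * (2 * (2 * v) powr (- (1/2))) \<le> e * (2 * e)" using e1 e0 v by (intro mult_mono) auto
    finally show ?thesis by (simp add: mult_ac)
  qed
  have "sqrt 2 \<le> 2" by (rule real_le_lsqrt) auto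
  then have s: "sqrt 2 / pi \<le> 1" using pi_ge_two by simp
  have "norm (mockM z) \<le> norm (overpartO (qexp z)) + norm ((- of_real (sqrt 2 / pi)) * Jint th4 (3/2) z)"
    unfolding mockM_Jint[OF z] by (rule norm_triangle_ineq)
  also have "norm ((- of_real (sqrt 2 / pi)) * Jint th4 (3/2) z) = sqrt 2 / pi * norm (Jint th4 (3/2) z)" by (simp add: norm_mult norm_divide)
  also have "\<dots> \<le> 1 * (2 * e * e)" using s J by (intro mult_mono) auto
  also have "norm (overpartO (qexp z)) + 1 * (2 * e * e) \<le> 4 * (e * e)" 
  proof -
    have gen: "x + 1 * (2 * e * e) \<le> 4 * p" if "x \<le> 2 * e" "e * 1 \<le> p" "p = e * e" for x p
    proof -
      have "1 * (2 * e * e) = 2 * p" using that(3) by (simp only: mult.assoc mult_1_left)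
      then show ?thesis using that(1,2) by linarith
    qed
    show ?thesis by (rule gen[OF o mult_left_mono[OF e0] refl]) (use e0 in linarith)
  qed
  also have "e * e = exp (2 / Im z)" unfolding e_def v_def by (simp flip: exp_add)
  finally show ?thesis by simp
qed

text \<open>Translation by \<open>h\<close> at the cusp is the action of A T^h A^(-1), whose lower
  left entry is -c^2 h, so it belongs to \<open>Gamma0 16\<close>. Its denominator at the image of z
  is the quotient of the denominators of A at z + h and at z.\<close>

lemma mockM_cusp_translate:
  assumes A: "a * d - b * c = (1::int)" and z: "Im z > 0" and h: "16 dvd h"
  shows "norm (mockM (moebius_int a b c d (z + of_int h))) \<le>
    norm (of_int c * (z + of_int h) + of_int d) powr (3/2) / norm (of_int c * z + of_int d) powr (3/2) * norm (mockM (moebius_int a b c d z))"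
proof -
  define w where "w = moebius_int a b c d z"
  have w: "Im w > 0" unfolding w_def by (rule Im_moebius_pos[OF A z])
  have nz: "of_int c * z + of_int d \<noteq> (0::complex)" using A by (intro moebius_denom_nonzero z) auto
  have zh: "Im (z + of_int h) > 0" using z by simp
  have nzh: "of_int c * (z + of_int h) + of_int d \<noteq> (0::complex)" using A by (intro moebius_denom_nonzero zh) auto
  have det: "(1 - a * c * h) * (1 + a * c * h) - (a * a * h) * (- (c * c * h)) = 1" by (simp add: algebra_simps)
  have cz: "of_int (- (c * c * h)) * w + of_int (1 + a * c * h) = (of_int c * (z + of_int h) + of_int d) / (of_int c * z + of_int d)"
  proof -
    have "of_int (- (c * c * h)) * (of_int a * z + of_int b) + of_int (1 + a * c * h) * (of_int c * z + of_int d) =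
        (of_int c * (z + of_int h) + of_int d) + of_int (a * d - b * c - 1) * complex_of_int (c * h)"
      by (simp add: algebra_simps)
    also have "\<dots> = of_int c * (z + of_int h) + of_int d" unfolding A by simp
    finally have E: "of_int (- (c * c * h)) * (of_int a * z + of_int b) + of_int (1 + a * c * h) * (of_int c * z + of_int d) =
        of_int c * (z + of_int h) + of_int d" .
    have "x * (p / q) + y = (x * p + y * q) / q" if "q \<noteq> 0" for x y p q :: complex using that by (simp add: add_divide_distrib)
    from this[OF nz] show ?thesis unfolding w_def moebius_int_def E by (simp only: E)
  qed
  have mo: "moebius_int (1 - a * c * h) (a * a * h) (- (c * c * h)) (1 + a * c * h) w = moebius_int a b c d (z + of_int h)"
  proof -
    have 1: "moebius_int a b c d (z + of_int h) = moebius_int a (a * h + b) c (c * h + d) z"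
      by (simp add: moebius_int_def algebra_simps)
    have "(1 - a * c * h) * a + a * a * h * c = a" by (simp add: algebra_simps)
    moreover have "(1 - a * c * h) * b + a * a * h * d = b + a * h * (a * d - b * c)" by (simp add: algebra_simps)
    moreover have "- (c * c * h) * a + (1 + a * c * h) * c = c" by (simp add: algebra_simps)
    moreover have "- (c * c * h) * b + (1 + a * c * h) * d = d + c * h * (a * d - b * c)" by (simp add: algebra_simps)
    ultimately show ?thesis unfolding w_def moebius_comp[OF z A] 1 A by (simp only: mult_1_right add.commute)
  qed
  have "16 dvd - (c * c * h)" using h by simp
  from mockM_Gamma0_16[OF det this w]
  have "norm (mockM (moebius_int a b c d (z + of_int h))) = norm (jfac (- (c * c * h)) (1 + a * c * h) w) * norm (mockM w)"
    unfolding mo by (simp only: norm_mult)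
  also have "\<dots> \<le> norm (of_int (- (c * c * h)) * w + of_int (1 + a * c * h)) powr (3/2) * norm (mockM w)"
    using nz nzh by (intro mult_right_mono norm_jfac_le) (simp_all only: cz divide_eq_0_iff norm_ge_zero simp_thms)
  also have "norm (of_int (- (c * c * h)) * w + of_int (1 + a * c * h)) powr (3/2) =
      norm (of_int c * (z + of_int h) + of_int d) powr (3/2) / norm (of_int c * z + of_int d) powr (3/2)"
    unfolding cz norm_divide powr_divide ..
  finally show ?thesis unfolding w_def .
qed

text \<open>\<open>mockM_bound\<close> gives exp(2 |cz + d|^2 / Im z), which is too large when Re z
  is unbounded. A translation by a multiple of 16 first brings Re z into a bounded range, where |cz
  + d|^2 <= K (Im z)^2 as soon as Im z >= 1.\<close>

lemma mockM_growth:
  assumes A: "a * d - b * c = (1::int)"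
  shows "\<exists>C Y. C > 0 \<and> (\<forall>z. Im z \<ge> Y \<longrightarrow> norm (mockM (moebius_int a b c d z)) \<le> C * exp (C * Im z) * norm (of_int c * z + of_int d) powr (3/2))"
proof -
  define K where "K = (16 * \<bar>real_of_int c\<bar> + \<bar>real_of_int d\<bar>)\<^sup>2 + (real_of_int c)\<^sup>2"
  have K: "K \<ge> 0" by (simp add: K_def)
  have main: "norm (mockM (moebius_int a b c d z)) \<le> (4 + 2 * K) * exp ((4 + 2 * K) * Im z) * norm (of_int c * z + of_int d) powr (3/2)"
    if z: "Im z \<ge> 1" for z
  proof -
    define j where "j = \<lfloor>Re z / 16\<rfloor>"
    define h where "h = 16 * j"
    define u where "u = z - of_int h"
    define n where "n = norm (of_int c * u + of_int d)"
    have zu: "z = u + of_int h" by (simp add: u_def)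
    have Iu: "Im u = Im z" by (simp add: u_def)
    have u0: "Im u > 0" using z Iu by simp
    have "of_int j \<le> Re z / 16" "Re z / 16 < of_int j + 1" unfolding j_def by linarith+
    then have Ru: "\<bar>Re u\<bar> \<le> 16" by (simp add: u_def h_def abs_le_iff)
    have n2: "n\<^sup>2 = (of_int c * Re u + of_int d)\<^sup>2 + (of_int c * Im z)\<^sup>2" by (simp add: n_def cmod_power2 Iu)
    have nK: "n\<^sup>2 \<le> K * (Im z)\<^sup>2"
    proof -
      have "\<bar>of_int c * Re u + of_int d\<bar> \<le> 16 * \<bar>real_of_int c\<bar> + \<bar>real_of_int d\<bar>"
      proof -
        have "\<bar>of_int c * Re u\<bar> \<le> \<bar>real_of_int c\<bar> * 16" unfolding abs_mult using Ru by (intro mult_left_mono) auto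
        then show ?thesis by linarith
      qed
      then have "(of_int c * Re u + of_int d)\<^sup>2 \<le> (16 * \<bar>real_of_int c\<bar> + \<bar>real_of_int d\<bar>)\<^sup>2" by (metis abs_ge_zero abs_le_square_iff abs_of_nonneg order_trans)
      also have "\<dots> \<le> (16 * \<bar>real_of_int c\<bar> + \<bar>real_of_int d\<bar>)\<^sup>2 * (Im z)\<^sup>2" 
      proof -
        have "1 \<le> (Im z)\<^sup>2" using z by simp
        from mult_left_mono[OF this, of "(16 * \<bar>real_of_int c\<bar> + \<bar>real_of_int d\<bar>)\<^sup>2"] show ?thesis by simp
      qed
      finally show ?thesis unfolding n2 K_def by (simp add: algebra_simps power_mult_distrib)
    qed
    \<comment> \<open>This allows the denominator n^(3/2) of the translated estimate to be dropped:
      Im z >= 1 handles nonzero \<open>c\<close>, and \<open>c = 0\<close> forces \<open>d\<close>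
      to be 1 or -1.\<close>
    have n1: "n \<ge> 1"
    proof -
      have "1 \<le> n\<^sup>2"
      proof (cases "c = 0")
        case True
        then have "a * d = 1" using A by simp
        then have "d = 1 \<or> d = - 1" by (auto simp: zmult_eq_1_iff)
        then have "(real_of_int d)\<^sup>2 = 1" by auto
        then show ?thesis unfolding n2 True by simp
      next
        case False
        then have "1 \<le> \<bar>real_of_int c\<bar>" by linarith
        then have "1 * 1 \<le> \<bar>real_of_int c\<bar> * Im z" using z by (intro mult_mono) auto
        then have "1 \<le> \<bar>of_int c * Im z\<bar>" using z by (simp add: abs_mult)
        from power_mono[OF this, of 2] have "1 \<le> (of_int c * Im z)\<^sup>2" by simp
        then show ?thesis unfolding n2 using zero_le_power2[of "of_int c * Re u + of_int d"] by linarith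
      qed
      then show ?thesis by (intro power2_le_imp_le[of 1 n]) (simp_all add: n_def)
    qed
    have n3: "1 \<le> n powr (3/2)" using n1 by (simp add: ge_one_powr_ge_zero)
    have M: "norm (mockM (moebius_int a b c d u)) \<le> (4 + 2 * K) * exp ((4 + 2 * K) * Im z)"
    proof -
      have "norm (mockM (moebius_int a b c d u)) \<le> 4 * exp (2 / Im (moebius_int a b c d u))"
        by (rule mockM_bound[OF Im_moebius_pos[OF A u0]])
      also have "2 / Im (moebius_int a b c d u) = 2 * n\<^sup>2 / Im z" unfolding Im_moebius[OF A u0] n_def Iu by simp
      also have "\<dots> \<le> 2 * (K * (Im z)\<^sup>2) / Im z" using nK z by (intro divide_right_mono mult_left_mono) auto
      also have "\<dots> = 2 * K * Im z" using z by (simp add: power2_eq_square)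
      also have "\<dots> \<le> (4 + 2 * K) * Im z" using z by (intro mult_right_mono) auto
      finally have "norm (mockM (moebius_int a b c d u)) \<le> 4 * exp ((4 + 2 * K) * Im z)" by simp
      also have "\<dots> \<le> (4 + 2 * K) * exp ((4 + 2 * K) * Im z)" using K by (intro mult_right_mono) auto
      finally show ?thesis .
    qed
    have "16 dvd h" by (simp add: h_def)
    from mockM_cusp_translate[OF A u0 this]
    have "norm (mockM (moebius_int a b c d z)) \<le> norm (of_int c * z + of_int d) powr (3/2) / n powr (3/2) * norm (mockM (moebius_int a b c d u))"
      unfolding zu[symmetric] n_def .
    also have "\<dots> \<le> norm (of_int c * z + of_int d) powr (3/2) / 1 * ((4 + 2 * K) * exp ((4 + 2 * K) * Im z))"
      using n3 M K by (intro mult_mono divide_left_mono) auto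
    finally show ?thesis by (simp add: mult_ac)
  qed
  have "4 + 2 * K > 0" using K by simp
  with main show ?thesis by (intro exI[of _ "4 + 2 * K"] exI[of _ 1]) blast
qed

theorem theorem1p1:
  shows "weak_maass_form (3 / 2) (trivial_char 16) (Gamma0 16) mockM"
proof -
  have "maass_class th4 (\<lambda>z. overpartO (qexp z) + (- of_real (sqrt 2 / pi)) * Jint th4 (3/2) z)"
    by (intro maass_class.add maass_class.cmult maass_class.Jint maass_class.hol overpartO_holomorphic) simp
  from maass_class_smooth[OF bhol_th4 this mockM_Jint] have 1: "smooth_on upper_half_plane mockM" .
  have 2: "hyp_laplacian (3 / 2) mockM z = 0" if "Im z > 0" for z
    by (rule laplacian_Jint[OF bhol_th4 overpartO_holomorphic that mockM_Jint])
  have 3: "mockM (moebius_int a b c d z) = of_int (shimura_symbol c d) powi round (2 * (3 / 2 :: real)) * eps d powi (- round (2 * (3 / 2 :: real)))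
      * trivial_char 16 d * (of_int c * z + of_int d) powr of_real (3 / 2) * mockM z"
    if A: "(a, b, c, d) \<in> Gamma0 16" and z: "Im z > 0" for a b c d z
  proof -
    have A': "a * d - b * c = 1" "16 dvd c" using A by (simp_all add: Gamma0_def)
    have "coprime d 16"
    proof (rule coprimeI)
      fix e assume "e dvd d" "e dvd (16::int)"
      then have "e dvd a * d - b * c" using A'(2) by (intro dvd_diff dvd_mult) (auto intro: dvd_trans)
      then show "is_unit e" by (simp add: A')
    qed
    then have t: "trivial_char 16 d = 1" by (simp add: trivial_char_def)
    have r: "round (2 * (3 / 2 :: real)) = 3" by simp
    have p: "complex_of_real (3 / 2) = 3 / 2" by simp
    show ?thesis unfolding t r p mult_1_right mockM_Gamma0_16[OF A' z] jfac_def ..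
  qed
  show ?thesis unfolding weak_maass_form_def
    using 1 2 3 mockM_growth by (auto simp only: SL2Z_def mem_Collect_eq case_prod_conv split_paired_All Ball_def simp_thms)
qed

end
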